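(* Let $G$ be a group, let $X=BG$ be its classifying space (a simplicial set), and let $n\geq 3$. Then the natural map $h_n^{-1}(0)\to F_{h_n}(0)$ from the fiber to the homotopy fiber of $h_n\colon X^{2n}\to\mathbb{Z}[X]$ over $0$ induces an isomorphism of fundamental groups $\pi_1(h_n^{-1}(0))\cong\pi_1(F_{h_n}(0))$.
   Context: $BG$ is the usual simplicial classifying space (nerve) of $G$: $BG_k=G^k$; it has a unique vertex, which is its base point. For a simplicial set $X$, $\mathbb{Z}[X]$ denotes the free simplicial abelian group on $X$ (so $\mathbb{Z}[X]_k$ is the free abelian group on the set $X_k$). The map of simplicial sets $h_n\colon X^{2n}\to\mathbb{Z}[X]$ is defined by $h_n(x_1,x_2,\ldots,x_{2n})=\sum_{i=1}^{2n}(-1)^i x_i$. The fiber $h_n^{-1}(0)\subseteq X^{2n}$ is the simplicial subset of all simplices mapped to $0$, and $F_{h_n}(0)$ is the homotopy fiber of $h_n$ over the vertex $0\in\mathbb{Z}[X]_0$, with the canonical map $h_n^{-1}(0)\to F_{h_n}(0)$. Fundamental groups are taken at the base point induced by the unique vertex of $BG$. *)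

theory Defs
  imports "HOL-Algebra.Free_Abelian_Groups"
begin

section \<open>Simplicial sets\<close>

text \<open>
  A monotone map \<open>\<theta> : [m] \<rightarrow> [k]\<close>, where \<open>[m] = {0, \<dots>, m}\<close>, is the list \<open>[\<theta> 0, \<dots>, \<theta> m]\<close> of
  its values.
\<close>

definition mono_maps :: "nat \<Rightarrow> nat \<Rightarrow> nat list set" where
  "mono_maps m k = {\<theta>. length \<theta> = Suc m \<and> sorted \<theta> \<and> set \<theta> \<subseteq> {..k}}"

definition id_map :: "nat \<Rightarrow> nat list" where
  "id_map k = [0..<Suc k]"

definition comp_map :: "nat list \<Rightarrow> nat list \<Rightarrow> nat list" (infixl \<open>\<odot>\<close> 70) where
  "\<theta> \<odot> \<phi> = map ((!) \<theta>) \<phi>"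

definition const_map :: "nat \<Rightarrow> nat \<Rightarrow> nat list" where
  "const_map m i = replicate (Suc m) i"

definition coface :: "nat \<Rightarrow> nat \<Rightarrow> nat list" where
  "coface k i = filter (\<lambda>j. j \<noteq> i) (id_map k)"

text \<open>
  A simplicial set is a contravariant functor from the simplex category: \<open>action X k \<theta>\<close> is the map
  \<open>\<theta>\<^sup>* : X\<^sub>k \<rightarrow> X\<^sub>m\<close> induced by \<open>\<theta> : [m] \<rightarrow> [k]\<close>.
\<close>

record 'a sset =
  simplices :: "nat \<Rightarrow> 'a set"
  action :: "nat \<Rightarrow> nat list \<Rightarrow> 'a \<Rightarrow> 'a"

locale simplicial_set =
  fixes X :: "'a sset"
  assumes action_closed:
      "\<lbrakk>\<theta> \<in> mono_maps m k; x \<in> simplices X k\<rbrakk> \<Longrightarrow> action X k \<theta> x \<in> simplices X m"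
    and action_id: "x \<in> simplices X k \<Longrightarrow> action X k (id_map k) x = x"
    and action_comp:
      "\<lbrakk>\<theta> \<in> mono_maps m k; \<phi> \<in> mono_maps l m; x \<in> simplices X k\<rbrakk>
        \<Longrightarrow> action X m \<phi> (action X k \<theta> x) = action X k (\<theta> \<odot> \<phi>) x"

definition simplicial_map :: "'a sset \<Rightarrow> 'b sset \<Rightarrow> (nat \<Rightarrow> 'a \<Rightarrow> 'b) \<Rightarrow> bool" where
  "simplicial_map X Y f \<longleftrightarrow>
     (\<forall>k. \<forall>x \<in> simplices X k. f k x \<in> simplices Y k) \<and>
     (\<forall>k m. \<forall>\<theta> \<in> mono_maps m k. \<forall>x \<in> simplices X k.
        f m (action X k \<theta> x) = action Y k \<theta> (f k x))"

definition face :: "'a sset \<Rightarrow> nat \<Rightarrow> nat \<Rightarrow> 'a \<Rightarrow> 'a" where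
  "face X k i = action X k (coface k i)"

text \<open>The \<open>k\<close>-dimensional degeneracy of a vertex.\<close>

definition degenerate :: "'a sset \<Rightarrow> 'a \<Rightarrow> nat \<Rightarrow> 'a" where
  "degenerate X v k = action X 0 (const_map k 0) v"

definition std_simplex :: "nat \<Rightarrow> nat list sset" where
  "std_simplex n = \<lparr>simplices = (\<lambda>k. mono_maps k n), action = (\<lambda>k \<theta> \<alpha>. \<alpha> \<odot> \<theta>)\<rparr>"

definition sset_prod :: "'a sset \<Rightarrow> 'b sset \<Rightarrow> ('a \<times> 'b) sset" where
  "sset_prod X Y = \<lparr>simplices = (\<lambda>k. simplices X k \<times> simplices Y k),
     action = (\<lambda>k \<theta>. map_prod (action X k \<theta>) (action Y k \<theta>))\<rparr>"

definition sset_power :: "'a sset \<Rightarrow> nat \<Rightarrow> 'a list sset" where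
  "sset_power X N = \<lparr>simplices = (\<lambda>k. {xs. length xs = N \<and> set xs \<subseteq> simplices X k}),
     action = (\<lambda>k \<theta>. map (action X k \<theta>))\<rparr>"

text \<open>
  The function complex \<open>Y\<^sup>X\<close>: its \<open>k\<close>-simplices are the simplicial maps \<open>\<Delta>[k] \<times> X \<rightarrow> Y\<close>, made
  unique by extensionality in each dimension.
\<close>

definition hom_sset :: "'a sset \<Rightarrow> 'b sset \<Rightarrow> (nat \<Rightarrow> nat list \<times> 'a \<Rightarrow> 'b) sset" where
  "hom_sset X Y = \<lparr>
     simplices = (\<lambda>k. {p. simplicial_map (sset_prod (std_simplex k) X) Y p \<and>
       (\<forall>m. p m \<in> extensional (simplices (sset_prod (std_simplex k) X) m))}),
     action = (\<lambda>k \<theta> p m. restrict (\<lambda>(\<alpha>, x). p m (\<theta> \<odot> \<alpha>, x))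
       (simplices (sset_prod (std_simplex (length \<theta> - 1)) X) m))\<rparr>"


section \<open>Fiber and homotopy fiber\<close>

definition fiber :: "'a sset \<Rightarrow> 'b sset \<Rightarrow> (nat \<Rightarrow> 'a \<Rightarrow> 'b) \<Rightarrow> 'b \<Rightarrow> 'a sset" where
  "fiber X Y f y = \<lparr>simplices = (\<lambda>k. {x \<in> simplices X k. f k x = degenerate Y y k}),
     action = action X\<rparr>"

text \<open>
  A \<open>k\<close>-simplex of \<open>Y\<^sup>\<Delta>\<^sup>[\<^sup>1\<^sup>]\<close> restricted to the endpoint \<open>i \<in> {0, 1}\<close> is a map \<open>\<Delta>[k] \<rightarrow> Y\<close>, identified
  with the \<open>k\<close>-simplex that is the image of the generator of \<open>\<Delta>[k]\<close>.
\<close>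

definition endpoint :: "nat \<Rightarrow> nat \<Rightarrow> (nat \<Rightarrow> nat list \<times> nat list \<Rightarrow> 'b) \<Rightarrow> 'b" where
  "endpoint i k p = p k (id_map k, const_map k i)"

text \<open>
  The homotopy fiber of \<open>f : X \<rightarrow> Y\<close> over a vertex \<open>y\<close> as the mapping path space
  \<open>X \<times>\<^sub>Y Y\<^sup>\<Delta>\<^sup>[\<^sup>1\<^sup>] \<times>\<^sub>Y {y}\<close>. This has the correct homotopy type only if \<open>Y\<close> is a Kan complex; below \<open>Y\<close>
  is a simplicial abelian group, hence Kan.
\<close>

definition homotopy_fiber :: "'a sset \<Rightarrow> 'b sset \<Rightarrow> (nat \<Rightarrow> 'a \<Rightarrow> 'b) \<Rightarrow> 'b
    \<Rightarrow> ('a \<times> (nat \<Rightarrow> nat list \<times> nat list \<Rightarrow> 'b)) sset" where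
  "homotopy_fiber X Y f y = \<lparr>
     simplices = (\<lambda>k. {(x, p). x \<in> simplices X k \<and> p \<in> simplices (hom_sset (std_simplex 1) Y) k \<and>
       endpoint 0 k p = degenerate Y y k \<and> endpoint 1 k p = f k x}),
     action = (\<lambda>k \<theta>. map_prod (action X k \<theta>) (action (hom_sset (std_simplex 1) Y) k \<theta>))\<rparr>"

definition const_path :: "'b sset \<Rightarrow> 'b \<Rightarrow> nat \<Rightarrow> (nat \<Rightarrow> nat list \<times> nat list \<Rightarrow> 'b)" where
  "const_path Y y k m = restrict (\<lambda>_. degenerate Y y m)
     (simplices (sset_prod (std_simplex k) (std_simplex 1)) m)"

definition fiber_to_homotopy_fiber :: "'b sset \<Rightarrow> 'b
    \<Rightarrow> nat \<Rightarrow> 'a \<Rightarrow> 'a \<times> (nat \<Rightarrow> nat list \<times> nat list \<Rightarrow> 'b)" where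
  "fiber_to_homotopy_fiber Y y k x = (x, const_path Y y k)"


section \<open>The fundamental group\<close>

text \<open>
  The fundamental group of a simplicial set that need not be a Kan complex (a fiber usually is not):
  the vertex group of the fundamental groupoid, i.e. of the groupoid with objects \<open>X\<^sub>0\<close> generated by
  the edges \<open>e : d\<^sub>1 e \<rightarrow> d\<^sub>0 e\<close>, \<open>e \<in> X\<^sub>1\<close>, subject to \<open>d\<^sub>2 \<sigma> \<cdot> d\<^sub>0 \<sigma> = d\<^sub>1 \<sigma>\<close> (path composition order)
  for \<open>\<sigma> \<in> X\<^sub>2\<close>. Degenerate edges are then identities: take \<open>\<sigma>\<close> to be a doubly degenerate vertex.
  Morphisms are represented by edge paths; the sign \<open>False\<close> marks an edge that is traversed
  backwards.
\<close>

type_synonym 'a edge_word = "('a \<times> bool) list"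

definition edge_source :: "'a sset \<Rightarrow> 'a \<times> bool \<Rightarrow> 'a" where
  "edge_source X = (\<lambda>(e, b). face X 1 (if b then 1 else 0) e)"

definition edge_target :: "'a sset \<Rightarrow> 'a \<times> bool \<Rightarrow> 'a" where
  "edge_target X = (\<lambda>(e, b). face X 1 (if b then 0 else 1) e)"

fun edge_path :: "'a sset \<Rightarrow> 'a \<Rightarrow> 'a edge_word \<Rightarrow> 'a \<Rightarrow> bool" where
  "edge_path X v [] w \<longleftrightarrow> v \<in> simplices X 0 \<and> v = w"
| "edge_path X v (a # p) w \<longleftrightarrow>
     fst a \<in> simplices X 1 \<and> edge_source X a = v \<and> edge_path X (edge_target X a) p w"

inductive edge_homotopic :: "'a sset \<Rightarrow> 'a \<Rightarrow> 'a \<Rightarrow> 'a edge_word \<Rightarrow> 'a edge_word \<Rightarrow> bool"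
  for X v w where
  refl: "edge_path X v p w \<Longrightarrow> edge_homotopic X v w p p"
| sym: "edge_homotopic X v w p q \<Longrightarrow> edge_homotopic X v w q p"
| trans: "\<lbrakk>edge_homotopic X v w p q; edge_homotopic X v w q r\<rbrakk> \<Longrightarrow> edge_homotopic X v w p r"
| cancel: "edge_path X v (p @ [(e, b), (e, \<not> b)] @ q) w
    \<Longrightarrow> edge_homotopic X v w (p @ [(e, b), (e, \<not> b)] @ q) (p @ q)"
| triangle: "\<lbrakk>\<sigma> \<in> simplices X 2;
      edge_path X v (p @ [(face X 2 2 \<sigma>, True), (face X 2 0 \<sigma>, True)] @ q) w\<rbrakk>
    \<Longrightarrow> edge_homotopic X v w (p @ [(face X 2 2 \<sigma>, True), (face X 2 0 \<sigma>, True)] @ q)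
          (p @ [(face X 2 1 \<sigma>, True)] @ q)"

definition edge_loops :: "'a sset \<Rightarrow> 'a \<Rightarrow> 'a edge_word set" where
  "edge_loops X v = {p. edge_path X v p v}"

definition loop_homotopy :: "'a sset \<Rightarrow> 'a \<Rightarrow> ('a edge_word \<times> 'a edge_word) set" where
  "loop_homotopy X v = {(p, q). edge_homotopic X v v p q}"

definition fundamental_group :: "'a sset \<Rightarrow> 'a \<Rightarrow> 'a edge_word set monoid" (\<open>\<pi>\<^sub>1\<close>) where
  "\<pi>\<^sub>1 X v = \<lparr>carrier = edge_loops X v // loop_homotopy X v,
     mult = (\<lambda>A B. loop_homotopy X v `` {p @ q | p q. p \<in> A \<and> q \<in> B}),
     one = loop_homotopy X v `` {[]}\<rparr>"

definition fundamental_group_map ::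
    "'b sset \<Rightarrow> 'b \<Rightarrow> (nat \<Rightarrow> 'a \<Rightarrow> 'b) \<Rightarrow> 'a edge_word set \<Rightarrow> 'b edge_word set" where
  "fundamental_group_map Y w f A = loop_homotopy Y w `` (map (map_prod (f 1) id) ` A)"


section \<open>Classifying spaces and the map \<open>h\<^sub>n\<close>\<close>

text \<open>
  \<open>BG\<^sub>k = G\<^sup>k\<close>, where \<open>\<theta> : [m] \<rightarrow> [k]\<close> sends \<open>(g\<^sub>1, \<dots>, g\<^sub>k)\<close> to the tuple with \<open>j\<close>-th entry
  \<open>g\<^bsub>\<theta>(j-1)+1\<^esub> \<cdots> g\<^bsub>\<theta>(j)\<^esub>\<close>, \<open>1 \<le> j \<le> m\<close>. Lists are indexed from \<open>0\<close>.
\<close>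

definition segment_product :: "('g, 'z) monoid_scheme \<Rightarrow> 'g list \<Rightarrow> nat \<Rightarrow> nat \<Rightarrow> 'g" where
  "segment_product G gs i j = foldr (mult G) (map ((!) gs) [i..<j]) (one G)"

definition classifying_space :: "('g, 'z) monoid_scheme \<Rightarrow> 'g list sset" where
  "classifying_space G = \<lparr>simplices = (\<lambda>k. {gs. length gs = k \<and> set gs \<subseteq> carrier G}),
     action = (\<lambda>k \<theta> gs. map (\<lambda>j. segment_product G gs (\<theta> ! j) (\<theta> ! Suc j)) [0..<length \<theta> - 1])\<rparr>"

definition free_simplicial_abelian_group :: "'a sset \<Rightarrow> ('a \<Rightarrow>\<^sub>0 int) sset" where
  "free_simplicial_abelian_group X =
     \<lparr>simplices = (\<lambda>k. carrier (free_Abelian_group (simplices X k))),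
      action = (\<lambda>k \<theta>. frag_extend (\<lambda>x. frag_of (action X k \<theta> x)))\<rparr>"

definition alternating_map :: "nat \<Rightarrow> nat \<Rightarrow> 'a list \<Rightarrow> 'a \<Rightarrow>\<^sub>0 int" where
  "alternating_map n k xs = (\<Sum>i = 1..2 * n. frag_cmul ((-1) ^ i) (frag_of (xs ! (i - 1))))"

text \<open>The unique vertex of \<open>(BG)\<^sup>2\<^sup>n\<close>; the only vertex of \<open>BG\<close> is the empty tuple.\<close>

definition base_vertex :: "nat \<Rightarrow> 'g list list" where
  "base_vertex n = replicate (2 * n) []"


section \<open>The constructions are well defined\<close>

lemma comp_map_nth: "j < length \<phi> \<Longrightarrow> (\<theta> \<odot> \<phi>) ! j = \<theta> ! (\<phi> ! j)"
  by (simp add: comp_map_def)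

lemma mono_maps_length: "\<theta> \<in> mono_maps m k \<Longrightarrow> length \<theta> = Suc m"
  by (simp add: mono_maps_def)

lemma mono_maps_nth_le: "\<lbrakk>\<theta> \<in> mono_maps m k; j \<le> m\<rbrakk> \<Longrightarrow> \<theta> ! j \<le> k"
  by (force simp: mono_maps_def)

lemma mono_maps_nth_mono: "\<lbrakk>\<theta> \<in> mono_maps m k; i \<le> j; j \<le> m\<rbrakk> \<Longrightarrow> \<theta> ! i \<le> \<theta> ! j"
  by (auto simp: mono_maps_def sorted_nth_mono)

lemma comp_map_closed:
  assumes t: "\<theta> \<in> mono_maps m k" and p: "\<phi> \<in> mono_maps l m"
  shows "\<theta> \<odot> \<phi> \<in> mono_maps l k"
proof -
  have "sorted (\<theta> \<odot> \<phi>)"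
    using mono_maps_nth_mono[OF t] mono_maps_nth_mono[OF p] mono_maps_nth_le[OF p] p
    by (simp add: sorted_iff_nth_mono comp_map_def mono_maps_def less_Suc_eq_le)
  moreover have "set (\<theta> \<odot> \<phi>) \<subseteq> {..k}"
    using mono_maps_nth_le[OF t] p by (auto simp: comp_map_def mono_maps_def)
  ultimately show ?thesis using p by (simp add: mono_maps_def comp_map_def)
qed

lemma id_map_closed: "id_map k \<in> mono_maps k k"
  by (auto simp: mono_maps_def id_map_def simp del: upt_Suc)

lemma const_map_closed: "i \<le> k \<Longrightarrow> const_map m i \<in> mono_maps m k"
  by (auto simp: mono_maps_def const_map_def)

lemma coface_closed: "i \<le> Suc k \<Longrightarrow> coface (Suc k) i \<in> mono_maps k (Suc k)"
proof -
  assume i: "i \<le> Suc k"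
  have "length (coface (Suc k) i) = card ({0..<Suc (Suc k)} - {i})"
  proof -
    have "distinct (coface (Suc k) i)" by (simp add: coface_def id_map_def)
    hence "length (coface (Suc k) i) = card (set (coface (Suc k) i))"
      by (simp add: distinct_card)
    also have "set (coface (Suc k) i) = {0..<Suc (Suc k)} - {i}"
      by (auto simp: coface_def id_map_def)
    finally show ?thesis .
  qed
  also have "\<dots> = Suc k" using i by (simp add: card_Diff_singleton)
  finally show ?thesis
    by (auto simp: mono_maps_def coface_def id_map_def sorted_wrt_filter simp del: upt_Suc)
qed

lemma comp_map_id_left: "\<theta> \<in> mono_maps m k \<Longrightarrow> id_map k \<odot> \<theta> = \<theta>"
proof -
  assume "\<theta> \<in> mono_maps m k"
  then have "id_map k ! x = x" if "x \<in> set \<theta>" for x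
    using that by (auto simp: mono_maps_def id_map_def less_Suc_eq_le simp del: upt_Suc)
  then show ?thesis by (simp add: comp_map_def map_idI)
qed

lemma comp_map_id_right: "\<theta> \<in> mono_maps m k \<Longrightarrow> \<theta> \<odot> id_map m = \<theta>"
  by (simp add: mono_maps_def comp_map_def id_map_def del: upt_Suc) (metis map_nth)

lemma comp_map_assoc:
  assumes "\<psi> \<in> mono_maps r l" "\<phi> \<in> mono_maps l m"
  shows "\<theta> \<odot> \<phi> \<odot> \<psi> = \<theta> \<odot> (\<phi> \<odot> \<psi>)"
proof -
  have "x < length \<phi>" if "x \<in> set \<psi>" for x
    using assms that by (auto simp: mono_maps_def less_Suc_eq_le)
  then show ?thesis by (simp add: comp_map_def)
qed

lemma comp_const_map: "\<phi> \<in> mono_maps l m \<Longrightarrow> const_map m i \<odot> \<phi> = const_map l i"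
proof -
  assume p: "\<phi> \<in> mono_maps l m"
  then have "const_map m i ! x = i" if "x \<in> set \<phi>" for x
    using that by (auto simp: mono_maps_def const_map_def less_Suc_eq_le simp del: replicate_Suc)
  then have "const_map m i \<odot> \<phi> = map (\<lambda>_. i) \<phi>"
    unfolding comp_map_def by (intro map_cong) auto
  then show ?thesis
    using p by (simp add: mono_maps_length const_map_def map_replicate_const)
qed

lemma simplicial_set_std_simplex: "simplicial_set (std_simplex n)"
  by unfold_locales
    (auto simp: std_simplex_def comp_map_closed comp_map_id_right comp_map_assoc)

lemma simplicial_set_prod:
  assumes X: "simplicial_set X" and Y: "simplicial_set Y"
  shows "simplicial_set (sset_prod X Y)"
proof -
  interpret X: simplicial_set X by fact
  interpret Y: simplicial_set Y by fact
  show ?thesis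
    by (intro simplicial_set.intro) (auto simp: sset_prod_def X.action_closed Y.action_closed
      X.action_id Y.action_id X.action_comp Y.action_comp)
qed

lemma simplicial_set_power:
  assumes X: "simplicial_set X"
  shows "simplicial_set (sset_power X N)"
proof -
  interpret X: simplicial_set X by fact
  show ?thesis
    by (intro simplicial_set.intro) (auto simp: sset_power_def X.action_closed
      X.action_id X.action_comp subset_iff intro!: map_idI)
qed

lemma (in simplicial_set) degenerate_closed: "v \<in> simplices X 0 \<Longrightarrow> degenerate X v k \<in> simplices X k"
  by (simp add: action_closed const_map_closed degenerate_def[unfolded])

lemma (in simplicial_set) action_degenerate:
  "\<lbrakk>v \<in> simplices X 0; \<theta> \<in> mono_maps m k\<rbrakk>
    \<Longrightarrow> action X k \<theta> (degenerate X v k) = degenerate X v m"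
  by (simp add: degenerate_def action_comp[OF const_map_closed] comp_const_map)

lemma simplicial_set_hom:
  assumes X: "simplicial_set X" and Y: "simplicial_set Y"
  shows "simplicial_set (hom_sset X Y)"
proof
  fix \<theta> m k p
  assume t: "\<theta> \<in> mono_maps m k" and p: "p \<in> simplices (hom_sset X Y) k"
  have nat: "p l (\<alpha> \<odot> \<phi>, action X j \<phi> x) = action Y j \<phi> (p j (\<alpha>, x))"
    if "\<phi> \<in> mono_maps l j" "\<alpha> \<in> mono_maps j k" "x \<in> simplices X j" for l j \<phi> \<alpha> x
    using p that by (force simp: hom_sset_def simplicial_map_def sset_prod_def std_simplex_def)
  have closed: "p j (\<alpha>, x) \<in> simplices Y j"
    if "\<alpha> \<in> mono_maps j k" "x \<in> simplices X j" for j \<alpha> x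
    using p that by (force simp: hom_sset_def simplicial_map_def sset_prod_def std_simplex_def)
  show "action (hom_sset X Y) k \<theta> p \<in> simplices (hom_sset X Y) m"
    using t
    by (auto simp: hom_sset_def simplicial_map_def sset_prod_def std_simplex_def mono_maps_length
        comp_map_closed simplicial_set.action_closed[OF X] nat closed comp_map_assoc[symmetric])
next
  fix p k assume "p \<in> simplices (hom_sset X Y) k"
  then show "action (hom_sset X Y) k (id_map k) p = p"
    by (auto simp: hom_sset_def sset_prod_def std_simplex_def id_map_def[of k, symmetric]
        mono_maps_length[OF id_map_closed] comp_map_id_left extensional_def fun_eq_iff)
next
  fix \<theta> m k \<phi> l p
  assume t: "\<theta> \<in> mono_maps m k" "\<phi> \<in> mono_maps l m" and p: "p \<in> simplices (hom_sset X Y) k"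
  show "action (hom_sset X Y) m \<phi> (action (hom_sset X Y) k \<theta> p) = action (hom_sset X Y) k (\<theta> \<odot> \<phi>) p"
    using t mono_maps_length[OF comp_map_closed[OF t]]
    by (auto simp: hom_sset_def sset_prod_def std_simplex_def mono_maps_length
        comp_map_closed comp_map_assoc fun_eq_iff restrict_def)
qed

lemma simplicial_set_fiber:
  assumes "simplicial_set X" "simplicial_set Y" "simplicial_map X Y f" "y \<in> simplices Y 0"
  shows "simplicial_set (fiber X Y f y)"
proof -
  interpret X: simplicial_set X by fact
  interpret Y: simplicial_set Y by fact
  show ?thesis
    using assms(3,4)
    by (intro simplicial_set.intro)
      (auto simp: fiber_def simplicial_map_def X.action_closed X.action_id X.action_comp
        Y.action_degenerate)
qed

lemma endpoint_action:
  assumes Y: "simplicial_set Y" and p: "p \<in> simplices (hom_sset (std_simplex 1) Y) k"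
    and t: "\<theta> \<in> mono_maps m k" and i: "i \<le> 1"
  shows "endpoint i m (action (hom_sset (std_simplex 1) Y) k \<theta> p) = action Y k \<theta> (endpoint i k p)"
proof -
  have sm: "simplicial_map (sset_prod (std_simplex k) (std_simplex 1)) Y p"
    using p by (simp add: hom_sset_def)
  have "(id_map k, const_map k i) \<in> simplices (sset_prod (std_simplex k) (std_simplex 1)) k"
    using i by (simp add: sset_prod_def std_simplex_def id_map_closed const_map_closed)
  then have "p m (action (sset_prod (std_simplex k) (std_simplex 1)) k \<theta> (id_map k, const_map k i))
      = action Y k \<theta> (p k (id_map k, const_map k i))"
    using sm t unfolding simplicial_map_def by blast
  moreover have "action (sset_prod (std_simplex k) (std_simplex 1)) k \<theta> (id_map k, const_map k i)
      = (\<theta> \<odot> id_map m, const_map m i)"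
    using t by (simp add: sset_prod_def std_simplex_def comp_map_id_left comp_map_id_right
      comp_const_map)
  ultimately show ?thesis using t i
    by (simp add: endpoint_def hom_sset_def sset_prod_def std_simplex_def mono_maps_length
      id_map_closed const_map_closed)
qed

lemma simplicial_set_homotopy_fiber:
  assumes X: "simplicial_set X" and Y: "simplicial_set Y" and f: "simplicial_map X Y f"
    and y: "y \<in> simplices Y 0"
  shows "simplicial_set (homotopy_fiber X Y f y)"
proof -
  interpret X: simplicial_set X by fact
  interpret Y: simplicial_set Y by fact
  interpret H: simplicial_set "hom_sset (std_simplex 1) Y"
    by (intro simplicial_set_hom simplicial_set_std_simplex Y)
  show ?thesis
    using f y
    by (intro simplicial_set.intro)
      (auto simp: homotopy_fiber_def simplicial_map_def X.action_closed H.action_closed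
        X.action_id H.action_id X.action_comp H.action_comp endpoint_action[OF Y] Y.action_degenerate
        simp del: One_nat_def)
qed

lemma simplicial_map_fiber_to_homotopy_fiber:
  assumes X: "simplicial_set X" and Y: "simplicial_set Y" and f: "simplicial_map X Y f"
    and y: "y \<in> simplices Y 0"
  shows "simplicial_map (fiber X Y f y) (homotopy_fiber X Y f y) (fiber_to_homotopy_fiber Y y)"
proof -
  interpret Y: simplicial_set Y by fact
  have 1: "const_path Y y k \<in> simplices (hom_sset (std_simplex 1) Y) k" for k
    using y by (auto simp: hom_sset_def const_path_def simplicial_map_def Y.degenerate_closed
      Y.action_degenerate sset_prod_def std_simplex_def comp_map_closed)
  have 2: "endpoint i k (const_path Y y k) = degenerate Y y k" if "i \<le> 1" for i k
    using that by (simp add: endpoint_def const_path_def sset_prod_def std_simplex_def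
      id_map_closed const_map_closed)
  have 3: "action (hom_sset (std_simplex 1) Y) k \<theta> (const_path Y y k) = const_path Y y m"
    if "\<theta> \<in> mono_maps m k" for \<theta> m k
    using that by (auto simp: hom_sset_def const_path_def fun_eq_iff restrict_def sset_prod_def
      std_simplex_def comp_map_closed mono_maps_length)
  show ?thesis
    using 1 2 3 by (auto simp: simplicial_map_def fiber_def homotopy_fiber_def fiber_to_homotopy_fiber_def)
qed

lemma (in monoid) foldr_mult_closed: "set xs \<subseteq> carrier G \<Longrightarrow> foldr (\<otimes>) xs \<one> \<in> carrier G"
  by (induction xs) auto

lemma (in monoid) foldr_mult_append:
  "\<lbrakk>set xs \<subseteq> carrier G; set ys \<subseteq> carrier G\<rbrakk>
    \<Longrightarrow> foldr (\<otimes>) (xs @ ys) \<one> = foldr (\<otimes>) xs \<one> \<otimes> foldr (\<otimes>) ys \<one>"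
proof (induction xs)
  case (Cons x xs)
  then show ?case
    using foldr_mult_closed[of xs] foldr_mult_closed[of ys] by (simp add: m_assoc)
qed (simp add: foldr_mult_closed)

lemma (in monoid) segment_product_closed:
  "\<lbrakk>set gs \<subseteq> carrier G; j \<le> length gs\<rbrakk> \<Longrightarrow> segment_product G gs i j \<in> carrier G"
  unfolding segment_product_def by (intro foldr_mult_closed) (auto simp: subset_iff)

lemma (in monoid) segment_product_trans:
  assumes gs: "set gs \<subseteq> carrier G" and ij: "i \<le> j" and jk: "j \<le> k" and k: "k \<le> length gs"
  shows "segment_product G gs i j \<otimes> segment_product G gs j k = segment_product G gs i k"
proof -
  have "[i..<k] = [i..<j] @ [j..<k]"
    using ij jk by (metis upt_add_eq_append le_add_diff_inverse)
  then show ?thesis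
    using gs jk k unfolding segment_product_def
    by (simp only: map_append) (intro foldr_mult_append[symmetric]; force simp: subset_iff)
qed

lemma (in monoid) segment_product_single:
  "\<lbrakk>set gs \<subseteq> carrier G; i < length gs\<rbrakk> \<Longrightarrow> segment_product G gs i (Suc i) = gs ! i"
  by (simp add: segment_product_def subset_iff)

lemma (in monoid) segment_product_action:
  assumes gs: "gs \<in> simplices (classifying_space G) k" and t: "\<theta> \<in> mono_maps m k"
    and ij: "i \<le> j" and jm: "j \<le> m"
  shows "segment_product G (action (classifying_space G) k \<theta> gs) i j
    = segment_product G gs (\<theta> ! i) (\<theta> ! j)"
  using ij jm
proof (induction j rule: dec_induct)
  case base
  then show ?case by (simp add: segment_product_def)
next
  case (step j)
  let ?hs = "action (classifying_space G) k \<theta> gs"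
  have g: "set gs \<subseteq> carrier G" "length gs = k" using gs by (auto simp: classifying_space_def)
  have hs: "length ?hs = m" "?hs ! j = segment_product G gs (\<theta> ! j) (\<theta> ! Suc j)"
    using step t by (auto simp: classifying_space_def mono_maps_length)
  have hc: "set ?hs \<subseteq> carrier G"
    using g mono_maps_nth_le[OF t]
    by (auto simp: classifying_space_def mono_maps_length[OF t] intro!: segment_product_closed)
  have "segment_product G ?hs i (Suc j) = segment_product G ?hs i j \<otimes> segment_product G ?hs j (Suc j)"
    using step.hyps step.prems hs hc by (intro segment_product_trans[symmetric]) auto
  also have "\<dots> = segment_product G gs (\<theta> ! i) (\<theta> ! j) \<otimes> segment_product G gs (\<theta> ! j) (\<theta> ! Suc j)"
    using step hs hc by (simp add: segment_product_single)
  also have "\<dots> = segment_product G gs (\<theta> ! i) (\<theta> ! Suc j)"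
    using step g mono_maps_nth_le[OF t] mono_maps_nth_mono[OF t]
    by (intro segment_product_trans) auto
  finally show ?case .
qed

lemma simplicial_set_classifying_space:
  assumes "group G"
  shows "simplicial_set (classifying_space G)"
proof -
  interpret group G by fact
  let ?B = "classifying_space G"
  have closed: "action ?B k \<theta> gs \<in> simplices ?B m"
    if "\<theta> \<in> mono_maps m k" "gs \<in> simplices ?B k" for \<theta> m k gs
    using that mono_maps_nth_le[OF that(1)]
    by (auto simp: classifying_space_def mono_maps_length intro!: segment_product_closed)
  have ident: "action ?B k (id_map k) gs = gs" if "gs \<in> simplices ?B k" for k gs
    using that by (auto simp: classifying_space_def id_map_def segment_product_single simp del: upt_Suc
      intro!: nth_equalityI)
  have comp: "action ?B m \<phi> (action ?B k \<theta> gs) = action ?B k (\<theta> \<odot> \<phi>) gs"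
    if t: "\<theta> \<in> mono_maps m k" and p: "\<phi> \<in> mono_maps l m" and g: "gs \<in> simplices ?B k"
    for \<theta> m k \<phi> l gs
  proof -
    let ?hs = "action ?B k \<theta> gs"
    have "action ?B m \<phi> ?hs = map (\<lambda>j. segment_product G ?hs (\<phi> ! j) (\<phi> ! Suc j)) [0..<l]"
      using p by (simp add: classifying_space_def mono_maps_length)
    also have "\<dots> = map (\<lambda>j. segment_product G gs (\<theta> ! (\<phi> ! j)) (\<theta> ! (\<phi> ! Suc j))) [0..<l]"
      using mono_maps_nth_le[OF p] mono_maps_nth_mono[OF p]
      by (intro map_cong HOL.refl segment_product_action[OF g t]) auto
    also have "\<dots> = action ?B k (\<theta> \<odot> \<phi>) gs"
      using p by (simp add: classifying_space_def comp_map_def mono_maps_length)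
    finally show ?thesis .
  qed
  show ?thesis by (intro simplicial_set.intro closed ident comp)
qed

lemma simplicial_set_free:
  assumes "simplicial_set X"
  shows "simplicial_set (free_simplicial_abelian_group X)"
proof -
  interpret simplicial_set X by fact
  have closed: "action (free_simplicial_abelian_group X) k \<theta> c \<in> simplices (free_simplicial_abelian_group X) m"
    if "\<theta> \<in> mono_maps m k" "c \<in> simplices (free_simplicial_abelian_group X) k" for \<theta> m k c
    using that keys_frag_extend[of "\<lambda>x. frag_of (action X k \<theta> x)" c]
    by (fastforce simp: free_simplicial_abelian_group_def action_closed)
  have ident: "action (free_simplicial_abelian_group X) k (id_map k) c = c"
    if "c \<in> simplices (free_simplicial_abelian_group X) k" for k c
    using that frag_extend_eq[of c "\<lambda>x. frag_of (action X k (id_map k) x)" frag_of]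
    by (auto simp: free_simplicial_abelian_group_def action_id subset_iff frag_expansion[symmetric])
  have comp: "action (free_simplicial_abelian_group X) m \<phi> (action (free_simplicial_abelian_group X) k \<theta> c)
      = action (free_simplicial_abelian_group X) k (\<theta> \<odot> \<phi>) c"
    if "\<theta> \<in> mono_maps m k" "\<phi> \<in> mono_maps l m" "c \<in> simplices (free_simplicial_abelian_group X) k"
    for \<theta> m k \<phi> l c
  proof -
    have "frag_extend (\<lambda>y. frag_of (action X m \<phi> y)) (frag_extend (\<lambda>x. frag_of (action X k \<theta> x)) c)
      = frag_extend (\<lambda>x. frag_of (action X m \<phi> (action X k \<theta> x))) c"
      using frag_extend_compose[of "\<lambda>y. frag_of (action X m \<phi> y)" "action X k \<theta>" c] by (simp add: comp_def)
    also have "\<dots> = frag_extend (\<lambda>x. frag_of (action X k (\<theta> \<odot> \<phi>) x)) c"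
      using that by (intro frag_extend_eq) (auto simp: free_simplicial_abelian_group_def action_comp subset_iff)
    finally show ?thesis by (simp add: free_simplicial_abelian_group_def)
  qed
  show ?thesis by (intro simplicial_set.intro closed ident comp)
qed

lemma simplicial_map_alternating_map:
  "simplicial_map (sset_power X (2 * n)) (free_simplicial_abelian_group X) (alternating_map n)"
proof -
  have closed: "alternating_map n k xs \<in> simplices (free_simplicial_abelian_group X) k"
    if "xs \<in> simplices (sset_power X (2 * n)) k" for k xs
  proof -
    have "frag_cmul ((-1) ^ i) (frag_of (xs ! (i - 1))) \<in> carrier (free_Abelian_group (simplices X k))"
      if "i \<in> {1..2 * n}" for i
    proof -
      have "xs ! (i - 1) \<in> simplices X k"
        using \<open>xs \<in> _\<close> that by (auto simp: sset_power_def subset_iff)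
      then show ?thesis
        using keys_cmul[of "(-1) ^ i" "frag_of (xs ! (i - 1))"] by (auto simp: keys_frag_of)
    qed
    then show ?thesis
      using sum_closed_free_Abelian_group[of "{1..2 * n}" "\<lambda>i. frag_cmul ((-1) ^ i) (frag_of (xs ! (i - 1)))"]
      by (simp add: alternating_map_def free_simplicial_abelian_group_def)
  qed
  have nat: "alternating_map n m (map (action X k \<theta>) xs)
      = frag_extend (\<lambda>x. frag_of (action X k \<theta> x)) (alternating_map n k xs)"
    if "length xs = 2 * n" for k m \<theta> xs
    unfolding alternating_map_def
    using that by (subst frag_extend_sum) (auto simp: frag_extend_cmul o_def intro!: sum.cong)
  show ?thesis
    using closed nat by (auto simp: simplicial_map_def sset_power_def free_simplicial_abelian_group_def)
qed

lemma classifying_space_vertices: "simplices (classifying_space G) 0 = {[]}"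
  by (auto simp: classifying_space_def)

lemma alternating_map_replicate: "alternating_map n k (replicate (2 * n) x) = 0"
proof -
  have "(\<Sum>i = 1..2 * n. (-1) ^ i) = (0::int)"
    by (induction n) auto
  moreover have "alternating_map n k (replicate (2 * n) x) = (\<Sum>i = 1..2 * n. frag_cmul ((-1) ^ i) (frag_of x))"
    unfolding alternating_map_def by (intro sum.cong) auto
  moreover have "(\<Sum>i\<in>I. frag_cmul (g i) c) = frag_cmul (sum g I) c" for I :: "nat set" and g and c :: "'a \<Rightarrow>\<^sub>0 int"
    by (induction I rule: infinite_finite_induct) (auto simp: frag_cmul_distrib)
  ultimately show ?thesis by simp
qed

lemma fiber_vertices:
  "simplices (fiber (sset_power (classifying_space G) (2 * n))
     (free_simplicial_abelian_group (classifying_space G)) (alternating_map n) 0) 0 = {base_vertex n}"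
proof -
  have "xs = replicate (2 * n) []" if "length xs = 2 * n" "set xs \<subseteq> {[]}" for xs :: "'a list list"
    using that by (metis replicate_eqI singletonD subsetD)
  then show ?thesis
    by (auto simp: fiber_def sset_power_def classifying_space_vertices base_vertex_def
        alternating_map_replicate degenerate_def free_simplicial_abelian_group_def)
qed

lemma fiber_to_homotopy_fiber_classifying_space:
  fixes G :: "('g, 'z) monoid_scheme" and n :: nat
  defines "X \<equiv> classifying_space G"
  defines "ZX \<equiv> free_simplicial_abelian_group X"
  defines "P \<equiv> sset_power X (2 * n)"
  defines "F0 \<equiv> fiber P ZX (alternating_map n) 0"
    and "HF \<equiv> homotopy_fiber P ZX (alternating_map n) 0"
  assumes "group G"
  shows "simplicial_set F0" "simplicial_set HF"
    "simplicial_map F0 HF (fiber_to_homotopy_fiber ZX 0)"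
proof -
  have "simplicial_set P" "simplicial_set ZX"
    using assms by (simp_all add: simplicial_set_classifying_space simplicial_set_power simplicial_set_free)
  moreover have "simplicial_map P ZX (alternating_map n)"
    by (simp add: P_def ZX_def simplicial_map_alternating_map)
  moreover have "0 \<in> simplices ZX 0"
    by (simp add: ZX_def free_simplicial_abelian_group_def)
  ultimately show "simplicial_set F0" "simplicial_set HF"
    "simplicial_map F0 HF (fiber_to_homotopy_fiber ZX 0)"
    by (simp_all add: F0_def HF_def simplicial_set_fiber simplicial_set_homotopy_fiber
        simplicial_map_fiber_to_homotopy_fiber)
qed

lemma (in simplicial_set) face_closed:
  "\<lbrakk>x \<in> simplices X (Suc k); i \<le> Suc k\<rbrakk> \<Longrightarrow> face X (Suc k) i x \<in> simplices X k"
  by (simp add: face_def action_closed coface_closed)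

lemma (in simplicial_set) edge_target_closed:
  "e \<in> simplices X 1 \<Longrightarrow> edge_target X (e, b) \<in> simplices X 0"
  using face_closed[of e 0] by (auto simp: edge_target_def)

lemma edge_target_flip: "edge_target X (e, \<not> b) = edge_source X (e, b)"
  by (simp add: edge_target_def edge_source_def)

lemma edge_source_flip: "edge_source X (e, \<not> b) = edge_target X (e, b)"
  by (simp add: edge_target_def edge_source_def)

lemma (in simplicial_set) triangle_vertices:
  assumes s: "\<sigma> \<in> simplices X 2"
  shows "face X 1 1 (face X 2 2 \<sigma>) = face X 1 1 (face X 2 1 \<sigma>)"
    and "face X 1 0 (face X 2 0 \<sigma>) = face X 1 0 (face X 2 1 \<sigma>)"
    and "face X 1 0 (face X 2 2 \<sigma>) = face X 1 1 (face X 2 0 \<sigma>)"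
proof -
  have c: "face X 1 i (face X 2 j \<sigma>) = action X 2 (coface 2 j \<odot> coface 1 i) \<sigma>"
    if "i \<le> 1" "j \<le> 2" for i j
    using that s coface_closed[of j 1] coface_closed[of i 0]
    by (simp add: face_def action_comp numeral_2_eq_2)
  have v: "coface 1 0 = [1]" "coface 1 1 = [0]" "coface 2 0 = [1, 2]" "coface 2 1 = [0, 2]"
    "coface 2 2 = [0, 1]"
    by (simp_all add: coface_def id_map_def numeral_2_eq_2)
  show "face X 1 1 (face X 2 2 \<sigma>) = face X 1 1 (face X 2 1 \<sigma>)"
    and "face X 1 0 (face X 2 0 \<sigma>) = face X 1 0 (face X 2 1 \<sigma>)"
    and "face X 1 0 (face X 2 2 \<sigma>) = face X 1 1 (face X 2 0 \<sigma>)"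
    by (simp_all only: c v order.refl zero_le one_le_numeral) (simp_all add: comp_map_def)
qed

lemma edge_path_end: "edge_path X v p w \<Longrightarrow> w \<in> simplices X 0"
  by (induction p arbitrary: v) auto

lemma edge_path_append:
  assumes X: "simplicial_set X"
  shows "edge_path X v (p @ q) w \<longleftrightarrow> (\<exists>u. edge_path X v p u \<and> edge_path X u q w)"
proof (induction p arbitrary: v)
  case Nil
  have "v \<in> simplices X 0" if "edge_path X v q w"
    using that simplicial_set.face_closed[OF X, of _ 0]
    by (cases q) (auto simp: edge_source_def)
  then show ?case by auto
qed auto

lemma edge_homotopic_path:
  assumes X: "simplicial_set X"
  shows "edge_homotopic X v w p q \<Longrightarrow> edge_path X v p w \<and> edge_path X v q w"
proof (induction rule: edge_homotopic.induct)
  case (cancel p e b q)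
  then show ?case
    by (auto simp: edge_path_append[OF X] edge_target_flip edge_source_flip)
next
  case (triangle \<sigma> p q)
  have "face X 2 1 \<sigma> \<in> simplices X 1"
    using simplicial_set.face_closed[OF X, of \<sigma> 1 1] triangle by (simp add: numeral_2_eq_2)
  with triangle simplicial_set.triangle_vertices[OF X triangle(1)] show ?case
    by (auto simp: edge_path_append[OF X] edge_source_def edge_target_def)
qed auto

lemma edge_homotopic_append:
  assumes X: "simplicial_set X"
  shows "\<lbrakk>edge_homotopic X v w p q; edge_path X u l v; edge_path X w r z\<rbrakk>
    \<Longrightarrow> edge_homotopic X u z (l @ p @ r) (l @ q @ r)"
proof (induction rule: edge_homotopic.induct)
  case (refl p)
  then show ?case by (intro edge_homotopic.refl) (auto simp: edge_path_append[OF X])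
next
  case (sym p q)
  then show ?case by (blast intro: edge_homotopic.sym)
next
  case (trans p q r)
  then show ?case by (blast intro: edge_homotopic.trans)
next
  case (cancel p e b q)
  have "edge_path X u ((l @ p) @ [(e, b), (e, \<not> b)] @ (q @ r)) z"
    using cancel unfolding edge_path_append[OF X] by blast
  from edge_homotopic.cancel[OF this] show ?case by simp
next
  case (triangle \<sigma> p q)
  have "edge_path X u ((l @ p) @ [(face X 2 2 \<sigma>, True), (face X 2 0 \<sigma>, True)] @ (q @ r)) z"
    using triangle unfolding edge_path_append[OF X] by blast
  from edge_homotopic.triangle[OF triangle(1) this] show ?case by simp
qed

lemma edge_homotopic_append2:
  assumes X: "simplicial_set X" and "edge_homotopic X u v p p'" "edge_homotopic X v w q q'"
  shows "edge_homotopic X u w (p @ q) (p' @ q')"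
proof -
  have e: "edge_path X u p' v" "edge_path X v q w" "edge_path X u p v"
    using assms edge_homotopic_path[OF X] by blast+
  have "edge_path X u [] u" "edge_path X w [] w"
    using e edge_path_end[OF e(2)] edge_path_append[OF X, of u "[]" p v] by auto
  then have "edge_homotopic X u w (p @ q) (p' @ q)" "edge_homotopic X u w (p' @ q) (p' @ q')"
    using edge_homotopic_append[OF X assms(2), of u "[]" q w]
      edge_homotopic_append[OF X assms(3), of u p' "[]" w] e by auto
  then show ?thesis by (rule edge_homotopic.trans)
qed

definition reverse_path :: "'a edge_word \<Rightarrow> 'a edge_word" where
  "reverse_path p = rev (map (\<lambda>(e, b). (e, \<not> b)) p)"

lemma edge_path_reverse:
  assumes X: "simplicial_set X"
  shows "edge_path X v p w \<Longrightarrow> edge_path X w (reverse_path p) v"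
proof (induction p arbitrary: v)
  case (Cons a p)
  obtain e b where a: "a = (e, b)" by force
  have "v \<in> simplices X 0"
    using Cons.prems edge_path_append[OF X, of v "[]" "a # p" w] by auto
  then have "edge_path X (edge_target X a) [(e, \<not> b)] v"
    using Cons.prems a by (simp add: edge_source_flip edge_target_flip)
  then show ?case
    using Cons a by (auto simp: reverse_path_def edge_path_append[OF X])
qed (simp add: reverse_path_def)

lemma reverse_path_cancel:
  assumes X: "simplicial_set X"
  shows "edge_path X v p w \<Longrightarrow> edge_homotopic X w w (reverse_path p @ p) []"
proof (induction p arbitrary: v)
  case Nil
  then show ?case by (auto simp: reverse_path_def intro: edge_homotopic.refl)
next
  case (Cons a p)
  obtain e b where a: "a = (e, b)" by force
  let ?q = "reverse_path p @ [(e, \<not> b), (e, \<not> \<not> b)] @ p"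
  have q: "?q = reverse_path (a # p) @ (a # p)" using a by (simp add: reverse_path_def)
  have "edge_path X w ?q w"
    unfolding q edge_path_append[OF X] using edge_path_reverse[OF X Cons.prems] Cons.prems by blast
  have "edge_homotopic X w w ?q (reverse_path p @ p)"
    by (rule edge_homotopic.cancel) fact
  moreover have "edge_homotopic X w w (reverse_path p @ p) []"
    using Cons by auto
  ultimately show ?case
    unfolding q by (rule edge_homotopic.trans)
qed

lemma equiv_loop_homotopy:
  assumes X: "simplicial_set X"
  shows "equiv (edge_loops X v) (loop_homotopy X v)"
  using edge_homotopic_path[OF X]
  by (auto simp: equiv_def refl_on_def sym_def trans_def edge_loops_def loop_homotopy_def
      intro: edge_homotopic.refl edge_homotopic.sym edge_homotopic.trans)

lemma fundamental_group_mult: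
  assumes X: "simplicial_set X" and p: "p \<in> edge_loops X v" and q: "q \<in> edge_loops X v"
  shows "loop_homotopy X v `` {p} \<otimes>\<^bsub>\<pi>\<^sub>1 X v\<^esub> loop_homotopy X v `` {q} = loop_homotopy X v `` {p @ q}"
proof -
  have "(p, p) \<in> loop_homotopy X v" "(q, q) \<in> loop_homotopy X v"
    using p q by (auto simp: loop_homotopy_def edge_loops_def intro: edge_homotopic.refl)
  moreover have "(p @ q, r) \<in> loop_homotopy X v"
    if "(p, p') \<in> loop_homotopy X v" "(q, q') \<in> loop_homotopy X v" "(p' @ q', r) \<in> loop_homotopy X v" for p' q' r
    using that edge_homotopic_append2[OF X, of v v p p' v q q']
    by (auto simp: loop_homotopy_def intro: edge_homotopic.trans)
  ultimately show ?thesis by (fastforce simp: fundamental_group_def)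
qed

lemma group_fundamental_group:
  assumes X: "simplicial_set X" and v: "v \<in> simplices X 0"
  shows "group (\<pi>\<^sub>1 X v)"
proof -
  let ?c = "\<lambda>p. loop_homotopy X v `` {p}"
  have carr: "carrier (\<pi>\<^sub>1 X v) = ?c ` edge_loops X v"
    by (auto simp: fundamental_group_def quotient_def)
  have one: "\<one>\<^bsub>\<pi>\<^sub>1 X v\<^esub> = ?c []" and nil: "[] \<in> edge_loops X v"
    using v by (auto simp: fundamental_group_def edge_loops_def)
  have app: "p @ q \<in> edge_loops X v" if "p \<in> edge_loops X v" "q \<in> edge_loops X v" for p q
    using that by (auto simp: edge_loops_def edge_path_append[OF X])
  note m = fundamental_group_mult[OF X]
  show ?thesis
  proof (rule groupI)
    fix A assume "A \<in> carrier (\<pi>\<^sub>1 X v)"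
    then obtain p where A: "A = ?c p" and p: "p \<in> edge_loops X v" by (auto simp: carr)
    have r: "reverse_path p \<in> edge_loops X v"
      using p edge_path_reverse[OF X] by (auto simp: edge_loops_def)
    have "(reverse_path p @ p, []) \<in> loop_homotopy X v"
      using p reverse_path_cancel[OF X] by (auto simp: edge_loops_def loop_homotopy_def)
    then have "?c (reverse_path p) \<otimes>\<^bsub>\<pi>\<^sub>1 X v\<^esub> A = \<one>\<^bsub>\<pi>\<^sub>1 X v\<^esub>"
      unfolding A one m[OF r p] by (rule equiv_class_eq[OF equiv_loop_homotopy[OF X]])
    then show "\<exists>B\<in>carrier (\<pi>\<^sub>1 X v). B \<otimes>\<^bsub>\<pi>\<^sub>1 X v\<^esub> A = \<one>\<^bsub>\<pi>\<^sub>1 X v\<^esub>"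
      using r by (auto simp: carr)
    show "\<one>\<^bsub>\<pi>\<^sub>1 X v\<^esub> \<otimes>\<^bsub>\<pi>\<^sub>1 X v\<^esub> A = A"
      by (simp add: A one m[OF nil p])
  qed (auto simp: carr one nil m app)
qed

lemma fundamental_group_map_hom:
  assumes X: "simplicial_set X" and Y: "simplicial_set Y" and f: "simplicial_map X Y f"
    and v: "v \<in> simplices X 0"
  shows "fundamental_group_map Y (f 0 v) f \<in> hom (\<pi>\<^sub>1 X v) (\<pi>\<^sub>1 Y (f 0 v))"
proof -
  let ?f = "map (map_prod (f 1) id)"
  let ?c = "\<lambda>p. loop_homotopy X v `` {p}" and ?d = "\<lambda>p. loop_homotopy Y (f 0 v) `` {p}"
  have face: "face Y (Suc k) i (f (Suc k) x) = f k (face X (Suc k) i x)"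
    if "x \<in> simplices X (Suc k)" "i \<le> Suc k" for k i x
    using f that coface_closed[of i k] by (simp add: simplicial_map_def face_def)
  have face1: "face Y 1 i (f 1 x) = f 0 (face X 1 i x)" if "x \<in> simplices X 1" "i \<le> 1" for i x
    using that face[of x 0 i] by simp
  have face2: "face Y 2 i (f 2 x) = f 1 (face X 2 i x)" if "x \<in> simplices X 2" "i \<le> 2" for i x
    using that face[of x 1 i] by (simp add: numeral_2_eq_2)
  have fc: "f k x \<in> simplices Y k" if "x \<in> simplices X k" for k x
    using f that by (simp add: simplicial_map_def)
  have path: "edge_path Y (f 0 u) (?f p) (f 0 w)" if "edge_path X u p w" for u p w
    using that
  proof (induction p arbitrary: u)
    case (Cons a p)
    then show ?case
      by (cases a) (force simp: edge_source_def edge_target_def face1 fc split: if_splits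
        simp del: One_nat_def)
  qed (simp add: fc)
  have htpy: "edge_homotopic Y (f 0 u) (f 0 w) (?f p) (?f q)" if "edge_homotopic X u w p q" for u w p q
    using that
  proof (induction rule: edge_homotopic.induct)
    case (refl p) then show ?case by (intro edge_homotopic.refl path)
  next
    case (sym p q) show ?case by (rule edge_homotopic.sym[OF sym.IH])
  next
    case (trans p q r) show ?case by (rule edge_homotopic.trans[OF trans.IH])
  next
    case (cancel p e b q)
    from edge_homotopic.cancel[of Y "f 0 u" "?f p" "f 1 e" b "?f q" "f 0 w"] path[OF cancel]
    show ?case by (simp add: id_def)
  next
    case (triangle \<sigma> p q)
    have "face X 2 i \<sigma> \<in> simplices X 1" if "i \<le> 2" for i
      using simplicial_set.face_closed[OF X, of \<sigma> 1 i] triangle that by (simp add: numeral_2_eq_2)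
    from edge_homotopic.triangle[of "f 2 \<sigma>" Y "f 0 u" "?f p" "?f q" "f 0 w"] path[OF triangle(2)]
    show ?case using triangle(1) by (simp add: fc face2 id_def del: One_nat_def)
  qed
  have loops: "?f p \<in> edge_loops Y (f 0 v)" if "p \<in> edge_loops X v" for p
    using that path by (auto simp: edge_loops_def)
  have app: "p @ q \<in> edge_loops X v" if "p \<in> edge_loops X v" "q \<in> edge_loops X v" for p q
    using that by (auto simp: edge_loops_def edge_path_append[OF X])
  have cls: "fundamental_group_map Y (f 0 v) f (?c p) = ?d (?f p)" if p: "p \<in> edge_loops X v" for p
  proof -
    have "(p, p) \<in> loop_homotopy X v"
      using p by (auto simp: loop_homotopy_def edge_loops_def intro: edge_homotopic.refl)
    moreover have "(?f p, r) \<in> loop_homotopy Y (f 0 v)"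
      if "(p, q) \<in> loop_homotopy X v" "(?f q, r) \<in> loop_homotopy Y (f 0 v)" for q r
      using that htpy[of v v p q] by (auto simp: loop_homotopy_def intro: edge_homotopic.trans)
    ultimately show ?thesis by (fastforce simp: fundamental_group_map_def)
  qed
  have carr: "carrier (\<pi>\<^sub>1 X v) = ?c ` edge_loops X v"
    "carrier (\<pi>\<^sub>1 Y (f 0 v)) = ?d ` edge_loops Y (f 0 v)"
    by (auto simp: fundamental_group_def quotient_def)
  show ?thesis
    by (rule homI) (auto simp: carr cls loops app fundamental_group_mult[OF X]
      fundamental_group_mult[OF Y] simp del: One_nat_def)
qed

end

theory Submission
  imports Defs "HOL-Algebra.Bij"
begin

text \<open>
  An edge of the fiber is a tuple in which every value occurs as often at odd as at even positions,
  so \<open>\<pi>\<^sub>1\<close> of the fiber is a group \<open>\<Gamma>\<close> generated by the classes \<open>x i j g\<close> of the edges with entry \<open>g\<close>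
  at one odd and one even position; for \<open>n \<ge> 3\<close> commuting and exchange relations between them hold.

  Injectivity: by these relations \<open>\<Gamma>\<close> embeds in a group \<open>B\<close> in which the edges with a single entry
  lift as well, multiplicatively up to a central factor set \<open>f\<close>, which extends linearly to the
  2-chains in \<open>\<int>[X]\<close>. Correcting by this factor set, evaluated on the two triangles of the path
  component of an edge of the homotopy fiber, extends the embedding to a functor on the edges of the
  homotopy fiber with values in \<open>B\<close>.

  Surjectivity: every edge of the homotopy fiber is homotopic to the cone over a 2-chain, and hence to
  a canonical lift of a word in the edges of \<open>X\<^sup>2\<^sup>n\<close>. Modulo the image of \<open>\<Gamma>\<close> the edges with a single
  entry commute and depend only on the parity of the position, so a word with vanishing alternating
  sum comes from the fiber.
\<close>

section \<open>Extending a group along a crossed pairing\<close>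

text \<open>Entries at one position need not commute, and a commutator of two elements of
  \<open>G\<close> can be realized at a single position without leaving the fiber. Its class
  \<open>c a b\<close> obeys the rules of the pairing into a nonabelian exterior square. Adjoining
  lifts of single entries therefore means adjoining elements \<open>s a\<close> with commutators
  \<open>c a b\<close> that act on the old group by the twisted rule \<gamma> \<mapsto>
  \<open>c a (\<pi> \<gamma>) \<cdot> \<gamma>\<close>. A presentation would leave open whether the
  old group survives; permutations of the expected normal forms settle this at once. One lift is
  adjoined for each element of \<open>G\<close> separately, which is why \<open>s\<close> is only a
  map and a factor set appears.

  The bound \<open>n \<ge> 3\<close> gives a third odd and a third even position, so that two blocks
  can always be compared through one that meets neither.

  In the second half, the lift of a triangle of the power closes up only up to a loop determined by
  its 2-chain. The subset \<open>Q\<close> retains all edges but only those triangles for which this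
  loop is invisible.\<close>

lemma exists_linorder: "\<exists>le lt :: 'a \<Rightarrow> 'a \<Rightarrow> bool. class.linorder le lt"
proof -
  obtain r :: "'a rel" where r: "well_order_on UNIV r"
    using Zorn.well_order_on ..
  then have *: "refl r" "trans r" "antisym r" "total r"
    by (simp_all only: well_order_on_def linear_order_on_def partial_order_on_def preorder_on_def)
  have tr: "\<And>x y z. (x, y) \<in> r \<Longrightarrow> (y, z) \<in> r \<Longrightarrow> (x, z) \<in> r" using *(2) by (rule transD)
  have as: "\<And>x y. (x, y) \<in> r \<Longrightarrow> (y, x) \<in> r \<Longrightarrow> x = y" using *(3) by (rule antisymD)
  have rf: "\<And>x. (x, x) \<in> r" using *(1) by (simp add: refl_on_def)
  have tt: "\<And>x y. (x, y) \<in> r \<or> (y, x) \<in> r" using *(4) rf by (metis UNIV_I total_on_def)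
  have "class.linorder (\<lambda>x y. (x, y) \<in> r) (\<lambda>x y. (x, y) \<in> r \<and> x \<noteq> y)"
    apply unfold_locales
    subgoal for x y using as[of x y] rf[of x] by metis
    subgoal by (rule rf)
    subgoal by (rule tr)
    subgoal by (rule as)
    subgoal by (rule tt)
    done
  then show ?thesis by (intro exI)
qed

lemma (in group) foldr_mult_filter:
  assumes "\<And>h. h \<in> set L \<Longrightarrow> \<not> P h \<Longrightarrow> f h = \<one>" "\<And>h. h \<in> set L \<Longrightarrow> f h \<in> carrier G"
  shows "foldr (\<otimes>) (map f L) \<one> = foldr (\<otimes>) (map f (filter P L)) \<one>"
  using assms
proof (induction L)
  case (Cons h L)
  have "foldr (\<otimes>) (map f (filter P L)) \<one> \<in> carrier G"
    by (rule foldr_mult_closed) (use Cons in auto)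
  with Cons show ?case by auto
qed auto

text \<open>
  For a linear order \<open>lt\<close> of the group, \<open>v a p\<close> is the ordered product of the powers \<open>h [^] p h\<close> of
  the elements \<open>h\<close> below \<open>a\<close>.
\<close>

lemma (in group) exists_ordered_value:
  "\<exists>(lt :: 'a \<Rightarrow> 'a \<Rightarrow> bool) (v :: 'a \<Rightarrow> ('a \<Rightarrow>\<^sub>0 int) \<Rightarrow> 'a). (\<forall>a b. a \<noteq> b \<longrightarrow> lt a b \<or> lt b a)
    \<and> (\<forall>a p. Poly_Mapping.keys p \<subseteq> carrier G \<longrightarrow> v a p \<in> carrier G)
    \<and> (\<forall>a b p. lt b a \<longrightarrow> v b (p + frag_of a) = v b p)
    \<and> (\<forall>a b p. lt b a \<longrightarrow> b \<in> carrier G \<longrightarrow> Poly_Mapping.keys p \<subseteq> carrier G \<longrightarrow>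
         (\<exists>u\<in>carrier G. v a p = v b p \<otimes> u \<and> v a (p + frag_of b) = v b p \<otimes> b \<otimes> u))"
proof -
  obtain le lt :: "'a \<Rightarrow> 'a \<Rightarrow> bool" where "class.linorder le lt"
    using exists_linorder by blast
  then interpret O: linorder le lt .
  let ?L = "O.sorted_list_of_set" and ?k = "Poly_Mapping.keys" and ?l = "Poly_Mapping.lookup"
  define W where "W L (p :: 'a \<Rightarrow>\<^sub>0 int) = foldr (\<otimes>) (map (\<lambda>h. h [^] ?l p h) L) \<one>" for L p
  define v where "v a (p :: 'a \<Rightarrow>\<^sub>0 int) = W (?L {h \<in> ?k p. lt h a}) p" for a p
  have Wc: "W L p \<in> carrier G" if "set L \<subseteq> carrier G" for L and p :: "'a \<Rightarrow>\<^sub>0 int"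
    unfolding W_def by (rule foldr_mult_closed) (use that in auto)
  have Wcong: "W L p = W L q" if "\<And>h. h \<in> set L \<Longrightarrow> ?l p h = ?l q h" for L and p q :: "'a \<Rightarrow>\<^sub>0 int"
    unfolding W_def using that by (simp cong: map_cong)
  \<comment> \<open>Every increasing list of elements below \<open>a\<close> that contains all keys
    of \<open>p\<close> below \<open>a\<close> gives the same product, since the additional elements
    enter with exponent 0. This allows one list for both \<open>p\<close> and
    \<open>p + frag_of b\<close>.\<close>
  have key: "W L p = v a p" if L: "sorted_wrt lt L" "set L \<subseteq> carrier G" 
    "{h \<in> ?k p. lt h a} \<subseteq> set L" "\<And>h. h \<in> set L \<Longrightarrow> lt h a" for L p a
  proof -
    let ?F = "filter (\<lambda>h. h \<in> ?k p) L"
    have "W L p = W ?F p" unfolding W_def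
      by (rule foldr_mult_filter) (use L in \<open>auto simp: in_keys_iff\<close>)
    moreover have "set ?F = {h \<in> ?k p. lt h a}" using L by auto
    moreover have "O.sorted ?F \<and> distinct ?F"
      using sorted_wrt_filter[OF L(1)] unfolding O.strict_sorted_iff by blast
    ultimately show ?thesis unfolding v_def
      by (metis O.sorted_list_of_set.idem_if_sorted_distinct)
  qed
  have 1: "v a p \<in> carrier G" if "?k p \<subseteq> carrier G" for a p
    unfolding v_def by (rule Wc) (use that in auto)
  have lk: "?l (p + frag_of a) h = (if h = a then ?l p h + 1 else ?l p h)" for a h :: 'a and p
    by (simp add: lookup_add lookup_single when_def)
  have 2: "v b (p + frag_of a) = v b p" if "lt b a" for a b p
  proof -
    have ne: "h \<noteq> a" if "lt h b" for h
      using O.less_trans[OF that \<open>lt b a\<close>] by blast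
    then have K: "{h \<in> ?k (p + frag_of a). lt h b} = {h \<in> ?k p. lt h b}"
      by (auto simp: in_keys_iff lk)
    have "h \<noteq> a" if "h \<in> set (?L {h \<in> ?k p. lt h b})" for h
      using ne that by simp
    then show ?thesis unfolding v_def K
      by (intro Wcong) (simp only: lk if_False)
  qed
  have 3: "\<exists>u\<in>carrier G. v a p = v b p \<otimes> u \<and> v a (p + frag_of b) = v b p \<otimes> b \<otimes> u"
    if ab: "lt b a" "b \<in> carrier G" "?k p \<subseteq> carrier G" for a b p
  proof -
    \<comment> \<open>The list is cut at \<open>b\<close>; passing to \<open>p + frag_of b\<close>
      raises only the exponent in the middle, and the extra factor can be placed directly after
      \<open>v b p\<close>.\<close>
    let ?L1 = "?L {h \<in> ?k p. lt h b}" and ?L2 = "?L {h \<in> ?k p. lt b h \<and> lt h a}"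
    let ?K = "?L1 @ b # ?L2"
    have c: "set ?L1 \<subseteq> carrier G" "set ?L2 \<subseteq> carrier G" using ab by auto
    have s: "sorted_wrt lt ?K"
      using O.strict_sorted_list_of_set by (auto simp: sorted_wrt_append) 
    have "W ?K p = v a p"
      by (rule key[OF s]) (use c ab in auto)
    moreover have "W ?K (p + frag_of b) = v a (p + frag_of b)"
      by (rule key[OF s]) (use c ab in \<open>auto simp: in_keys_iff lk split: if_splits\<close>)
    moreover have W: "W ?K q = W ?L1 q \<otimes> (b [^] ?l q b \<otimes> W ?L2 q)" for q
      unfolding W_def using c ab by (subst map_append, subst foldr_mult_append) auto
    moreover have "W ?L1 (p + frag_of b) = W ?L1 p" "W ?L2 (p + frag_of b) = W ?L2 p"
      by (rule Wcong; auto simp: lk)+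
    moreover have "b [^] ?l (p + frag_of b) b = b \<otimes> b [^] ?l p b"
      using ab int_pow_mult[of b 1 "?l p b"] by (simp add: lk add.commute)
    moreover have "W ?L1 p = v b p" by (simp add: v_def)
    ultimately have "v a p = v b p \<otimes> (b [^] ?l p b \<otimes> W ?L2 p) \<and>
        v a (p + frag_of b) = v b p \<otimes> b \<otimes> (b [^] ?l p b \<otimes> W ?L2 p)"
      using ab c Wc[of ?L2 p] 1[of p b] by (simp add: m_assoc)
    then show ?thesis using ab c Wc[of ?L2 p] by blast
  qed
  show ?thesis
    by (rule exI[of _ lt], rule exI[of _ v], intro conjI allI impI, erule O.neqE)
      (simp_all only: simp_thms 1 2 3)
qed

lemma (in group) inv_cancel_left:
  "\<lbrakk>a \<in> carrier G; b \<in> carrier G\<rbrakk> \<Longrightarrow> inv a \<otimes> (a \<otimes> b) = b"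
  "\<lbrakk>a \<in> carrier G; b \<in> carrier G\<rbrakk> \<Longrightarrow> a \<otimes> (inv a \<otimes> b) = b"
  by (simp_all add: m_assoc[symmetric])

lemmas (in group) free_reduce = m_assoc inv_mult_group inv_cancel_left

text \<open>
  \<open>c\<close> is a lift to \<open>H\<close> of the commutator pairing of \<open>G\<close>, and \<open>x\<close> is a lift of the identity of \<open>G\<close>.
\<close>

locale crossed_pairing = G: group G + H: group H
  for G :: "('g, 'y) monoid_scheme" (structure) and H :: "('h, 'z) monoid_scheme" +
  fixes \<pi> :: "'h \<Rightarrow> 'g" and x :: "'g \<Rightarrow> 'h" and c :: "'g \<Rightarrow> 'g \<Rightarrow> 'h"
  assumes proj_hom: "\<pi> \<in> hom H G" and lift_hom: "x \<in> hom G H"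
    and pairing_closed: "\<lbrakk>a \<in> carrier G; b \<in> carrier G\<rbrakk> \<Longrightarrow> c a b \<in> carrier H"
    and proj_pairing:
      "\<lbrakk>a \<in> carrier G; b \<in> carrier G\<rbrakk> \<Longrightarrow> \<pi> (c a b) = a \<otimes> b \<otimes> inv a \<otimes> inv b"
    and pairing_conj: "\<lbrakk>a \<in> carrier G; b \<in> carrier G; \<gamma> \<in> carrier H\<rbrakk> \<Longrightarrow>
      \<gamma> \<otimes>\<^bsub>H\<^esub> c a b \<otimes>\<^bsub>H\<^esub> inv\<^bsub>H\<^esub> \<gamma> = x (\<pi> \<gamma>) \<otimes>\<^bsub>H\<^esub> c a b \<otimes>\<^bsub>H\<^esub> inv\<^bsub>H\<^esub> x (\<pi> \<gamma>)"
    and pairing_mult: "\<lbrakk>a \<in> carrier G; b \<in> carrier G; d \<in> carrier G\<rbrakk> \<Longrightarrow>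
      c a (b \<otimes> d) = c a b \<otimes>\<^bsub>H\<^esub> (x b \<otimes>\<^bsub>H\<^esub> c a d \<otimes>\<^bsub>H\<^esub> inv\<^bsub>H\<^esub> x b)"
    and pairing_commutator: "\<lbrakk>a \<in> carrier G; b \<in> carrier G; d \<in> carrier G\<rbrakk> \<Longrightarrow>
      c d (a \<otimes> b \<otimes> inv a \<otimes> inv b) = x d \<otimes>\<^bsub>H\<^esub> c a b \<otimes>\<^bsub>H\<^esub> inv\<^bsub>H\<^esub> x d \<otimes>\<^bsub>H\<^esub> inv\<^bsub>H\<^esub> c a b"
    and pairing_swap: "\<lbrakk>a \<in> carrier G; b \<in> carrier G\<rbrakk> \<Longrightarrow> c b a = inv\<^bsub>H\<^esub> c a b"
    and pairing_self: "a \<in> carrier G \<Longrightarrow> c a a = \<one>\<^bsub>H\<^esub>"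
begin

abbreviation mult_H (infixl \<open>\<cdot>\<close> 70) where "a \<cdot> b \<equiv> a \<otimes>\<^bsub>H\<^esub> b"
abbreviation inv_H (\<open>inv\<^sub>H _\<close> [81] 80) where "inv\<^sub>H a \<equiv> inv\<^bsub>H\<^esub> a"

sublocale proj: group_hom H G \<pi>
  by (simp add: group_hom_def group_hom_axioms_def proj_hom)

sublocale lift: group_hom G H x
  by (simp add: group_hom_def group_hom_axioms_def lift_hom)

declare pairing_closed [simp] proj_pairing [simp]

lemma pairing_one_right [simp]: "a \<in> carrier G \<Longrightarrow> c a \<one> = \<one>\<^bsub>H\<^esub>"
  using pairing_mult[of a \<one> \<one>] by (simp add: H.l_cancel_one[OF pairing_closed pairing_closed])

lemma pairing_one_left [simp]: "a \<in> carrier G \<Longrightarrow> c \<one> a = \<one>\<^bsub>H\<^esub>"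
  using pairing_swap[of a \<one>] by simp

lemma pairing_mult_left:
  "\<lbrakk>a \<in> carrier G; b \<in> carrier G; d \<in> carrier G\<rbrakk> \<Longrightarrow>
    c (a \<otimes> b) d = (x a \<cdot> c b d \<cdot> inv\<^sub>H x a) \<cdot> c a d"
  using pairing_mult[of d a b] pairing_swap[of d "a \<otimes> b"] pairing_swap[of a d] pairing_swap[of b d]
  by (simp add: H.free_reduce)

text \<open>A Peiffer-type identity: \<open>pairing_conj\<close> for \<gamma> =
  \<open>c a b\<close>, whose projection is the commutator.\<close>

lemma pairing_conj_pairing:
  "\<lbrakk>a \<in> carrier G; b \<in> carrier G; d \<in> carrier G; e \<in> carrier G\<rbrakk> \<Longrightarrow>
   x (a \<otimes> b \<otimes> inv a \<otimes> inv b) \<cdot> c d e \<cdot> inv\<^sub>H x (a \<otimes> b \<otimes> inv a \<otimes> inv b)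
     = c a b \<cdot> c d e \<cdot> inv\<^sub>H c a b"
  using pairing_conj[of d e "c a b"] by simp

lemma pairing_commutator_mult:
  assumes "a \<in> carrier G" "b \<in> carrier G" "d \<in> carrier G" "e \<in> carrier G"
  shows "c d (a \<otimes> b \<otimes> inv a \<otimes> inv b \<otimes> e) = x d \<cdot> c a b \<cdot> inv\<^sub>H x d \<cdot> c d e \<cdot> inv\<^sub>H c a b"
  using assms
  by (subst pairing_mult) (simp_all only: pairing_commutator pairing_conj_pairing G.m_closed G.inv_closed,
    simp add: H.free_reduce)

text \<open>Both sides lift the same word; this is the relation between the permutations \<open>\<sigma> a\<close> below.\<close>

lemma pairing_exchange:
  assumes "a \<in> carrier G" "b \<in> carrier G" "m \<in> carrier G" "u \<in> carrier G"
  shows "c a (b \<otimes> m) \<cdot> c b (m \<otimes> inv u) = c a b \<cdot> c b (a \<otimes> m \<otimes> inv a \<otimes> inv u) \<cdot> c a m"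
proof -
  have e: "a \<otimes> m \<otimes> inv a \<otimes> inv u = a \<otimes> m \<otimes> inv a \<otimes> inv m \<otimes> (m \<otimes> inv u)"
    using assms by (simp add: G.free_reduce)
  show ?thesis
    using assms unfolding e by (subst pairing_commutator_mult) (simp_all add: pairing_mult H.free_reduce)
qed

text \<open>Composition law of the twisted maps \<gamma> \<mapsto>
  \<open>c a (\<pi> \<gamma>) \<cdot> \<gamma>\<close>: the map for \<open>b\<close> conjugates the
  projection by \<open>b\<close>, and then the map for \<open>a\<close> gives the map for
  \<open>a \<otimes> b\<close>. So \<open>G\<close> acts on \<open>H\<close>.\<close>

lemma pairing_action_mult:
  assumes "a \<in> carrier G" "b \<in> carrier G" "u \<in> carrier G"
  shows "c a (b \<otimes> u \<otimes> inv b) \<cdot> c b u = c (a \<otimes> b) u"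
proof -
  have e: "b \<otimes> u \<otimes> inv b = b \<otimes> u \<otimes> inv b \<otimes> inv u \<otimes> u"
    using assms by (simp add: G.free_reduce)
  show ?thesis
    using assms by (subst e, subst pairing_commutator_mult) (simp_all add: pairing_mult_left H.free_reduce)
qed

text \<open>A pair (\<kappa>, p) stands for the normal form \<kappa> followed by the powers
  \<open>s h [^] p h\<close> in increasing order of \<open>h\<close>. The group consists of
  permutations of these forms, \<open>l\<close> acting by left multiplication on \<kappa>; its
  injectivity is then visible on the pair with trivial components.\<close>

lemma extension:
  "\<exists>(B :: ('h \<times> ('g \<Rightarrow>\<^sub>0 int) \<Rightarrow> 'h \<times> ('g \<Rightarrow>\<^sub>0 int)) monoid) l s.
     group B \<and> l \<in> hom H B \<and> inj_on l (carrier H) \<and> s \<in> carrier G \<rightarrow> carrier B \<and> s \<one> = \<one>\<^bsub>B\<^esub> \<and>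
     (\<forall>a\<in>carrier G. \<forall>\<gamma>\<in>carrier H. s a \<otimes>\<^bsub>B\<^esub> l \<gamma> = l (c a (\<pi> \<gamma>) \<cdot> \<gamma>) \<otimes>\<^bsub>B\<^esub> s a) \<and>
     (\<forall>a\<in>carrier G. \<forall>b\<in>carrier G. s a \<otimes>\<^bsub>B\<^esub> s b = l (c a b) \<otimes>\<^bsub>B\<^esub> (s b \<otimes>\<^bsub>B\<^esub> s a))"
proof -
  from G.exists_ordered_value obtain lt :: "'g \<Rightarrow> 'g \<Rightarrow> bool" and v :: "'g \<Rightarrow> ('g \<Rightarrow>\<^sub>0 int) \<Rightarrow> 'g"
    where *: "\<forall>a b. a \<noteq> b \<longrightarrow> lt a b \<or> lt b a"
      "\<forall>a p. Poly_Mapping.keys p \<subseteq> carrier G \<longrightarrow> v a p \<in> carrier G"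
      "\<forall>a b p. lt b a \<longrightarrow> v b (p + frag_of a) = v b p"
      "\<forall>a b p. lt b a \<longrightarrow> b \<in> carrier G \<longrightarrow> Poly_Mapping.keys p \<subseteq> carrier G \<longrightarrow>
         (\<exists>u\<in>carrier G. v a p = v b p \<otimes> u \<and> v a (p + frag_of b) = v b p \<otimes> b \<otimes> u)"
    by (elim exE conjE) (rule that)
  note lt = *(1)[rule_format] and v = *(2)[rule_format] and v_ge = *(3)[rule_format] and v_lt = *(4)[rule_format]
  define S where "S = carrier H \<times> {p :: 'g \<Rightarrow>\<^sub>0 int. Poly_Mapping.keys p \<subseteq> carrier G}"
  \<comment> \<open>Left multiplication by \<open>s a\<close> on a normal form: moving
    \<open>s a\<close> to its place in the order passes \<kappa> and the powers of all
    \<open>h\<close> below \<open>a\<close>. By multiplicativity of the pairing the collected factor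
    is the pairing of \<open>a\<close> with the projection of what was passed.\<close>
  define \<sigma> where "\<sigma> a = (\<lambda>(\<kappa>, p)\<in>S. (c a (\<pi> \<kappa> \<otimes> v a p) \<cdot> \<kappa>, p + frag_of a))" for a
  define l where "l \<gamma> = (\<lambda>(\<kappa>, p)\<in>S. (\<gamma> \<cdot> \<kappa>, p))" for \<gamma>
  \<comment> \<open>The permutation \<sigma> of the unit still raises an exponent, so the unit has
    to be sent to the identity by hand; the relations persist because the pairing with the unit is
    trivial.\<close>
  define s where "s a = (if a = \<one> then \<lambda>z\<in>S. z else \<sigma> a)" for a
  let ?B = "BijGroup S"
  have keys: "Poly_Mapping.keys (p + frag_of a) \<subseteq> carrier G"
    if "Poly_Mapping.keys p \<subseteq> carrier G" "a \<in> carrier G" for p a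
    using that Poly_Mapping.keys_add[of p "frag_of a"] by auto
  have keys': "Poly_Mapping.keys (p - frag_of a) \<subseteq> carrier G"
    if "Poly_Mapping.keys p \<subseteq> carrier G" "a \<in> carrier G" for p a
    using that keys_diff[of p "frag_of a"] by auto
  have l_bij: "l \<gamma> \<in> Bij S" if g: "\<gamma> \<in> carrier H" for \<gamma>
  proof -
    have "bij_betw (l \<gamma>) S S"
      by (rule bij_betw_byWitness[where f' = "l (inv\<^sub>H \<gamma>)"])
        (use g in \<open>auto simp: l_def S_def H.inv_cancel_left\<close>)
    then show ?thesis by (simp add: Bij_def l_def)
  qed
  have \<sigma>_bij: "\<sigma> a \<in> Bij S" if a: "a \<in> carrier G" for a
  proof -
    \<comment> \<open>Recovers the projection of \<kappa> from that of its image: the image projects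
      to \<open>a \<otimes> \<pi> \<kappa> \<otimes> w \<otimes> inv a \<otimes> inv w\<close> with
      \<open>w = v a p\<close>. The factor can thus be undone without knowing \<kappa>.\<close>
    define k where "k \<kappa>' p = inv a \<otimes> \<pi> \<kappa>' \<otimes> v a p \<otimes> a \<otimes> inv v a p" for \<kappa>' p
    define \<tau> where "\<tau> = (\<lambda>(\<kappa>', p')\<in>S. (inv\<^sub>H c a (k \<kappa>' (p' - frag_of a) \<otimes> v a (p' - frag_of a)) \<cdot> \<kappa>', p' - frag_of a))"
    have "bij_betw (\<sigma> a) S S"
    proof (rule bij_betw_byWitness[where f' = \<tau>])
      show "\<forall>z\<in>S. \<tau> (\<sigma> a z) = z"
        using a v keys by (auto simp: \<tau>_def \<sigma>_def S_def k_def G.free_reduce H.inv_cancel_left)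
      show "\<forall>z\<in>S. \<sigma> a (\<tau> z) = z"
        using a v keys' by (auto simp: \<tau>_def \<sigma>_def S_def k_def G.free_reduce H.inv_cancel_left)
    qed (use a v in \<open>auto simp: \<tau>_def \<sigma>_def S_def k_def keys keys' dest: subsetD[OF keys] subsetD[OF keys']\<close>)
    then show ?thesis by (simp add: Bij_def \<sigma>_def)
  qed
  have s_bij: "s a \<in> Bij S" if "a \<in> carrier G" for a
    using that \<sigma>_bij id_Bij by (auto simp: s_def)
  have carrier_BijGroup: "carrier ?B = Bij S" by (simp add: BijGroup_def)
  have BI: "f \<otimes>\<^bsub>?B\<^esub> g = compose S f g" if "f \<in> Bij S" "g \<in> Bij S" for f g
    using that by (simp add: BijGroup_def)
  have hom: "l \<in> hom H ?B"
    by (rule homI) (use l_bij in \<open>auto simp: BI carrier_BijGroup, auto simp: l_def compose_def S_def H.m_assoc restrict_def fun_eq_iff\<close>)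
  have inj: "inj_on l (carrier H)"
  proof
    fix \<gamma> \<gamma>' assume "\<gamma> \<in> carrier H" "\<gamma>' \<in> carrier H" "l \<gamma> = l \<gamma>'"
    then show "\<gamma> = \<gamma>'" by (auto simp: l_def S_def fun_eq_iff restrict_def dest!: spec[of _ "\<one>\<^bsub>H\<^esub>"] spec[of _ 0])
  qed
  have \<sigma>l: "compose S (\<sigma> a) (l \<gamma>) = compose S (l (c a (\<pi> \<gamma>) \<cdot> \<gamma>)) (\<sigma> a)"
    if a: "a \<in> carrier G" and g: "\<gamma> \<in> carrier H" for a \<gamma>
  proof (rule extensionalityI[of _ S])
    fix z assume "z \<in> S"
    then obtain \<kappa> p where z: "z = (\<kappa>, p)" "\<kappa> \<in> carrier H" "Poly_Mapping.keys p \<subseteq> carrier G"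
      by (auto simp: S_def)
    have "c a (\<pi> \<gamma> \<otimes> (\<pi> \<kappa> \<otimes> v a p)) = c a (\<pi> \<gamma>) \<cdot> (\<gamma> \<cdot> c a (\<pi> \<kappa> \<otimes> v a p) \<cdot> inv\<^sub>H \<gamma>)"
      using a g z v pairing_conj[of a "\<pi> \<kappa> \<otimes> v a p" \<gamma>]
        pairing_mult[of a "\<pi> \<gamma>" "\<pi> \<kappa> \<otimes> v a p"] by simp
    then show "compose S (\<sigma> a) (l \<gamma>) z = compose S (l (c a (\<pi> \<gamma>) \<cdot> \<gamma>)) (\<sigma> a) z"
      using a g z v keys by (simp add: compose_def S_def \<sigma>_def l_def H.free_reduce G.m_assoc)
  qed (auto simp: compose_def)
  have lt_comm: "compose S (\<sigma> a) (\<sigma> b) = compose S (l (c a b)) (compose S (\<sigma> b) (\<sigma> a))"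
    if a: "a \<in> carrier G" and b: "b \<in> carrier G" and ba: "lt b a" for a b
  proof (rule extensionalityI[of _ S])
    fix z assume "z \<in> S"
    then obtain \<kappa> p where z: "z = (\<kappa>, p)" "\<kappa> \<in> carrier H" "Poly_Mapping.keys p \<subseteq> carrier G"
      by (auto simp: S_def)
    obtain u where u: "u \<in> carrier G" "v a p = v b p \<otimes> u" "v a (p + frag_of b) = v b p \<otimes> b \<otimes> u"
      using v_lt[OF ba b z(3)] by blast
    define w where "w = v b p"
    have w: "w \<in> carrier G" using v z by (simp add: w_def)
    note u = u[folded w_def]
    have e: "v b (p + frag_of a) = w" "v b p = w" using v_ge[OF ba] by (simp_all add: w_def)
    \<comment> \<open>With \<open>v b p = w\<close> and \<open>v a p = w \<otimes> u\<close>, the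
      two orders of applying \<sigma> turn into the two sides of \<open>pairing_exchange\<close> for
      this \<open>m\<close>.\<close>
    define m where "m = \<pi> \<kappa> \<otimes> w \<otimes> u"
    have m: "m \<in> carrier G" "\<pi> \<kappa> = m \<otimes> inv u \<otimes> inv w" using z w u by (simp_all add: m_def G.free_reduce)
    have "c a (b \<otimes> m) \<cdot> c b (m \<otimes> inv u) \<cdot> \<kappa> = c a b \<cdot> c b (a \<otimes> m \<otimes> inv a \<otimes> inv u) \<cdot> c a m \<cdot> \<kappa>"
      using a b m u by (simp add: pairing_exchange)
    then show "compose S (\<sigma> a) (\<sigma> b) z = compose S (l (c a b)) (compose S (\<sigma> b) (\<sigma> a)) z"
      using a b z w m(1) u keys e keys[OF keys[OF z(3) a] b]
      by (simp add: compose_def S_def \<sigma>_def l_def G.free_reduce H.m_assoc m(2) add.commute add.left_commute)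
  qed (auto simp: compose_def)
  interpret B: group ?B by (rule group_BijGroup)
  interpret l: group_hom H ?B l using hom by (simp add: group_hom_def group_hom_axioms_def B.group_axioms)
  have \<sigma>_closed [simp]: "\<sigma> a \<in> carrier ?B" if "a \<in> carrier G" for a
    using that \<sigma>_bij by (simp add: carrier_BijGroup)
  have comm: "\<sigma> a \<otimes>\<^bsub>?B\<^esub> \<sigma> b = l (c a b) \<otimes>\<^bsub>?B\<^esub> (\<sigma> b \<otimes>\<^bsub>?B\<^esub> \<sigma> a)"
    if a: "a \<in> carrier G" and b: "b \<in> carrier G" for a b
  proof -
    have *: "\<sigma> a \<otimes>\<^bsub>?B\<^esub> \<sigma> b = l (c a b) \<otimes>\<^bsub>?B\<^esub> (\<sigma> b \<otimes>\<^bsub>?B\<^esub> \<sigma> a)"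
      if "a \<in> carrier G" "b \<in> carrier G" "lt b a" for a b
      using lt_comm[OF that] that by (simp add: BI \<sigma>_bij l_bij compose_Bij)
    consider "a = b" | "lt b a" | "lt a b" using lt by blast
    then show ?thesis
    proof cases
      case 1
      then show ?thesis using a by (simp add: pairing_self)
    next
      case 3
      have "l (c a b) \<otimes>\<^bsub>?B\<^esub> (\<sigma> b \<otimes>\<^bsub>?B\<^esub> \<sigma> a) = l (c a b \<cdot> c b a) \<otimes>\<^bsub>?B\<^esub> (\<sigma> a \<otimes>\<^bsub>?B\<^esub> \<sigma> b)"
        using *[OF b a 3] a b by (simp add: B.m_assoc)
      then show ?thesis using a b by (simp add: pairing_swap[of a b])
    qed (use * a b in blast)
  qed
  have s1: "s \<one> = \<one>\<^bsub>?B\<^esub>" by (simp add: s_def BijGroup_def)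
  have s: "s a = \<sigma> a" if "a \<noteq> \<one>" for a using that by (simp add: s_def)
  have sl: "s a \<otimes>\<^bsub>?B\<^esub> l \<gamma> = l (c a (\<pi> \<gamma>) \<cdot> \<gamma>) \<otimes>\<^bsub>?B\<^esub> s a"
    if "a \<in> carrier G" "\<gamma> \<in> carrier H" for a \<gamma>
    using that \<sigma>l[of a \<gamma>] by (cases "a = \<one>") (simp_all add: s1 s BI \<sigma>_bij l_bij compose_Bij)
  have ss: "s a \<otimes>\<^bsub>?B\<^esub> s b = l (c a b) \<otimes>\<^bsub>?B\<^esub> (s b \<otimes>\<^bsub>?B\<^esub> s a)"
    if "a \<in> carrier G" "b \<in> carrier G" for a b
    using that comm[of a b] by (cases "a = \<one>"; cases "b = \<one>") (simp_all add: s1 s)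
  have sc: "s \<in> carrier G \<rightarrow> carrier ?B" using s_bij by (simp add: carrier_BijGroup)
  show ?thesis
    by (rule exI[of _ ?B], rule exI[of _ l], rule exI[of _ s])
      (use B.group_axioms hom inj sc s1 sl ss in blast)
qed

end

section \<open>The crossed pairing contained in the group of blocks\<close>

lemma (in group) quotient_eq:
  assumes "p \<in> carrier G" "q \<in> carrier G" "u \<in> carrier G" "v \<in> carrier G"
  shows "inv p \<otimes> u = q \<otimes> inv v \<longleftrightarrow> u \<otimes> v = p \<otimes> q"
proof -
  have "inv p \<otimes> u = q \<otimes> inv v \<longleftrightarrow> p \<otimes> (inv p \<otimes> u) \<otimes> v = p \<otimes> (q \<otimes> inv v) \<otimes> v"
    using assms by simp
  then show ?thesis using assms by (simp add: free_reduce)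
qed

definition (in group) commutator where
  "commutator u v = u \<otimes> v \<otimes> inv u \<otimes> inv v"

lemma (in group) commutator_closed [simp]:
  "\<lbrakk>u \<in> carrier G; v \<in> carrier G\<rbrakk> \<Longrightarrow> commutator u v \<in> carrier G"
  by (simp add: commutator_def)

lemma (in group) inv_commutator:
  "\<lbrakk>u \<in> carrier G; v \<in> carrier G\<rbrakk> \<Longrightarrow> inv (commutator u v) = commutator v u"
  by (simp add: commutator_def free_reduce)

lemma (in group) commutator_mult_left:
  assumes "u \<in> carrier G" "v \<in> carrier G" "w \<in> carrier G" "w \<otimes> v = v \<otimes> w"
  shows "commutator (u \<otimes> w) v = commutator u v"
proof -
  have "w \<otimes> (v \<otimes> inv w) = v"
    using assms by (simp add: m_assoc[symmetric]) (simp add: m_assoc)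
  then have "w \<otimes> (v \<otimes> (inv w \<otimes> y)) = v \<otimes> y" if "y \<in> carrier G" for y
    using assms that by (metis inv_closed m_assoc m_closed)
  with assms show ?thesis by (simp add: commutator_def free_reduce)
qed

lemma (in group) commute_inv:
  assumes "u \<in> carrier G" "v \<in> carrier G" "u \<otimes> v = v \<otimes> u"
  shows "inv u \<otimes> v = v \<otimes> inv u"
  using quotient_eq[of u v v u] assms by simp

lemma (in group) commute_mult:
  assumes "u \<in> carrier G" "w \<in> carrier G" "v \<in> carrier G" "u \<otimes> v = v \<otimes> u" "w \<otimes> v = v \<otimes> w"
  shows "(u \<otimes> w) \<otimes> v = v \<otimes> (u \<otimes> w)"
  using assms by (metis m_assoc)

lemma (in group) commute_commutator:
  assumes "u \<in> carrier G" "w \<in> carrier G" "v \<in> carrier G" "u \<otimes> v = v \<otimes> u" "w \<otimes> v = v \<otimes> w"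
  shows "commutator u w \<otimes> v = v \<otimes> commutator u w"
  unfolding commutator_def using assms by (intro commute_mult commute_inv m_closed inv_closed)

text \<open>
  The relations between the classes \<open>x i j g\<close> of the edges with entry \<open>g\<close> at the odd position \<open>2i+1\<close>
  and at the even position \<open>2j+2\<close>, and \<open>\<one>\<close> elsewhere; \<open>\<pi>\<close> reads off the entry at position 2.
\<close>

locale block_group = G: group G + H: group H
  for G :: "('g, 'y) monoid_scheme" (structure) and H :: "('h, 'z) monoid_scheme" +
  fixes n :: nat and x :: "nat \<Rightarrow> nat \<Rightarrow> 'g \<Rightarrow> 'h" and \<pi> :: "'h \<Rightarrow> 'g"
  assumes n: "n \<ge> 3"
    and x_hom: "\<lbrakk>i < n; j < n\<rbrakk> \<Longrightarrow> x i j \<in> hom G H"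
    and x_commute: "\<lbrakk>i < n; j < n; k < n; m < n; i \<noteq> k; j \<noteq> m; a \<in> carrier G; b \<in> carrier G\<rbrakk> \<Longrightarrow>
      x i j a \<otimes>\<^bsub>H\<^esub> x k m b = x k m b \<otimes>\<^bsub>H\<^esub> x i j a"
    and x_exchange: "\<lbrakk>i < n; j < n; k < n; m < n; i \<noteq> k; j \<noteq> m; a \<in> carrier G\<rbrakk> \<Longrightarrow>
      x i j a \<otimes>\<^bsub>H\<^esub> x k m a = x i m a \<otimes>\<^bsub>H\<^esub> x k j a"
    and generated: "carrier H = generate H {x i j a | i j a. i < n \<and> j < n \<and> a \<in> carrier G}"
    and proj: "\<pi> \<in> hom H G"
    and proj_x: "\<lbrakk>i < n; j < n; a \<in> carrier G\<rbrakk> \<Longrightarrow> \<pi> (x i j a) = (if j = 0 then a else \<one>)"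
begin

abbreviation mult_H' (infixl \<open>\<cdot>\<close> 70) where "a \<cdot> b \<equiv> a \<otimes>\<^bsub>H\<^esub> b"
abbreviation inv_H' (\<open>inv\<^sub>H _\<close> [81] 80) where "inv\<^sub>H a \<equiv> inv\<^bsub>H\<^esub> a"

lemma x_closed [simp]: "\<lbrakk>i < n; j < n; a \<in> carrier G\<rbrakk> \<Longrightarrow> x i j a \<in> carrier H"
  using x_hom[of i j] by (auto simp: hom_def)

lemma x_mult: "\<lbrakk>i < n; j < n; a \<in> carrier G; b \<in> carrier G\<rbrakk> \<Longrightarrow> x i j (a \<otimes> b) = x i j a \<cdot> x i j b"
  using x_hom[of i j] by (auto simp: hom_def)

lemma x_inv: "\<lbrakk>i < n; j < n; a \<in> carrier G\<rbrakk> \<Longrightarrow> x i j (inv a) = inv\<^sub>H x i j a"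
  using x_hom[of i j] by (simp add: group_hom.hom_inv group_hom_def group_hom_axioms_def
      G.group_axioms H.group_axioms)

lemma x_one: "\<lbrakk>i < n; j < n\<rbrakk> \<Longrightarrow> x i j \<one> = \<one>\<^bsub>H\<^esub>"
  using x_hom[of i j] by (simp add: hom_one G.group_axioms H.group_axioms)

text \<open>The right side of the exchange relation commutes; after swapping its factors, the
  relation is an equation between a left quotient in column \<open>j\<close> and a right quotient in
  column \<open>m\<close>.\<close>

lemma column_quotient:
  assumes "i < n" "k < n" "i \<noteq> k" "j < n" "m < n" "j \<noteq> m" "a \<in> carrier G"
  shows "inv\<^sub>H x k j a \<cdot> x i j a = x i m a \<cdot> inv\<^sub>H x k m a"
proof -
  have "x i j a \<cdot> x k m a = x k j a \<cdot> x i m a"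
    using assms x_exchange[of i j k m a] x_commute[of i m k j a a] by simp
  then show ?thesis
    using assms by (subst H.quotient_eq) simp_all
qed

text \<open>Two further columns \<open>p\<close> and \<open>q\<close> handle the case of a single
  column: the left quotient in \<open>j\<close> equals the right one in \<open>p\<close>, this the
  left one in \<open>q\<close>, and this the right one in \<open>j\<close>. Here the third column is
  indispensable to the argument.\<close>

lemma column_quotient':
  assumes "i < n" "k < n" "i \<noteq> k" "j < n" "m < n" "a \<in> carrier G"
  shows "inv\<^sub>H x k j a \<cdot> x i j a = x i m a \<cdot> inv\<^sub>H x k m a"
proof (cases "j = m")
  case True
  have "\<exists>p q. p < n \<and> q < n \<and> p \<noteq> j \<and> q \<noteq> j \<and> p \<noteq> q"
  proof -
    consider "j = 0" | "j = 1" | "j > 1" by linarith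
    then show ?thesis
    proof cases
      case 1 then show ?thesis using n by (intro exI[of _ 1] exI[of _ 2]) auto
    next
      case 2 then show ?thesis using n by (intro exI[of _ 0] exI[of _ 2]) auto
    next
      case 3 then show ?thesis using n by (intro exI[of _ 0] exI[of _ 1]) auto
    qed
  qed
  then obtain p q where "p < n" "q < n" "p \<noteq> j" "q \<noteq> j" "p \<noteq> q" by blast
  with assms True column_quotient[of i k j p a] column_quotient[of i k q p a] column_quotient[of i k q j a]
  show ?thesis by simp
qed (use assms column_quotient in blast)

text \<open>The single-column case of the preceding lemma, where left and right quotient of the same
  two elements agree.\<close>

lemma column_commute:
  assumes "i < n" "k < n" "j < n" "a \<in> carrier G"
  shows "x i j a \<cdot> x k j a = x k j a \<cdot> x i j a"
proof (cases "i = k")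
  case False
  with column_quotient'[of i k j j a] assms show ?thesis
    by (simp add: H.quotient_eq)
qed simp

text \<open>The two blocks share only the even position 2. In the fiber the commutator therefore has
  trivial entries at both odd positions and the entry
  \<open>a \<otimes> b \<otimes> inv a \<otimes> inv b\<close> at position 2.\<close>

definition c where "c a b = H.commutator (x 0 0 a) (x 1 0 b)"

lemma c_closed [simp]: "\<lbrakk>a \<in> carrier G; b \<in> carrier G\<rbrakk> \<Longrightarrow> c a b \<in> carrier H"
  using n by (simp add: c_def)

text \<open>The correction lies in column 1 and thus commutes with column 0 of every row other than
  \<open>i\<close> and \<open>k\<close>. This is the device for replacing a row inside a
  commutator.\<close>

lemma row_change:
  assumes "i < n" "k < n" "a \<in> carrier G"
  shows "x k 0 a = x i 0 a \<cdot> (inv\<^sub>H x i 1 a \<cdot> x k 1 a)"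
proof (cases "i = k")
  case False
  have "inv\<^sub>H x i 1 a \<cdot> x k 1 a = inv\<^sub>H x i 0 a \<cdot> x k 0 a"
    using column_quotient'[of k i 1 0 a] column_quotient'[of k i 0 0 a] False assms n by simp
  then show ?thesis using assms n by (simp add: H.inv_cancel_left)
qed (use assms n in \<open>simp add: H.free_reduce\<close>)

lemma commutator_row_left:
  assumes "i < n" "k < n" "m < n" "i \<noteq> m" "k \<noteq> m" "a \<in> carrier G" "b \<in> carrier G"
  shows "H.commutator (x k 0 a) (x m 0 b) = H.commutator (x i 0 a) (x m 0 b)"
proof (subst row_change[of i k])
  show "H.commutator (x i 0 a \<cdot> (inv\<^sub>H x i 1 a \<cdot> x k 1 a)) (x m 0 b) = H.commutator (x i 0 a) (x m 0 b)"
    by (rule H.commutator_mult_left; (intro H.commute_mult H.commute_inv x_commute)?)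
      (use assms n in auto)
qed (use assms in auto)

lemma commutator_row_right:
  assumes "i < n" "k < n" "m < n" "i \<noteq> m" "k \<noteq> m" "a \<in> carrier G" "b \<in> carrier G"
  shows "H.commutator (x m 0 b) (x k 0 a) = H.commutator (x m 0 b) (x i 0 a)"
proof -
  have "inv\<^sub>H H.commutator (x k 0 a) (x m 0 b) = inv\<^sub>H H.commutator (x i 0 a) (x m 0 b)"
    using commutator_row_left[OF assms] by simp
  then show ?thesis using assms n by (simp add: H.inv_commutator)
qed

text \<open>Rows are exchanged one at a time, always for a row that the other entry does not use;
  going from rows (0, 1) to (1, 0) passes through row 2.\<close>

lemma c_rows:
  assumes "i < n" "k < n" "i \<noteq> k" "a \<in> carrier G" "b \<in> carrier G"
  shows "H.commutator (x i 0 a) (x k 0 b) = c a b"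
proof -
  have "H.commutator (x i 0 a) (x k 0 b) = H.commutator (x 2 0 a) (x 1 0 b)"
    if "k \<noteq> 2"
    using commutator_row_left[of 2 i k a b] commutator_row_right[of 1 k 2 b a] that assms n by simp
  moreover have "H.commutator (x i 0 a) (x k 0 b) = H.commutator (x 0 0 a) (x 1 0 b)"
    if "k \<noteq> 0"
    using commutator_row_left[of 0 i k a b] commutator_row_right[of 1 k 0 b a] that assms n by simp
  moreover have "H.commutator (x 2 0 a) (x 1 0 b) = H.commutator (x 0 0 a) (x 1 0 b)"
    using commutator_row_left[of 0 2 1 a b] assms n by simp
  ultimately show ?thesis unfolding c_def by (cases "k = 0") auto
qed

lemma obtain_rows:
  obtains k m where "k < n" "m < n" "k \<noteq> m" "k \<noteq> i" "m \<noteq> i"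
proof -
  consider "i = 0" | "i = 1" | "i > 1" by linarith
  then show ?thesis
  proof cases
    case 1 then show ?thesis using n by (intro that[of 1 2]) auto
  next
    case 2 then show ?thesis using n by (intro that[of 0 2]) auto
  next
    case 3 then show ?thesis using n by (intro that[of 0 1]) auto
  qed
qed

text \<open>By \<open>c_rows\<close> the pairing may be computed in two rows different from
  \<open>i\<close>, whose column-0 elements commute with \<open>x i j d\<close>.\<close>

lemma c_commute:
  assumes "i < n" "j < n" "j \<noteq> 0" "a \<in> carrier G" "b \<in> carrier G" "d \<in> carrier G"
  shows "x i j d \<cdot> c a b = c a b \<cdot> x i j d"
proof -
  obtain k m where k: "k < n" "m < n" "k \<noteq> m" "k \<noteq> i" "m \<noteq> i" by (rule obtain_rows)
  have "H.commutator (x k 0 a) (x m 0 b) \<cdot> x i j d = x i j d \<cdot> H.commutator (x k 0 a) (x m 0 b)"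
    by (intro H.commute_commutator x_commute) (use k assms n in auto)
  then show ?thesis using c_rows[of k m a b] k assms by simp
qed

lemma c_conj_row:
  assumes "i < n" "a \<in> carrier G" "b \<in> carrier G" "d \<in> carrier G"
  shows "x i 0 d \<cdot> c a b \<cdot> inv\<^sub>H x i 0 d = x 0 0 d \<cdot> c a b \<cdot> inv\<^sub>H x 0 0 d"
proof -
  let ?w = "inv\<^sub>H x 0 1 d \<cdot> x i 1 d"
  have w: "?w \<in> carrier H" using assms n by simp
  have "?w \<cdot> c a b = c a b \<cdot> ?w"
    by (intro H.commute_mult H.commute_inv c_commute) (use assms n in auto)
  then have *: "?w \<cdot> (c a b \<cdot> inv\<^sub>H ?w) = c a b"
    using w assms by (simp add: H.m_assoc[symmetric] del: H.inv_closed) (simp add: H.m_assoc)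
  have "x i 0 d \<cdot> c a b \<cdot> inv\<^sub>H x i 0 d = x 0 0 d \<cdot> (?w \<cdot> (c a b \<cdot> inv\<^sub>H ?w)) \<cdot> inv\<^sub>H x 0 0 d"
    using assms n by (subst (1 2) row_change[of 0 i d]) (simp_all add: H.m_assoc H.inv_mult_group)
  then show ?thesis unfolding * .
qed

lemma c_mult:
  assumes "a \<in> carrier G" "b \<in> carrier G" "d \<in> carrier G"
  shows "c a (b \<otimes> d) = c a b \<cdot> (x 0 0 b \<cdot> c a d \<cdot> inv\<^sub>H x 0 0 b)"
proof -
  have "c a (b \<otimes> d) = c a b \<cdot> (x 1 0 b \<cdot> c a d \<cdot> inv\<^sub>H x 1 0 b)"
    using assms n by (simp add: c_def H.commutator_def x_mult H.free_reduce)
  then show ?thesis using c_conj_row[of 1 a d b] assms n by simp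
qed

lemma c_swap: "\<lbrakk>a \<in> carrier G; b \<in> carrier G\<rbrakk> \<Longrightarrow> c b a = inv\<^sub>H c a b"
  using c_rows[of 1 0 b a] H.inv_commutator[of "x 0 0 a" "x 1 0 b"] n by (simp add: c_def[of a b])

lemma c_self: "a \<in> carrier G \<Longrightarrow> c a a = \<one>\<^bsub>H\<^esub>"
  using column_commute[of 0 1 0 a] n by (simp add: c_def H.commutator_def H.free_reduce)

lemma row_conj:
  assumes "i < n" "i \<noteq> 0" "a \<in> carrier G" "d \<in> carrier G"
  shows "x i 0 a \<cdot> (x 0 0 d \<cdot> inv\<^sub>H x i 0 a) = c a d \<cdot> x 0 0 d"
proof -
  have "c a d = x i 0 a \<cdot> x 0 0 d \<cdot> inv\<^sub>H x i 0 a \<cdot> inv\<^sub>H x 0 0 d"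
    using c_rows[of i 0 a d] assms n by (simp add: H.commutator_def)
  then show ?thesis using assms n by (simp add: H.free_reduce)
qed

text \<open>The conjugate \<open>D i u\<close> of \<open>x 0 0 d\<close> does not depend on the row
  \<open>i \<noteq> 0\<close>. When \<open>c a b\<close> is written as a commutator of rows 1 and 2,
  each of its four letters can be applied in its own row, and the conjugations accumulate to that by
  the commutator in \<open>G\<close>.\<close>

lemma c_commutator_left:
  assumes "a \<in> carrier G" "b \<in> carrier G" "d \<in> carrier G"
  shows "c (a \<otimes> b \<otimes> inv a \<otimes> inv b) d = c a b \<cdot> x 0 0 d \<cdot> inv\<^sub>H c a b \<cdot> inv\<^sub>H x 0 0 d"
proof -
  define D where "D i u = x i 0 u \<cdot> x 0 0 d \<cdot> inv\<^sub>H x i 0 u" for i u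
  have D: "D i u = c u d \<cdot> x 0 0 d" if "i < n" "i \<noteq> 0" "u \<in> carrier G" for i u
    using row_conj[of i u d] that assms n by (simp add: D_def H.m_assoc)
  have conj: "x i 0 v \<cdot> D i u \<cdot> inv\<^sub>H x i 0 v = D i (v \<otimes> u)"
    if "i < n" "u \<in> carrier G" "v \<in> carrier G" for i u v
    using that assms n by (simp add: D_def x_mult H.free_reduce)
  have D12: "D 2 u = D 1 u" if "u \<in> carrier G" for u using D[of 1 u] D[of 2 u] that n by simp
  have cm: "c a b = x 1 0 a \<cdot> x 2 0 b \<cdot> x 1 0 (inv a) \<cdot> x 2 0 (inv b)"
    using c_rows[of 1 2 a b] assms n by (simp add: H.commutator_def x_inv)
  have "c a b \<cdot> x 0 0 d \<cdot> inv\<^sub>H c a b =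
      x 1 0 a \<cdot> (x 2 0 b \<cdot> (x 1 0 (inv a) \<cdot> D 2 (inv b) \<cdot> inv\<^sub>H x 1 0 (inv a)) \<cdot> inv\<^sub>H x 2 0 b) \<cdot> inv\<^sub>H x 1 0 a"
    using assms n unfolding cm by (simp add: D_def H.free_reduce)
  also have "\<dots> = x 1 0 a \<cdot> (x 2 0 b \<cdot> D 2 (inv a \<otimes> inv b) \<cdot> inv\<^sub>H x 2 0 b) \<cdot> inv\<^sub>H x 1 0 a"
    using conj[of 1 "inv b" "inv a"] assms n by (simp add: D12)
  also have "\<dots> = x 1 0 a \<cdot> D 1 (b \<otimes> (inv a \<otimes> inv b)) \<cdot> inv\<^sub>H x 1 0 a"
    using conj[of 2 "inv a \<otimes> inv b" b] assms n by (simp add: D12)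
  also have "\<dots> = D 1 (a \<otimes> (b \<otimes> (inv a \<otimes> inv b)))"
    using conj[of 1 "b \<otimes> (inv a \<otimes> inv b)" a] assms n by simp
  also have "\<dots> = c (a \<otimes> b \<otimes> inv a \<otimes> inv b) d \<cdot> x 0 0 d"
    using D[of 1] assms n by (simp add: G.m_assoc)
  finally have "c a b \<cdot> x 0 0 d \<cdot> inv\<^sub>H c a b \<cdot> inv\<^sub>H x 0 0 d
      = c (a \<otimes> b \<otimes> inv a \<otimes> inv b) d \<cdot> x 0 0 d \<cdot> inv\<^sub>H x 0 0 d" by simp
  then show ?thesis using assms n by (simp add: H.m_assoc)
qed

text \<open>For generators the claim is \<open>c_conj_row\<close> in column 0 and
  \<open>c_commute\<close> in the others. For products, the conjugate of a value of \<open>c\<close>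
  is again a quotient of values of \<open>c\<close>, by multiplicativity in the second argument, so
  that the hypothesis applies a second time.\<close>

lemma c_conj:
  assumes "\<gamma> \<in> carrier H" "a \<in> carrier G" "b \<in> carrier G"
  shows "\<gamma> \<cdot> c a b \<cdot> inv\<^sub>H \<gamma> = x 0 0 (\<pi> \<gamma>) \<cdot> c a b \<cdot> inv\<^sub>H x 0 0 (\<pi> \<gamma>)"
proof -
  interpret \<pi>: group_hom H G \<pi> using proj by (simp add: group_hom_def group_hom_axioms_def)
  let ?S = "{x i j a | i j a. i < n \<and> j < n \<and> a \<in> carrier G}"
  have S: "?S \<subseteq> carrier H" by auto
  have act: "x 0 0 u \<cdot> c a b \<cdot> inv\<^sub>H x 0 0 u = inv\<^sub>H c a u \<cdot> c a (u \<otimes> b)" 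
    if "u \<in> carrier G" "a \<in> carrier G" "b \<in> carrier G" for u a b
    using that n c_mult[of a u b] by (simp add: H.inv_cancel_left)
  have "\<gamma> \<in> generate H ?S" using assms(1) generated by simp
  then have "\<forall>a\<in>carrier G. \<forall>b\<in>carrier G. \<gamma> \<cdot> c a b \<cdot> inv\<^sub>H \<gamma> = x 0 0 (\<pi> \<gamma>) \<cdot> c a b \<cdot> inv\<^sub>H x 0 0 (\<pi> \<gamma>)"
  proof (induction \<gamma> rule: generate.induct)
    case one
    then show ?case using n by (simp add: x_one)
  next
    case (incl h)
    then obtain i j g where h: "h = x i j g" "i < n" "j < n" "g \<in> carrier G" by blast
    then show ?case
      using c_conj_row[of i _ _ g] c_commute[of i j _ _ g] n
      by (cases "j = 0") (auto simp: proj_x x_one H.m_assoc)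
  next
    case (inv h)
    then obtain i j g where h: "h = x i j g" "i < n" "j < n" "g \<in> carrier G" by blast
    then have "inv\<^sub>H h = x i j (inv g)" by (simp add: x_inv)
    with h show ?case
      using c_conj_row[of i _ _ "inv g"] c_commute[of i j _ _ "inv g"] n
      by (cases "j = 0") (auto simp: proj_x x_one H.m_assoc)
  next
    case (eng h1 h2)
    then have c: "h1 \<in> carrier H" "h2 \<in> carrier H" using H.generate_in_carrier[OF S] by auto
    show ?case
    proof (intro ballI)
      fix a b assume ab: "a \<in> carrier G" "b \<in> carrier G"
      let ?u = "\<pi> h2" and ?v = "\<pi> h1"
      have "h1 \<cdot> h2 \<cdot> c a b \<cdot> inv\<^sub>H (h1 \<cdot> h2) = h1 \<cdot> (h2 \<cdot> c a b \<cdot> inv\<^sub>H h2) \<cdot> inv\<^sub>H h1"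
        using c ab by (simp add: H.free_reduce)
      also have "\<dots> = h1 \<cdot> (inv\<^sub>H c a ?u \<cdot> c a (?u \<otimes> b)) \<cdot> inv\<^sub>H h1"
        using eng.IH(2) ab c act[of ?u a b] by simp
      also have "\<dots> = inv\<^sub>H (h1 \<cdot> c a ?u \<cdot> inv\<^sub>H h1) \<cdot> (h1 \<cdot> c a (?u \<otimes> b) \<cdot> inv\<^sub>H h1)"
        using c ab by (simp add: H.free_reduce)
      also have "\<dots> = inv\<^sub>H (x 0 0 ?v \<cdot> c a ?u \<cdot> inv\<^sub>H x 0 0 ?v) \<cdot> (x 0 0 ?v \<cdot> c a (?u \<otimes> b) \<cdot> inv\<^sub>H x 0 0 ?v)"
        using eng.IH(1) ab c by simp
      also have "\<dots> = x 0 0 ?v \<cdot> (inv\<^sub>H c a ?u \<cdot> c a (?u \<otimes> b)) \<cdot> inv\<^sub>H x 0 0 ?v"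
        using c ab n by (simp add: H.free_reduce)
      also have "\<dots> = x 0 0 ?v \<cdot> (x 0 0 ?u \<cdot> c a b \<cdot> inv\<^sub>H x 0 0 ?u) \<cdot> inv\<^sub>H x 0 0 ?v"
        using ab c act[of ?u a b] by simp
      also have "\<dots> = x 0 0 (\<pi> (h1 \<cdot> h2)) \<cdot> c a b \<cdot> inv\<^sub>H x 0 0 (\<pi> (h1 \<cdot> h2))"
        using c ab n by (simp add: x_mult H.free_reduce)
      finally show "h1 \<cdot> h2 \<cdot> c a b \<cdot> inv\<^sub>H (h1 \<cdot> h2) = \<dots>" .
    qed
  qed
  then show ?thesis using assms by blast
qed

lemma crossed_pairing: "crossed_pairing G H \<pi> (x 0 0) c"
proof
  interpret \<pi>: group_hom H G \<pi> using proj by (simp add: group_hom_def group_hom_axioms_def)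
  show "\<pi> \<in> hom H G" by (rule proj)
  show "x 0 0 \<in> hom G H" using n by (intro x_hom) auto
  fix a b assume ab: "a \<in> carrier G" "b \<in> carrier G"
  show "c a b \<in> carrier H" using ab by simp
  show "\<pi> (c a b) = a \<otimes> b \<otimes> inv a \<otimes> inv b"
    using ab n by (simp add: c_def H.commutator_def proj_x)
  show "c b a = inv\<^sub>H c a b" using ab by (rule c_swap)
  show "\<gamma> \<cdot> c a b \<cdot> inv\<^sub>H \<gamma> = x 0 0 (\<pi> \<gamma>) \<cdot> c a b \<cdot> inv\<^sub>H x 0 0 (\<pi> \<gamma>)" if "\<gamma> \<in> carrier H" for \<gamma>
    using c_conj that ab by blast
  fix d assume d: "d \<in> carrier G"
  show "c a (b \<otimes> d) = c a b \<cdot> (x 0 0 b \<cdot> c a d \<cdot> inv\<^sub>H x 0 0 b)" using ab d by (rule c_mult)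
  show "c d (a \<otimes> b \<otimes> inv a \<otimes> inv b) = x 0 0 d \<cdot> c a b \<cdot> inv\<^sub>H x 0 0 d \<cdot> inv\<^sub>H c a b"
    using c_swap[of "a \<otimes> b \<otimes> inv a \<otimes> inv b" d] c_commutator_left[of a b d] ab d n by (simp add: H.free_reduce)
qed (rule c_self)

end

section \<open>Lifts of single entries and their central factor set\<close>

definition (in group) centralizer where
  "centralizer S = {z \<in> carrier G. \<forall>y\<in>S. z \<otimes> y = y \<otimes> z}"

lemma (in group) subgroup_centralizer: "S \<subseteq> carrier G \<Longrightarrow> subgroup (centralizer S) G"
  by (rule subgroupI) (auto simp: centralizer_def subset_iff commute_inv commute_mult)

text \<open>The intersection is the center of the centralizer of \<open>S\<close>. Being abelian, it
  can receive homomorphisms from free abelian groups.\<close>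

lemma (in group) comm_group_double_centralizer:
  assumes S: "S \<subseteq> carrier G"
  shows "comm_group (G\<lparr>carrier := centralizer S \<inter> centralizer (centralizer S)\<rparr>)"
proof -
  have c: "centralizer T \<subseteq> carrier G" for T by (auto simp: centralizer_def)
  have "subgroup (centralizer S \<inter> centralizer (centralizer S)) G"
    using subgroup_centralizer[OF S] subgroup_centralizer[OF c] by (rule subgroups_Inter_pair)
  then have "group (G\<lparr>carrier := centralizer S \<inter> centralizer (centralizer S)\<rparr>)"
    by (rule subgroup.subgroup_is_group[OF _ is_group])
  then show ?thesis
  proof (rule group.group_comm_groupI)
    fix y z assume "y \<in> carrier (G\<lparr>carrier := centralizer S \<inter> centralizer (centralizer S)\<rparr>)"
      "z \<in> carrier (G\<lparr>carrier := centralizer S \<inter> centralizer (centralizer S)\<rparr>)"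
    then have "y \<in> centralizer (centralizer S)" "z \<in> centralizer S" by auto
    then show "y \<otimes>\<^bsub>G\<lparr>carrier := centralizer S \<inter> centralizer (centralizer S)\<rparr>\<^esub> z
        = z \<otimes>\<^bsub>G\<lparr>carrier := centralizer S \<inter> centralizer (centralizer S)\<rparr>\<^esub> y"
      unfolding centralizer_def[of "centralizer S"] by simp
  qed
qed

context block_group
begin

lemma row_quotient:
  assumes "i < n" "k < n" "j < n" "a \<in> carrier G"
  shows "inv\<^sub>H x i 0 a \<cdot> x i j a = inv\<^sub>H x k 0 a \<cdot> x k j a"
proof (cases "i = k")
  case False
  define w where "w = x i 0 a \<cdot> inv\<^sub>H x k 0 a"
  have w: "w \<in> carrier H" using assms n by (simp add: w_def)
  have w': "w = x i j a \<cdot> inv\<^sub>H x k j a"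
    using column_quotient'[of i k j j a] column_quotient'[of i k j 0 a] False assms n by (simp add: w_def)
  have "x i j a = w \<cdot> x k j a" "x i 0 a = w \<cdot> x k 0 a"
    using assms n by (simp add: w' H.m_assoc, simp add: w_def H.m_assoc)
  then show ?thesis using w assms n by (simp add: H.free_reduce)
qed simp

text \<open>In the extension \<open>s a\<close> serves as the entry \<open>a\<close> at index 1
  alone. All other single entries are then forced by dividing: \<open>r i a\<close> is what remains
  of the block \<open>x i 0 a\<close>, and \<open>u j a\<close> is what remains of
  \<open>x i j a\<close> after removing \<open>r i a\<close>; by \<open>row_quotient\<close> the
  latter does not depend on \<open>i\<close>. Since a block is multiplicative, the defects of
  \<open>r\<close> and \<open>u\<close> are inverse to each other, which is the sign in the last
  clause.\<close>

lemma alternating_extension: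
  "\<exists>(B :: ('h \<times> ('g \<Rightarrow>\<^sub>0 int) \<Rightarrow> 'h \<times> ('g \<Rightarrow>\<^sub>0 int)) monoid) l t F.
     group B \<and> l \<in> hom H B \<and> inj_on l (carrier H) \<and>
     F \<in> hom (free_Abelian_group {gs. length gs = 2 \<and> set gs \<subseteq> carrier G}) B \<and>
     (\<forall>k<2 * n. t k \<in> carrier G \<rightarrow> carrier B \<and> t k \<one> = \<one>\<^bsub>B\<^esub>) \<and>
     (\<forall>k<2 * n. \<forall>m<2 * n. \<forall>a\<in>carrier G. \<forall>b\<in>carrier G.
        k \<noteq> m \<longrightarrow> t k a \<otimes>\<^bsub>B\<^esub> t m b = t m b \<otimes>\<^bsub>B\<^esub> t k a) \<and>
     (\<forall>i<n. \<forall>j<n. \<forall>a\<in>carrier G. l (x i j a) = t (2 * i) a \<otimes>\<^bsub>B\<^esub> t (2 * j + 1) a) \<and>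
     (\<forall>w\<in>carrier (free_Abelian_group {gs. length gs = 2 \<and> set gs \<subseteq> carrier G}).
        \<forall>k<2 * n. \<forall>a\<in>carrier G. F w \<otimes>\<^bsub>B\<^esub> t k a = t k a \<otimes>\<^bsub>B\<^esub> F w) \<and>
     (\<forall>k<2 * n. \<forall>a\<in>carrier G. \<forall>b\<in>carrier G.
        t k a \<otimes>\<^bsub>B\<^esub> t k b = F (frag_cmul ((-1) ^ Suc k) (frag_of [a, b])) \<otimes>\<^bsub>B\<^esub> t k (a \<otimes> b))"
proof -
  note [simp] = crossed_pairing.proj_pairing[OF crossed_pairing]
    crossed_pairing.pairing_one_left[OF crossed_pairing] crossed_pairing.pairing_one_right[OF crossed_pairing]
  note pairing_action_mult = crossed_pairing.pairing_action_mult[OF crossed_pairing]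
    and pairing_commutator = crossed_pairing.pairing_commutator[OF crossed_pairing]
  interpret \<pi>: group_hom H G \<pi> using proj by (simp add: group_hom_def group_hom_axioms_def)
  obtain B :: "('h \<times> ('g \<Rightarrow>\<^sub>0 int) \<Rightarrow> 'h \<times> ('g \<Rightarrow>\<^sub>0 int)) monoid" and l s where
    B: "group B" and l: "l \<in> hom H B" and inj: "inj_on l (carrier H)"
    and s: "s \<in> carrier G \<rightarrow> carrier B" and s1: "s \<one> = \<one>\<^bsub>B\<^esub>"
    and sl: "\<forall>a\<in>carrier G. \<forall>\<gamma>\<in>carrier H. s a \<otimes>\<^bsub>B\<^esub> l \<gamma> = l (c a (\<pi> \<gamma>) \<cdot> \<gamma>) \<otimes>\<^bsub>B\<^esub> s a"
    and ss: "\<forall>a\<in>carrier G. \<forall>b\<in>carrier G. s a \<otimes>\<^bsub>B\<^esub> s b = l (c a b) \<otimes>\<^bsub>B\<^esub> (s b \<otimes>\<^bsub>B\<^esub> s a)"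
    using crossed_pairing.extension[OF crossed_pairing] by (elim exE conjE) (rule that)
  interpret B: group B by fact
  interpret l: group_hom H B l by (simp add: group_hom_def group_hom_axioms_def l B H.group_axioms)
  note sl = sl[rule_format] and ss = ss[rule_format]
  have sc [simp]: "s a \<in> carrier B" if "a \<in> carrier G" for a using s that by auto
  have n0: "0 < n" "Suc 0 < n" "2 < n" using n by auto
  define f where "f a b = s a \<otimes>\<^bsub>B\<^esub> s b \<otimes>\<^bsub>B\<^esub> inv\<^bsub>B\<^esub> s (a \<otimes> b)" for a b
  have fc [simp]: "f a b \<in> carrier B" if "a \<in> carrier G" "b \<in> carrier G" for a b
    using that by (simp add: f_def)
  have f_s: "f a b \<otimes>\<^bsub>B\<^esub> s (a \<otimes> b) = s a \<otimes>\<^bsub>B\<^esub> s b" if "a \<in> carrier G" "b \<in> carrier G" for a b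
    using that by (simp add: f_def B.m_assoc)
  define S where "S = l ` carrier H \<union> s ` carrier G"
  have S: "S \<subseteq> carrier B" by (auto simp: S_def)
  \<comment> \<open>Conjugation by \<open>s a\<close> on the image of \<open>l\<close> is the
    twisted action, and this is an action by \<open>pairing_action_mult\<close>; so
    \<open>s a\<close> times \<open>s b\<close> and \<open>s (a \<otimes> b)\<close> conjugate alike
    and their quotient acts trivially.\<close>
  have f_l: "f a b \<otimes>\<^bsub>B\<^esub> l \<delta> = l \<delta> \<otimes>\<^bsub>B\<^esub> f a b"
    if ab: "a \<in> carrier G" "b \<in> carrier G" and \<delta>: "\<delta> \<in> carrier H" for a b \<delta>
  proof -
    define \<gamma> where "\<gamma> = c (inv (a \<otimes> b)) (\<pi> \<delta>) \<cdot> \<delta>"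
    have \<gamma>: "\<gamma> \<in> carrier H" using ab \<delta> by (simp add: \<gamma>_def)
    have \<pi>\<gamma>: "\<pi> \<gamma> = inv (a \<otimes> b) \<otimes> \<pi> \<delta> \<otimes> inv (inv (a \<otimes> b))"
      using ab \<delta> by (simp add: \<gamma>_def G.free_reduce)
    have "c (a \<otimes> b) (\<pi> \<gamma>) \<cdot> c (inv (a \<otimes> b)) (\<pi> \<delta>) = \<one>\<^bsub>H\<^esub>"
      unfolding \<pi>\<gamma> using ab \<delta> by (subst pairing_action_mult) simp_all
    then have \<delta>': "c (a \<otimes> b) (\<pi> \<gamma>) \<cdot> \<gamma> = \<delta>"
      using ab \<delta> \<gamma> unfolding \<gamma>_def by (simp add: H.m_assoc[symmetric])
    have 1: "s (a \<otimes> b) \<otimes>\<^bsub>B\<^esub> l \<gamma> = l \<delta> \<otimes>\<^bsub>B\<^esub> s (a \<otimes> b)"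
      using sl[of "a \<otimes> b" \<gamma>] ab \<gamma> by (simp add: \<delta>' del: l.hom_mult)
    have "s a \<otimes>\<^bsub>B\<^esub> s b \<otimes>\<^bsub>B\<^esub> l \<gamma> = s a \<otimes>\<^bsub>B\<^esub> l (c b (\<pi> \<gamma>) \<cdot> \<gamma>) \<otimes>\<^bsub>B\<^esub> s b"
      using sl[of b \<gamma>] ab \<gamma> by (simp add: B.m_assoc del: l.hom_mult)
    also have "\<dots> = l (c a (b \<otimes> \<pi> \<gamma> \<otimes> inv b) \<cdot> (c b (\<pi> \<gamma>) \<cdot> \<gamma>)) \<otimes>\<^bsub>B\<^esub> s a \<otimes>\<^bsub>B\<^esub> s b"
      using sl[of a "c b (\<pi> \<gamma>) \<cdot> \<gamma>"] ab \<gamma> by (simp add: G.free_reduce del: l.hom_mult)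
    also have "c a (b \<otimes> \<pi> \<gamma> \<otimes> inv b) \<cdot> (c b (\<pi> \<gamma>) \<cdot> \<gamma>) = \<delta>"
      using ab \<gamma> pairing_action_mult[of a b "\<pi> \<gamma>"] \<delta>' by (simp add: H.m_assoc[symmetric])
    finally have 2: "s a \<otimes>\<^bsub>B\<^esub> s b \<otimes>\<^bsub>B\<^esub> l \<gamma> = l \<delta> \<otimes>\<^bsub>B\<^esub> (s a \<otimes>\<^bsub>B\<^esub> s b)"
      using ab \<delta> by (simp add: B.m_assoc)
    have "f a b \<otimes>\<^bsub>B\<^esub> l \<delta> \<otimes>\<^bsub>B\<^esub> s (a \<otimes> b) = f a b \<otimes>\<^bsub>B\<^esub> s (a \<otimes> b) \<otimes>\<^bsub>B\<^esub> l \<gamma>"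
      using 1 ab \<gamma> \<delta> by (simp add: B.m_assoc)
    also have "\<dots> = l \<delta> \<otimes>\<^bsub>B\<^esub> (f a b \<otimes>\<^bsub>B\<^esub> s (a \<otimes> b))"
      unfolding f_s[OF ab] by (rule 2)
    finally have "f a b \<otimes>\<^bsub>B\<^esub> l \<delta> \<otimes>\<^bsub>B\<^esub> s (a \<otimes> b) = l \<delta> \<otimes>\<^bsub>B\<^esub> f a b \<otimes>\<^bsub>B\<^esub> s (a \<otimes> b)"
      using ab \<delta> by (simp add: B.m_assoc)
    then show ?thesis using ab \<delta> by simp
  qed
  \<comment> \<open>Moving \<open>s g\<close> across \<open>s a\<close> times \<open>s b\<close>, or
    across \<open>s (a \<otimes> b)\<close>, produces the same factor
    \<open>c g (a \<otimes> b)\<close>, and this commutes with \<open>f a b\<close> by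
    \<open>f_l\<close>.\<close>
  have f_s_commute: "f a b \<otimes>\<^bsub>B\<^esub> s g = s g \<otimes>\<^bsub>B\<^esub> f a b"
    if ab: "a \<in> carrier G" "b \<in> carrier G" "g \<in> carrier G" for a b g
  proof -
    have X: "c g a \<cdot> (c a (g \<otimes> b \<otimes> inv g \<otimes> inv b) \<cdot> c g b) = c g (a \<otimes> b)"
      using ab n0 by (simp add: pairing_commutator c_mult[of g a b] H.free_reduce)
    have "s g \<otimes>\<^bsub>B\<^esub> (s a \<otimes>\<^bsub>B\<^esub> s b) = l (c g a) \<otimes>\<^bsub>B\<^esub> (s a \<otimes>\<^bsub>B\<^esub> (s g \<otimes>\<^bsub>B\<^esub> s b))"
      using ss[of g a] ab by (simp add: B.m_assoc[symmetric])
    also have "\<dots> = l (c g a) \<otimes>\<^bsub>B\<^esub> ((s a \<otimes>\<^bsub>B\<^esub> l (c g b)) \<otimes>\<^bsub>B\<^esub> (s b \<otimes>\<^bsub>B\<^esub> s g))"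
      using ss[of g b] ab by (simp add: B.m_assoc)
    also have "\<dots> = l (c g a \<cdot> (c a (g \<otimes> b \<otimes> inv g \<otimes> inv b) \<cdot> c g b)) \<otimes>\<^bsub>B\<^esub> (s a \<otimes>\<^bsub>B\<^esub> (s b \<otimes>\<^bsub>B\<^esub> s g))"
      using sl[of a "c g b"] ab by (simp add: B.m_assoc)
    finally have 1: "s g \<otimes>\<^bsub>B\<^esub> (s a \<otimes>\<^bsub>B\<^esub> s b) = l (c g (a \<otimes> b)) \<otimes>\<^bsub>B\<^esub> (s a \<otimes>\<^bsub>B\<^esub> (s b \<otimes>\<^bsub>B\<^esub> s g))"
      unfolding X .
    have "s g \<otimes>\<^bsub>B\<^esub> f a b \<otimes>\<^bsub>B\<^esub> s (a \<otimes> b) = s g \<otimes>\<^bsub>B\<^esub> (s a \<otimes>\<^bsub>B\<^esub> s b)"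
      using f_s[of a b] ab by (simp add: B.m_assoc)
    also have "\<dots> = l (c g (a \<otimes> b)) \<otimes>\<^bsub>B\<^esub> (f a b \<otimes>\<^bsub>B\<^esub> s (a \<otimes> b) \<otimes>\<^bsub>B\<^esub> s g)"
      unfolding 1 f_s[OF ab(1,2)] using ab by (simp add: B.m_assoc)
    also have "\<dots> = l (c g (a \<otimes> b)) \<otimes>\<^bsub>B\<^esub> f a b \<otimes>\<^bsub>B\<^esub> (s (a \<otimes> b) \<otimes>\<^bsub>B\<^esub> s g)"
      using ab by (simp add: B.m_assoc)
    also have "\<dots> = f a b \<otimes>\<^bsub>B\<^esub> (l (c g (a \<otimes> b)) \<otimes>\<^bsub>B\<^esub> (s (a \<otimes> b) \<otimes>\<^bsub>B\<^esub> s g))"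
      using f_l[of a b "c g (a \<otimes> b)", symmetric] ab by (simp add: B.m_assoc)
    also have "\<dots> = f a b \<otimes>\<^bsub>B\<^esub> (s g \<otimes>\<^bsub>B\<^esub> s (a \<otimes> b))"
      using ss[of g "a \<otimes> b"] ab by simp
    finally have "s g \<otimes>\<^bsub>B\<^esub> f a b \<otimes>\<^bsub>B\<^esub> s (a \<otimes> b) = f a b \<otimes>\<^bsub>B\<^esub> s g \<otimes>\<^bsub>B\<^esub> s (a \<otimes> b)"
      using ab by (simp add: B.m_assoc)
    then show ?thesis using ab by simp
  qed
  \<comment> \<open>The values of \<open>f\<close> commute with \<open>S\<close>, and being words in
    \<open>S\<close> they also commute with everything that centralizes \<open>S\<close>. Hence they
    lie in an abelian group, and \<open>f\<close> extends linearly to 2-chains.\<close>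
  define Z where "Z = B.centralizer S \<inter> B.centralizer (B.centralizer S)"
  have fZ: "f a b \<in> Z" if ab: "a \<in> carrier G" "b \<in> carrier G" for a b
  proof -
    have "f a b \<otimes>\<^bsub>B\<^esub> w = w \<otimes>\<^bsub>B\<^esub> f a b" if w: "w \<in> B.centralizer S" for w
      unfolding f_def
      by (intro B.commute_mult B.commute_inv) (use w ab in \<open>auto simp: B.centralizer_def S_def\<close>)
    moreover have "f a b \<in> B.centralizer S"
      using ab f_l f_s_commute by (auto simp: B.centralizer_def S_def)
    ultimately show ?thesis by (simp add: Z_def B.centralizer_def[of "B.centralizer S"] ab)
  qed
  let ?A = "{gs. length gs = 2 \<and> set gs \<subseteq> carrier G}" and ?Z = "B\<lparr>carrier := Z\<rparr>"
  interpret Z: comm_group ?Z unfolding Z_def by (rule B.comm_group_double_centralizer[OF S])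
  obtain F where F: "F \<in> hom (free_Abelian_group ?A) ?Z" 
    and Ff: "\<And>gs. gs \<in> ?A \<Longrightarrow> F (frag_of gs) = f (gs ! 0) (gs ! 1)"
  proof (rule Z.free_Abelian_group_universal[of "\<lambda>gs. f (gs ! 0) (gs ! 1)" ?A])
    show "(\<lambda>gs. f (gs ! 0) (gs ! 1)) ` ?A \<subseteq> carrier ?Z"
      using fZ by (auto simp: subset_iff)
  qed (rule that)
  have ZS: "z \<otimes>\<^bsub>B\<^esub> y = y \<otimes>\<^bsub>B\<^esub> z" if "z \<in> Z" "y \<in> S" for z y
    using that by (simp add: Z_def B.centralizer_def)
  have Zc: "Z \<subseteq> carrier B" by (auto simp: Z_def B.centralizer_def)
  have FZ: "F w \<in> Z" if "w \<in> carrier (free_Abelian_group ?A)" for w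
    using F that by (auto simp: hom_def)
  have FB: "F \<in> hom (free_Abelian_group ?A) B"
    using F Zc by (auto simp: hom_def)
  have Finv: "F (- w) = inv\<^bsub>B\<^esub> F w" if "w \<in> carrier (free_Abelian_group ?A)" for w
    using group_hom.hom_inv[of "free_Abelian_group ?A" B F w] FB that
    by (simp add: group_hom_def group_hom_axioms_def)
  define r where "r i a = l (x i 0 a) \<otimes>\<^bsub>B\<^esub> inv\<^bsub>B\<^esub> s a" for i a
  define u where "u j a = s a \<otimes>\<^bsub>B\<^esub> l (inv\<^sub>H x 0 0 a \<cdot> x 0 j a)" for j a
  have rc [simp]: "r i a \<in> carrier B" if "i < n" "a \<in> carrier G" for i a
    using that n0 by (simp add: r_def)
  have uc [simp]: "u j a \<in> carrier B" if "j < n" "a \<in> carrier G" for j a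
    using that n0 by (simp add: u_def)
  have s_x: "s a \<otimes>\<^bsub>B\<^esub> l (x i 0 b) = l (c a b) \<otimes>\<^bsub>B\<^esub> l (x i 0 b) \<otimes>\<^bsub>B\<^esub> s a"
    if "i < n" "a \<in> carrier G" "b \<in> carrier G" for i a b
    using sl[of a "x i 0 b"] that n0 by (simp add: proj_x)
  have s_x': "s a \<otimes>\<^bsub>B\<^esub> l (x i j b) = l (x i j b) \<otimes>\<^bsub>B\<^esub> s a"
    if "i < n" "j < n" "j \<noteq> 0" "a \<in> carrier G" "b \<in> carrier G" for i j a b
    using sl[of a "x i j b"] that n0 by (simp add: proj_x)
  have r_alt: "r i a = inv\<^bsub>B\<^esub> s a \<otimes>\<^bsub>B\<^esub> l (x i 0 a)" if "i < n" "a \<in> carrier G" for i a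
    using B.commute_inv[of "s a" "l (x i 0 a)"] s_x[of i a a] that n0 by (simp add: r_def c_self)
  have x_x: "l (x i 0 a) \<otimes>\<^bsub>B\<^esub> l (x k 0 b) = l (c a b) \<otimes>\<^bsub>B\<^esub> l (x k 0 b) \<otimes>\<^bsub>B\<^esub> l (x i 0 a)"
    if "i < n" "k < n" "i \<noteq> k" "a \<in> carrier G" "b \<in> carrier G" for i k a b
    using c_rows[of i k a b, symmetric] that n0 by (simp add: H.commutator_def B.free_reduce)
  have r_x: "r i a \<otimes>\<^bsub>B\<^esub> l (x k j b) = l (x k j b) \<otimes>\<^bsub>B\<^esub> r i a"
    if "i < n" "k < n" "j < n" "i \<noteq> k" "a \<in> carrier G" "b \<in> carrier G" for i j k a b
  proof (cases "j = 0")
    case False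
    then show ?thesis unfolding r_def
      using that n0 s_x' x_commute[of i 0 k j a b] l.hom_mult[of "x i 0 a" "x k j b"] l.hom_mult[of "x k j b" "x i 0 a"]
      by (intro B.commute_mult B.commute_inv) auto
  next
    case True
    have "s a \<otimes>\<^bsub>B\<^esub> (l (x k 0 b) \<otimes>\<^bsub>B\<^esub> r i a) = (s a \<otimes>\<^bsub>B\<^esub> l (x k 0 b)) \<otimes>\<^bsub>B\<^esub> r i a"
      using that n0 by (simp add: B.m_assoc)
    also have "\<dots> = l (x i 0 a) \<otimes>\<^bsub>B\<^esub> l (x k 0 b)"
      unfolding s_x[OF that(2,5,6)] x_x[OF that(1,2,4-6)] r_alt[OF that(1,5)]
      using that n0 by (simp add: B.free_reduce)
    also have "\<dots> = s a \<otimes>\<^bsub>B\<^esub> (r i a \<otimes>\<^bsub>B\<^esub> l (x k 0 b))"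
      unfolding r_alt[OF that(1,5)] using that n0 by (simp add: B.free_reduce)
    finally have "s a \<otimes>\<^bsub>B\<^esub> (r i a \<otimes>\<^bsub>B\<^esub> l (x k 0 b)) = s a \<otimes>\<^bsub>B\<^esub> (l (x k 0 b) \<otimes>\<^bsub>B\<^esub> r i a)" ..
    then show ?thesis using True that n0 by simp
  qed
  have r_s: "r i a \<otimes>\<^bsub>B\<^esub> s b = s b \<otimes>\<^bsub>B\<^esub> r i a"
    if "i < n" "a \<in> carrier G" "b \<in> carrier G" for i a b
  proof -
    have "s a \<otimes>\<^bsub>B\<^esub> (s b \<otimes>\<^bsub>B\<^esub> r i a) = l (c a b) \<otimes>\<^bsub>B\<^esub> (s b \<otimes>\<^bsub>B\<^esub> l (x i 0 a))"
      using ss[of a b] that n0 by (simp add: r_alt B.m_assoc[symmetric]) (simp add: B.m_assoc)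
    also have "\<dots> = s a \<otimes>\<^bsub>B\<^esub> (r i a \<otimes>\<^bsub>B\<^esub> s b)"
      using s_x[of i b a] that n0 by (simp add: r_alt B.free_reduce c_swap[of a b])
    finally show ?thesis using that n0 by simp
  qed
  have r_r: "r i a \<otimes>\<^bsub>B\<^esub> r k b = r k b \<otimes>\<^bsub>B\<^esub> r i a"
    if "i < n" "k < n" "i \<noteq> k" "a \<in> carrier G" "b \<in> carrier G" for i k a b
    unfolding r_def[of k b]
    by (rule HOL.sym, intro B.commute_mult B.commute_inv) (use that n0 r_x r_s in auto)
  have ru: "l (x i j a) = r i a \<otimes>\<^bsub>B\<^esub> u j a" if "i < n" "j < n" "a \<in> carrier G" for i j a
    using row_quotient[of 0 i j a] that n0 by (simp add: r_def u_def B.free_reduce del: l.hom_mult)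
      (simp add: B.inv_cancel_left)
  have u_alt: "u j a = inv\<^bsub>B\<^esub> r i a \<otimes>\<^bsub>B\<^esub> l (x i j a)" if "i < n" "j < n" "a \<in> carrier G" for i j a
    using that by (simp add: ru B.inv_cancel_left)
  have r_u: "u j b \<otimes>\<^bsub>B\<^esub> r i a = r i a \<otimes>\<^bsub>B\<^esub> u j b"
    if "i < n" "j < n" "a \<in> carrier G" "b \<in> carrier G" for i j a b
  proof -
    obtain k where k: "k < n" "k \<noteq> i" by (rule obtain_rows[of i]) auto
    show ?thesis unfolding u_alt[OF k(1) that(2,4)]
      by (intro B.commute_mult B.commute_inv) (use k that r_r r_x in auto)
  qed
  have u_u: "u j a \<otimes>\<^bsub>B\<^esub> u m b = u m b \<otimes>\<^bsub>B\<^esub> u j a"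
    if "j < n" "m < n" "j \<noteq> m" "a \<in> carrier G" "b \<in> carrier G" for j m a b
  proof -
    have "l (x 1 m b) \<otimes>\<^bsub>B\<^esub> u j a = u j a \<otimes>\<^bsub>B\<^esub> l (x 1 m b)"
      unfolding u_alt[OF n0(1) that(1,4)]
      by (rule HOL.sym, intro B.commute_mult B.commute_inv)
        (use that n0 r_x[of 0 1 m a b] x_commute[of 0 j 1 m a b] l.hom_mult[of "x 0 j a" "x 1 m b"]
          l.hom_mult[of "x 1 m b" "x 0 j a"] in auto)
    then have "u m b \<otimes>\<^bsub>B\<^esub> u j a = u j a \<otimes>\<^bsub>B\<^esub> u m b"
      unfolding u_alt[OF n0(2) that(2,5)]
      by (intro B.commute_mult B.commute_inv) (use that n0 r_u in auto)
    then show ?thesis by simp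
  qed
  have f_r: "f a b \<otimes>\<^bsub>B\<^esub> r i d = r i d \<otimes>\<^bsub>B\<^esub> f a b"
    if "i < n" "a \<in> carrier G" "b \<in> carrier G" "d \<in> carrier G" for a b d i
    unfolding r_def by (rule HOL.sym, intro B.commute_mult B.commute_inv) (use that n0 f_l f_s_commute in auto)
  have rr: "r i a \<otimes>\<^bsub>B\<^esub> r i b = inv\<^bsub>B\<^esub> f a b \<otimes>\<^bsub>B\<^esub> r i (a \<otimes> b)"
    if "i < n" "a \<in> carrier G" "b \<in> carrier G" for i a b
  proof -
    have "s a \<otimes>\<^bsub>B\<^esub> s b \<otimes>\<^bsub>B\<^esub> (r i a \<otimes>\<^bsub>B\<^esub> r i b) = s a \<otimes>\<^bsub>B\<^esub> r i a \<otimes>\<^bsub>B\<^esub> (s b \<otimes>\<^bsub>B\<^esub> r i b)"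
      using r_s[of i a b] that by (simp add: B.m_assoc) (simp add: B.m_assoc[symmetric])
    also have "\<dots> = l (x i 0 (a \<otimes> b))"
      using that n0 by (simp add: r_alt B.inv_cancel_left x_mult)
    also have "\<dots> = s (a \<otimes> b) \<otimes>\<^bsub>B\<^esub> r i (a \<otimes> b)"
      using that n0 by (simp add: r_alt B.inv_cancel_left)
    finally have e: "f a b \<otimes>\<^bsub>B\<^esub> s (a \<otimes> b) \<otimes>\<^bsub>B\<^esub> (r i a \<otimes>\<^bsub>B\<^esub> r i b) = s (a \<otimes> b) \<otimes>\<^bsub>B\<^esub> r i (a \<otimes> b)"
      using that by (simp add: f_s)
    have "s (a \<otimes> b) \<otimes>\<^bsub>B\<^esub> (f a b \<otimes>\<^bsub>B\<^esub> (r i a \<otimes>\<^bsub>B\<^esub> r i b)) = s (a \<otimes> b) \<otimes>\<^bsub>B\<^esub> r i (a \<otimes> b)"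
      using e f_s_commute[of a b "a \<otimes> b"] that by (simp add: B.m_assoc[symmetric])
    then have "f a b \<otimes>\<^bsub>B\<^esub> (r i a \<otimes>\<^bsub>B\<^esub> r i b) = r i (a \<otimes> b)"
      using that by simp
    then show ?thesis using that by (metis B.inv_cancel_left(1) B.m_closed fc rc)
  qed
  have uu: "u j a \<otimes>\<^bsub>B\<^esub> u j b = f a b \<otimes>\<^bsub>B\<^esub> u j (a \<otimes> b)"
    if "j < n" "a \<in> carrier G" "b \<in> carrier G" for j a b
  proof -
    have "l (x 0 j (a \<otimes> b)) = r 0 a \<otimes>\<^bsub>B\<^esub> u j a \<otimes>\<^bsub>B\<^esub> (r 0 b \<otimes>\<^bsub>B\<^esub> u j b)"
      using that n0 by (simp add: x_mult ru)
    also have "\<dots> = r 0 a \<otimes>\<^bsub>B\<^esub> r 0 b \<otimes>\<^bsub>B\<^esub> (u j a \<otimes>\<^bsub>B\<^esub> u j b)"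
      using r_u[of 0 j b a] that n0 by (simp add: B.m_assoc) (simp add: B.m_assoc[symmetric])
    also have "\<dots> = r 0 (a \<otimes> b) \<otimes>\<^bsub>B\<^esub> (inv\<^bsub>B\<^esub> f a b \<otimes>\<^bsub>B\<^esub> (u j a \<otimes>\<^bsub>B\<^esub> u j b))"
      using rr[of 0 a b] B.commute_inv[OF _ _ f_r[of 0 a b "a \<otimes> b"]] that n0
      by (simp add: B.m_assoc[symmetric])
    finally have "u j (a \<otimes> b) = inv\<^bsub>B\<^esub> f a b \<otimes>\<^bsub>B\<^esub> (u j a \<otimes>\<^bsub>B\<^esub> u j b)"
      using that n0 by (simp add: ru)
    then show ?thesis using that by (simp add: B.inv_cancel_left)
  qed
  define t where "t k = (if even k then r (k div 2) else u (k div 2))" for k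
  show ?thesis
  proof (intro exI[of _ B] exI[of _ l] exI[of _ t] exI[of _ F] conjI allI impI ballI)
    fix k assume k: "k < 2 * n"
    then have k2: "k div 2 < n" by auto
    show "t k \<in> carrier G \<rightarrow> carrier B" using k2 by (simp add: t_def)
    show "t k \<one> = \<one>\<^bsub>B\<^esub>" using k2 n0 by (simp add: t_def r_def u_def s1 x_one)
    show "t k a \<otimes>\<^bsub>B\<^esub> t m b = t m b \<otimes>\<^bsub>B\<^esub> t k a"
      if m: "m < 2 * n" and "a \<in> carrier G" "b \<in> carrier G" "k \<noteq> m" for m a b
    proof -
      have m2: "m div 2 < n" using m by auto
      have "k div 2 \<noteq> m div 2" if "even k \<longleftrightarrow> even m"
        using that \<open>k \<noteq> m\<close> by (metis bit_eq_rec)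
      then show ?thesis using that k2 m2 by (auto simp: t_def r_r u_u r_u)
    qed
    show "t k a \<otimes>\<^bsub>B\<^esub> t k b = F (frag_cmul ((-1) ^ Suc k) (frag_of [a, b])) \<otimes>\<^bsub>B\<^esub> t k (a \<otimes> b)"
      if "a \<in> carrier G" "b \<in> carrier G" for a b
      using that k2 by (auto simp: t_def rr uu Ff Finv)
    show "F w \<otimes>\<^bsub>B\<^esub> t k a = t k a \<otimes>\<^bsub>B\<^esub> F w"
      if "w \<in> carrier (free_Abelian_group ?A)" "a \<in> carrier G" for w a
    proof -
      have "F w \<in> carrier B" "F w \<in> Z" using FZ that Zc by auto
      then have y: "y \<otimes>\<^bsub>B\<^esub> F w = F w \<otimes>\<^bsub>B\<^esub> y" if "y \<in> S" for y
        using ZS that by simp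
      have "r i a \<otimes>\<^bsub>B\<^esub> F w = F w \<otimes>\<^bsub>B\<^esub> r i a" if "i < n" for i
        unfolding r_def using that \<open>a \<in> carrier G\<close> \<open>F w \<in> carrier B\<close> n0
        by (intro B.commute_mult B.commute_inv) (auto intro!: y simp: S_def)
      moreover have "u j a \<otimes>\<^bsub>B\<^esub> F w = F w \<otimes>\<^bsub>B\<^esub> u j a" if "j < n" for j
      proof -
        have "inv\<^sub>H x 0 0 a \<cdot> x 0 j a \<in> carrier H" using that \<open>a \<in> carrier G\<close> n0 by simp
        then have "l (inv\<^sub>H x 0 0 a \<cdot> x 0 j a) \<in> S" "s a \<in> S"
          using \<open>a \<in> carrier G\<close> unfolding S_def by blast+
        then show ?thesis
          unfolding u_def using S \<open>F w \<in> carrier B\<close> by (intro B.commute_mult y) auto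
      qed
      ultimately show ?thesis using k2 by (simp add: t_def)
    qed
  qed (use B l inj FB ru in \<open>auto simp: t_def\<close>)
qed

end

declare One_nat_def [simp del]

section \<open>Edge words and the fundamental group\<close>

definition word_value :: "('m, 'z) monoid_scheme \<Rightarrow> ('a \<Rightarrow> 'm) \<Rightarrow> 'a edge_word \<Rightarrow> 'm" where
  "word_value B \<phi> p =
     foldr (\<lambda>(e, b) z. (if b then \<phi> e else inv\<^bsub>B\<^esub> \<phi> e) \<otimes>\<^bsub>B\<^esub> z) p \<one>\<^bsub>B\<^esub>"

lemma word_value_simps [simp]:
  "word_value B \<phi> [] = \<one>\<^bsub>B\<^esub>"
  "word_value B \<phi> ((e, True) # p) = \<phi> e \<otimes>\<^bsub>B\<^esub> word_value B \<phi> p"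
  "word_value B \<phi> ((e, False) # p) = inv\<^bsub>B\<^esub> \<phi> e \<otimes>\<^bsub>B\<^esub> word_value B \<phi> p"
  by (simp_all add: word_value_def)

lemma word_value_cong:
  "(\<And>e. e \<in> fst ` set p \<Longrightarrow> \<phi> e = \<psi> e) \<Longrightarrow> word_value B \<phi> p = word_value B \<psi> p"
  by (induction p) (auto simp: word_value_def)

lemma word_value_map: "word_value B \<phi> (map (map_prod f id) p) = word_value B (\<lambda>e. \<phi> (f e)) p"
  by (induction p) (auto simp: word_value_def)

lemma (in group) word_value_closed:
  "\<phi> ` fst ` set p \<subseteq> carrier G \<Longrightarrow> word_value G \<phi> p \<in> carrier G"
  by (induction p) (auto simp: word_value_def)

lemma (in group) word_value_append:
  "\<lbrakk>\<phi> ` fst ` set p \<subseteq> carrier G; \<phi> ` fst ` set q \<subseteq> carrier G\<rbrakk>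
    \<Longrightarrow> word_value G \<phi> (p @ q) = word_value G \<phi> p \<otimes> word_value G \<phi> q"
proof (induction p)
  case (Cons a p)
  then show ?case
    using word_value_closed[of \<phi> p] word_value_closed[of \<phi> q] by (cases a; cases "snd a") (auto simp: m_assoc)
qed (simp add: word_value_closed)

lemma (in group) word_value_hom:
  assumes B: "group B" and h: "h \<in> hom G B" and p: "\<phi> ` fst ` set p \<subseteq> carrier G"
  shows "h (word_value G \<phi> p) = word_value B (\<lambda>e. h (\<phi> e)) p"
proof -
  interpret h: group_hom G B h using B h by (simp add: group_hom_def group_hom_axioms_def is_group)
  show ?thesis using p
  proof (induction p)
    case (Cons a p)
    then show ?case using word_value_closed[of \<phi> p] by (cases a; cases "snd a") auto
  qed simp
qed

lemma edge_path_edges: "edge_path X v p w \<Longrightarrow> fst ` set p \<subseteq> simplices X 1"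
  by (induction p arbitrary: v) auto

text \<open>The endpoints are arbitrary: the homotopy fiber has many vertices, so a functor on its
  edge groupoid is needed and not just a homomorphism on loops.\<close>

lemma (in group) word_value_homotopic:
  assumes X: "simplicial_set X"
    and \<phi>: "\<And>e. e \<in> simplices X 1 \<Longrightarrow> \<phi> e \<in> carrier G"
    and tri: "\<And>\<sigma>. \<sigma> \<in> simplices X 2 \<Longrightarrow> \<phi> (face X 2 2 \<sigma>) \<otimes> \<phi> (face X 2 0 \<sigma>) = \<phi> (face X 2 1 \<sigma>)"
    and h: "edge_homotopic X v w p q"
  shows "word_value G \<phi> p = word_value G \<phi> q"
proof -
  have c: "\<phi> ` fst ` set p \<subseteq> carrier G" if "edge_path X v p w" for v p w
    using edge_path_edges[OF that] \<phi> by blast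
  show ?thesis using h
  proof (induction rule: edge_homotopic.induct)
    case (cancel p e b q)
    have "edge_path X v (p @ q) w" 
      using edge_homotopic_path[OF X edge_homotopic.cancel[OF cancel]] by blast
    then have "\<phi> ` fst ` set p \<subseteq> carrier G" "\<phi> ` fst ` set q \<subseteq> carrier G" "\<phi> e \<in> carrier G"
      using c[OF cancel] by auto
    then show ?case
      using word_value_closed[of \<phi> q] by (cases b) (simp_all add: word_value_append inv_cancel_left)
  next
    case (triangle \<sigma> p q)
    have P: "edge_path X v (p @ [(face X 2 1 \<sigma>, True)] @ q) w" 
      using edge_homotopic_path[OF X edge_homotopic.triangle[OF triangle]] by blast
    have "\<phi> ` fst ` set p \<subseteq> carrier G" "\<phi> ` fst ` set q \<subseteq> carrier G" 
      "\<phi> (face X 2 2 \<sigma>) \<in> carrier G" "\<phi> (face X 2 0 \<sigma>) \<in> carrier G" "\<phi> (face X 2 1 \<sigma>) \<in> carrier G"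
      using c[OF triangle(2)] c[OF P] by auto
    then show ?case
      using word_value_closed[of \<phi> q] tri[OF triangle(1)]
      by (simp add: word_value_append m_assoc[symmetric])
  qed auto
qed

text \<open>All faces of the doubly degenerate triangle are the same edge, so this edge is
  idempotent; appending its inverse makes it trivial.\<close>

lemma degenerate_edge_homotopic:
  assumes X: "simplicial_set X" and v: "v \<in> simplices X 0"
  shows "edge_homotopic X v v [(degenerate X v 1, True)] []"
proof -
  interpret simplicial_set X by fact
  let ?e = "degenerate X v 1" and ?s = "degenerate X v 2"
  have f: "face X 2 i ?s = ?e" if "i \<le> 2" for i
    using action_degenerate[OF v coface_closed[of i 1]] that by (simp add: face_def numeral_2_eq_2)
  have "face X 1 i ?e = v" if "i \<le> 1" for i
  proof -
    have "const_map 0 0 = id_map 0" by (simp add: const_map_def id_map_def)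
    then have "degenerate X v 0 = v" using action_id[OF v] by (simp add: degenerate_def)
    then show ?thesis using action_degenerate[OF v coface_closed[of i 0]] that by (simp add: face_def One_nat_def)
  qed
  then have st: "edge_source X (?e, b) = v" "edge_target X (?e, b) = v" for b
    by (auto simp: edge_source_def edge_target_def)
  have p: "edge_path X v p v" if "fst ` set p \<subseteq> {?e}" for p
    using that degenerate_closed[OF v, of 1] v
    by (induction p) (auto simp: st)
  have "edge_homotopic X v v [(?e, True), (?e, True)] [(?e, True)]"
    using edge_homotopic.triangle[of ?s X v "[]" "[]" v] degenerate_closed[OF v, of 2] degenerate_closed[OF v, of 1] v by (simp add: f st)
  then have "edge_homotopic X v v ([] @ [(?e, True), (?e, True)] @ [(?e, False)]) ([] @ [(?e, True)] @ [(?e, False)])"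
    by (rule edge_homotopic_append[OF X]) (use v degenerate_closed[OF v, of 1] in \<open>auto simp: st\<close>)
  moreover have "edge_homotopic X v v ([(?e, True)] @ [(?e, True), (?e, \<not> True)] @ []) ([(?e, True)] @ [])"
    by (rule edge_homotopic.cancel) (use v degenerate_closed[OF v, of 1] in \<open>auto simp: st\<close>)
  moreover have "edge_homotopic X v v ([] @ [(?e, True), (?e, \<not> True)] @ []) ([] @ [])"
    by (rule edge_homotopic.cancel) (use v degenerate_closed[OF v, of 1] in \<open>auto simp: st\<close>)
  ultimately show ?thesis
    by (simp, blast intro: edge_homotopic.sym edge_homotopic.trans)
qed

definition path_class :: "'a sset \<Rightarrow> 'a \<Rightarrow> 'a edge_word \<Rightarrow> 'a edge_word set" where
  "path_class X v p = loop_homotopy X v `` {p}"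

definition edge_class :: "'a sset \<Rightarrow> 'a \<Rightarrow> 'a \<Rightarrow> 'a edge_word set" where
  "edge_class X v e = path_class X v [(e, True)]"

lemma path_class_eq_iff:
  assumes X: "simplicial_set X" and "p \<in> edge_loops X v" "q \<in> edge_loops X v"
  shows "path_class X v p = path_class X v q \<longleftrightarrow> edge_homotopic X v v p q"
  using eq_equiv_class_iff[OF equiv_loop_homotopy[OF X] assms(2,3)]
  by (simp add: path_class_def loop_homotopy_def)

lemma carrier_fundamental_group: "carrier (\<pi>\<^sub>1 X v) = path_class X v ` edge_loops X v"
  by (auto simp: fundamental_group_def quotient_def path_class_def)

lemma one_fundamental_group: "\<one>\<^bsub>\<pi>\<^sub>1 X v\<^esub> = path_class X v []"
  by (simp add: fundamental_group_def path_class_def)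

lemma mult_path_class:
  "\<lbrakk>simplicial_set X; p \<in> edge_loops X v; q \<in> edge_loops X v\<rbrakk>
    \<Longrightarrow> path_class X v p \<otimes>\<^bsub>\<pi>\<^sub>1 X v\<^esub> path_class X v q = path_class X v (p @ q)"
  by (simp add: path_class_def fundamental_group_mult)

lemma fundamental_group_map_path_class:
  assumes X: "simplicial_set X" and Y: "simplicial_set Y" and f: "simplicial_map X Y f"
    and p: "p \<in> edge_loops X v"
  shows "fundamental_group_map Y (f 0 v) f (path_class X v p) = path_class Y (f 0 v) (map (map_prod (f 1) id) p)"
    and "map (map_prod (f 1) id) p \<in> edge_loops Y (f 0 v)"
proof -
  let ?f = "map (map_prod (f 1) id)"
  have face: "face Y (Suc k) i (f (Suc k) x) = f k (face X (Suc k) i x)"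
    if "x \<in> simplices X (Suc k)" "i \<le> Suc k" for k i x
    using f that coface_closed[of i k] by (simp add: simplicial_map_def face_def)
  have face1: "face Y 1 i (f 1 x) = f 0 (face X 1 i x)" if "x \<in> simplices X 1" "i \<le> 1" for i x
    using that face[of x 0 i] by (simp add: One_nat_def)
  have face2: "face Y 2 i (f 2 x) = f 1 (face X 2 i x)" if "x \<in> simplices X 2" "i \<le> 2" for i x
    using that face[of x 1 i] by (simp add: numeral_2_eq_2)
  have fc: "f k x \<in> simplices Y k" if "x \<in> simplices X k" for k x
    using f that by (simp add: simplicial_map_def)
  have path: "edge_path Y (f 0 u) (?f p) (f 0 w)" if "edge_path X u p w" for u p w
    using that
  proof (induction p arbitrary: u)
    case (Cons a p)
    then show ?case
      by (cases a) (force simp: edge_source_def edge_target_def face1 fc split: if_splits)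
  qed (simp add: fc)
  have htpy: "edge_homotopic Y (f 0 u) (f 0 w) (?f p) (?f q)" if "edge_homotopic X u w p q" for u w p q
    using that
  proof (induction rule: edge_homotopic.induct)
    case (refl p) then show ?case by (intro edge_homotopic.refl path)
  next
    case (sym p q) show ?case by (rule edge_homotopic.sym[OF sym.IH])
  next
    case (trans p q r) show ?case by (rule edge_homotopic.trans[OF trans.IH])
  next
    case (cancel p e b q)
    from edge_homotopic.cancel[of Y "f 0 u" "?f p" "f 1 e" b "?f q" "f 0 w"] path[OF cancel]
    show ?case by (simp add: id_def)
  next
    case (triangle \<sigma> p q)
    from edge_homotopic.triangle[of "f 2 \<sigma>" Y "f 0 u" "?f p" "?f q" "f 0 w"] path[OF triangle(2)]
    show ?case using triangle(1) by (simp add: fc face2 id_def)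
  qed
  show loop: "?f p \<in> edge_loops Y (f 0 v)"
    using p path by (auto simp: edge_loops_def)
  have "(?f p, r) \<in> loop_homotopy Y (f 0 v)"
    if "(p, q) \<in> loop_homotopy X v" "(?f q, r) \<in> loop_homotopy Y (f 0 v)" for q r
    using that htpy[of v v p q] by (auto simp: loop_homotopy_def intro: edge_homotopic.trans)
  moreover have "(p, p) \<in> loop_homotopy X v"
    using p by (auto simp: loop_homotopy_def edge_loops_def intro: edge_homotopic.refl)
  ultimately show "fundamental_group_map Y (f 0 v) f (path_class X v p) = path_class Y (f 0 v) (?f p)"
    by (fastforce simp: fundamental_group_map_def path_class_def)
qed

text \<open>With one vertex every edge is a loop, and the fundamental group has the presentation
  with the edges as generators and the triangles as relations.\<close>

locale one_vertex = simplicial_set X for X :: "'a sset" +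
  fixes v assumes vertices: "simplices X 0 = {v}"
begin

lemma sset: "simplicial_set X"
  by (rule simplicial_set_axioms)

lemma edge_path_iff: "edge_path X v p v \<longleftrightarrow> fst ` set p \<subseteq> simplices X 1"
proof
  assume "fst ` set p \<subseteq> simplices X 1"
  then show "edge_path X v p v"
  proof (induction p)
    case (Cons a p)
    then have "edge_source X a = v" "edge_target X a = v"
      using edge_target_closed[of "fst a"] face_closed[of "fst a" 0] vertices
      by (auto simp: edge_source_def edge_target_def One_nat_def split: prod.splits)
    with Cons show ?case by simp
  qed (simp add: vertices)
qed (rule edge_path_edges)

lemma edge_loops_iff: "p \<in> edge_loops X v \<longleftrightarrow> fst ` set p \<subseteq> simplices X 1"
  by (simp add: edge_loops_def edge_path_iff)

sublocale fg: group "\<pi>\<^sub>1 X v"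
  using vertices by (intro group_fundamental_group[OF sset]) simp

lemma edge_class_closed [simp]: "e \<in> simplices X 1 \<Longrightarrow> edge_class X v e \<in> carrier (\<pi>\<^sub>1 X v)"
  by (auto simp: edge_class_def carrier_fundamental_group edge_loops_iff)

lemma edge_class_triangle:
  assumes s: "\<sigma> \<in> simplices X 2"
  shows "edge_class X v (face X 2 2 \<sigma>) \<otimes>\<^bsub>\<pi>\<^sub>1 X v\<^esub> edge_class X v (face X 2 0 \<sigma>) = edge_class X v (face X 2 1 \<sigma>)"
proof -
  have f: "face X 2 i \<sigma> \<in> simplices X 1" if "i \<le> 2" for i
    using face_closed[of \<sigma> 1 i] s that by (simp add: numeral_2_eq_2)
  then have "edge_homotopic X v v ([] @ [(face X 2 2 \<sigma>, True), (face X 2 0 \<sigma>, True)] @ []) ([] @ [(face X 2 1 \<sigma>, True)] @ [])"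
    by (intro edge_homotopic.triangle s) (simp add: edge_path_iff[THEN iffD2] del: edge_path.simps)
  then show ?thesis
    using f by (simp add: edge_class_def mult_path_class[OF sset] edge_loops_iff path_class_eq_iff[OF sset])
qed

lemma path_class_word_value:
  "fst ` set p \<subseteq> simplices X 1 \<Longrightarrow> path_class X v p = word_value (\<pi>\<^sub>1 X v) (edge_class X v) p"
proof (induction p)
  case (Cons a p)
  obtain e b where a: "a = (e, b)" by force
  have e: "e \<in> simplices X 1" and p: "fst ` set p \<subseteq> simplices X 1" using Cons.prems a by auto
  have inv: "path_class X v [(e, False)] = inv\<^bsub>\<pi>\<^sub>1 X v\<^esub> edge_class X v e"
  proof (rule fg.inv_equality[symmetric])
    have "edge_homotopic X v v ([] @ [(e, False), (e, \<not> False)] @ []) ([] @ [])"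
      by (rule edge_homotopic.cancel) (use e in \<open>simp add: edge_path_iff[THEN iffD2] del: edge_path.simps\<close>)
    then show "path_class X v [(e, False)] \<otimes>\<^bsub>\<pi>\<^sub>1 X v\<^esub> edge_class X v e = \<one>\<^bsub>\<pi>\<^sub>1 X v\<^esub>"
      using e by (simp add: edge_class_def mult_path_class[OF sset] edge_loops_iff path_class_eq_iff[OF sset]
          one_fundamental_group)
  qed (use e in \<open>auto simp: edge_class_def carrier_fundamental_group edge_loops_iff\<close>)
  have "path_class X v (a # p) = path_class X v [a] \<otimes>\<^bsub>\<pi>\<^sub>1 X v\<^esub> path_class X v p"
    using e p a by (simp add: mult_path_class[OF sset] edge_loops_iff)
  then show ?case
    using Cons.IH[OF p] inv a by (cases b) (simp_all add: edge_class_def)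
qed (simp add: one_fundamental_group)

lemma generate_edge_classes: "carrier (\<pi>\<^sub>1 X v) = generate (\<pi>\<^sub>1 X v) (edge_class X v ` simplices X 1)"
proof
  have "word_value (\<pi>\<^sub>1 X v) (edge_class X v) p \<in> generate (\<pi>\<^sub>1 X v) (edge_class X v ` simplices X 1)"
    if "fst ` set p \<subseteq> simplices X 1" for p
    using that
  proof (induction p)
    case (Cons a p)
    then show ?case
      by (cases a; cases "snd a") (auto intro: generate.intros)
  qed (auto intro: generate.one)
  then show "carrier (\<pi>\<^sub>1 X v) \<subseteq> generate (\<pi>\<^sub>1 X v) (edge_class X v ` simplices X 1)"
    by (auto simp: carrier_fundamental_group edge_loops_iff path_class_word_value)
  show "generate (\<pi>\<^sub>1 X v) (edge_class X v ` simplices X 1) \<subseteq> carrier (\<pi>\<^sub>1 X v)"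
    by (rule fg.generate_incl) auto
qed

text \<open>The universal property of this presentation; \<open>word_value_homotopic\<close> makes
  the value independent of the chosen representative.\<close>

lemma exists_hom:
  assumes B: "group B" and \<phi>: "\<And>e. e \<in> simplices X 1 \<Longrightarrow> \<phi> e \<in> carrier B"
    and tri: "\<And>\<sigma>. \<sigma> \<in> simplices X 2 \<Longrightarrow> \<phi> (face X 2 2 \<sigma>) \<otimes>\<^bsub>B\<^esub> \<phi> (face X 2 0 \<sigma>) = \<phi> (face X 2 1 \<sigma>)"
  shows "\<exists>h\<in>hom (\<pi>\<^sub>1 X v) B. \<forall>e\<in>simplices X 1. h (edge_class X v e) = \<phi> e"
proof -
  interpret B: group B by fact
  define h where "h A = word_value B \<phi> (SOME p. p \<in> edge_loops X v \<and> path_class X v p = A)" for A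
  have h: "h (path_class X v p) = word_value B \<phi> p" if p: "p \<in> edge_loops X v" for p
  proof -
    define q where "q = (SOME q. q \<in> edge_loops X v \<and> path_class X v q = path_class X v p)"
    have "q \<in> edge_loops X v \<and> path_class X v q = path_class X v p"
      unfolding q_def by (rule someI[of _ p]) (simp add: p)
    then have "edge_homotopic X v v q p" using p path_class_eq_iff[OF sset, of q v p] by blast
    then have "word_value B \<phi> q = word_value B \<phi> p"
      using B.word_value_homotopic[OF sset, of \<phi> v v q p] \<phi> tri by blast
    then show ?thesis by (simp add: h_def q_def)
  qed
  have im: "\<phi> ` fst ` set p \<subseteq> carrier B" if "p \<in> edge_loops X v" for p
    using that \<phi> by (auto simp: edge_loops_iff)
  have "h \<in> hom (\<pi>\<^sub>1 X v) B"
  proof (rule homI)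
    fix A C assume "A \<in> carrier (\<pi>\<^sub>1 X v)" "C \<in> carrier (\<pi>\<^sub>1 X v)"
    then obtain p q where pq: "p \<in> edge_loops X v" "q \<in> edge_loops X v" "A = path_class X v p" "C = path_class X v q"
      by (auto simp: carrier_fundamental_group)
    then have "p @ q \<in> edge_loops X v" by (simp add: edge_loops_iff image_Un)
    with pq show "h (A \<otimes>\<^bsub>\<pi>\<^sub>1 X v\<^esub> C) = h A \<otimes>\<^bsub>B\<^esub> h C"
      by (simp add: mult_path_class[OF sset] h B.word_value_append im)
  qed (auto simp: carrier_fundamental_group h intro!: B.word_value_closed im)
  moreover have "h (edge_class X v e) = \<phi> e" if "e \<in> simplices X 1" for e
    using that \<phi>[of e] by (simp add: edge_class_def h edge_loops_iff)
  ultimately show ?thesis by blast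
qed

end

section \<open>Balanced tuples\<close>

text \<open>Indices start at 0, whereas positions start at 1: index \<open>2 * i\<close> is an odd
  position and carries the sign -1.\<close>

definition alternating_sum :: "nat \<Rightarrow> (nat \<Rightarrow> 'a) \<Rightarrow> 'a \<Rightarrow>\<^sub>0 int" where
  "alternating_sum n f = (\<Sum>i<n. frag_of (f (2 * i + 1)) - frag_of (f (2 * i)))"

lemma alternating_map_eq: "alternating_map n k (map f [0..<2 * n]) = alternating_sum n f"
proof -
  have "(\<Sum>i = 1..2 * m. frag_cmul ((-1) ^ i) (frag_of (f (i - 1)))) = alternating_sum m f" for m
  proof (induction m)
    case (Suc m)
    have "{1..2 * Suc m} = insert (2 * m + 1) (insert (2 * m + 2) {1..2 * m})" by auto
    then show ?case using Suc by (simp add: alternating_sum_def One_nat_def)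
  qed (simp add: alternating_sum_def)
  moreover have "alternating_map n k (map f [0..<2 * n]) = (\<Sum>i = 1..2 * n. frag_cmul ((-1) ^ i) (frag_of (f (i - 1))))"
    unfolding alternating_map_def by (intro sum.cong refl) auto
  ultimately show ?thesis by simp
qed

lemma alternating_sum_const [simp]: "alternating_sum n (\<lambda>_. u) = 0"
  by (simp add: alternating_sum_def)

lemma frag_extend_alternating_sum:
  "frag_extend (\<lambda>x. frag_of (h x)) (alternating_sum n f) = alternating_sum n (\<lambda>k. h (f k))"
  by (simp add: alternating_sum_def frag_extend_sum frag_extend_diff o_def)

text \<open>Equal values at one index of each parity contribute opposite terms, so the common value
  may be replaced by any other.\<close>

lemma alternating_sum_pair:
  assumes ij: "i < n" "j < n" and eq: "f (2 * i) = f (2 * j + 1)" "g (2 * i) = g (2 * j + 1)"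
    and off: "\<And>k. k \<noteq> 2 * i \<Longrightarrow> k \<noteq> 2 * j + 1 \<Longrightarrow> f k = g k"
  shows "alternating_sum n f = alternating_sum n g"
proof -
  have s: "alternating_sum n f = (\<Sum>i<n. frag_of (f (2 * i + 1))) - (\<Sum>i<n. frag_of (f (2 * i)))"
    for f :: "nat \<Rightarrow> 'a" by (simp add: alternating_sum_def sum_subtractf)
  have "(\<Sum>i<n. frag_of (f (2 * i))) = frag_of (f (2 * i)) + (\<Sum>i\<in>{..<n} - {i}. frag_of (f (2 * i)))" 
    "(\<Sum>i<n. frag_of (f (2 * i + 1))) = frag_of (f (2 * j + 1)) + (\<Sum>i\<in>{..<n} - {j}. frag_of (f (2 * i + 1)))" 
    for f :: "nat \<Rightarrow> 'a" using ij by (auto intro: sum.remove)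
  moreover have "(\<Sum>i\<in>{..<n} - {i}. frag_of (f (2 * i))) = (\<Sum>i\<in>{..<n} - {i}. frag_of (g (2 * i)))"
    by (intro sum.cong refl arg_cong[where f = frag_of] off) (auto, presburger)
  moreover have "(\<Sum>i\<in>{..<n} - {j}. frag_of (f (2 * i + 1))) = (\<Sum>i\<in>{..<n} - {j}. frag_of (g (2 * i + 1)))"
    by (intro sum.cong refl arg_cong[where f = frag_of] off) (auto, presburger)
  ultimately show ?thesis unfolding s using eq by simp
qed

text \<open>The coefficient of \<open>f k\<close> counts its occurrences at odd indices minus those
  at even indices. If it vanishes and the value occurs at all, then it occurs at both
  parities.\<close>

lemma alternating_sum_zero_partner:
  assumes z: "alternating_sum n f = 0" and k: "k < 2 * n"
  obtains i j where "i < n" "j < n" "f (2 * i) = f k" "f (2 * j + 1) = f k"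
proof -
  define y where "y = f k"
  have l: "Poly_Mapping.lookup (frag_of x) y = (if x = y then 1 else 0)" for x
    by (simp add: lookup_single)
  have ls: "Poly_Mapping.lookup (\<Sum>i\<in>I. g i) y = (\<Sum>i\<in>I. Poly_Mapping.lookup (g i) y)"
    for I :: "nat set" and g :: "nat \<Rightarrow> 'a \<Rightarrow>\<^sub>0 int"
    by (induction I rule: infinite_finite_induct) (auto simp: lookup_add)
  have "Poly_Mapping.lookup (alternating_sum n f) y = 0" using z by simp
  then have e: "(\<Sum>i<n. if f (2 * i + 1) = y then 1 else 0) = (\<Sum>i<n. if f (2 * i) = y then 1 else 0 :: int)"
    by (simp add: alternating_sum_def ls lookup_minus l sum_subtractf eq_commute[of y])
  have pos: "(\<Sum>i<n. if g i = y then 1 else 0 :: int) > 0 \<longleftrightarrow> (\<exists>i<n. g i = y)" for g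
  proof
    assume "\<exists>i<n. g i = y"
    then obtain i where "i < n" "g i = y" by blast
    then show "(\<Sum>i<n. if g i = y then 1 else 0 :: int) > 0" by (intro sum_pos2[of _ i]) auto
  next
    assume *: "(\<Sum>i<n. if g i = y then 1 else 0 :: int) > 0"
    show "\<exists>i<n. g i = y"
    proof (rule ccontr)
      assume "\<not> (\<exists>i<n. g i = y)"
      then have "(\<Sum>i<n. if g i = y then 1 else 0 :: int) = 0" by (intro sum.neutral) auto
      with * show False by simp
    qed
  qed
  have "(\<exists>i<n. f (2 * i) = y) \<longleftrightarrow> (\<exists>i<n. f (2 * i + 1) = y)"
    using pos[of "\<lambda>i. f (2 * i)"] pos[of "\<lambda>i. f (2 * i + 1)"] e by simp
  moreover have "(\<exists>i<n. f (2 * i) = y) \<or> (\<exists>i<n. f (2 * i + 1) = y)"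
  proof (cases "even k")
    case True
    then have "k div 2 < n \<and> f (2 * (k div 2)) = y" using k by (simp add: y_def)
    then show ?thesis by blast
  next
    case False
    then have "2 * (k div 2) + 1 = k" by presburger
    then have "f (2 * (k div 2) + 1) = y" unfolding y_def by (rule arg_cong)
    moreover have "k div 2 < n" using k by auto
    ultimately show ?thesis by blast
  qed
  ultimately show ?thesis using that unfolding y_def by blast
qed

lemma coface_1: "coface 1 0 = [1]" "coface 1 1 = [0]"
  by (simp_all add: coface_def id_map_def One_nat_def)

lemma coface_2: "coface 2 0 = [1, 2]" "coface 2 1 = [0, 2]" "coface 2 2 = [0, 1]"
  by (simp_all add: coface_def id_map_def numeral_2_eq_2 One_nat_def)

lemma coface_3: "coface 3 0 = [1, 2, 3]" "coface 3 1 = [0, 2, 3]" "coface 3 2 = [0, 1, 3]" "coface 3 3 = [0, 1, 2]"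
  by (simp_all add: coface_def id_map_def numeral_3_eq_3 numeral_2_eq_2 One_nat_def)

lemma face_power: "face (sset_power X N) k i xs = map (face X k i) xs"
  by (simp add: face_def sset_power_def)

lemma degenerate_zero: "degenerate (free_simplicial_abelian_group X) 0 k = 0"
  by (simp add: degenerate_def free_simplicial_abelian_group_def)

locale alternating_fiber = group G for G :: "('g, 'z) monoid_scheme" (structure) +
  fixes n :: nat
  assumes n: "n \<ge> 3"
begin

abbreviation "X \<equiv> classifying_space G"
abbreviation "ZX \<equiv> free_simplicial_abelian_group X"
abbreviation "P \<equiv> sset_power X (2 * n)"
abbreviation "F0 \<equiv> fiber P ZX (alternating_map n) 0"
abbreviation "HF \<equiv> homotopy_fiber P ZX (alternating_map n) 0"
abbreviation "v \<equiv> base_vertex n :: 'g list list"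

text \<open>Tuples are given by functions on all natural numbers, of which only the values below
  \<open>2 * n\<close> count; this allows function updates instead of list surgery.\<close>

definition edge :: "(nat \<Rightarrow> 'g) \<Rightarrow> 'g list list" where
  "edge t = map (\<lambda>k. [t k]) [0..<2 * n]"

definition triangle :: "(nat \<Rightarrow> 'g) \<Rightarrow> (nat \<Rightarrow> 'g) \<Rightarrow> 'g list list" where
  "triangle t u = map (\<lambda>k. [t k, u k]) [0..<2 * n]"

lemma edge_cong: "(\<And>k. k < 2 * n \<Longrightarrow> t k = u k) \<Longrightarrow> edge t = edge u"
  by (simp add: edge_def)

lemma face_X_2: 
  assumes "a \<in> carrier G" "b \<in> carrier G"
  shows "face X 2 0 [a, b] = [b]" "face X 2 1 [a, b] = [a \<otimes> b]" "face X 2 2 [a, b] = [a]"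
  using assms by (simp_all add: face_def coface_2 classifying_space_def segment_product_def upt_rec)

lemma edge_closed: "(\<And>k. k < 2 * n \<Longrightarrow> t k \<in> carrier G) \<Longrightarrow> edge t \<in> simplices P 1"
  by (auto simp: edge_def sset_power_def classifying_space_def)

lemma triangle_closed:
  "(\<And>k. k < 2 * n \<Longrightarrow> t k \<in> carrier G \<and> u k \<in> carrier G) \<Longrightarrow> triangle t u \<in> simplices P 2"
  by (auto simp: triangle_def sset_power_def classifying_space_def)

lemma face_triangle:
  assumes "\<And>k. k < 2 * n \<Longrightarrow> t k \<in> carrier G \<and> u k \<in> carrier G"
  shows "face P 2 0 (triangle t u) = edge u" "face P 2 1 (triangle t u) = edge (\<lambda>k. t k \<otimes> u k)"
    "face P 2 2 (triangle t u) = edge t"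
  using assms by (simp_all add: face_power triangle_def edge_def face_X_2)

lemma edgeE:
  assumes "x \<in> simplices P 1"
  obtains t where "x = edge t" "\<And>k. k < 2 * n \<Longrightarrow> t k \<in> carrier G"
proof (rule that[of "\<lambda>k. hd (x ! k)"])
  have *: "length x = 2 * n" "\<And>y. y \<in> set x \<Longrightarrow> length y = 1 \<and> set y \<subseteq> carrier G"
    using assms by (auto simp: sset_power_def classifying_space_def)
  have m: "x ! k \<in> set x" if "k < 2 * n" for k using that *(1) by simp
  have "x ! k = [hd (x ! k)]" if "k < 2 * n" for k
    using *(2)[OF m[OF that]] by (cases "x ! k") (auto simp: One_nat_def)
  then show "x = edge (\<lambda>k. hd (x ! k))" using *(1) by (simp add: edge_def list_eq_iff_nth_eq)
  show "hd (x ! k) \<in> carrier G" if "k < 2 * n" for k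
    using *(2)[OF m[OF that]] by (cases "x ! k") (auto simp: One_nat_def)
qed

lemma triangleE:
  assumes "x \<in> simplices P 2"
  obtains t u where "x = triangle t u" "\<And>k. k < 2 * n \<Longrightarrow> t k \<in> carrier G \<and> u k \<in> carrier G"
proof (rule that[of "\<lambda>k. x ! k ! 0" "\<lambda>k. x ! k ! 1"])
  have *: "length x = 2 * n" "\<And>y. y \<in> set x \<Longrightarrow> length y = 2 \<and> set y \<subseteq> carrier G"
    using assms by (auto simp: sset_power_def classifying_space_def)
  have m: "x ! k \<in> set x" if "k < 2 * n" for k using that *(1) by simp
  have e: "x ! k = [x ! k ! 0, x ! k ! 1]" if "k < 2 * n" for k
    using *(2)[OF m[OF that]] by (intro nth_equalityI) (auto simp: less_2_cases_iff One_nat_def)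
  have "triangle (\<lambda>k. x ! k ! 0) (\<lambda>k. x ! k ! 1) = map ((!) x) [0..<2 * n]"
    unfolding triangle_def by (intro map_cong HOL.refl e[symmetric]) simp
  then show "x = triangle (\<lambda>k. x ! k ! 0) (\<lambda>k. x ! k ! 1)" using *(1) by (metis map_nth)
  show "x ! k ! 0 \<in> carrier G \<and> x ! k ! 1 \<in> carrier G" if "k < 2 * n" for k
    using *(2)[OF m[OF that]] by (auto simp: subset_iff)
qed

lemma hd_edge: "k < 2 * n \<Longrightarrow> hd (edge t ! k) = t k"
  by (simp add: edge_def)

lemma simplices_F0: "simplices F0 k = {x \<in> simplices P k. alternating_map n k x = 0}"
  by (simp add: fiber_def degenerate_zero)

lemma action_F0: "action F0 = action P"
  by (simp add: fiber_def)

lemma face_F0: "face F0 = face P"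
  by (intro ext) (simp add: face_def action_F0)

lemma edge_in_F0:
  "(\<And>k. k < 2 * n \<Longrightarrow> t k \<in> carrier G) \<Longrightarrow>
    edge t \<in> simplices F0 1 \<longleftrightarrow> alternating_sum n (\<lambda>k. [t k]) = 0"
  using edge_closed[of t] by (simp add: simplices_F0) (simp add: edge_def alternating_map_eq)

lemma triangle_in_F0:
  "(\<And>k. k < 2 * n \<Longrightarrow> t k \<in> carrier G \<and> u k \<in> carrier G) \<Longrightarrow>
    triangle t u \<in> simplices F0 2 \<longleftrightarrow> alternating_sum n (\<lambda>k. [t k, u k]) = 0"
  using triangle_closed[of t u] by (simp add: simplices_F0) (simp add: triangle_def alternating_map_eq)

lemma simplicial_set_F0: "simplicial_set F0"
  using fiber_to_homotopy_fiber_classifying_space(1)[OF is_group] by simp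

sublocale F0: one_vertex F0 v
  by (simp add: one_vertex_def one_vertex_axioms_def simplicial_set_F0 fiber_vertices)

abbreviation "\<Gamma> \<equiv> \<pi>\<^sub>1 F0 v"

definition single :: "nat \<Rightarrow> 'g \<Rightarrow> nat \<Rightarrow> 'g" where
  "single k a = (\<lambda>_. \<one>)(k := a)"

definition pair :: "nat \<Rightarrow> nat \<Rightarrow> 'g \<Rightarrow> nat \<Rightarrow> 'g" where
  "pair i j a = (\<lambda>_. \<one>)(2 * i := a, 2 * j + 1 := a)"

lemma single_closed [simp]: "a \<in> carrier G \<Longrightarrow> single k a m \<in> carrier G"
  by (simp add: single_def)

lemma pair_closed [simp]: "a \<in> carrier G \<Longrightarrow> pair i j a k \<in> carrier G"
  by (simp add: pair_def)

definition x :: "nat \<Rightarrow> nat \<Rightarrow> 'g \<Rightarrow> 'g list list edge_word set" where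
  "x i j a = edge_class F0 v (edge (pair i j a))"

lemma odd_neq_even [simp]: "Suc (2 * j) \<noteq> 2 * i" "2 * i \<noteq> Suc (2 * j)" "2 * j + 1 \<noteq> 2 * i" "2 * i \<noteq> 2 * j + 1" for i j :: nat
  by presburger+

lemma edge_pair_closed: "\<lbrakk>i < n; j < n; a \<in> carrier G\<rbrakk> \<Longrightarrow> edge (pair i j a) \<in> simplices F0 1"
  using alternating_sum_pair[of i n j "\<lambda>k. [pair i j a k]" "\<lambda>_. [\<one>]"]
  by (subst edge_in_F0) (auto simp: pair_def)

text \<open>The triangle itself has to lie in the fiber, which is more than its edges lying there.
  This is why commutation and exchange are first obtained only for blocks in different rows and
  columns.\<close>

lemma edge_class_mult:
  assumes "\<And>k. k < 2 * n \<Longrightarrow> t k \<in> carrier G \<and> u k \<in> carrier G"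
    and "alternating_sum n (\<lambda>k. [t k, u k]) = 0"
  shows "edge_class F0 v (edge t) \<otimes>\<^bsub>\<Gamma>\<^esub> edge_class F0 v (edge u) = edge_class F0 v (edge (\<lambda>k. t k \<otimes> u k))"
  using F0.edge_class_triangle[of "triangle t u"] assms by (simp add: triangle_in_F0 face_F0 face_triangle)

lemma alternating_sum_pair_pair:
  assumes "i < n" "j < n" "k < n" "m < n" "i \<noteq> k" "j \<noteq> m" 
  shows "alternating_sum n (\<lambda>l. [pair i j a l, pair k m b l]) = 0"
proof -
  have "alternating_sum n (\<lambda>l. [pair i j a l, pair k m b l]) = alternating_sum n (\<lambda>l. [\<one>, pair k m b l])"
    using assms by (intro alternating_sum_pair[of i n j]) (auto simp: pair_def)
  also have "\<dots> = alternating_sum n (\<lambda>l. [\<one>, \<one>])"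
    using assms by (intro alternating_sum_pair[of k n m]) (auto simp: pair_def)
  finally show ?thesis by simp
qed

lemma edge_one: "edge_class F0 v (edge (\<lambda>_. \<one>)) = \<one>\<^bsub>\<Gamma>\<^esub>"
proof -
  have "edge (\<lambda>_. \<one>) \<in> simplices F0 1" by (subst edge_in_F0) auto
  with edge_class_mult[of "\<lambda>_. \<one>" "\<lambda>_. \<one>"] show ?thesis by simp
qed

text \<open>A nontrivial value occurs at both parities. One such pair is split off as a block; the
  remaining tuple is still balanced and has fewer nontrivial entries.\<close>

lemma edge_class_generated:
  assumes "\<And>k. k < 2 * n \<Longrightarrow> t k \<in> carrier G" "alternating_sum n (\<lambda>k. [t k]) = 0"
  shows "edge_class F0 v (edge t) \<in> generate \<Gamma> {x i j a | i j a. i < n \<and> j < n \<and> a \<in> carrier G}"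
  using assms
proof (induction "card {k. k < 2 * n \<and> t k \<noteq> \<one>}" arbitrary: t rule: less_induct)
  case less
  show ?case
  proof (cases "\<exists>k<2 * n. t k \<noteq> \<one>")
    case False
    then have "edge t = edge (\<lambda>_. \<one>)" by (intro edge_cong) auto
    then show ?thesis by (simp add: edge_one generate.one)
  next
    case True
    then obtain k where k: "k < 2 * n" "t k \<noteq> \<one>" by blast
    from alternating_sum_zero_partner[OF less.prems(2) k(1)] obtain i j
      where ij: "i < n" "j < n" "[t (2 * i)] = [t k]" "[t (2 * j + 1)] = [t k]" .
    define a where "a = t k"
    have a: "a \<in> carrier G" "a \<noteq> \<one>" "t (2 * i) = a" "t (2 * j + 1) = a" using k ij less.prems by (auto simp: a_def)
    define u where "u = t(2 * i := \<one>, 2 * j + 1 := \<one>)"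
    have u: "u k \<in> carrier G" if "k < 2 * n" for k using less.prems that by (simp add: u_def)
    have "alternating_sum n (\<lambda>k. [u k]) = alternating_sum n (\<lambda>k. [t k])"
      by (rule alternating_sum_pair[OF ij(1,2)]) (use a in \<open>auto simp: u_def\<close>)
    then have u0: "alternating_sum n (\<lambda>k. [u k]) = 0" using less.prems by simp
    \<comment> \<open>At both indices of the block \<open>u\<close> is trivial, so the columns of
      the triangle there are equal and cancel; elsewhere the first entry is trivial and the sum is
      that of \<open>u\<close>.\<close>
    have "alternating_sum n (\<lambda>k. [pair i j a k, u k]) = alternating_sum n (\<lambda>k. [\<one>, u k])"
      by (rule alternating_sum_pair[OF ij(1,2)]) (use a in \<open>auto simp: u_def pair_def\<close>)
    also have "\<dots> = 0" using frag_extend_alternating_sum[of "\<lambda>y. \<one> # y" n "\<lambda>k. [u k]"] u0 by simp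
    finally have "edge_class F0 v (edge (pair i j a)) \<otimes>\<^bsub>\<Gamma>\<^esub> edge_class F0 v (edge u)
        = edge_class F0 v (edge (\<lambda>k. pair i j a k \<otimes> u k))"
      using u a by (intro edge_class_mult) auto
    also have "edge (\<lambda>k. pair i j a k \<otimes> u k) = edge t"
      by (rule edge_cong) (use a less.prems in \<open>auto simp: pair_def u_def\<close>)
    finally have e: "edge_class F0 v (edge t) = x i j a \<otimes>\<^bsub>\<Gamma>\<^esub> edge_class F0 v (edge u)"
      by (simp add: x_def)
    have "{k. k < 2 * n \<and> u k \<noteq> \<one>} \<subset> {k. k < 2 * n \<and> t k \<noteq> \<one>}"
      using a ij by (auto simp: u_def psubset_eq set_eq_iff split: if_splits)
    then have "card {k. k < 2 * n \<and> u k \<noteq> \<one>} < card {k. k < 2 * n \<and> t k \<noteq> \<one>}"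
      by (intro psubset_card_mono) auto
    from less.hyps[OF this u u0] show ?thesis
      unfolding e using ij a by (intro generate.eng) (auto intro: generate.incl)
  qed
qed

lemma exists_coordinate:
  assumes "k < 2 * n"
  shows "\<exists>\<pi>\<in>hom \<Gamma> G. \<forall>t. edge t \<in> simplices F0 1 \<longrightarrow> \<pi> (edge_class F0 v (edge t)) = t k"
proof -
  have P: "y \<in> simplices P m" if "y \<in> simplices F0 m" for y m using that by (simp add: simplices_F0)
  have "\<exists>h\<in>hom \<Gamma> G. \<forall>e\<in>simplices F0 1. h (edge_class F0 v e) = hd (e ! k)"
  proof (rule F0.exists_hom[OF is_group])
    fix e assume "e \<in> simplices F0 1"
    then obtain t where "e = edge t" "\<And>k. k < 2 * n \<Longrightarrow> t k \<in> carrier G" using edgeE[OF P] by blast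
    then show "hd (e ! k) \<in> carrier G" using assms by (simp add: hd_edge)
  next
    fix \<sigma> assume "\<sigma> \<in> simplices F0 2"
    then obtain t u where "\<sigma> = triangle t u" "\<And>k. k < 2 * n \<Longrightarrow> t k \<in> carrier G \<and> u k \<in> carrier G" 
      using triangleE[OF P] by blast
    then show "hd (face F0 2 2 \<sigma> ! k) \<otimes> hd (face F0 2 0 \<sigma> ! k) = hd (face F0 2 1 \<sigma> ! k)"
      using assms by (simp add: face_F0 face_triangle hd_edge)
  qed
  then obtain h where "h \<in> hom \<Gamma> G" "\<forall>e\<in>simplices F0 1. h (edge_class F0 v e) = hd (e ! k)" by blast
  then show ?thesis using assms by (intro bexI[of _ h]) (simp_all add: hd_edge)
qed

definition coordinate :: "'g list list edge_word set \<Rightarrow> 'g" where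
  "coordinate = (SOME \<pi>. \<pi> \<in> hom \<Gamma> G \<and> (\<forall>t. edge t \<in> simplices F0 1 \<longrightarrow> \<pi> (edge_class F0 v (edge t)) = t 1))"

lemma coordinate:
  "coordinate \<in> hom \<Gamma> G" "edge t \<in> simplices F0 1 \<Longrightarrow> coordinate (edge_class F0 v (edge t)) = t 1"
proof -
  have "\<exists>\<pi>. \<pi> \<in> hom \<Gamma> G \<and> (\<forall>t. edge t \<in> simplices F0 1 \<longrightarrow> \<pi> (edge_class F0 v (edge t)) = t 1)"
    using exists_coordinate[of 1] n by auto
  from someI_ex[OF this] show "coordinate \<in> hom \<Gamma> G"
    "edge t \<in> simplices F0 1 \<Longrightarrow> coordinate (edge_class F0 v (edge t)) = t 1"
    unfolding coordinate_def by blast+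
qed

sublocale block_group G \<Gamma> n x coordinate
proof
  show "n \<ge> 3" by (rule n)
  show "coordinate \<in> hom \<Gamma> G" by (rule coordinate)
next
  fix i j a assume ij: "i < n" "j < n" and a: "a \<in> carrier G"
  have "pair i j a 1 = (if j = 0 then a else \<one>)"
    using odd_neq_even(3)[of 0 i] by (auto simp: pair_def)
  then show "coordinate (x i j a) = (if j = 0 then a else \<one>)"
    using edge_pair_closed[OF ij a] by (simp add: x_def coordinate)
next
  fix i j assume ij: "i < n" "j < n"
  show "x i j \<in> hom G \<Gamma>"
  proof (rule homI)
    fix a assume "a \<in> carrier G"
    then show "x i j a \<in> carrier \<Gamma>" using edge_pair_closed[OF ij] by (simp add: x_def)
    fix b assume "b \<in> carrier G"
    have "alternating_sum n (\<lambda>k. [pair i j a k, pair i j b k]) = alternating_sum n (\<lambda>_. [\<one>, \<one>])"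
      by (rule alternating_sum_pair[OF ij]) (auto simp: pair_def)
    then have "x i j a \<otimes>\<^bsub>\<Gamma>\<^esub> x i j b = edge_class F0 v (edge (\<lambda>k. pair i j a k \<otimes> pair i j b k))"
      unfolding x_def using \<open>a \<in> carrier G\<close> \<open>b \<in> carrier G\<close> by (intro edge_class_mult) auto
    also have "edge (\<lambda>k. pair i j a k \<otimes> pair i j b k) = edge (pair i j (a \<otimes> b))"
      by (rule edge_cong) (auto simp: pair_def)
    finally show "x i j (a \<otimes> b) = x i j a \<otimes>\<^bsub>\<Gamma>\<^esub> x i j b" by (simp add: x_def)
  qed
next
  fix i j k m a b
  assume ij: "i < n" "j < n" "k < n" "m < n" "i \<noteq> k" "j \<noteq> m" and ab: "a \<in> carrier G" "b \<in> carrier G"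
  have "x i j a \<otimes>\<^bsub>\<Gamma>\<^esub> x k m b = edge_class F0 v (edge (\<lambda>l. pair i j a l \<otimes> pair k m b l))"
    unfolding x_def using ij ab by (intro edge_class_mult alternating_sum_pair_pair) auto
  also have "edge (\<lambda>l. pair i j a l \<otimes> pair k m b l) = edge (\<lambda>l. pair k m b l \<otimes> pair i j a l)"
    by (rule edge_cong) (use ij ab in \<open>auto simp: pair_def\<close>)
  also have "edge_class F0 v \<dots> = x k m b \<otimes>\<^bsub>\<Gamma>\<^esub> x i j a"
    unfolding x_def using ij ab by (intro edge_class_mult[symmetric] alternating_sum_pair_pair) auto
  finally show "x i j a \<otimes>\<^bsub>\<Gamma>\<^esub> x k m b = x k m b \<otimes>\<^bsub>\<Gamma>\<^esub> x i j a" .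
next
  fix i j k m a
  assume ij: "i < n" "j < n" "k < n" "m < n" "i \<noteq> k" "j \<noteq> m" and a: "a \<in> carrier G"
  have "x i j a \<otimes>\<^bsub>\<Gamma>\<^esub> x k m a = edge_class F0 v (edge (\<lambda>l. pair i j a l \<otimes> pair k m a l))"
    unfolding x_def using ij a by (intro edge_class_mult alternating_sum_pair_pair) auto
  \<comment> \<open>The tuple with \<open>a\<close> at these four positions does not remember how
    odd and even positions were paired.\<close>
  also have "edge (\<lambda>l. pair i j a l \<otimes> pair k m a l) = edge (\<lambda>l. pair i m a l \<otimes> pair k j a l)"
    by (rule edge_cong) (use ij a in \<open>auto simp: pair_def\<close>)
  also have "edge_class F0 v \<dots> = x i m a \<otimes>\<^bsub>\<Gamma>\<^esub> x k j a"
    unfolding x_def using ij a by (intro edge_class_mult[symmetric] alternating_sum_pair_pair) auto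
  finally show "x i j a \<otimes>\<^bsub>\<Gamma>\<^esub> x k m a = x i m a \<otimes>\<^bsub>\<Gamma>\<^esub> x k j a" .
next
  let ?S = "{x i j a | i j a. i < n \<and> j < n \<and> a \<in> carrier G}"
  have S: "?S \<subseteq> carrier \<Gamma>" using edge_pair_closed by (auto simp: x_def)
  have "edge_class F0 v ` simplices F0 1 \<subseteq> generate \<Gamma> ?S"
  proof
    fix y assume "y \<in> edge_class F0 v ` simplices F0 1"
    then obtain e where e: "e \<in> simplices F0 1" "y = edge_class F0 v e" by blast
    then have "e \<in> simplices P 1" by (simp add: simplices_F0)
    then obtain t where "e = edge t" "\<And>k. k < 2 * n \<Longrightarrow> t k \<in> carrier G" using edgeE by blast
    then show "y \<in> generate \<Gamma> ?S" using e edge_class_generated[of t] edge_in_F0[of t] by simp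
  qed
  then have "generate \<Gamma> (edge_class F0 v ` simplices F0 1) \<subseteq> generate \<Gamma> ?S"
    using F0.fg.generate_is_subgroup[OF S] by (intro F0.fg.generate_subgroup_incl) auto
  then show "carrier \<Gamma> = generate \<Gamma> ?S"
    using F0.generate_edge_classes F0.fg.generate_incl[OF S] by auto
qed

end

section \<open>Injectivity\<close>

primrec (in monoid) ordered_product :: "nat \<Rightarrow> (nat \<Rightarrow> 'a) \<Rightarrow> 'a" where
  "ordered_product 0 f = \<one>"
| "ordered_product (Suc m) f = ordered_product m f \<otimes> f m"

context group
begin

lemma ordered_product_closed: "(\<And>k. k < m \<Longrightarrow> f k \<in> carrier G) \<Longrightarrow> ordered_product m f \<in> carrier G"
  by (induction m) auto

lemma ordered_product_cong: "(\<And>k. k < m \<Longrightarrow> f k = g k) \<Longrightarrow> ordered_product m f = ordered_product m g"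
  by (induction m) auto

lemma ordered_product_commute:
  assumes "\<And>k. k < m \<Longrightarrow> f k \<in> carrier G" "y \<in> carrier G" "\<And>k. k < m \<Longrightarrow> f k \<otimes> y = y \<otimes> f k"
  shows "ordered_product m f \<otimes> y = y \<otimes> ordered_product m f"
  using assms(1,3)
  by (induction m) (auto simp: assms(2) ordered_product_closed intro!: commute_mult)

lemma ordered_product_single:
  assumes "\<And>k. k < m \<Longrightarrow> k \<noteq> i \<Longrightarrow> f k = \<one>" "f i \<in> carrier G"
  shows "ordered_product m f = (if i < m then f i else \<one>)"
  using assms(1)
proof (induction m)
  case (Suc m)
  then have "ordered_product m f = (if i < m then f i else \<one>)" by simp
  then show ?case using Suc.prems[of m] assms(2) by (cases "i = m") auto
qed simp

lemma ordered_product_pair: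
  assumes "\<And>k. k < m \<Longrightarrow> k \<noteq> i \<Longrightarrow> k \<noteq> j \<Longrightarrow> f k = \<one>" "f i \<in> carrier G" "f j \<in> carrier G"
    "i \<noteq> j" "i < m" "j < m" "f i \<otimes> f j = f j \<otimes> f i"
  shows "ordered_product m f = f i \<otimes> f j"
  using assms(1,5,6)
proof (induction m)
  case (Suc m)
  consider "i = m" | "j = m" | "i < m" "j < m" using Suc.prems by linarith
  then show ?case
  proof cases
    case 1
    then have "ordered_product m f = f j" using Suc.prems assms by (subst ordered_product_single[of m j]) auto
    then show ?thesis using 1 assms by simp
  next
    case 2
    then have "ordered_product m f = f i" using Suc.prems assms by (subst ordered_product_single[of m i]) auto
    then show ?thesis using 2 by simp
  next
    case 3
    then show ?thesis using Suc assms by simp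
  qed
qed simp

lemma hom_eq_on_generate:
  assumes "group B" "f \<in> hom G B" "h \<in> hom G B" "S \<subseteq> carrier G" "\<And>s. s \<in> S \<Longrightarrow> f s = h s" "y \<in> generate G S"
  shows "f y = h y"
proof -
  interpret f: group_hom G B f using assms by (simp add: group_hom_def group_hom_axioms_def group_axioms)
  interpret h: group_hom G B h using assms by (simp add: group_hom_def group_hom_axioms_def is_group)
  show ?thesis using assms(6)
  proof (induction rule: generate.induct)
    case (eng y z)
    then show ?case using generate_in_carrier[OF assms(4)] by simp
  qed (use assms in auto)
qed

end

lemma sum_signed_frag:
  "(\<Sum>k<2 * n. frag_cmul ((-1) ^ Suc k) (frag_of (f k))) = alternating_sum n f"
  by (induction n) (simp_all add: alternating_sum_def One_nat_def)

lemma hom_sset_natural: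
  assumes "p \<in> simplices (hom_sset (std_simplex 1) Y) k" "\<alpha> \<in> mono_maps m k" "\<beta> \<in> mono_maps m 1"
    "\<theta> \<in> mono_maps l m"
  shows "action Y m \<theta> (p m (\<alpha>, \<beta>)) = p l (\<alpha> \<odot> \<theta>, \<beta> \<odot> \<theta>)"
  using assms by (force simp: hom_sset_def simplicial_map_def sset_prod_def std_simplex_def)

lemma hom_sset_closed:
  assumes "p \<in> simplices (hom_sset (std_simplex 1) Y) k" "\<alpha> \<in> mono_maps m k" "\<beta> \<in> mono_maps m 1"
  shows "p m (\<alpha>, \<beta>) \<in> simplices Y m"
  using assms by (force simp: hom_sset_def simplicial_map_def sset_prod_def std_simplex_def)

lemma hom_sset_action:
  assumes "\<theta> \<in> mono_maps l k" "\<alpha> \<in> mono_maps m l" "\<beta> \<in> mono_maps m 1"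
  shows "action (hom_sset (std_simplex 1) Y) k \<theta> p m (\<alpha>, \<beta>) = p m (\<theta> \<odot> \<alpha>, \<beta>)"
  using assms by (simp add: hom_sset_def sset_prod_def std_simplex_def mono_maps_length)

lemma free_closed:
  assumes "a \<in> simplices (free_simplicial_abelian_group X) k" "b \<in> simplices (free_simplicial_abelian_group X) k"
  shows "a - b \<in> simplices (free_simplicial_abelian_group X) k"
    "a + b \<in> simplices (free_simplicial_abelian_group X) k"
  using assms keys_diff[of a b] Poly_Mapping.keys_add[of a b]
  unfolding free_simplicial_abelian_group_def by (simp_all, blast+)

lemma action_free_diff:
  "action (free_simplicial_abelian_group X) k \<theta> (a - b)
    = action (free_simplicial_abelian_group X) k \<theta> a - action (free_simplicial_abelian_group X) k \<theta> b"
  "action (free_simplicial_abelian_group X) k \<theta> (a + b)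
    = action (free_simplicial_abelian_group X) k \<theta> a + action (free_simplicial_abelian_group X) k \<theta> b"
  by (simp_all add: free_simplicial_abelian_group_def frag_extend_diff frag_extend_add)

text \<open>
  The square \<open>p\<close> in a 1-simplex \<open>(x, p)\<close> of the homotopy fiber consists of the two triangles below,
  and the prism in a 2-simplex of the homotopy fiber consists of three tetrahedra.
\<close>

definition upper :: "(nat \<Rightarrow> nat list \<times> nat list \<Rightarrow> 'b) \<Rightarrow> 'b" where
  "upper p = p 2 ([0, 0, 1], [0, 1, 1])"

definition lower :: "(nat \<Rightarrow> nat list \<times> nat list \<Rightarrow> 'b) \<Rightarrow> 'b" where
  "lower p = p 2 ([0, 1, 1], [0, 0, 1])"

definition boundary_3 :: "'a sset \<Rightarrow> ('a \<Rightarrow>\<^sub>0 int) \<Rightarrow> ('a \<Rightarrow>\<^sub>0 int)" where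
  "boundary_3 X S = face (free_simplicial_abelian_group X) 3 0 S - face (free_simplicial_abelian_group X) 3 1 S
     + face (free_simplicial_abelian_group X) 3 2 S - face (free_simplicial_abelian_group X) 3 3 S"

lemma boundary_3_diff: "boundary_3 X (a - b) = boundary_3 X a - boundary_3 X b"
  by (simp add: boundary_3_def face_def action_free_diff)

lemma boundary_3_zero: "boundary_3 X 0 = 0"
  using boundary_3_diff[of X 0 0] by simp

lemma mono_maps_lists:
  "[a, b, c] \<in> mono_maps 2 k \<longleftrightarrow> a \<le> b \<and> b \<le> c \<and> c \<le> k"
  "[a, b, c, d] \<in> mono_maps 3 k \<longleftrightarrow> a \<le> b \<and> b \<le> c \<and> c \<le> d \<and> d \<le> k"
  "[a, b] \<in> mono_maps 1 k \<longleftrightarrow> a \<le> b \<and> b \<le> k"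
  by (auto simp: mono_maps_def)

text \<open>The prism is cut into the tetrahedra \<open>Sa\<close>, \<open>Sb\<close>,
  \<open>Sc\<close>. In the boundary of their alternating sum the two inner triangles cancel, the
  top triangle is the end of the path, the bottom is 0 by assumption, and the three side squares
  contribute their upper and lower triangles.\<close>

lemma prism_boundary:
  assumes X: "simplicial_set X" and q: "q \<in> simplices (hom_sset (std_simplex 1) (free_simplicial_abelian_group X)) 2"
    and e0: "endpoint 0 2 q = 0"
  defines "d \<equiv> \<lambda>i. action (hom_sset (std_simplex 1) (free_simplicial_abelian_group X)) 2 (coface 2 i) q"
  shows "\<exists>S\<in>simplices (free_simplicial_abelian_group X) 3.
    (upper (d 2) - lower (d 2)) + (upper (d 0) - lower (d 0)) - (upper (d 1) - lower (d 1))
      = endpoint 1 2 q - boundary_3 X S"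
proof -
  let ?ZX = "free_simplicial_abelian_group X"
  interpret Z: simplicial_set ?ZX by (rule simplicial_set_free[OF X])
  define Sa where "Sa = q 3 ([0,0,1,2], [0,1,1,1])"
  define Sb where "Sb = q 3 ([0,1,1,2], [0,0,1,1])"
  define Sc where "Sc = q 3 ([0,1,2,2], [0,0,0,1])"
  have c: "Sa \<in> simplices ?ZX 3" "Sb \<in> simplices ?ZX 3" "Sc \<in> simplices ?ZX 3"
    unfolding Sa_def Sb_def Sc_def by (intro hom_sset_closed[OF q]; simp add: mono_maps_lists)+
  have S: "Sc - (Sb - Sa) \<in> simplices ?ZX 3"
    by (intro free_closed c)
  have f: "face ?ZX 3 i (q 3 (\<alpha>, \<beta>)) = q 2 (\<alpha> \<odot> coface 3 i, \<beta> \<odot> coface 3 i)"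
    if "\<alpha> \<in> mono_maps 3 2" "\<beta> \<in> mono_maps 3 1" "i \<le> 3" for i \<alpha> \<beta>
    unfolding face_def using coface_closed[of i 2] that
    by (intro hom_sset_natural[OF q]) (auto simp: numeral_3_eq_3 numeral_2_eq_2)
  have d: "d i 2 (\<alpha>, \<beta>) = q 2 (coface 2 i \<odot> \<alpha>, \<beta>)"
    if "\<alpha> \<in> mono_maps 2 1" "\<beta> \<in> mono_maps 2 1" "i \<le> 2" for i \<alpha> \<beta>
    unfolding d_def using coface_closed[of i 1] that
    by (intro hom_sset_action[of _ 1]) (auto simp: numeral_2_eq_2 One_nat_def)
  have id2: "id_map 2 = [0, 1, 2]" by (simp add: id_map_def upt_rec)
  have cm: "const_map 2 i = [i, i, i]" for i by (simp add: const_map_def numeral_2_eq_2)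
  have e0': "q 2 ([0, 1, 2], [0, 0, 0]) = 0" using e0 by (simp add: endpoint_def id2 cm)
  have "(upper (d 2) - lower (d 2)) + (upper (d 0) - lower (d 0)) - (upper (d 1) - lower (d 1))
      = endpoint 1 2 q - boundary_3 X (Sc - (Sb - Sa))"
    unfolding boundary_3_diff unfolding boundary_3_def Sa_def Sb_def Sc_def upper_def lower_def
    by (simp add: f d mono_maps_lists coface_3 coface_2 comp_map_def endpoint_def id2 cm e0')
  then show ?thesis using S by blast
qed

context alternating_fiber
begin

lemma simplicial_set_X: "simplicial_set X"
  by (rule simplicial_set_classifying_space) (rule group_axioms)

lemma simplicial_set_HF: "simplicial_set HF"
  using fiber_to_homotopy_fiber_classifying_space(2)[OF group_axioms] by simp

abbreviation inclusion :: "nat \<Rightarrow> 'g list list \<Rightarrow> 'g list list \<times> (nat \<Rightarrow> nat list \<times> nat list \<Rightarrow> 'g list \<Rightarrow>\<^sub>0 int)" where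
  "inclusion \<equiv> fiber_to_homotopy_fiber ZX 0"

lemma simplicial_map_inclusion: "simplicial_map F0 HF inclusion"
  using fiber_to_homotopy_fiber_classifying_space(3)[OF group_axioms] by simp

lemma simplices_HF:
  "simplices HF k = {(x, p). x \<in> simplices P k \<and> p \<in> simplices (hom_sset (std_simplex 1) ZX) k \<and>
     endpoint 0 k p = 0 \<and> endpoint 1 k p = alternating_map n k x}"
  by (simp add: homotopy_fiber_def degenerate_zero)

lemma face_HF:
  "face HF k i (y, p) = (face P k i y, action (hom_sset (std_simplex 1) ZX) k (coface k i) p)"
  by (simp add: face_def homotopy_fiber_def)

lemma alternating_map_triangle: "alternating_map n 2 (triangle t u) = alternating_sum n (\<lambda>k. [t k, u k])"
  by (simp add: triangle_def alternating_map_eq)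

lemma const_path_triangles: "upper (const_path ZX 0 1) = 0" "lower (const_path ZX 0 1) = 0"
  by (simp_all add: const_path_def upper_def lower_def sset_prod_def std_simplex_def mono_maps_lists degenerate_zero)

lemma alternating_sum_in_free:
  assumes "\<And>k. k < 2 * m \<Longrightarrow> f k \<in> S"
  shows "alternating_sum m f \<in> carrier (free_Abelian_group S)"
  unfolding alternating_sum_def
proof (rule sum_closed_free_Abelian_group)
  fix i assume "i \<in> {..<m}"
  then have "f (2 * i + 1) \<in> S" "f (2 * i) \<in> S" using assms by auto
  then show "frag_of (f (2 * i + 1)) - frag_of (f (2 * i)) \<in> carrier (free_Abelian_group S)"
    using keys_diff[of "frag_of (f (2 * i + 1))" "frag_of (f (2 * i))"] by (auto simp: keys_frag_of)
qed

text \<open>A homotopy in the homotopy fiber preserves the value of the functor \<phi> defined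
  below. On words from the fiber this value is the image under \<open>l\<close> of the path class,
  and \<open>l\<close> is injective.\<close>

lemma inclusion_injective:
  assumes p: "p \<in> edge_loops F0 v" and q: "q \<in> edge_loops F0 v"
    and h: "edge_homotopic HF w w' (map (map_prod (inclusion 1) id) p) (map (map_prod (inclusion 1) id) q)"
  shows "edge_homotopic F0 v v p q"
proof -
  let ?A = "free_Abelian_group {gs. length gs = 2 \<and> set gs \<subseteq> carrier G}"
  from alternating_extension obtain B :: "('g list list edge_word set \<times> ('g \<Rightarrow>\<^sub>0 int) \<Rightarrow>
        'g list list edge_word set \<times> ('g \<Rightarrow>\<^sub>0 int)) monoid" and l t F where
    ext: "group B" "l \<in> hom \<Gamma> B" "inj_on l (carrier \<Gamma>)" "F \<in> hom ?A B"
    "\<forall>k<2 * n. t k \<in> carrier G \<rightarrow> carrier B \<and> t k \<one> = \<one>\<^bsub>B\<^esub>"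
    "\<forall>k<2 * n. \<forall>m<2 * n. \<forall>a\<in>carrier G. \<forall>b\<in>carrier G.
        k \<noteq> m \<longrightarrow> t k a \<otimes>\<^bsub>B\<^esub> t m b = t m b \<otimes>\<^bsub>B\<^esub> t k a"
    "\<forall>i<n. \<forall>j<n. \<forall>a\<in>carrier G. l (x i j a) = t (2 * i) a \<otimes>\<^bsub>B\<^esub> t (2 * j + 1) a"
    "\<forall>w\<in>carrier ?A. \<forall>k<2 * n. \<forall>a\<in>carrier G. F w \<otimes>\<^bsub>B\<^esub> t k a = t k a \<otimes>\<^bsub>B\<^esub> F w"
    "\<forall>k<2 * n. \<forall>a\<in>carrier G. \<forall>b\<in>carrier G.
        t k a \<otimes>\<^bsub>B\<^esub> t k b = F (frag_cmul ((-1) ^ Suc k) (frag_of [a, b])) \<otimes>\<^bsub>B\<^esub> t k (a \<otimes> b)"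
    by (elim exE conjE) (rule that)
  interpret B: group B by fact
  have tc: "t k a \<in> carrier B" if "k < 2 * n" "a \<in> carrier G" for k a using ext(5) that by auto
  have t1: "t k \<one> = \<one>\<^bsub>B\<^esub>" if "k < 2 * n" for k using ext(5) that by auto
  note t_commute = ext(6)[rule_format] and l_x = ext(7)[rule_format] and F_t = ext(8)[rule_format]
    and tt = ext(9)[rule_format]
  have A: "carrier ?A = simplices ZX 2"
    by (simp add: free_simplicial_abelian_group_def classifying_space_def)
  have Fc: "F a \<in> carrier B" if "a \<in> carrier ?A" for a using ext(4) that by (rule hom_in_carrier)
  have F_add: "F (a + b) = F a \<otimes>\<^bsub>B\<^esub> F b" if "a \<in> carrier ?A" "b \<in> carrier ?A" for a b
    using hom_mult[OF ext(4) that] by simp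
  have A0: "0 \<in> carrier ?A" by simp
  have F0: "F 0 = \<one>\<^bsub>B\<^esub>" using F_add[OF A0 A0] Fc[OF A0] by simp
  have A_diff: "a - b \<in> carrier ?A" "a + b \<in> carrier ?A" if "a \<in> carrier ?A" "b \<in> carrier ?A" for a b
    using that unfolding A by (rule free_closed)+
  have F_eq: "F (a - b) = \<one>\<^bsub>B\<^esub> \<Longrightarrow> F a = F b" if "a \<in> carrier ?A" "b \<in> carrier ?A" for a b
    using F_add[of "a - b" b] A_diff[OF that] that Fc[OF that(2)] by simp
  define op where "op s = B.ordered_product (2 * n) (\<lambda>k. t k (s k))" for s
  \<comment> \<open>Entries at different positions commute, so the factors can be sorted by
    position. Each position contributes its factor set with its sign, and together these are
    \<open>F\<close> of the alternating sum of the triangle.\<close>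
  have op_mult: "op s \<otimes>\<^bsub>B\<^esub> op u = F (alternating_sum n (\<lambda>k. [s k, u k])) \<otimes>\<^bsub>B\<^esub> op (\<lambda>k. s k \<otimes> u k)"
    if su: "\<And>k. k < 2 * n \<Longrightarrow> s k \<in> carrier G \<and> u k \<in> carrier G" for s u
  proof -
    have "B.ordered_product m (\<lambda>k. t k (s k)) \<otimes>\<^bsub>B\<^esub> B.ordered_product m (\<lambda>k. t k (u k)) =
        F (\<Sum>k<m. frag_cmul ((-1) ^ Suc k) (frag_of [s k, u k])) \<otimes>\<^bsub>B\<^esub> B.ordered_product m (\<lambda>k. t k (s k \<otimes> u k)) \<and>
        (\<Sum>k<m. frag_cmul ((-1) ^ Suc k) (frag_of [s k, u k])) \<in> carrier ?A" if "m \<le> 2 * n" for m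
      using that
    proof (induction m)
      case 0
      then show ?case by (simp add: F0)
    next
      case (Suc m)
      define S where "S = (\<Sum>k<m. frag_cmul ((-1) ^ Suc k) (frag_of [s k, u k]))"
      define f where "f = frag_cmul ((-1) ^ Suc m) (frag_of [s m, u m])"
      let ?o = "B.ordered_product m"
      have m: "m < 2 * n" "m \<le> 2 * n" using Suc.prems by auto
      have S: "S \<in> carrier ?A" and IH: "?o (\<lambda>k. t k (s k)) \<otimes>\<^bsub>B\<^esub> ?o (\<lambda>k. t k (u k)) = F S \<otimes>\<^bsub>B\<^esub> ?o (\<lambda>k. t k (s k \<otimes> u k))"
        using Suc.IH[OF m(2)] unfolding S_def by blast+
      have f: "f \<in> carrier ?A"
        using su[OF m(1)] keys_cmul[of "(-1) ^ Suc m" "frag_of [s m, u m]"] by (auto simp: f_def keys_frag_of)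
      have c: "?o (\<lambda>k. t k (s k)) \<in> carrier B" "?o (\<lambda>k. t k (u k)) \<in> carrier B" "?o (\<lambda>k. t k (s k \<otimes> u k)) \<in> carrier B"
        using su m by (auto intro!: B.ordered_product_closed tc)
      have c': "t m (s m) \<in> carrier B" "t m (u m) \<in> carrier B" "t m (s m \<otimes> u m) \<in> carrier B"
        "F S \<in> carrier B" "F f \<in> carrier B"
        using su[OF m(1)] m(1) Fc[OF S] Fc[OF f] by (simp_all add: tc)
      have com: "t m (s m) \<otimes>\<^bsub>B\<^esub> ?o (\<lambda>k. t k (u k)) = ?o (\<lambda>k. t k (u k)) \<otimes>\<^bsub>B\<^esub> t m (s m)"
        by (rule B.ordered_product_commute[symmetric]) (use su m in \<open>auto intro!: tc t_commute\<close>)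
      have comF: "F f \<otimes>\<^bsub>B\<^esub> ?o (\<lambda>k. t k (s k \<otimes> u k)) = ?o (\<lambda>k. t k (s k \<otimes> u k)) \<otimes>\<^bsub>B\<^esub> F f"
        by (rule B.ordered_product_commute[symmetric]) (use su m c' in \<open>auto intro!: tc F_t[OF f, symmetric]\<close>)
      have "?o (\<lambda>k. t k (s k)) \<otimes>\<^bsub>B\<^esub> t m (s m) \<otimes>\<^bsub>B\<^esub> (?o (\<lambda>k. t k (u k)) \<otimes>\<^bsub>B\<^esub> t m (u m))
          = ?o (\<lambda>k. t k (s k)) \<otimes>\<^bsub>B\<^esub> (t m (s m) \<otimes>\<^bsub>B\<^esub> ?o (\<lambda>k. t k (u k))) \<otimes>\<^bsub>B\<^esub> t m (u m)"
        using c c' by (simp add: B.m_assoc)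
      also have "\<dots> = (?o (\<lambda>k. t k (s k)) \<otimes>\<^bsub>B\<^esub> ?o (\<lambda>k. t k (u k))) \<otimes>\<^bsub>B\<^esub> (t m (s m) \<otimes>\<^bsub>B\<^esub> t m (u m))"
        unfolding com using c c' by (simp add: B.m_assoc)
      also have "\<dots> = F S \<otimes>\<^bsub>B\<^esub> (?o (\<lambda>k. t k (s k \<otimes> u k)) \<otimes>\<^bsub>B\<^esub> F f) \<otimes>\<^bsub>B\<^esub> t m (s m \<otimes> u m)"
        unfolding IH using tt[OF m(1), of "s m" "u m", folded f_def] su[OF m(1)] c c' by (simp add: B.m_assoc)
      also have "\<dots> = F (S + f) \<otimes>\<^bsub>B\<^esub> (?o (\<lambda>k. t k (s k \<otimes> u k)) \<otimes>\<^bsub>B\<^esub> t m (s m \<otimes> u m))"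
        unfolding comF[symmetric] F_add[OF S f] using c c' by (simp add: B.m_assoc)
      finally show ?case using A_diff(2)[OF S f] by (simp add: S_def f_def)
    qed
    from this[of "2 * n"] show ?thesis by (simp only: op_def sum_signed_frag order.refl)
  qed
  have op_closed: "op s \<in> carrier B" if "\<And>k. k < 2 * n \<Longrightarrow> s k \<in> carrier G" for s
    unfolding op_def using that by (intro B.ordered_product_closed tc) auto
  have F_op: "F a \<otimes>\<^bsub>B\<^esub> op s = op s \<otimes>\<^bsub>B\<^esub> F a"
    if "a \<in> carrier ?A" "\<And>k. k < 2 * n \<Longrightarrow> s k \<in> carrier G" for a s
    unfolding op_def using that F_t[OF that(1)]
    by (intro B.ordered_product_commute[symmetric]) (auto intro!: tc Fc)
  \<comment> \<open>Associativity of three entries at one position is the 2-cocycle identity of the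
    factor set, that is, the vanishing of \<open>F\<close> on the boundary of a basic 3-simplex; the
    rest is linearity.\<close>
  have cocycle: "F (boundary_3 X S) = \<one>\<^bsub>B\<^esub>" if "S \<in> simplices ZX 3" for S
  proof -
    have "Poly_Mapping.keys S \<subseteq> simplices X 3" using that by (simp add: free_simplicial_abelian_group_def)
    then have "boundary_3 X S \<in> carrier ?A \<and> F (boundary_3 X S) = \<one>\<^bsub>B\<^esub>"
    proof (induction S rule: frag_induction)
      case zero
      then show ?case by (simp add: boundary_3_zero F0)
    next
      case (one s)
      then obtain a b d where s: "s = [a, b, d]" "a \<in> carrier G" "b \<in> carrier G" "d \<in> carrier G"
        by (auto simp: classifying_space_def numeral_3_eq_3 length_Suc_conv)
      let ?f = "\<lambda>a b. F (frag_of [a, b])"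
      have fA: "frag_of [a, b] \<in> carrier ?A" if "a \<in> carrier G" "b \<in> carrier G" for a b
        using that by (simp add: keys_frag_of)
      have bd: "boundary_3 X (frag_of s) = (frag_of [b, d] + frag_of [a, b \<otimes> d]) - (frag_of [a, b] + frag_of [a \<otimes> b, d])"
        using s by (simp add: boundary_3_def face_def free_simplicial_abelian_group_def coface_3
            classifying_space_def segment_product_def upt_rec)
      \<comment> \<open>Index 1 has sign +1, so the defect there is \<open>F\<close> of the
        2-simplex and not of its negative.\<close>
      have k: "1 < 2 * n" using n by simp
      have t1: "t 1 a \<otimes>\<^bsub>B\<^esub> t 1 b = ?f a b \<otimes>\<^bsub>B\<^esub> t 1 (a \<otimes> b)" if "a \<in> carrier G" "b \<in> carrier G" for a b
        using tt[OF k that] by (simp add: One_nat_def)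
      have ft: "?f a b \<otimes>\<^bsub>B\<^esub> t 1 d = t 1 d \<otimes>\<^bsub>B\<^esub> ?f a b"
        if "a \<in> carrier G" "b \<in> carrier G" "d \<in> carrier G" for a b d
        using F_t[OF fA[OF that(1,2)] k that(3)] .
      have fc: "?f a b \<in> carrier B" if "a \<in> carrier G" "b \<in> carrier G" for a b
        using Fc[OF fA[OF that]] .
      have "?f a b \<otimes>\<^bsub>B\<^esub> ?f (a \<otimes> b) d \<otimes>\<^bsub>B\<^esub> t 1 (a \<otimes> b \<otimes> d) = t 1 a \<otimes>\<^bsub>B\<^esub> t 1 b \<otimes>\<^bsub>B\<^esub> t 1 d"
        using t1[of "a \<otimes> b" d] t1[of a b] s fc by (simp add: B.m_assoc tc[OF k])
      also have "\<dots> = t 1 a \<otimes>\<^bsub>B\<^esub> ?f b d \<otimes>\<^bsub>B\<^esub> t 1 (b \<otimes> d)"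
        using t1[of b d] s fc by (simp add: B.m_assoc tc[OF k])
      also have "\<dots> = ?f b d \<otimes>\<^bsub>B\<^esub> (t 1 a \<otimes>\<^bsub>B\<^esub> t 1 (b \<otimes> d))"
        using ft[of b d a] s fc by (simp add: B.m_assoc[symmetric] tc[OF k])
      also have "\<dots> = ?f b d \<otimes>\<^bsub>B\<^esub> ?f a (b \<otimes> d) \<otimes>\<^bsub>B\<^esub> t 1 (a \<otimes> b \<otimes> d)"
        using t1[of a "b \<otimes> d"] s fc by (simp add: B.m_assoc tc[OF k] m_assoc)
      finally have "?f a b \<otimes>\<^bsub>B\<^esub> ?f (a \<otimes> b) d = ?f b d \<otimes>\<^bsub>B\<^esub> ?f a (b \<otimes> d)"
        using s fc by (simp add: tc[OF k])
      then have e: "F (frag_of [a, b] + frag_of [a \<otimes> b, d]) = F (frag_of [b, d] + frag_of [a, b \<otimes> d])"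
        using s by (simp add: F_add fA del: carrier_free_Abelian_group_iff)
      have m: "frag_of [a, b] + frag_of [a \<otimes> b, d] \<in> carrier ?A" "frag_of [b, d] + frag_of [a, b \<otimes> d] \<in> carrier ?A"
        using s by (intro A_diff fA; simp)+
      have "F (boundary_3 X (frag_of s)) \<otimes>\<^bsub>B\<^esub> F (frag_of [a, b] + frag_of [a \<otimes> b, d]) = F (frag_of [a, b] + frag_of [a \<otimes> b, d])"
        using F_add[OF A_diff(1)[OF m(2,1)] m(1)] unfolding bd e by simp
      then show ?case
        using A_diff(1)[OF m(2,1)] Fc[OF A_diff(1)[OF m(2,1)]] Fc[OF m(1)] unfolding bd by simp
    next
      case (diff a b)
      then have "boundary_3 X (a - b) \<in> carrier ?A" unfolding boundary_3_diff by (intro A_diff) auto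
      moreover have "F (boundary_3 X (a - b)) \<otimes>\<^bsub>B\<^esub> F (boundary_3 X b) = F (boundary_3 X a)"
        using calculation diff F_add[of "boundary_3 X (a - b)" "boundary_3 X b"]
        by (simp add: boundary_3_diff del: carrier_free_Abelian_group_iff)
      ultimately show ?case using diff Fc[of "boundary_3 X (a - b)"] by simp
    qed
    then show ?thesis by blast
  qed
  \<comment> \<open>The ordered product fails to be multiplicative by \<open>F\<close> of the
    2-chain at the end of the prism. \<open>prism_boundary\<close> writes this chain, up to a
    boundary, as the total difference of upper and lower triangles, which the second factor
    compensates.\<close>
  define \<phi> where "\<phi> = (\<lambda>(x, p). op (\<lambda>k. hd (x ! k)) \<otimes>\<^bsub>B\<^esub> F (lower p - upper p))"
  have up: "lower p - upper p \<in> carrier ?A" if "p \<in> simplices (hom_sset (std_simplex 1) ZX) 1" for p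
    unfolding A upper_def lower_def
    by (rule free_closed(1)[OF hom_sset_closed[OF that] hom_sset_closed[OF that]]) (simp_all add: mono_maps_lists)
  have op_edge: "op (\<lambda>k. hd (edge s ! k)) = op s" for s
    unfolding op_def by (intro B.ordered_product_cong) (simp add: hd_edge)
  have \<phi>c: "\<phi> e \<in> carrier B" if e: "e \<in> simplices HF 1" for e
  proof -
    obtain x p where xp: "e = (x, p)" "x \<in> simplices P 1" "p \<in> simplices (hom_sset (std_simplex 1) ZX) 1"
      using e by (auto simp: simplices_HF)
    obtain s where s: "x = edge s" "\<And>k. k < 2 * n \<Longrightarrow> s k \<in> carrier G" using edgeE[OF xp(2)] by blast
    show ?thesis using op_closed[of s] s(2) Fc[OF up[OF xp(3)]] by (simp add: \<phi>_def xp(1) s(1) op_edge)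
  qed
  have \<phi>_tri: "\<phi> (face HF 2 2 \<sigma>) \<otimes>\<^bsub>B\<^esub> \<phi> (face HF 2 0 \<sigma>) = \<phi> (face HF 2 1 \<sigma>)" if \<sigma>: "\<sigma> \<in> simplices HF 2" for \<sigma>
  proof -
    obtain y q where yq: "\<sigma> = (y, q)" "y \<in> simplices P 2" "q \<in> simplices (hom_sset (std_simplex 1) ZX) 2"
      "endpoint 0 2 q = 0" "endpoint 1 2 q = alternating_map n 2 y"
      using \<sigma> by (auto simp: simplices_HF)
    obtain s u where su: "y = triangle s u" "\<And>k. k < 2 * n \<Longrightarrow> s k \<in> carrier G \<and> u k \<in> carrier G"
      using triangleE[OF yq(2)] by blast
    define d where "d i = action (hom_sset (std_simplex 1) ZX) 2 (coface 2 i) q" for i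
    have H: "simplicial_set (hom_sset (std_simplex 1) ZX)"
      by (intro simplicial_set_hom simplicial_set_std_simplex simplicial_set_free simplicial_set_X)
    have d: "d i \<in> simplices (hom_sset (std_simplex 1) ZX) 1" if "i \<le> 2" for i
      unfolding d_def using simplicial_set.action_closed[OF H _ yq(3), of "coface 2 i" 1] coface_closed[of i 1] that
      by (simp add: numeral_2_eq_2 One_nat_def)
    let ?w = "\<lambda>i. lower (d i) - upper (d i)" and ?h = "alternating_sum n (\<lambda>k. [s k, u k])"
    obtain S where S: "S \<in> simplices ZX 3"
      "(upper (d 2) - lower (d 2)) + (upper (d 0) - lower (d 0)) - (upper (d 1) - lower (d 1)) = ?h - boundary_3 X S"
      using prism_boundary[OF simplicial_set_X yq(3,4)] yq(5)
      by (auto simp: d_def su(1) alternating_map_triangle)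
    have w: "?w i \<in> carrier ?A" if "i \<le> 2" for i using up[OF d[OF that]] .
    have hA: "?h \<in> carrier ?A" using su(2) by (intro alternating_sum_in_free) auto
    have e: "?h + (?w 2 + ?w 0) = ?w 1 + boundary_3 X S" "boundary_3 X S = ?h + (?w 2 + ?w 0) - ?w 1"
      using S(2) by (simp_all add: algebra_simps)
    have "boundary_3 X S \<in> carrier ?A"
      unfolding e(2) by (rule A_diff(1)[OF A_diff(2)[OF hA A_diff(2)[OF w w]] w]) simp_all
    then have Fe: "F (?h + (?w 2 + ?w 0)) = F (?w 1)"
      unfolding e(1) using F_add[OF w[of 1], of "boundary_3 X S"] cocycle[OF S(1)] Fc[OF w[of 1]] by simp
    have f: "\<phi> (face HF 2 2 \<sigma>) = op s \<otimes>\<^bsub>B\<^esub> F (?w 2)" "\<phi> (face HF 2 0 \<sigma>) = op u \<otimes>\<^bsub>B\<^esub> F (?w 0)"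
      "\<phi> (face HF 2 1 \<sigma>) = op (\<lambda>k. s k \<otimes> u k) \<otimes>\<^bsub>B\<^esub> F (?w 1)"
      using su(2) by (simp_all add: \<phi>_def yq(1) su(1) face_HF d_def[symmetric] face_triangle op_edge)
    have c: "op s \<in> carrier B" "op u \<in> carrier B" "op (\<lambda>k. s k \<otimes> u k) \<in> carrier B"
      "F (?w 2) \<in> carrier B" "F (?w 0) \<in> carrier B" "F (?w 1) \<in> carrier B" "F ?h \<in> carrier B"
      using su(2) Fc[OF hA] Fc[OF w] by (auto intro!: op_closed)
    have "op s \<otimes>\<^bsub>B\<^esub> F (?w 2) \<otimes>\<^bsub>B\<^esub> (op u \<otimes>\<^bsub>B\<^esub> F (?w 0)) = op s \<otimes>\<^bsub>B\<^esub> (F (?w 2) \<otimes>\<^bsub>B\<^esub> op u) \<otimes>\<^bsub>B\<^esub> F (?w 0)"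
      using c by (simp add: B.m_assoc)
    also have "F (?w 2) \<otimes>\<^bsub>B\<^esub> op u = op u \<otimes>\<^bsub>B\<^esub> F (?w 2)" using F_op[OF w[of 2], of u] su(2) by simp
    also have "op s \<otimes>\<^bsub>B\<^esub> (op u \<otimes>\<^bsub>B\<^esub> F (?w 2)) \<otimes>\<^bsub>B\<^esub> F (?w 0) = (op s \<otimes>\<^bsub>B\<^esub> op u) \<otimes>\<^bsub>B\<^esub> F (?w 2 + ?w 0)"
      using c F_add[OF w[of 2] w[of 0]] by (simp add: B.m_assoc)
    also have "\<dots> = op (\<lambda>k. s k \<otimes> u k) \<otimes>\<^bsub>B\<^esub> F ?h \<otimes>\<^bsub>B\<^esub> F (?w 2 + ?w 0)"
      using op_mult[of s u] su(2) F_op[OF hA, of "\<lambda>k. s k \<otimes> u k"] by simp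
    also have "\<dots> = op (\<lambda>k. s k \<otimes> u k) \<otimes>\<^bsub>B\<^esub> F (?h + (?w 2 + ?w 0))"
      using c Fc[OF A_diff(2)[OF w[of 2] w[of 0]]] F_add[OF hA A_diff(2)[OF w[of 2] w[of 0]]]
      by (simp add: B.m_assoc)
    finally show ?thesis unfolding f Fe .
  qed
  have "word_value B \<phi> (map (map_prod (inclusion 1) id) p) = word_value B \<phi> (map (map_prod (inclusion 1) id) q)"
    by (rule B.word_value_homotopic[OF simplicial_set_HF _ _ h]) (use \<phi>c \<phi>_tri in auto)
  moreover have "word_value B \<phi> (map (map_prod (inclusion 1) id) p) = l (path_class F0 v p)"
    if p: "p \<in> edge_loops F0 v" for p
  proof -
    let ?f = "inclusion"
    have fc: "?f m e \<in> simplices HF m" if "e \<in> simplices F0 m" for e m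
      using simplicial_map_inclusion that by (auto simp: simplicial_map_def)
    have ff: "face HF 2 i (?f 2 \<sigma>) = ?f 1 (face F0 2 i \<sigma>)" if "\<sigma> \<in> simplices F0 2" "i \<le> 2" for i \<sigma>
      using simplicial_map_inclusion coface_closed[of i 1] that
      by (auto simp: simplicial_map_def face_def numeral_2_eq_2 One_nat_def)
    obtain h where h: "h \<in> hom \<Gamma> B" "\<forall>e\<in>simplices F0 1. h (edge_class F0 v e) = \<phi> (?f 1 e)"
      using F0.exists_hom[OF B.group_axioms, of "\<lambda>e. \<phi> (?f 1 e)"] \<phi>c \<phi>_tri fc ff by (metis le_numeral_extra(3) one_le_numeral order.refl zero_le)
    have hx: "h (x i j a) = l (x i j a)" if ij: "i < n" "j < n" "a \<in> carrier G" for i j a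
    proof -
      have "h (x i j a) = \<phi> (?f 1 (edge (pair i j a)))"
        using h(2) edge_pair_closed[OF ij] by (simp add: x_def)
      also have "\<dots> = op (pair i j a)"
        using op_closed[of "pair i j a"] ij
        by (simp add: \<phi>_def fiber_to_homotopy_fiber_def const_path_triangles op_edge F0)
      also have "\<dots> = t (2 * i) (pair i j a (2 * i)) \<otimes>\<^bsub>B\<^esub> t (2 * j + 1) (pair i j a (2 * j + 1))"
        unfolding op_def
        by (rule B.ordered_product_pair) (use ij in \<open>auto simp: pair_def t1 tc intro!: t_commute\<close>)
      also have "\<dots> = l (x i j a)" using l_x[OF ij] by (simp add: pair_def)
      finally show ?thesis .
    qed
    have e1: "fst ` set p \<subseteq> simplices F0 1" using p by (simp add: F0.edge_loops_iff)
    have "word_value B \<phi> (map (map_prod (?f 1) id) p) = word_value B (\<lambda>e. h (edge_class F0 v e)) p"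
      unfolding word_value_map by (rule word_value_cong) (use h(2) e1 in auto)
    also have "\<dots> = h (word_value \<Gamma> (edge_class F0 v) p)"
      by (rule F0.fg.word_value_hom[symmetric, OF B.group_axioms h(1)]) (use e1 in auto)
    also have "\<dots> = h (path_class F0 v p)" using F0.path_class_word_value[OF e1] by simp
    also have "\<dots> = l (path_class F0 v p)"
    proof (rule F0.fg.hom_eq_on_generate[OF B.group_axioms h(1) ext(2)])
      show "path_class F0 v p \<in> generate \<Gamma> {x i j a | i j a. i < n \<and> j < n \<and> a \<in> carrier G}"
        using p generated by (auto simp: carrier_fundamental_group)
    qed (use hx in auto)
    finally show ?thesis .
  qed
  ultimately have "l (path_class F0 v p) = l (path_class F0 v q)" using p q by simp
  then have "path_class F0 v p = path_class F0 v q"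
    using ext(3) p q by (auto simp: inj_on_def carrier_fundamental_group)
  then show ?thesis using path_class_eq_iff[OF simplicial_set_F0 p q] by simp
qed

end

section \<open>Surjectivity\<close>

text \<open>Centralizers are subgroups. Applied to \<open>S\<close> this shows that all elements
  commute with \<open>S\<close>; applied to the carrier, that they commute with each other.\<close>

lemma (in group) comm_group_generate:
  assumes S: "S \<subseteq> carrier G" and gen: "carrier G = generate G S"
    and comm: "\<And>y z. \<lbrakk>y \<in> S; z \<in> S\<rbrakk> \<Longrightarrow> y \<otimes> z = z \<otimes> y"
  shows "comm_group G"
proof -
  have "S \<subseteq> centralizer S" using S comm by (auto simp: centralizer_def)
  then have "carrier G \<subseteq> centralizer S"
    unfolding gen by (rule generate_subgroup_incl[OF _ subgroup_centralizer[OF S]])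
  then have "S \<subseteq> centralizer (carrier G)" using S by (auto simp: centralizer_def)
  then have *: "carrier G \<subseteq> centralizer (carrier G)"
    by (subst gen) (rule generate_subgroup_incl[OF _ subgroup_centralizer]; simp)
  show ?thesis by (rule group_comm_groupI) (use * in \<open>auto simp: centralizer_def\<close>)
qed

section \<open>A simplicial subset between the fiber and the power\<close>

context alternating_fiber
begin

text \<open>The two summands come from the degenerate triangles with second, respectively first,
  entry replaced by the unit. The condition thus says that the 2-chain has no part beyond these
  degenerate ones.\<close>

definition additive :: "'g list list \<Rightarrow> bool" where
  "additive y \<longleftrightarrow> alternating_map n 2 y
     = alternating_map n 2 (action P 2 [0, 1, 1] y) + alternating_map n 2 (action P 2 [1, 1, 2] y)"

text \<open>Testing all 2-dimensional images makes the condition stable under the simplicial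
  operators. On the fiber all chains vanish, so the fiber is contained in this subset.\<close>

definition Q :: "'g list list sset" where
  "Q = \<lparr>simplices = (\<lambda>k. {y \<in> simplices P k. \<forall>\<theta>\<in>mono_maps 2 k. additive (action P k \<theta> y)}),
        action = action P\<rparr>"

lemma simplices_Q: "simplices Q k = {y \<in> simplices P k. \<forall>\<theta>\<in>mono_maps 2 k. additive (action P k \<theta> y)}"
  by (simp add: Q_def)

lemma action_Q: "action Q = action P"
  by (simp add: Q_def)

lemma face_Q: "face Q = face P"
  by (intro ext) (simp add: face_def action_Q)

sublocale P: simplicial_set P
  by (rule simplicial_set_power[OF simplicial_set_X])

lemma simplicial_set_Q: "simplicial_set Q"
  by (intro simplicial_set.intro)
    (auto simp: simplices_Q action_Q P.action_closed P.action_id P.action_comp comp_map_closed)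

lemma F0_subset_Q: "simplices F0 k \<subseteq> simplices Q k"
proof
  fix y assume y: "y \<in> simplices F0 k"
  have z: "alternating_map n m (action P k \<theta> y) = 0" if "\<theta> \<in> mono_maps m k" for \<theta> m
    using F0.action_closed[OF that y] by (simp add: action_F0 simplices_F0)
  have yP: "y \<in> simplices P k" using y by (simp add: simplices_F0)
  have "additive (action P k \<theta> y)" if t: "\<theta> \<in> mono_maps 2 k" for \<theta>
  proof -
    have m: "[0, 1, 1] \<in> mono_maps 2 2" "[1, 1, 2] \<in> mono_maps 2 2" by (simp_all add: mono_maps_lists)
    show ?thesis
      using z[OF t] z[OF comp_map_closed[OF t m(1)]] z[OF comp_map_closed[OF t m(2)]]
        P.action_comp[OF t m(1) yP] P.action_comp[OF t m(2) yP] by (simp add: additive_def)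
  qed
  with yP show "y \<in> simplices Q k" by (simp add: simplices_Q)
qed

lemma vertices_P: "simplices P 0 = {v}"
proof -
  have "y = replicate (2 * n) []" if "length y = 2 * n" "set y \<subseteq> {[]}" for y :: "'g list list"
    using that by (metis replicate_eqI singletonD subsetD)
  then show ?thesis by (auto simp: sset_power_def classifying_space_vertices base_vertex_def)
qed

sublocale Q: one_vertex Q v
proof -
  have "v \<in> simplices Q 0" using F0_subset_Q F0.vertices by blast
  then have "simplices Q 0 = {v}" using vertices_P by (auto simp: simplices_Q)
  then show "one_vertex Q v" by (simp add: one_vertex_def one_vertex_axioms_def simplicial_set_Q)
qed

abbreviation "\<Theta> \<equiv> \<pi>\<^sub>1 Q v"

lemma segment_product_trivial:
  assumes "\<And>m. i \<le> m \<Longrightarrow> m < j \<Longrightarrow> gs ! m = \<one>"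
  shows "segment_product G gs i j = \<one>"
proof -
  have "foldr (\<otimes>) (map (\<lambda>m. gs ! m) ms) \<one> = \<one>" if "\<And>m. m \<in> set ms \<Longrightarrow> gs ! m = \<one>" for ms
    using that by (induction ms) auto
  from this[of "[i..<j]"] show ?thesis using assms by (simp add: segment_product_def)
qed

lemma alternating_sum_split:
  assumes "\<And>k. k < 2 * m \<Longrightarrow> t k = \<one> \<or> u k = \<one>"
  shows "alternating_sum m (\<lambda>k. [t k, u k]) = alternating_sum m (\<lambda>k. [t k, \<one>]) + alternating_sum m (\<lambda>k. [\<one>, u k])"
proof -
  have "frag_of [t (2 * i + 1), u (2 * i + 1)] - frag_of [t (2 * i), u (2 * i)] =
      (frag_of [t (2 * i + 1), \<one>] - frag_of [t (2 * i), \<one>])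
      + (frag_of [\<one>, u (2 * i + 1)] - frag_of [\<one>, u (2 * i)] :: 'g list \<Rightarrow>\<^sub>0 int)" if "i < m" for i
    using assms[of "2 * i"] assms[of "2 * i + 1"] that by auto
  then show ?thesis by (simp add: alternating_sum_def sum.distrib[symmetric])
qed

lemma action_triangle:
  assumes "\<And>k. k < 2 * n \<Longrightarrow> t k \<in> carrier G \<and> u k \<in> carrier G"
  shows "action P 2 [0, 1, 1] (triangle t u) = triangle t (\<lambda>_. \<one>)"
    "action P 2 [1, 1, 2] (triangle t u) = triangle (\<lambda>_. \<one>) u"
proof -
  have "action X 2 [0, 1, 1] [a, b] = [a, \<one>]" "action X 2 [1, 1, 2] [a, b] = [\<one>, b]"
    if "a \<in> carrier G" "b \<in> carrier G" for a b
    using that by (simp_all add: classifying_space_def segment_product_def upt_rec)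
  then show "action P 2 [0, 1, 1] (triangle t u) = triangle t (\<lambda>_. \<one>)"
    "action P 2 [1, 1, 2] (triangle t u) = triangle (\<lambda>_. \<one>) u"
    using assms by (simp_all add: sset_power_def triangle_def)
qed

lemma additive_triangle:
  "(\<And>k. k < 2 * n \<Longrightarrow> t k \<in> carrier G \<and> u k \<in> carrier G) \<Longrightarrow>
    additive (triangle t u) \<longleftrightarrow> alternating_sum n (\<lambda>k. [t k, u k])
      = alternating_sum n (\<lambda>k. [t k, \<one>]) + alternating_sum n (\<lambda>k. [\<one>, u k])"
  by (simp add: additive_def action_triangle alternating_map_triangle)

text \<open>Of two consecutive segments of a tuple with at most one nontrivial entry, at most one
  contains that entry; so in every 2-dimensional image each coordinate has a unit in one of its two
  places.\<close>

lemma supported_in_Q: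
  assumes y: "y \<in> simplices P k"
    and supp: "\<And>gs. gs \<in> set y \<Longrightarrow> \<exists>m. \<forall>i<k. i \<noteq> m \<longrightarrow> gs ! i = \<one>"
  shows "y \<in> simplices Q k"
proof -
  have "additive (action P k \<theta> y)" if t: "\<theta> \<in> mono_maps 2 k" for \<theta>
  proof -
    obtain s u where su: "action P k \<theta> y = triangle s u" "\<And>k. k < 2 * n \<Longrightarrow> s k \<in> carrier G \<and> u k \<in> carrier G"
      using triangleE[OF P.action_closed[OF t y]] by blast
    have l: "length y = 2 * n" using y by (simp add: sset_power_def)
    have len: "length \<theta> = 3" using t by (simp add: mono_maps_def)
    have ord: "\<theta> ! 1 \<le> k" "\<theta> ! 2 \<le> k" using mono_maps_nth_le[OF t] by auto
    have "s j = \<one> \<or> u j = \<one>" if j: "j < 2 * n" for j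
    proof -
      have "[s j, u j] = action X k \<theta> (y ! j)"
        using arg_cong[OF su(1), of "\<lambda>z. z ! j"] j l by (simp add: triangle_def sset_power_def)
      also have "\<dots> = [segment_product G (y ! j) (\<theta> ! 0) (\<theta> ! 1), segment_product G (y ! j) (\<theta> ! 1) (\<theta> ! 2)]"
        using len by (simp add: classifying_space_def upt_rec numeral_2_eq_2 One_nat_def)
      finally have e: "s j = segment_product G (y ! j) (\<theta> ! 0) (\<theta> ! 1)" "u j = segment_product G (y ! j) (\<theta> ! 1) (\<theta> ! 2)"
        by auto
      obtain m where m: "\<forall>i<k. i \<noteq> m \<longrightarrow> y ! j ! i = \<one>" using supp[of "y ! j"] j l by auto
      show ?thesis
      proof (cases "\<theta> ! 1 \<le> m")
        case True
        then show ?thesis using m ord unfolding e by (intro disjI1 segment_product_trivial) auto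
      next
        case False
        then show ?thesis using m ord unfolding e by (intro disjI2 segment_product_trivial) auto
      qed
    qed
    then have "alternating_sum n (\<lambda>k. [s k, u k])
        = alternating_sum n (\<lambda>k. [s k, \<one>]) + alternating_sum n (\<lambda>k. [\<one>, u k])"
      by (rule alternating_sum_split)
    with su show ?thesis by (simp only: additive_triangle)
  qed
  then show ?thesis using y by (simp add: simplices_Q)
qed

lemma edge_in_Q: "(\<And>k. k < 2 * n \<Longrightarrow> t k \<in> carrier G) \<Longrightarrow> edge t \<in> simplices Q 1"
  by (rule supported_in_Q[OF edge_closed]) (auto intro: exI[of _ 0])

lemma triangle_in_Q:
  assumes "\<And>k. k < 2 * n \<Longrightarrow> t k \<in> carrier G \<and> u k \<in> carrier G" "\<And>k. k < 2 * n \<Longrightarrow> t k = \<one> \<or> u k = \<one>"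
  shows "triangle t u \<in> simplices Q 2"
proof (rule supported_in_Q[OF triangle_closed[OF assms(1)]])
  fix gs assume "gs \<in> set (triangle t u)"
  then obtain k where k: "k < 2 * n" "gs = [t k, u k]" by (auto simp: triangle_def)
  show "\<exists>m. \<forall>i<2. i \<noteq> m \<longrightarrow> gs ! i = \<one>"
  proof (cases "t k = \<one>")
    case True
    then show ?thesis using k by (intro exI[of _ 1]) (auto simp: less_2_cases_iff)
  next
    case False
    then show ?thesis using k assms(2)[of k] by (intro exI[of _ 0]) (auto simp: less_2_cases_iff)
  qed
qed auto

lemma Q_class_mult:
  assumes "\<And>k. k < 2 * n \<Longrightarrow> t k \<in> carrier G \<and> u k \<in> carrier G" "triangle t u \<in> simplices Q 2"
  shows "edge_class Q v (edge t) \<otimes>\<^bsub>\<Theta>\<^esub> edge_class Q v (edge u) = edge_class Q v (edge (\<lambda>k. t k \<otimes> u k))"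
  using Q.edge_class_triangle[OF assms(2)] assms(1) by (simp add: face_Q face_triangle)

definition s :: "nat \<Rightarrow> 'g \<Rightarrow> 'g list list edge_word set" where
  "s k a = edge_class Q v (edge (single k a))"

lemma s_closed [simp]: "a \<in> carrier G \<Longrightarrow> s k a \<in> carrier \<Theta>"
  by (simp add: s_def edge_in_Q)

lemma Q_edge_one: "edge_class Q v (edge (\<lambda>_. \<one>)) = \<one>\<^bsub>\<Theta>\<^esub>"
  using Q_class_mult[of "\<lambda>_. \<one>" "\<lambda>_. \<one>"] by (simp add: edge_in_Q triangle_in_Q)

lemma single_one: "single k \<one> = (\<lambda>_. \<one>)"
  by (auto simp: single_def)

lemma s_one: "s k \<one> = \<one>\<^bsub>\<Theta>\<^esub>"
  by (simp add: s_def single_one Q_edge_one)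

lemma s_mult:
  assumes "k \<noteq> m" "a \<in> carrier G" "b \<in> carrier G"
  shows "s k a \<otimes>\<^bsub>\<Theta>\<^esub> s m b = edge_class Q v (edge (\<lambda>l. single k a l \<otimes> single m b l))"
  unfolding s_def using assms by (intro Q_class_mult triangle_in_Q) (auto simp: single_def)

lemma s_commute:
  assumes "k \<noteq> m" "a \<in> carrier G" "b \<in> carrier G"
  shows "s k a \<otimes>\<^bsub>\<Theta>\<^esub> s m b = s m b \<otimes>\<^bsub>\<Theta>\<^esub> s k a"
proof -
  have "edge (\<lambda>l. single k a l \<otimes> single m b l) = edge (\<lambda>l. single m b l \<otimes> single k a l)"
    by (rule edge_cong) (use assms in \<open>auto simp: single_def\<close>)
  then show ?thesis using assms by (simp add: s_mult)
qed

definition y :: "nat \<Rightarrow> nat \<Rightarrow> 'g \<Rightarrow> 'g list list edge_word set" where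
  "y i j a = s (2 * i) a \<otimes>\<^bsub>\<Theta>\<^esub> s (2 * j + 1) a"

lemma y_eq: "a \<in> carrier G \<Longrightarrow> y i j a = edge_class Q v (edge (pair i j a))"
proof -
  assume a: "a \<in> carrier G"
  have "edge (\<lambda>l. single (2 * i) a l \<otimes> single (2 * j + 1) a l) = edge (pair i j a)"
    by (rule edge_cong) (use a in \<open>auto simp: single_def pair_def\<close>)
  then show ?thesis using a by (simp add: y_def s_mult)
qed

lemma y_closed [simp]: "a \<in> carrier G \<Longrightarrow> y i j a \<in> carrier \<Theta>"
  by (simp add: y_def)

text \<open>Entries are appended one position at a time; each triangle used has at every position at
  most one nontrivial entry and hence lies in \<open>Q\<close>.\<close>

lemma edge_class_Q_product:
  assumes "\<And>k. k < 2 * n \<Longrightarrow> t k \<in> carrier G"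
  shows "edge_class Q v (edge t) = Q.fg.ordered_product (2 * n) (\<lambda>k. s k (t k))"
proof -
  have "edge_class Q v (edge (\<lambda>k. if k < m then t k else \<one>)) = Q.fg.ordered_product m (\<lambda>k. s k (t k))"
    if "m \<le> 2 * n" for m
    using that
  proof (induction m)
    case 0
    then show ?case by (simp add: Q_edge_one)
  next
    case (Suc m)
    then have tm: "t m \<in> carrier G" using assms by simp
    have "Q.fg.ordered_product (Suc m) (\<lambda>k. s k (t k)) =
        edge_class Q v (edge (\<lambda>k. if k < m then t k else \<one>)) \<otimes>\<^bsub>\<Theta>\<^esub> edge_class Q v (edge (single m (t m)))"
      using Suc by (simp add: s_def)
    also have "\<dots> = edge_class Q v (edge (\<lambda>k. (if k < m then t k else \<one>) \<otimes> single m (t m) k))"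
      using assms tm by (intro Q_class_mult triangle_in_Q) (auto simp: single_def)
    also have "edge (\<lambda>k. (if k < m then t k else \<one>) \<otimes> single m (t m) k) = edge (\<lambda>k. if k < Suc m then t k else \<one>)"
      by (rule edge_cong) (use assms tm in \<open>auto simp: single_def less_Suc_eq\<close>)
    finally show ?case ..
  qed
  from this[of "2 * n"] have "edge_class Q v (edge (\<lambda>k. if k < 2 * n then t k else \<one>))
      = Q.fg.ordered_product (2 * n) (\<lambda>k. s k (t k))" by simp
  moreover have "edge (\<lambda>k. if k < 2 * n then t k else \<one>) = edge t" by (rule edge_cong) simp
  ultimately show ?thesis by simp
qed

lemma generate_s: "carrier \<Theta> = generate \<Theta> {s k a | k a. k < 2 * n \<and> a \<in> carrier G}" (is "_ = generate \<Theta> ?S")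
proof -
  have S: "?S \<subseteq> carrier \<Theta>" by auto
  have "Q.fg.ordered_product m (\<lambda>k. s k (t k)) \<in> generate \<Theta> ?S"
    if "m \<le> 2 * n" "\<And>k. k < 2 * n \<Longrightarrow> t k \<in> carrier G" for m t
    using that
  proof (induction m)
    case 0
    then show ?case by (simp add: generate.one)
  next
    case (Suc m)
    moreover have "s m (t m) \<in> generate \<Theta> ?S"
    proof (rule generate.incl)
      have "m < 2 * n" "t m \<in> carrier G" using Suc.prems by auto
      then show "s m (t m) \<in> ?S" by blast
    qed
    ultimately show ?case by (simp add: generate.eng)
  qed
  then have et: "edge_class Q v (edge t) \<in> generate \<Theta> ?S" if "\<And>k. k < 2 * n \<Longrightarrow> t k \<in> carrier G" for t
    using that edge_class_Q_product[of t] by simp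
  have "edge_class Q v e \<in> generate \<Theta> ?S" if "e \<in> simplices Q 1" for e
  proof -
    have "e \<in> simplices P 1" using that by (simp add: simplices_Q)
    then obtain t where "e = edge t" "\<And>k. k < 2 * n \<Longrightarrow> t k \<in> carrier G" using edgeE by blast
    then show ?thesis using et[of t] by simp
  qed
  then have "generate \<Theta> (edge_class Q v ` simplices Q 1) \<subseteq> generate \<Theta> ?S"
    using Q.fg.generate_is_subgroup[OF S] by (intro Q.fg.generate_subgroup_incl) auto
  then show ?thesis
    using Q.generate_edge_classes Q.fg.generate_incl[OF S] by auto
qed

lemma exists_transfer: "\<exists>\<iota>\<in>hom \<Gamma> \<Theta>. \<forall>e\<in>simplices F0 1. \<iota> (edge_class F0 v e) = edge_class Q v e"
proof (rule F0.exists_hom[OF Q.fg.group_axioms])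
  show "edge_class Q v e \<in> carrier \<Theta>" if "e \<in> simplices F0 1" for e
    by (rule Q.edge_class_closed[OF subsetD[OF F0_subset_Q that]])
  show "edge_class Q v (face F0 2 2 \<sigma>) \<otimes>\<^bsub>\<Theta>\<^esub> edge_class Q v (face F0 2 0 \<sigma>) = edge_class Q v (face F0 2 1 \<sigma>)"
    if "\<sigma> \<in> simplices F0 2" for \<sigma>
    using Q.edge_class_triangle[OF subsetD[OF F0_subset_Q that]] by (simp add: face_Q face_F0)
qed

text \<open>Stands in for the image of \<Gamma> in \<Theta>: its generators are the classes of the
  blocks, and only its inclusion in that image is needed.\<close>

definition M :: "'g list list edge_word set set" where
  "M = generate \<Theta> {y i j a | i j a. i < n \<and> j < n \<and> a \<in> carrier G}"

lemma subgroup_M: "subgroup M \<Theta>"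
  unfolding M_def by (rule Q.fg.generate_is_subgroup) auto

lemma y_in_M: "\<lbrakk>i < n; j < n; a \<in> carrier G\<rbrakk> \<Longrightarrow> y i j a \<in> M"
  unfolding M_def by (rule generate.incl) auto

lemma M_subset_image:
  assumes h: "h \<in> hom \<Gamma> \<Theta>" and e: "\<And>e. e \<in> simplices F0 1 \<Longrightarrow> h (edge_class F0 v e) = edge_class Q v e"
  shows "M \<subseteq> h ` carrier \<Gamma>"
proof -
  interpret h: group_hom \<Gamma> \<Theta> h by (simp add: group_hom_def group_hom_axioms_def h F0.fg.group_axioms Q.fg.group_axioms)
  have "y i j a \<in> h ` carrier \<Gamma>" if "i < n" "j < n" "a \<in> carrier G" for i j a
    using e[OF edge_pair_closed[OF that]] that edge_pair_closed[OF that]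
    by (intro image_eqI[of _ _ "edge_class F0 v (edge (pair i j a))"]) (auto simp: y_eq)
  then show ?thesis
    unfolding M_def by (intro Q.fg.generate_subgroup_incl h.img_is_subgroup) auto
qed

text \<open>
  Conjugation by \<open>s k a\<close> moves \<open>y i j b\<close> only if \<open>k\<close> is one of its two positions; then \<open>s k a\<close> can be
  replaced by an element of \<open>M\<close>, compensating at a further position.
\<close>

lemma s_factor:
  assumes "k < 2 * n" "i < n" "j < n" "a \<in> carrier G"
  obtains e z where "e \<in> M" "z \<in> carrier \<Theta>" "s k a = e \<otimes>\<^bsub>\<Theta>\<^esub> z" "e \<otimes>\<^bsub>\<Theta>\<^esub> z = z \<otimes>\<^bsub>\<Theta>\<^esub> e"
    "\<And>b. b \<in> carrier G \<Longrightarrow> z \<otimes>\<^bsub>\<Theta>\<^esub> y i j b = y i j b \<otimes>\<^bsub>\<Theta>\<^esub> z"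
proof -
  have com: "s m a \<otimes>\<^bsub>\<Theta>\<^esub> y i j b = y i j b \<otimes>\<^bsub>\<Theta>\<^esub> s m a"
    if "m \<noteq> 2 * i" "m \<noteq> 2 * j + 1" "b \<in> carrier G" for m b
    unfolding y_def by (rule Q.fg.commute_mult[symmetric]) (use that assms s_commute in auto)
  have M1: "\<one>\<^bsub>\<Theta>\<^esub> \<in> M" by (rule subgroup.one_closed[OF subgroup_M])
  consider "k = 2 * i" | "k = 2 * j + 1" | "k \<noteq> 2 * i" "k \<noteq> 2 * j + 1" by blast
  then show ?thesis
  proof cases
    case 1
    obtain m where m: "m < n" "m \<noteq> j" by (rule obtain_rows[of j]) auto
    have c: "s (2 * m + 1) a \<otimes>\<^bsub>\<Theta>\<^esub> y i m a = y i m a \<otimes>\<^bsub>\<Theta>\<^esub> s (2 * m + 1) a"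
      unfolding y_def by (rule Q.fg.commute_mult[symmetric]) (use assms s_commute in auto)
    show ?thesis
    proof (rule that[of "y i m a" "inv\<^bsub>\<Theta>\<^esub> s (2 * m + 1) a"])
      show "y i m a \<in> M" using assms m by (intro y_in_M) auto
      show "s k a = y i m a \<otimes>\<^bsub>\<Theta>\<^esub> inv\<^bsub>\<Theta>\<^esub> s (2 * m + 1) a"
        using assms 1 by (simp add: y_def Q.fg.m_assoc)
      show "y i m a \<otimes>\<^bsub>\<Theta>\<^esub> inv\<^bsub>\<Theta>\<^esub> s (2 * m + 1) a = inv\<^bsub>\<Theta>\<^esub> s (2 * m + 1) a \<otimes>\<^bsub>\<Theta>\<^esub> y i m a"
        using Q.fg.commute_inv[OF _ _ c] assms by simp
      show "inv\<^bsub>\<Theta>\<^esub> s (2 * m + 1) a \<otimes>\<^bsub>\<Theta>\<^esub> y i j b = y i j b \<otimes>\<^bsub>\<Theta>\<^esub> inv\<^bsub>\<Theta>\<^esub> s (2 * m + 1) a" if "b \<in> carrier G" for b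
        by (rule Q.fg.commute_inv[OF _ _ com]) (use assms that m in auto)
    qed (use assms in auto)
  next
    case 2
    obtain m where m: "m < n" "m \<noteq> i" by (rule obtain_rows[of i]) auto
    have c: "s (2 * m) a \<otimes>\<^bsub>\<Theta>\<^esub> y m j a = y m j a \<otimes>\<^bsub>\<Theta>\<^esub> s (2 * m) a"
      unfolding y_def by (rule Q.fg.commute_mult[symmetric]) (use assms s_commute in auto)
    show ?thesis
    proof (rule that[of "y m j a" "inv\<^bsub>\<Theta>\<^esub> s (2 * m) a"])
      show "y m j a \<in> M" using assms m by (intro y_in_M) auto
      show "s k a = y m j a \<otimes>\<^bsub>\<Theta>\<^esub> inv\<^bsub>\<Theta>\<^esub> s (2 * m) a"
        using assms 2 s_commute[of "2 * m" "2 * j + 1" a a] by (simp add: y_def Q.fg.m_assoc)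
      show "y m j a \<otimes>\<^bsub>\<Theta>\<^esub> inv\<^bsub>\<Theta>\<^esub> s (2 * m) a = inv\<^bsub>\<Theta>\<^esub> s (2 * m) a \<otimes>\<^bsub>\<Theta>\<^esub> y m j a"
        using Q.fg.commute_inv[OF _ _ c] assms by simp
      show "inv\<^bsub>\<Theta>\<^esub> s (2 * m) a \<otimes>\<^bsub>\<Theta>\<^esub> y i j b = y i j b \<otimes>\<^bsub>\<Theta>\<^esub> inv\<^bsub>\<Theta>\<^esub> s (2 * m) a" if "b \<in> carrier G" for b
        by (rule Q.fg.commute_inv[OF _ _ com]) (use assms that m in auto)
    qed (use assms in auto)
  next
    case 3
    show ?thesis
      by (rule that[OF M1, of "s k a"]) (use assms com 3 in auto)
  qed
qed

lemma normal_M: "M \<lhd> \<Theta>"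
proof (rule Q.fg.normal_invI[OF subgroup_M])
  let ?Y = "{y i j a | i j a. i < n \<and> j < n \<and> a \<in> carrier G}"
  have Y: "?Y \<subseteq> carrier \<Theta>" by auto
  have Mc: "m \<in> carrier \<Theta>" if "m \<in> M" for m using subgroup.mem_carrier[OF subgroup_M that] .
  note Mm = subgroup.m_closed[OF subgroup_M] and Mi = subgroup.m_inv_closed[OF subgroup_M]
  have conj_gen: "g \<otimes>\<^bsub>\<Theta>\<^esub> m \<otimes>\<^bsub>\<Theta>\<^esub> inv\<^bsub>\<Theta>\<^esub> g \<in> M"
    if g: "g \<in> carrier \<Theta>" and gy: "\<And>w. w \<in> ?Y \<Longrightarrow> g \<otimes>\<^bsub>\<Theta>\<^esub> w \<otimes>\<^bsub>\<Theta>\<^esub> inv\<^bsub>\<Theta>\<^esub> g \<in> M" and m: "m \<in> M" for g m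
    using m unfolding M_def
  proof (induction m rule: generate.induct)
    case one
    then show ?case using g generate.one by simp
  next
    case (incl h)
    then show ?case using gy unfolding M_def by blast
  next
    case (inv h)
    then have "inv\<^bsub>\<Theta>\<^esub> (g \<otimes>\<^bsub>\<Theta>\<^esub> h \<otimes>\<^bsub>\<Theta>\<^esub> inv\<^bsub>\<Theta>\<^esub> g) \<in> M" "h \<in> carrier \<Theta>" using gy Mi Y by blast+
    then show ?case using g by (simp add: M_def Q.fg.free_reduce)
  next
    case (eng h1 h2)
    then have "h1 \<in> carrier \<Theta>" "h2 \<in> carrier \<Theta>" using Q.fg.generate_in_carrier[OF Y] by blast+
    moreover have "(g \<otimes>\<^bsub>\<Theta>\<^esub> h1 \<otimes>\<^bsub>\<Theta>\<^esub> inv\<^bsub>\<Theta>\<^esub> g) \<otimes>\<^bsub>\<Theta>\<^esub> (g \<otimes>\<^bsub>\<Theta>\<^esub> h2 \<otimes>\<^bsub>\<Theta>\<^esub> inv\<^bsub>\<Theta>\<^esub> g) \<in> M"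
      using eng.IH unfolding M_def by (rule generate.eng)
    ultimately show ?case using g by (simp add: M_def Q.fg.free_reduce)
  qed
  \<comment> \<open>Both conjugations are tracked, because mapping a subgroup into itself does not
    by itself give the same for the inverse. With \<open>s k a = e \<otimes> z\<close> the factor
    \<open>z\<close> fixes the generator at hand, and \<open>e\<close> lies in
    \<open>M\<close>.\<close>
  have conj_s: "s k a \<otimes>\<^bsub>\<Theta>\<^esub> m \<otimes>\<^bsub>\<Theta>\<^esub> inv\<^bsub>\<Theta>\<^esub> s k a \<in> M \<and> inv\<^bsub>\<Theta>\<^esub> s k a \<otimes>\<^bsub>\<Theta>\<^esub> m \<otimes>\<^bsub>\<Theta>\<^esub> s k a \<in> M"
    if k: "k < 2 * n" "a \<in> carrier G" and m: "m \<in> M" for k a m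
  proof -
    have *: "s k a \<otimes>\<^bsub>\<Theta>\<^esub> w \<otimes>\<^bsub>\<Theta>\<^esub> inv\<^bsub>\<Theta>\<^esub> s k a \<in> M \<and> inv\<^bsub>\<Theta>\<^esub> s k a \<otimes>\<^bsub>\<Theta>\<^esub> w \<otimes>\<^bsub>\<Theta>\<^esub> s k a \<in> M" if w: "w \<in> ?Y" for w
    proof -
      obtain i j b where ij: "w = y i j b" "i < n" "j < n" "b \<in> carrier G" using w by blast
      obtain e z where e: "e \<in> M" "z \<in> carrier \<Theta>" "s k a = e \<otimes>\<^bsub>\<Theta>\<^esub> z" "e \<otimes>\<^bsub>\<Theta>\<^esub> z = z \<otimes>\<^bsub>\<Theta>\<^esub> e"
        "z \<otimes>\<^bsub>\<Theta>\<^esub> y i j b = y i j b \<otimes>\<^bsub>\<Theta>\<^esub> z"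
        using s_factor[OF k(1) ij(2,3) k(2)] ij(4) by metis
      have c: "e \<in> carrier \<Theta>" "w \<in> carrier \<Theta>" "w \<in> M" using e Mc ij y_in_M by auto
      have zw: "z \<otimes>\<^bsub>\<Theta>\<^esub> (w \<otimes>\<^bsub>\<Theta>\<^esub> inv\<^bsub>\<Theta>\<^esub> z) = w" "inv\<^bsub>\<Theta>\<^esub> z \<otimes>\<^bsub>\<Theta>\<^esub> (w \<otimes>\<^bsub>\<Theta>\<^esub> z) = w"
        using e c ij Q.fg.commute_inv[OF _ _ e(5)]
        by (simp_all add: Q.fg.m_assoc[symmetric]) (simp_all add: Q.fg.m_assoc)
      have "s k a \<otimes>\<^bsub>\<Theta>\<^esub> w \<otimes>\<^bsub>\<Theta>\<^esub> inv\<^bsub>\<Theta>\<^esub> s k a = e \<otimes>\<^bsub>\<Theta>\<^esub> (z \<otimes>\<^bsub>\<Theta>\<^esub> (w \<otimes>\<^bsub>\<Theta>\<^esub> inv\<^bsub>\<Theta>\<^esub> z)) \<otimes>\<^bsub>\<Theta>\<^esub> inv\<^bsub>\<Theta>\<^esub> e"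
        unfolding e(3) using c e(2) by (simp add: Q.fg.free_reduce)
      moreover have "inv\<^bsub>\<Theta>\<^esub> s k a \<otimes>\<^bsub>\<Theta>\<^esub> w \<otimes>\<^bsub>\<Theta>\<^esub> s k a = inv\<^bsub>\<Theta>\<^esub> e \<otimes>\<^bsub>\<Theta>\<^esub> (inv\<^bsub>\<Theta>\<^esub> z \<otimes>\<^bsub>\<Theta>\<^esub> (w \<otimes>\<^bsub>\<Theta>\<^esub> z)) \<otimes>\<^bsub>\<Theta>\<^esub> e"
        unfolding e(3,4) using c e(2) by (simp add: Q.fg.free_reduce)
      ultimately show ?thesis unfolding zw using c e(1) Mm Mi by simp
    qed
    have "inv\<^bsub>\<Theta>\<^esub> s k a \<otimes>\<^bsub>\<Theta>\<^esub> m \<otimes>\<^bsub>\<Theta>\<^esub> inv\<^bsub>\<Theta>\<^esub> (inv\<^bsub>\<Theta>\<^esub> s k a) \<in> M"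
      by (rule conj_gen) (use * k m in auto)
    moreover have "s k a \<otimes>\<^bsub>\<Theta>\<^esub> m \<otimes>\<^bsub>\<Theta>\<^esub> inv\<^bsub>\<Theta>\<^esub> s k a \<in> M"
      by (rule conj_gen) (use * k m in auto)
    ultimately show ?thesis using k by simp
  qed
  fix g m assume g: "g \<in> carrier \<Theta>" and m: "m \<in> M"
  have "g \<in> generate \<Theta> {s k a | k a. k < 2 * n \<and> a \<in> carrier G}" using g generate_s by simp
  then show "g \<otimes>\<^bsub>\<Theta>\<^esub> m \<otimes>\<^bsub>\<Theta>\<^esub> inv\<^bsub>\<Theta>\<^esub> g \<in> M" using m
  proof (induction g arbitrary: m rule: generate.induct)
    case one
    then show ?case using Mc by simp
  next
    case (incl h)
    then show ?case using conj_s by blast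
  next
    case (inv h)
    then show ?case using conj_s by force
  next
    case (eng h1 h2)
    have "{s k a | k a. k < 2 * n \<and> a \<in> carrier G} \<subseteq> carrier \<Theta>" by auto
    then have "h1 \<in> carrier \<Theta>" "h2 \<in> carrier \<Theta>" using Q.fg.generate_in_carrier eng.hyps by blast+
    moreover have "h1 \<otimes>\<^bsub>\<Theta>\<^esub> (h2 \<otimes>\<^bsub>\<Theta>\<^esub> m \<otimes>\<^bsub>\<Theta>\<^esub> inv\<^bsub>\<Theta>\<^esub> h2) \<otimes>\<^bsub>\<Theta>\<^esub> inv\<^bsub>\<Theta>\<^esub> h1 \<in> M" using eng by blast
    ultimately show ?case using Mc[OF eng.prems] by (simp add: Q.fg.free_reduce)
  qed
qed

end

section \<open>Words with vanishing displacement\<close>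

context alternating_fiber
begin

abbreviation "A \<equiv> free_Abelian_group (simplices X 1)"

lemma carrier_A: "carrier A = simplices ZX 1"
  by (simp add: free_simplicial_abelian_group_def)

lemma alternating_map_edge: "alternating_map n 1 (edge t) = alternating_sum n (\<lambda>k. [t k])"
  by (simp add: edge_def alternating_map_eq)

lemma alternating_map_natural:
  "\<lbrakk>\<theta> \<in> mono_maps m k; z \<in> simplices P k\<rbrakk> \<Longrightarrow>
    alternating_map n m (action P k \<theta> z) = action ZX k \<theta> (alternating_map n k z)"
  using simplicial_map_alternating_map[of X n] by (simp add: simplicial_map_def)

lemma alternating_map_closed: "z \<in> simplices P k \<Longrightarrow> alternating_map n k z \<in> simplices ZX k"
  using simplicial_map_alternating_map[of X n] by (simp add: simplicial_map_def)

sublocale ZX: simplicial_set ZX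
  by (rule simplicial_set_free[OF simplicial_set_X])

text \<open>Restates additivity in terms of the 1-chains of two faces. In this form it matches the
  chains that define the canonical lifts of edges.\<close>

lemma triangle_Q:
  assumes z: "z \<in> simplices Q 2"
  shows "alternating_map n 2 z = action ZX 1 [0, 1, 1] (alternating_map n 1 (face P 2 2 z))
    + action ZX 1 [0, 0, 1] (alternating_map n 1 (face P 2 0 z))"
proof -
  have zP: "z \<in> simplices P 2" using z by (simp add: simplices_Q)
  have "additive z" using z P.action_id[OF zP] id_map_closed[of 2] by (auto simp: simplices_Q)
  moreover have "[0, 1] \<in> mono_maps 1 2" "[1, 2] \<in> mono_maps 1 2" "[0, 1, 1] \<in> mono_maps 2 1"
    "[0, 0, 1] \<in> mono_maps 2 1" "[0, 1, 1] \<in> mono_maps 2 2" "[1, 1, 2] \<in> mono_maps 2 2"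
    by (simp_all add: mono_maps_lists)
  ultimately show ?thesis
    using zP by (simp add: additive_def face_def coface_2 alternating_map_natural ZX.action_comp
        alternating_map_closed comp_map_def)
qed

lemma displacement_triangle:
  assumes z: "z \<in> simplices Q 2"
  shows "alternating_map n 1 (face P 2 2 z) + alternating_map n 1 (face P 2 0 z) = alternating_map n 1 (face P 2 1 z)"
proof -
  have zP: "z \<in> simplices P 2" using z by (simp add: simplices_Q)
  have f: "alternating_map n 1 (face P 2 i z) \<in> simplices ZX 1" if "i \<le> 2" for i
    using P.face_closed[of z 1 i] zP that by (intro alternating_map_closed) (simp add: numeral_2_eq_2 One_nat_def)
  have id: "id_map 1 = [0, 1]" by (simp add: id_map_def upt_rec)
  have i: "action ZX 1 [0, 1] w = w" if "w \<in> simplices ZX 1" for w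
    using ZX.action_id[OF that] by (simp add: id)
  have "[0, 2] \<in> mono_maps 1 2" "[0, 1, 1] \<in> mono_maps 2 1" "[0, 0, 1] \<in> mono_maps 2 1" by (simp_all add: mono_maps_lists)
  moreover have "alternating_map n 1 (face P 2 1 z) = action ZX 2 [0, 2] (alternating_map n 2 z)"
    using zP calculation by (simp add: face_def coface_2 alternating_map_natural)
  ultimately show ?thesis
    unfolding triangle_Q[OF z] using f by (simp add: action_free_diff ZX.action_comp comp_map_def i)
qed

lemma alternating_sum_single:
  "j < n \<Longrightarrow> alternating_sum n (\<lambda>k. [single (2 * j + 1) a k]) = frag_of [a] - frag_of [\<one>]"
  "j < n \<Longrightarrow> alternating_sum n (\<lambda>k. [single (2 * j) a k]) = frag_of [\<one>] - frag_of [a]"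
proof -
  assume j: "j < n"
  have "frag_of [single (2 * j + 1) a (2 * i + 1)] - frag_of [single (2 * j + 1) a (2 * i)]
      = (if i = j then frag_of [a] - frag_of [\<one>] else 0)" for i
    by (simp add: single_def)
  then show "alternating_sum n (\<lambda>k. [single (2 * j + 1) a k]) = frag_of [a] - frag_of [\<one>]"
    using j by (simp add: alternating_sum_def)
  have "frag_of [single (2 * j) a (2 * i + 1)] - frag_of [single (2 * j) a (2 * i)]
      = (if i = j then frag_of [\<one>] - frag_of [a] else 0)" for i
    by (simp add: single_def)
  then show "alternating_sum n (\<lambda>k. [single (2 * j) a k]) = frag_of [\<one>] - frag_of [a]"
    using j by (simp add: alternating_sum_def)
qed

text \<open>The projection \<open>q\<close> to the quotient by \<open>M\<close> factors as \<eta>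
  after \<delta>, where \<delta> is the displacement and \<eta> sends the 1-simplex with entry
  \<open>a\<close> to \<open>q (s 1 a)\<close>. Zero displacement therefore forces the class into
  \<open>M\<close>, hence into the image of \<Gamma>.\<close>

lemma kernel_displacement:
  assumes p: "p \<in> edge_loops Q v" and zero: "word_value A (alternating_map n 1) p = 0"
  shows "\<exists>q\<in>edge_loops F0 v. edge_homotopic Q v v p q"
proof -
  let ?S = "{s k a | k a. k < 2 * n \<and> a \<in> carrier G}"
  interpret M: normal M \<Theta> by (rule normal_M)
  obtain K :: "'g list list edge_word set set monoid" and q where Kg: "group K" and qh: "q \<in> hom \<Theta> K"
    and q_surj: "carrier K = q ` carrier \<Theta>" and q_ker: "\<And>z. z \<in> carrier \<Theta> \<Longrightarrow> q z = \<one>\<^bsub>K\<^esub> \<longleftrightarrow> z \<in> M"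
  proof (rule that[of "\<Theta> Mod M" "\<lambda>z. M #>\<^bsub>\<Theta>\<^esub> z"])
    show "group (\<Theta> Mod M)" by (rule M.factorgroup_is_group)
    show "(\<lambda>z. M #>\<^bsub>\<Theta>\<^esub> z) \<in> hom \<Theta> (\<Theta> Mod M)" by (rule M.r_coset_hom_Mod)
    show "carrier (\<Theta> Mod M) = (\<lambda>z. M #>\<^bsub>\<Theta>\<^esub> z) ` carrier \<Theta>"
      by (auto simp: FactGroup_def RCOSETS_def)
    show "M #>\<^bsub>\<Theta>\<^esub> z = \<one>\<^bsub>\<Theta> Mod M\<^esub> \<longleftrightarrow> z \<in> M" if "z \<in> carrier \<Theta>" for z
      using Q.fg.coset_join1[OF _ that subgroup_M] Q.fg.coset_join2[OF that subgroup_M]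
      by (simp add: FactGroup_def) blast
  qed
  interpret K: group K by (rule Kg)
  interpret q: group_hom \<Theta> K q
    by (simp add: group_hom_def group_hom_axioms_def Kg qh Q.fg.group_axioms)
  have S: "?S \<subseteq> carrier \<Theta>" by auto
  have qM: "q m = \<one>\<^bsub>K\<^esub>" if "m \<in> M" for m
    using q_ker[OF M.mem_carrier[OF that]] that by simp
  have odd2: "2 * j + 1 < 2 * n" "2 * j < 2 * n" if "j < n" for j using that by auto
  have n0: "0 < n" "1 < n" using n by auto
  have q_y: "q (s (2 * i) a) \<otimes>\<^bsub>K\<^esub> q (s (2 * j + 1) a) = \<one>\<^bsub>K\<^esub>" if "i < n" "j < n" "a \<in> carrier G" for i j a
    using qM[OF y_in_M[OF that]] that by (simp add: y_def)
  have qc: "q z \<in> carrier K" if "z \<in> carrier \<Theta>" for z using that by (rule q.hom_closed)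
  have q_inv: "q (s (2 * i) a) = inv\<^bsub>K\<^esub> q (s (2 * j + 1) a)" if "i < n" "j < n" "a \<in> carrier G" for i j a
    by (rule K.inv_equality[symmetric, OF q_y[OF that] qc qc]) (use that in auto)
  have q_row: "q (s (2 * i) a) = inv\<^bsub>K\<^esub> q (s 1 a)" if "i < n" "a \<in> carrier G" for i a
    using q_inv[of i 0 a] that n0 by simp
  have q_col: "q (s (2 * j + 1) a) = q (s 1 a)" if "j < n" "a \<in> carrier G" for j a
  proof -
    have "q (s (2 * j + 1) a) = inv\<^bsub>K\<^esub> (inv\<^bsub>K\<^esub> q (s (2 * j + 1) a))"
      using qc that by (intro K.inv_inv[symmetric]) auto
    also have "\<dots> = inv\<^bsub>K\<^esub> (inv\<^bsub>K\<^esub> q (s 1 a))"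
      unfolding q_inv[OF n0(1) that, symmetric] q_row[OF n0(1) that(2)] ..
    also have "\<dots> = q (s 1 a)" using qc that by (intro K.inv_inv) auto
    finally show ?thesis .
  qed
  have q_s: "q (s k a) = (if even k then inv\<^bsub>K\<^esub> q (s 1 a) else q (s 1 a))" if "k < 2 * n" "a \<in> carrier G" for k a
    using q_row[of "k div 2" a] q_col[of "k div 2" a] that
    by (auto elim!: evenE oddE)
  let ?T = "{q (s 1 a) | a. a \<in> carrier G}"
  have T: "?T \<subseteq> carrier K" by auto
  have gi: "q (s 1 a) \<in> generate K ?T" "inv\<^bsub>K\<^esub> q (s 1 a) \<in> generate K ?T" if "a \<in> carrier G" for a
    by (rule generate.incl generate.inv; use that in blast)+
  have "q z \<in> generate K ?T" if "z \<in> generate \<Theta> ?S" for z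
    using that
  proof (induction z rule: generate.induct)
    case one
    then show ?case by (simp add: generate.one)
  next
    case (incl h)
    then show ?case by (auto simp: q_s gi)
  next
    case (inv h)
    then have "q (inv\<^bsub>\<Theta>\<^esub> h) = inv\<^bsub>K\<^esub> q h" using S by (intro q.hom_inv) blast
    with inv show ?case by (auto simp: q_s gi)
  next
    case (eng h1 h2)
    then show ?case using Q.fg.generate_in_carrier[OF S] by (simp add: generate.eng)
  qed
  then have gen: "carrier K = generate K ?T"
    using K.generate_incl[OF T] generate_s q_surj by auto
  interpret K: comm_group K
  proof (rule K.comm_group_generate[OF T gen])
    fix z w assume "z \<in> ?T" "w \<in> ?T"
    then obtain a b where ab: "z = q (s 1 a)" "w = q (s 1 b)" "a \<in> carrier G" "b \<in> carrier G" by blast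
    \<comment> \<open>Two entries at index 1 need not commute in \<Theta>, but in the quotient the
      first can be moved to index 3, where it commutes with the second.\<close>
    have "q (s 3 a) \<otimes>\<^bsub>K\<^esub> q (s 1 b) = q (s 1 b) \<otimes>\<^bsub>K\<^esub> q (s 3 a)"
      using ab s_commute[of 3 1 a b] by (simp flip: q.hom_mult)
    then show "z \<otimes>\<^bsub>K\<^esub> w = w \<otimes>\<^bsub>K\<^esub> z"
      using q_col[of 1 a] ab n0 by simp
  qed
  obtain \<eta> where \<eta>: "\<eta> \<in> hom A K" "\<And>gs. gs \<in> simplices X 1 \<Longrightarrow> \<eta> (frag_of gs) = q (s 1 (hd gs))"
  proof (rule K.free_Abelian_group_universal[of "\<lambda>gs. q (s 1 (hd gs))" "simplices X 1"])
    have "hd gs \<in> carrier G" if "gs \<in> simplices X 1" for gs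
      using that by (cases gs) (auto simp: classifying_space_def)
    then show "(\<lambda>gs. q (s 1 (hd gs))) ` simplices X 1 \<subseteq> carrier K" by auto
  qed (rule that)
  obtain \<delta> where \<delta>: "\<delta> \<in> hom \<Theta> A" "\<And>e. e \<in> simplices Q 1 \<Longrightarrow> \<delta> (edge_class Q v e) = alternating_map n 1 e"
  proof -
    have "\<exists>\<delta>\<in>hom \<Theta> A. \<forall>e\<in>simplices Q 1. \<delta> (edge_class Q v e) = alternating_map n 1 e"
    proof (rule Q.exists_hom)
      show "alternating_map n 1 e \<in> carrier A" if "e \<in> simplices Q 1" for e
        unfolding carrier_A using that by (intro alternating_map_closed) (simp add: simplices_Q)
      show "alternating_map n 1 (face Q 2 2 \<sigma>) \<otimes>\<^bsub>A\<^esub> alternating_map n 1 (face Q 2 0 \<sigma>) = alternating_map n 1 (face Q 2 1 \<sigma>)"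
        if "\<sigma> \<in> simplices Q 2" for \<sigma>
        using displacement_triangle[OF that] by (simp add: face_Q)
    qed simp
    then show ?thesis using that by blast
  qed
  have "(\<eta> \<circ> \<delta>) z = q z" if "z \<in> generate \<Theta> ?S" for z
  proof (rule Q.fg.hom_eq_on_generate[OF K.group_axioms _ _ S _ that])
    show "\<eta> \<circ> \<delta> \<in> hom \<Theta> K" by (rule Group.hom_compose[OF \<delta>(1) \<eta>(1)])
    show "q \<in> hom \<Theta> K" by (rule qh)
    fix z assume "z \<in> ?S"
    then obtain k a where z: "z = s k a" "k < 2 * n" "a \<in> carrier G" by blast
    have fA: "[b] \<in> simplices X 1" if "b \<in> carrier G" for b
      using that by (simp add: classifying_space_def)
    have \<eta>f: "\<eta> (frag_of [b]) = q (s 1 b)" if "b \<in> carrier G" for b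
      using \<eta>(2)[OF fA[OF that]] by simp
    \<comment> \<open>The displacement of a single entry is, up to sign, the difference of that
      entry and the unit; the contribution of the unit must disappear under \<eta>.\<close>
    have \<eta>1: "\<eta> (frag_of [\<one>]) = \<one>\<^bsub>K\<^esub>" using \<eta>f[of \<one>] q.hom_one by (simp add: s_one)
    have \<eta>d: "\<eta> (frag_of [b] - frag_of [d]) = \<eta> (frag_of [b]) \<otimes>\<^bsub>K\<^esub> inv\<^bsub>K\<^esub> \<eta> (frag_of [d])"
      if "b \<in> carrier G" "d \<in> carrier G" for b d
    proof -
      interpret \<eta>: group_hom A K \<eta> using \<eta>(1) by (simp add: group_hom_def group_hom_axioms_def K.group_axioms)
      have m: "frag_of [b] \<in> carrier A" "frag_of [d] \<in> carrier A" "- frag_of [d] \<in> carrier A"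
        using that fA by (simp_all add: keys_frag_of)
      have "\<eta> (frag_of [b] - frag_of [d]) = \<eta> (frag_of [b]) \<otimes>\<^bsub>K\<^esub> \<eta> (- frag_of [d])"
        using \<eta>.hom_mult[OF m(1,3)] by simp
      also have "\<eta> (- frag_of [d]) = inv\<^bsub>K\<^esub> \<eta> (frag_of [d])"
        using \<eta>.hom_inv[OF m(2)] inv_free_Abelian_group[of "frag_of [d]" "simplices X 1"] m(2) by simp
      finally show ?thesis .
    qed
    have e: "\<delta> z = alternating_sum n (\<lambda>l. [single k a l])"
      using z \<delta>(2)[of "edge (single k a)"] by (simp add: s_def edge_in_Q alternating_map_edge)
    show "(\<eta> \<circ> \<delta>) z = q z"
    proof (cases "even k")
      case True
      then obtain j where j: "k = 2 * j" by (elim evenE)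
      then have "\<delta> z = frag_of [\<one>] - frag_of [a]" using e z alternating_sum_single(2)[of j a] by simp
      then show ?thesis using z True by (simp add: \<eta>d \<eta>f \<eta>1 q_s)
    next
      case False
      then obtain j where j: "k = 2 * j + 1" by (elim oddE)
      then have "\<delta> z = frag_of [a] - frag_of [\<one>]" using e z alternating_sum_single(1)[of j a] by simp
      then show ?thesis using z False by (simp add: \<eta>d \<eta>f \<eta>1 q_s)
    qed
  qed
  then have \<eta>\<delta>: "\<eta> (\<delta> z) = q z" if "z \<in> carrier \<Theta>" for z
    using that generate_s by simp
  have e1: "fst ` set p \<subseteq> simplices Q 1" using p by (simp add: Q.edge_loops_iff)
  have pc: "path_class Q v p \<in> carrier \<Theta>" using p by (auto simp: carrier_fundamental_group)
  have "\<delta> (path_class Q v p) = word_value A (\<lambda>e. \<delta> (edge_class Q v e)) p"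
    unfolding Q.path_class_word_value[OF e1]
    by (rule Q.fg.word_value_hom[OF _ \<delta>(1)]) (use e1 in auto)
  also have "\<dots> = word_value A (alternating_map n 1) p"
    by (rule word_value_cong) (use e1 \<delta>(2) in auto)
  finally have "\<delta> (path_class Q v p) = 0" using zero by simp
  then have "q (path_class Q v p) = \<eta> 0" using \<eta>\<delta>[OF pc] by simp
  also have "\<eta> 0 = \<one>\<^bsub>K\<^esub>"
    using hom_one[OF \<eta>(1)] K.group_axioms by simp
  finally have "path_class Q v p \<in> M" using q_ker[OF pc] by simp
  moreover obtain \<iota> where \<iota>: "\<iota> \<in> hom \<Gamma> \<Theta>" "\<forall>e\<in>simplices F0 1. \<iota> (edge_class F0 v e) = edge_class Q v e"
    using exists_transfer by blast
  ultimately obtain w where w: "w \<in> carrier \<Gamma>" "path_class Q v p = \<iota> w"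
    using M_subset_image[OF \<iota>(1)] by blast
  then obtain r where r: "r \<in> edge_loops F0 v" "w = path_class F0 v r" by (auto simp: carrier_fundamental_group)
  have r1: "fst ` set r \<subseteq> simplices F0 1" using r by (simp add: F0.edge_loops_iff)
  then have r2: "fst ` set r \<subseteq> simplices Q 1" using F0_subset_Q by blast
  have "\<iota> w = word_value \<Theta> (\<lambda>e. \<iota> (edge_class F0 v e)) r"
    unfolding r(2) F0.path_class_word_value[OF r1]
    by (rule F0.fg.word_value_hom[OF _ \<iota>(1)]) (use r1 Q.fg.group_axioms in auto)
  also have "\<dots> = word_value \<Theta> (edge_class Q v) r"
    by (rule word_value_cong) (use r1 \<iota>(2) in auto)
  also have "\<dots> = path_class Q v r" using Q.path_class_word_value[OF r2] by simp
  finally have "path_class Q v p = path_class Q v r" using w by simp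
  then have "edge_homotopic Q v v p r"
    using path_class_eq_iff[OF simplicial_set_Q p] r2 by (simp add: Q.edge_loops_iff)
  then show ?thesis using r(1) by blast
qed

end

section \<open>Cones over chains as simplices of the homotopy fiber\<close>

definition shift_map :: "nat list \<Rightarrow> nat list \<Rightarrow> nat list" where
  "shift_map \<alpha> \<beta> = map2 (\<lambda>i t. if t = 0 then 0 else Suc i) \<alpha> \<beta>"

lemma shift_map_closed:
  assumes a: "\<alpha> \<in> mono_maps m k" and b: "\<beta> \<in> mono_maps m 1"
  shows "shift_map \<alpha> \<beta> \<in> mono_maps m (Suc k)"
proof -
  have l: "length \<alpha> = Suc m" "length \<beta> = Suc m" using a b by (simp_all add: mono_maps_length)
  have e: "shift_map \<alpha> \<beta> ! i = (if \<beta> ! i = 0 then 0 else Suc (\<alpha> ! i))" if "i \<le> m" for i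
    using l that by (simp add: shift_map_def)
  have "sorted (shift_map \<alpha> \<beta>)"
    unfolding sorted_iff_nth_mono
  proof (intro allI impI)
    fix i j assume ij: "i \<le> j" "j < length (shift_map \<alpha> \<beta>)"
    then have "j \<le> m" using l by (simp add: shift_map_def)
    then show "shift_map \<alpha> \<beta> ! i \<le> shift_map \<alpha> \<beta> ! j"
      using e[of i] e[of j] mono_maps_nth_mono[OF a ij(1)] mono_maps_nth_mono[OF b ij(1)] ij by auto
  qed
  moreover have "set (shift_map \<alpha> \<beta>) \<subseteq> {..Suc k}"
  proof
    fix z assume "z \<in> set (shift_map \<alpha> \<beta>)"
    then obtain i where "i \<le> m" "z = shift_map \<alpha> \<beta> ! i"
      using l by (auto simp: in_set_conv_nth shift_map_def less_Suc_eq_le)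
    then show "z \<in> {..Suc k}" using e mono_maps_nth_le[OF a] by auto
  qed
  ultimately show ?thesis using l by (simp add: mono_maps_def shift_map_def)
qed

lemma shift_map_comp:
  assumes "\<alpha> \<in> mono_maps m k" "\<beta> \<in> mono_maps m 1" "\<theta> \<in> mono_maps l m"
  shows "shift_map (\<alpha> \<odot> \<theta>) (\<beta> \<odot> \<theta>) = shift_map \<alpha> \<beta> \<odot> \<theta>"
  using assms mono_maps_nth_le[OF assms(3)]
  by (intro nth_equalityI) (auto simp: shift_map_def comp_map_def mono_maps_length less_Suc_eq_le)

lemma shift_map_comp_left:
  assumes "\<alpha> \<in> mono_maps m l" "\<beta> \<in> mono_maps m 1" "\<theta> \<in> mono_maps l k"
  shows "shift_map (\<theta> \<odot> \<alpha>) \<beta> = (0 # map Suc \<theta>) \<odot> shift_map \<alpha> \<beta>"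
  using assms mono_maps_nth_le[OF assms(1)]
  by (intro nth_equalityI) (auto simp: shift_map_def comp_map_def mono_maps_length less_Suc_eq_le)

text \<open>
  The path in the simplicial abelian group that a simplex \<open>V\<close> of dimension \<open>k + 1\<close> defines by
  collapsing the bottom \<open>\<Delta>[k] \<times> {0}\<close> of the prism to the vertex 0: it runs from the initial vertex of
  \<open>V\<close> to the face \<open>d\<^sub>0 V\<close>.
\<close>

definition cone_path :: "'a sset \<Rightarrow> nat \<Rightarrow> 'a \<Rightarrow> nat \<Rightarrow> nat list \<times> nat list \<Rightarrow> 'a" where
  "cone_path Y k V m = restrict (\<lambda>(\<alpha>, \<beta>). action Y (Suc k) (shift_map \<alpha> \<beta>) V)
     (simplices (sset_prod (std_simplex k) (std_simplex 1)) m)"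

lemma cone_path_apply:
  "\<lbrakk>\<alpha> \<in> mono_maps m k; \<beta> \<in> mono_maps m 1\<rbrakk> \<Longrightarrow>
    cone_path Y k V m (\<alpha>, \<beta>) = action Y (Suc k) (shift_map \<alpha> \<beta>) V"
  by (simp add: cone_path_def sset_prod_def std_simplex_def)

lemma simplices_prod_iff:
  "z \<in> simplices (sset_prod (std_simplex k) (std_simplex 1)) m \<longleftrightarrow>
    (\<exists>\<alpha> \<beta>. z = (\<alpha>, \<beta>) \<and> \<alpha> \<in> mono_maps m k \<and> \<beta> \<in> mono_maps m 1)"
  by (auto simp: sset_prod_def std_simplex_def)

context simplicial_set
begin

lemma cone_path_closed: "V \<in> simplices X (Suc k) \<Longrightarrow> cone_path X k V \<in> simplices (hom_sset (std_simplex 1) X) k"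
  unfolding hom_sset_def simplicial_map_def
  by (auto simp: simplices_prod_iff cone_path_apply action_closed shift_map_closed comp_map_closed action_comp
      sset_prod_def std_simplex_def shift_map_comp)
    (simp add: cone_path_def sset_prod_def std_simplex_def)

text \<open>The list \<open>0 # map Suc \<theta>\<close> is \<theta> extended to the cones, fixing
  the cone point 0.\<close>

lemma cone_path_action:
  assumes V: "V \<in> simplices X (Suc k)" and t: "\<theta> \<in> mono_maps m k"
  shows "action (hom_sset (std_simplex 1) X) k \<theta> (cone_path X k V) = cone_path X m (action X (Suc k) (0 # map Suc \<theta>) V)"
proof (intro ext)
  fix l z
  have t': "0 # map Suc \<theta> \<in> mono_maps (Suc m) (Suc k)"
    using t by (auto simp: mono_maps_def sorted_map intro: sorted_wrt_mono_rel)
  show "action (hom_sset (std_simplex 1) X) k \<theta> (cone_path X k V) l z = cone_path X m (action X (Suc k) (0 # map Suc \<theta>) V) l z"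
  proof (cases "z \<in> simplices (sset_prod (std_simplex m) (std_simplex 1)) l")
    case True
    then obtain \<alpha> \<beta> where z: "z = (\<alpha>, \<beta>)" "\<alpha> \<in> mono_maps l m" "\<beta> \<in> mono_maps l 1"
      by (auto simp: simplices_prod_iff)
    then show ?thesis
      using comp_map_closed[OF t z(2)] shift_map_closed[OF z(2,3)] V t
      by (simp add: hom_sset_action[OF t] cone_path_apply action_comp[OF t'] shift_map_comp_left)
  next
    case False
    then show ?thesis using t by (simp add: hom_sset_def cone_path_def mono_maps_length)
  qed
qed

lemma endpoint_1_cone_path:
  assumes "V \<in> simplices X (Suc k)"
  shows "endpoint 1 k (cone_path X k V) = face X (Suc k) 0 V"
proof -
  have "shift_map (id_map k) (const_map k 1) = map Suc [0..<Suc k]"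
    by (intro nth_equalityI) (auto simp: shift_map_def id_map_def const_map_def nth_append simp del: upt_Suc replicate_Suc)
  moreover have "coface (Suc k) 0 = map Suc [0..<Suc k]"
    unfolding coface_def id_map_def by (simp only: map_Suc_upt upt_rec[of 0 "Suc (Suc k)"]) simp
  ultimately show ?thesis
    by (simp add: endpoint_def cone_path_apply id_map_closed const_map_closed face_def)
qed

lemma endpoint_0_cone_path:
  "endpoint 0 k (cone_path X k V) = action X (Suc k) (const_map k 0) V"
proof -
  have "shift_map (id_map k) (const_map k 0) = const_map k 0"
    by (intro nth_equalityI) (auto simp: shift_map_def id_map_def const_map_def simp del: upt_Suc replicate_Suc)
  then show ?thesis by (simp add: endpoint_def cone_path_apply id_map_closed const_map_closed)
qed

end

context alternating_fiber
begin

text \<open>The classifying space has one vertex, so restriction along a constant map does not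
  depend on the constant.\<close>

lemma vertex_action:
  assumes w: "w \<in> simplices ZX k" and i: "i \<le> k" and j: "j \<le> k"
  shows "action ZX k (const_map m i) w = action ZX k (const_map m j) w"
proof -
  have "action X k (const_map m l) gs = replicate m \<one>" if "l \<le> k" for l gs
    by (intro nth_equalityI)
      (auto simp: classifying_space_def const_map_def segment_product_def simp del: replicate_Suc)
  then show ?thesis using i j by (simp add: free_simplicial_abelian_group_def)
qed

text \<open>The 1-chains that are loops at the vertex 0; by \<open>vertex_action\<close> one
  endpoint suffices. They parametrize the vertices of the homotopy fiber that are cones.\<close>

definition Z0 :: "('g list \<Rightarrow>\<^sub>0 int) set" where
  "Z0 = {d \<in> simplices ZX 1. action ZX 1 [0] d = 0}"

lemma alternating_map_vertex:
  assumes "z \<in> simplices P k" "i \<le> k"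
  shows "action ZX k [i] (alternating_map n k z) = 0"
proof -
  have t: "[i] \<in> mono_maps 0 k" using assms by (simp add: mono_maps_def)
  have "action P k [i] z = v" using P.action_closed[OF t assms(1)] vertices_P by simp
  moreover have "alternating_map n 0 v = 0" by (simp add: base_vertex_def alternating_map_replicate)
  ultimately show ?thesis using alternating_map_natural[OF t assms(1)] by simp
qed

text \<open>All vertices of \<open>w\<close> agree, and one of them is a vertex of the chain of
  \<open>z\<close>, which is 0 because the chain of the base vertex is 0.\<close>

lemma const_vertex:
  assumes w: "w \<in> simplices ZX (Suc k)" and f: "face ZX (Suc k) 0 w = alternating_map n k z" and z: "z \<in> simplices P k"
    and i: "i \<le> Suc k"
  shows "action ZX (Suc k) (const_map m i) w = 0"
proof -
  have c: "coface (Suc k) 0 \<in> mono_maps k (Suc k)" by (intro coface_closed) simp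
  have t: "[0] \<in> mono_maps 0 k" "const_map m 0 \<in> mono_maps m 0" by (simp add: mono_maps_def) (simp add: const_map_closed)
  have j: "coface (Suc k) 0 ! 0 \<le> Suc k" by (rule mono_maps_nth_le[OF c]) simp
  have "0 = action ZX 0 (const_map m 0) (action ZX k [0] (face ZX (Suc k) 0 w))"
    using alternating_map_vertex[OF z, of 0] f by (simp add: free_simplicial_abelian_group_def)
  also have "\<dots> = action ZX (Suc k) (coface (Suc k) 0 \<odot> [0] \<odot> const_map m 0) w"
    using w c t by (simp add: face_def ZX.action_comp ZX.action_closed comp_map_closed)
  also have "coface (Suc k) 0 \<odot> [0] \<odot> const_map m 0 = const_map m (coface (Suc k) 0 ! 0)"
    by (simp add: comp_map_def const_map_def)
  also have "action ZX (Suc k) (const_map m (coface (Suc k) 0 ! 0)) w = action ZX (Suc k) (const_map m i) w"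
    by (rule vertex_action[OF w j i])
  finally show ?thesis ..
qed

lemma cone_in_HF:
  assumes "z \<in> simplices P k" "w \<in> simplices ZX (Suc k)" "face ZX (Suc k) 0 w = alternating_map n k z"
  shows "(z, cone_path ZX k w) \<in> simplices HF k"
  using assms const_vertex[OF assms(2,3,1), of 0]
  by (simp add: simplices_HF ZX.cone_path_closed ZX.endpoint_1_cone_path ZX.endpoint_0_cone_path)

definition vertex :: "('g list \<Rightarrow>\<^sub>0 int) \<Rightarrow> 'g list list \<times> (nat \<Rightarrow> nat list \<times> nat list \<Rightarrow> 'g list \<Rightarrow>\<^sub>0 int)" where
  "vertex d = (v, cone_path ZX 0 d)"

lemma face_cone_1:
  assumes "z \<in> simplices P 1" "w \<in> simplices ZX 2"
  shows "face HF 1 0 (z, cone_path ZX 1 w) = vertex (action ZX 2 [0, 2] w)"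
    "face HF 1 1 (z, cone_path ZX 1 w) = vertex (action ZX 2 [0, 1] w)"
proof -
  have w: "w \<in> simplices ZX (Suc 1)" using assms(2) by (simp add: numeral_2_eq_2 One_nat_def)
  have f: "face P 1 i z = v" if "i \<le> 1" for i
    using P.face_closed[of z 0 i] assms(1) that vertices_P by (simp add: One_nat_def)
  have m: "[0] \<in> mono_maps 0 1" "[1] \<in> mono_maps 0 1" by (simp_all add: mono_maps_def)
  show "face HF 1 0 (z, cone_path ZX 1 w) = vertex (action ZX 2 [0, 2] w)"
    "face HF 1 1 (z, cone_path ZX 1 w) = vertex (action ZX 2 [0, 1] w)"
    using ZX.cone_path_action[OF w m(1)] ZX.cone_path_action[OF w m(2)]
    by (simp_all add: face_HF f coface_1 vertex_def flip: One_nat_def)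
qed

lemma face_cone_2:
  assumes "w \<in> simplices ZX 3"
  shows "face HF 2 0 (z, cone_path ZX 2 w) = (face P 2 0 z, cone_path ZX 1 (action ZX 3 [0, 2, 3] w))"
    "face HF 2 1 (z, cone_path ZX 2 w) = (face P 2 1 z, cone_path ZX 1 (action ZX 3 [0, 1, 3] w))"
    "face HF 2 2 (z, cone_path ZX 2 w) = (face P 2 2 z, cone_path ZX 1 (action ZX 3 [0, 1, 2] w))"
proof -
  have w: "w \<in> simplices ZX (Suc 2)" using assms by (simp add: numeral_3_eq_3 numeral_2_eq_2)
  have m: "[1, 2] \<in> mono_maps 1 2" "[0, 2] \<in> mono_maps 1 2" "[0, 1] \<in> mono_maps 1 2" by (simp_all add: mono_maps_lists)
  show "face HF 2 0 (z, cone_path ZX 2 w) = (face P 2 0 z, cone_path ZX 1 (action ZX 3 [0, 2, 3] w))"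
    "face HF 2 1 (z, cone_path ZX 2 w) = (face P 2 1 z, cone_path ZX 1 (action ZX 3 [0, 1, 3] w))"
    "face HF 2 2 (z, cone_path ZX 2 w) = (face P 2 2 z, cone_path ZX 1 (action ZX 3 [0, 1, 2] w))"
    using ZX.cone_path_action[OF w m(1)] ZX.cone_path_action[OF w m(2)] ZX.cone_path_action[OF w m(3)]
    by (simp_all add: face_HF coface_2 flip: One_nat_def)
qed

lemma cone_edge_path:
  assumes "z \<in> simplices P 1" "w \<in> simplices ZX 2" "action ZX 2 [1, 2] w = alternating_map n 1 z"
  shows "edge_path HF (vertex (action ZX 2 [0, 1] w)) [((z, cone_path ZX 1 w), True)] (vertex (action ZX 2 [0, 2] w))"
    "edge_path HF (vertex (action ZX 2 [0, 2] w)) [((z, cone_path ZX 1 w), False)] (vertex (action ZX 2 [0, 1] w))"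
proof -
  have e: "(z, cone_path ZX 1 w) \<in> simplices HF 1"
    using cone_in_HF[of z 1 w] assms by (simp add: face_def coface_2)
  note f = face_cone_1[OF assms(1,2)]
  have "vertex (action ZX 2 [0, 2] w) \<in> simplices HF 0" "vertex (action ZX 2 [0, 1] w) \<in> simplices HF 0"
    using simplicial_set.face_closed[OF simplicial_set_HF, of "(z, cone_path ZX 1 w)" 0 0]
      simplicial_set.face_closed[OF simplicial_set_HF, of "(z, cone_path ZX 1 w)" 0 1] e f
    by (simp_all flip: One_nat_def)
  with e f show "edge_path HF (vertex (action ZX 2 [0, 1] w)) [((z, cone_path ZX 1 w), True)] (vertex (action ZX 2 [0, 2] w))"
    "edge_path HF (vertex (action ZX 2 [0, 2] w)) [((z, cone_path ZX 1 w), False)] (vertex (action ZX 2 [0, 1] w))"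
    by (simp_all add: edge_source_def edge_target_def)
qed

text \<open>The cone on a 3-chain over \<open>z\<close> is a 2-simplex of the homotopy fiber; its
  faces are the cones on the three faces of \<open>w\<close> that contain the vertex 0. All later
  homotopies between cones come from choosing \<open>w\<close>.\<close>

lemma cone_triangle:
  assumes z: "z \<in> simplices P 2" and w: "w \<in> simplices ZX 3"
    and f: "action ZX 3 [1, 2, 3] w = alternating_map n 2 z"
  shows "edge_homotopic HF (vertex (action ZX 3 [0, 1] w)) (vertex (action ZX 3 [0, 3] w))
    [((face P 2 2 z, cone_path ZX 1 (action ZX 3 [0, 1, 2] w)), True),
     ((face P 2 0 z, cone_path ZX 1 (action ZX 3 [0, 2, 3] w)), True)]
    [((face P 2 1 z, cone_path ZX 1 (action ZX 3 [0, 1, 3] w)), True)]"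
proof -
  have w': "w \<in> simplices ZX (Suc 2)" using w by (simp add: numeral_3_eq_3 numeral_2_eq_2)
  have s: "(z, cone_path ZX 2 w) \<in> simplices HF 2"
    using cone_in_HF[OF z w'] f by (simp add: face_def coface_3)
  have fz: "face P 2 i z \<in> simplices P 1" if "i \<le> 2" for i
    using P.face_closed[of z 1 i] z that by (simp add: numeral_2_eq_2 One_nat_def)
  have m: "[0, 1, 2] \<in> mono_maps 2 3" "[0, 2, 3] \<in> mono_maps 2 3" "[0, 1, 3] \<in> mono_maps 2 3" "[1, 2, 3] \<in> mono_maps 2 3"
    "[0, 1] \<in> mono_maps 1 2" "[0, 2] \<in> mono_maps 1 2" "[1, 2] \<in> mono_maps 1 2" by (simp_all add: mono_maps_lists)
  have h: "alternating_map n 1 (face P 2 i z) = action ZX 3 ([1, 2, 3] \<odot> coface 2 i) w" if "i \<le> 2" for i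
    using alternating_map_natural[of "coface 2 i" 1 2 z] z f coface_closed[of i 1] that w m
      ZX.action_comp[of "[1, 2, 3]" 2 3 "coface 2 i" 1 w]
    by (simp add: face_def numeral_2_eq_2 One_nat_def)
  have p1: "edge_path HF (vertex (action ZX 3 [0, 1] w)) [((face P 2 2 z, cone_path ZX 1 (action ZX 3 [0, 1, 2] w)), True)] (vertex (action ZX 3 [0, 2] w))"
    using cone_edge_path(1)[of "face P 2 2 z" "action ZX 3 [0, 1, 2] w"] fz[of 2] h[of 2] m w ZX.action_closed[OF m(1) w]
    by (simp add: ZX.action_comp comp_map_def coface_2 del: edge_path.simps)
  have p2: "edge_path HF (vertex (action ZX 3 [0, 2] w)) [((face P 2 0 z, cone_path ZX 1 (action ZX 3 [0, 2, 3] w)), True)] (vertex (action ZX 3 [0, 3] w))"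
    using cone_edge_path(1)[of "face P 2 0 z" "action ZX 3 [0, 2, 3] w"] fz[of 0] h[of 0] m w ZX.action_closed[OF m(2) w]
    by (simp add: ZX.action_comp comp_map_def coface_2 del: edge_path.simps)
  have "edge_path HF (vertex (action ZX 3 [0, 1] w)) ([((face P 2 2 z, cone_path ZX 1 (action ZX 3 [0, 1, 2] w)), True)]
      @ [((face P 2 0 z, cone_path ZX 1 (action ZX 3 [0, 2, 3] w)), True)]) (vertex (action ZX 3 [0, 3] w))"
    using p1 p2 unfolding edge_path_append[OF simplicial_set_HF] by blast
  then have "edge_path HF (vertex (action ZX 3 [0, 1] w)) ([] @ [(face HF 2 2 (z, cone_path ZX 2 w), True), (face HF 2 0 (z, cone_path ZX 2 w), True)] @ []) (vertex (action ZX 3 [0, 3] w))"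
    by (simp add: face_cone_2[OF w] del: edge_path.simps)
  from edge_homotopic.triangle[OF s this] show ?thesis by (simp add: face_cone_2[OF w])
qed

end

lemma id_map_1: "id_map 1 = [0, 1]" and id_map_2: "id_map 2 = [0, 1, 2]"
  by (simp_all add: id_map_def upt_rec)

lemma (in simplicial_set) action_comp_list:
  assumes "\<theta> \<in> mono_maps m k" "\<phi> \<noteq> []" "sorted \<phi>" "set \<phi> \<subseteq> {..m}" "w \<in> simplices X k"
  shows "action X m \<phi> (action X k \<theta> w) = action X k (\<theta> \<odot> \<phi>) w"
proof -
  have "\<phi> \<in> mono_maps (length \<phi> - 1) m" using assms by (cases \<phi>) (auto simp: mono_maps_def)
  then show ?thesis using assms by (intro action_comp)
qed

section \<open>Canonical lifts of edge words\<close>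

context alternating_fiber
begin

abbreviation h :: "'g list list \<Rightarrow> 'g list \<Rightarrow>\<^sub>0 int" where "h \<equiv> alternating_map n 1"

text \<open>A degenerate way to fill a triangle with sides \<open>d\<close> and \<open>h z\<close>:
  its third side is their sum. The edge \<open>E z d\<close> built from it runs from
  \<open>vertex d\<close> to \<open>vertex (d + h z)\<close> over \<open>z\<close>.\<close>

definition weight :: "'g list list \<Rightarrow> ('g list \<Rightarrow>\<^sub>0 int) \<Rightarrow> 'g list \<Rightarrow>\<^sub>0 int" where
  "weight z d = action ZX 1 [0, 0, 1] (h z) + action ZX 1 [0, 1, 1] d"

definition E where
  "E z d = (z, cone_path ZX 1 (weight z d))"

lemma mono_lists:
  "[0, 0, 1] \<in> mono_maps 2 1" "[0, 1, 1] \<in> mono_maps 2 1" "[0, 1] \<in> mono_maps 1 1" "[0, 0] \<in> mono_maps 1 1" "[1, 1] \<in> mono_maps 1 1"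
  "[0, 1] \<in> mono_maps 1 2" "[0, 2] \<in> mono_maps 1 2" "[1, 2] \<in> mono_maps 1 2" "[1, 1] \<in> mono_maps 1 2"
  "[1, 1, 1] \<in> mono_maps 2 1" "[0, 1, 2] \<in> mono_maps 2 2" "[1, 1, 2] \<in> mono_maps 2 2" "[0, 1, 1] \<in> mono_maps 2 2"
  "[0, 0, 1] \<in> mono_maps 2 2" "[0, 0, 2] \<in> mono_maps 2 2"
  "[1, 1, 1] \<in> mono_maps 2 2" "[0, 2, 2] \<in> mono_maps 2 2" "[1, 2, 2] \<in> mono_maps 2 2" 
  "[0, 0, 1, 2] \<in> mono_maps 3 2" "[0, 1, 1, 2] \<in> mono_maps 3 2" "[0, 1, 2, 2] \<in> mono_maps 3 2" "[0, 1, 1, 1] \<in> mono_maps 3 1"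
  "[0, 1, 2] \<in> mono_maps 2 3" "[0, 2, 3] \<in> mono_maps 2 3" "[0, 1, 3] \<in> mono_maps 2 3" "[1, 2, 3] \<in> mono_maps 2 3"
  "[0, 1] \<in> mono_maps 1 3" "[0, 3] \<in> mono_maps 1 3" "[0] \<in> mono_maps 0 1" "[0] \<in> mono_maps 0 2" "[0, 0] \<in> mono_maps 1 0" "[0, 0, 0] \<in> mono_maps 2 0"
  "[1] \<in> mono_maps 0 1"
  by (simp_all add: mono_maps_lists) (simp_all add: mono_maps_def)

lemma action_identity:
  "w \<in> simplices ZX 1 \<Longrightarrow> action ZX 1 [0, 1] w = w" "w \<in> simplices ZX 2 \<Longrightarrow> action ZX 2 [0, 1, 2] w = w"
  using ZX.action_id[of w 1] ZX.action_id[of w 2] by (simp_all add: id_map_1 id_map_2)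

lemma action_zero [simp]: "action ZX k \<theta> 0 = 0"
  by (simp add: free_simplicial_abelian_group_def)

lemma ZX_closed_plus: "\<lbrakk>a \<in> simplices ZX k; b \<in> simplices ZX k\<rbrakk> \<Longrightarrow> a + b \<in> simplices ZX k"
  and ZX_closed_minus: "\<lbrakk>a \<in> simplices ZX k; b \<in> simplices ZX k\<rbrakk> \<Longrightarrow> a - b \<in> simplices ZX k"
  by (rule free_closed; assumption)+

lemma zero_closed: "0 \<in> simplices ZX k"
  by (simp add: free_simplicial_abelian_group_def)

lemmas ZX_simps = action_free_diff ZX.action_comp_list ZX.action_closed comp_map_def mono_lists action_identity
  ZX_closed_plus ZX_closed_minus zero_closed

lemma Z0_closed: "d \<in> Z0 \<Longrightarrow> d \<in> simplices ZX 1"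
  by (simp add: Z0_def)

lemma Z0_vertices:
  assumes d: "d \<in> Z0"
  shows "action ZX 1 [0] d = 0" "action ZX 1 [1] d = 0" "action ZX 1 [0, 0] d = 0" "action ZX 1 [1, 1] d = 0"
    "action ZX 1 [1, 1, 1] d = 0"
proof -
  have cm: "const_map 0 i = [i]" for i by (simp add: const_map_def)
  show 0: "action ZX 1 [0] d = 0" using d by (simp add: Z0_def)
  then show 1: "action ZX 1 [1] d = 0"
    using vertex_action[OF Z0_closed[OF d], of 1 0 0] by (simp add: cm)
  have "action ZX 0 [0, 0] (action ZX 1 [0] d) = action ZX 1 [0, 0] d"
    "action ZX 0 [0, 0] (action ZX 1 [1] d) = action ZX 1 [1, 1] d"
    "action ZX 0 [0, 0, 0] (action ZX 1 [1] d) = action ZX 1 [1, 1, 1] d"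
    using Z0_closed[OF d] by (simp_all add: ZX.action_comp_list mono_lists comp_map_def)
  then show "action ZX 1 [0, 0] d = 0" "action ZX 1 [1, 1] d = 0" "action ZX 1 [1, 1, 1] d = 0"
    unfolding 0 1 by simp_all
qed

lemma h_closed: "z \<in> simplices P 1 \<Longrightarrow> h z \<in> Z0"
  using alternating_map_vertex[of z 1 0] alternating_map_closed[of z 1] by (simp add: Z0_def)

lemma Z0_plus: "\<lbrakk>d \<in> Z0; e \<in> Z0\<rbrakk> \<Longrightarrow> d + e \<in> Z0"
  and Z0_minus: "\<lbrakk>d \<in> Z0; e \<in> Z0\<rbrakk> \<Longrightarrow> d - e \<in> Z0"
  by (simp_all add: Z0_def ZX_simps)

lemma zero_Z0: "0 \<in> Z0"
  by (simp add: Z0_def zero_closed)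

lemma weight:
  assumes "z \<in> simplices P 1" "d \<in> Z0"
  shows "weight z d \<in> simplices ZX 2" "action ZX 2 [0, 1] (weight z d) = d"
    "action ZX 2 [0, 2] (weight z d) = d + h z" "action ZX 2 [1, 2] (weight z d) = h z"
  using assms Z0_closed[OF assms(2)] Z0_closed[OF h_closed[OF assms(1)]] Z0_vertices[OF assms(2)]
    Z0_vertices[OF h_closed[OF assms(1)]]
  by (simp_all add: weight_def ZX_simps)

lemma E_path:
  assumes "z \<in> simplices P 1" "d \<in> Z0"
  shows "edge_path HF (vertex d) [(E z d, True)] (vertex (d + h z))"
    "edge_path HF (vertex (d + h z)) [(E z d, False)] (vertex d)"
  using cone_edge_path[OF assms(1) weight(1)[OF assms]] weight[OF assms] by (simp_all add: E_def del: edge_path.simps)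

lemma vertex_in_HF: "d \<in> Z0 \<Longrightarrow> vertex d \<in> simplices HF 0"
  using cone_in_HF[of v 0 d] vertices_P Z0_vertices(2)[of d] Z0_closed[of d]
  by (simp add: vertex_def face_def coface_1 base_vertex_def alternating_map_replicate flip: One_nat_def)

lemma vertex_inject:
  assumes "d \<in> simplices ZX 1" "e \<in> simplices ZX 1" "vertex d = vertex e"
  shows "d = e"
proof -
  have m: "[0, 0] \<in> mono_maps 1 0" "[0, 1] \<in> mono_maps 1 1" by (simp_all add: mono_lists)
  \<comment> \<open>At this simplex the shift map is the identity of [1], so the cone path returns
    the chain itself.\<close>
  have "cone_path ZX 0 d 1 ([0, 0], [0, 1]) = cone_path ZX 0 e 1 ([0, 0], [0, 1])"
    using assms(3) by (simp add: vertex_def)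
  then show ?thesis
    using assms action_identity(1)[of d] action_identity(1)[of e]
    by (simp add: cone_path_apply[OF m] shift_map_def flip: One_nat_def)
qed

definition one_edge :: "'g list list" where
  "one_edge = edge (\<lambda>_. \<one>)"

lemma one_edge: "one_edge \<in> simplices P 1" "h one_edge = 0"
  unfolding one_edge_def alternating_map_edge by (rule edge_closed) simp_all

lemma action_P_constant:
  assumes "z \<in> simplices P 1"
  shows "action P 1 [1, 1] z = one_edge"
proof -
  have "action P 1 [1] z = v"
    using P.action_closed[OF _ assms, of "[1]" 0] vertices_P by (simp add: mono_lists)
  moreover have "action P 0 [0, 0] (action P 1 [1] z) = action P 1 [1, 1] z"
    using assms by (simp add: P.action_comp_list mono_lists comp_map_def)
  moreover have "action P 0 [0, 0] v = one_edge"
    by (simp add: sset_power_def base_vertex_def classifying_space_def segment_product_def one_edge_def edge_def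
        map_replicate_const)
  ultimately show ?thesis by simp
qed

text \<open>A correction \<open>R\<close> with vanishing outer faces can be separated from a cone
  edge: the edge for \<open>w + R\<close> is the edge for \<open>w\<close> followed by an edge over
  the degenerate edge that carries \<open>R\<close>. The 3-chain is a sum of degeneracies of
  \<open>w\<close> and \<open>R\<close>, over a degeneracy of \<open>z\<close>.\<close>

lemma cone_split:
  assumes z: "z \<in> simplices P 1" and w: "w \<in> simplices ZX 2" "action ZX 2 [1, 2] w = h z"
    and R: "R \<in> simplices ZX 2" "action ZX 2 [1, 2] R = 0" "action ZX 2 [0, 1] R = 0"
  shows "edge_homotopic HF (vertex (action ZX 2 [0, 1] w)) (vertex (action ZX 2 [0, 2] (w + R)))
    [((z, cone_path ZX 1 w), True),
     ((one_edge, cone_path ZX 1 (R + action ZX 1 [0, 1, 1] (action ZX 2 [0, 2] w))), True)]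
    [((z, cone_path ZX 1 (w + R)), True)]"
proof -
  let ?z = "action P 1 [0, 1, 1] z" and ?V = "action ZX 2 [0, 1, 2, 2] w + action ZX 2 [0, 1, 1, 2] R"
  have z': "?z \<in> simplices P 2" using P.action_closed[OF _ z] by (simp add: mono_lists)
  have V: "?V \<in> simplices ZX 3" using w R by (simp add: ZX_simps)
  have id: "action P 1 [0, 1] z = z" using P.action_id[OF z] by (simp add: id_map_1)
  have f: "face P 2 0 ?z = one_edge" "face P 2 1 ?z = z" "face P 2 2 ?z = z"
    using z by (simp_all add: face_def coface_2 P.action_comp_list mono_lists comp_map_def id action_P_constant)
  have "action ZX 1 [0, 0, 1] (action ZX 2 [1, 2] R) = action ZX 2 [1, 1, 2] R"
    "action ZX 1 [0, 1, 1] (action ZX 2 [0, 1] R) = action ZX 2 [0, 1, 1] R"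
    "action ZX 1 [0, 1, 1] (action ZX 2 [1, 2] w) = action ZX 2 [1, 2, 2] w"
    "action ZX 1 [0, 1, 1] (action ZX 2 [0, 2] w) = action ZX 2 [0, 2, 2] w"
    using R(1) w(1) by (simp_all add: ZX.action_comp_list mono_lists comp_map_def)
  then have zero: "action ZX 2 [1, 1, 2] R = 0" "action ZX 2 [0, 1, 1] R = 0"
    and e: "action ZX 2 [1, 2, 2] w = action ZX 1 [0, 1, 1] (h z)"
      "action ZX 2 [0, 2, 2] w = action ZX 1 [0, 1, 1] (action ZX 2 [0, 2] w)"
    unfolding R w by simp_all
  have a: "action ZX 3 [0, 1, 2] ?V = w" "action ZX 3 [0, 2, 3] ?V = R + action ZX 2 [0, 2, 2] w" "action ZX 3 [0, 1, 3] ?V = w + R"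
    "action ZX 3 [1, 2, 3] ?V = action ZX 1 [0, 1, 1] (h z)" "action ZX 3 [0, 1] ?V = action ZX 2 [0, 1] w"
    "action ZX 3 [0, 3] ?V = action ZX 2 [0, 2] (w + R)"
    using w R zero e(1) by (simp_all add: ZX_simps add.commute)
  have "alternating_map n 2 ?z = action ZX 1 [0, 1, 1] (h z)"
    using alternating_map_natural[OF _ z] by (simp add: mono_lists)
  then show ?thesis
    using cone_triangle[OF z' V] unfolding a f e(2)[symmetric] by simp
qed

text \<open>Holds over any triangle of the power, but the second edge carries the 2-chain of
  \<open>z\<close> and is in general not of the form \<open>E\<close>. For triangles of
  \<open>Q\<close> it is, by \<open>triangle_Q\<close>.\<close>

lemma triangle_lift:
  assumes z: "z \<in> simplices P 2" and d: "d \<in> Z0"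
  shows "edge_homotopic HF (vertex d) (vertex (d + h (face P 2 1 z)))
    [(E (face P 2 2 z) d, True),
     ((face P 2 0 z, cone_path ZX 1 (alternating_map n 2 z + action ZX 1 [0, 1, 1] d)), True)]
    [(E (face P 2 1 z) d, True)]"
proof -
  let ?h = "alternating_map n 2 z"
  let ?V = "action ZX 2 [0, 0, 1, 2] ?h + action ZX 1 [0, 1, 1, 1] d"
  have h: "?h \<in> simplices ZX 2" by (rule alternating_map_closed[OF z])
  have d1: "d \<in> simplices ZX 1" by (rule Z0_closed[OF d])
  have V: "?V \<in> simplices ZX 3" using h d1 by (simp add: ZX_simps)
  have hf: "h (face P 2 2 z) = action ZX 2 [0, 1] ?h" "h (face P 2 1 z) = action ZX 2 [0, 2] ?h"
    using z by (simp_all add: face_def coface_2 alternating_map_natural mono_lists)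
  have "action ZX 2 [0, 0] ?h = 0"
  proof -
    have "action ZX 0 [0, 0] (action ZX 2 [0] ?h) = action ZX 2 [0, 0] ?h"
      using h by (simp add: ZX.action_comp_list mono_lists comp_map_def)
    then show ?thesis using alternating_map_vertex[OF z, of 0] by simp
  qed
  then have a: "action ZX 3 [0, 1, 2] ?V = weight (face P 2 2 z) d" "action ZX 3 [0, 1, 3] ?V = weight (face P 2 1 z) d"
    "action ZX 3 [0, 2, 3] ?V = ?h + action ZX 1 [0, 1, 1] d" "action ZX 3 [1, 2, 3] ?V = ?h"
    "action ZX 3 [0, 1] ?V = d" "action ZX 3 [0, 3] ?V = d + h (face P 2 1 z)"
    using h d1 Z0_vertices[OF d] by (simp_all add: ZX_simps weight_def hf add.commute)
  show ?thesis using cone_triangle[OF z V] unfolding a E_def by simp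
qed

text \<open>The chain \<open>d\<close> labels the current vertex. An edge traversed backwards
  arrives at \<open>d - h\<close>, which is the starting label of the lifted edge.\<close>

primrec lift :: "('g list \<Rightarrow>\<^sub>0 int) \<Rightarrow> 'g list list edge_word \<Rightarrow>
    ('g list list \<times> (nat \<Rightarrow> nat list \<times> nat list \<Rightarrow> 'g list \<Rightarrow>\<^sub>0 int)) edge_word" where
  "lift d [] = []"
| "lift d (a # p) = (if snd a then (E (fst a) d, True) # lift (d + h (fst a)) p
     else (E (fst a) (d - h (fst a)), False) # lift (d - h (fst a)) p)"

primrec displacement :: "'g list list edge_word \<Rightarrow> 'g list \<Rightarrow>\<^sub>0 int" where
  "displacement [] = 0"
| "displacement (a # p) = (if snd a then h (fst a) else - h (fst a)) + displacement p"

lemma displacement_append: "displacement (p @ q) = displacement p + displacement q"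
  by (induction p) auto

lemma lift_append: "lift d (p @ q) = lift d p @ lift (d + displacement p) q"
  by (induction p arbitrary: d) (auto simp: algebra_simps)

lemma displacement_Z0: "fst ` set p \<subseteq> simplices P 1 \<Longrightarrow> displacement p \<in> Z0"
proof (induction p)
  case (Cons a p)
  then have "h (fst a) \<in> Z0" "displacement p \<in> Z0" using h_closed by auto
  then show ?case using Z0_plus[of "h (fst a)" "displacement p"] Z0_minus[of "displacement p" "h (fst a)"] by auto
qed (simp add: zero_Z0)

lemma lift_path:
  "\<lbrakk>fst ` set p \<subseteq> simplices P 1; d \<in> Z0\<rbrakk> \<Longrightarrow> edge_path HF (vertex d) (lift d p) (vertex (d + displacement p))"
proof (induction p arbitrary: d)
  case Nil
  then show ?case by (simp add: vertex_in_HF)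
next
  case (Cons a p)
  then have a: "fst a \<in> simplices P 1" and p: "fst ` set p \<subseteq> simplices P 1" by auto
  show ?case
  proof (cases "snd a")
    case True
    have "edge_path HF (vertex d) ([(E (fst a) d, True)] @ lift (d + h (fst a)) p) (vertex (d + h (fst a) + displacement p))"
      unfolding edge_path_append[OF simplicial_set_HF]
      using E_path(1)[OF a Cons.prems(2)] Cons.IH[OF p Z0_plus[OF Cons.prems(2) h_closed[OF a]]] by blast
    then show ?thesis using True by (simp add: algebra_simps del: edge_path.simps)
  next
    case False
    have d: "d - h (fst a) \<in> Z0" using Z0_minus[OF Cons.prems(2) h_closed[OF a]] .
    have "edge_path HF (vertex d) ([(E (fst a) (d - h (fst a)), False)] @ lift (d - h (fst a)) p) (vertex (d - h (fst a) + displacement p))"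
      unfolding edge_path_append[OF simplicial_set_HF]
      using E_path(2)[OF a d] Cons.IH[OF p d] by (metis diff_add_cancel)
    then show ?thesis using False by (simp add: algebra_simps del: edge_path.simps)
  qed
qed

lemma lift_homotopic:
  assumes "edge_homotopic Q v v p q"
  shows "displacement p = displacement q \<and>
    (\<forall>d\<in>Z0. edge_homotopic HF (vertex d) (vertex (d + displacement p)) (lift d p) (lift d q))"
  using assms
proof (induction rule: edge_homotopic.induct)
  case (refl p)
  then have "fst ` set p \<subseteq> simplices P 1" using edge_path_edges by (fastforce simp: simplices_Q)
  then show ?case using lift_path by (auto intro: edge_homotopic.refl)
next
  case (sym p q)
  then show ?case by (auto intro: edge_homotopic.sym)
next
  case (trans p q r)
  have "edge_homotopic HF (vertex d) (vertex (d + displacement p)) (lift d p) (lift d r)" if "d \<in> Z0" for d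
    by (rule edge_homotopic.trans[of _ _ _ _ "lift d q"]) (use trans.IH that in auto)
  with trans.IH show ?case by simp
next
  case (cancel p e b q)
  have P: "fst ` set (p @ [(e, b), (e, \<not> b)] @ q) \<subseteq> simplices P 1"
    using edge_path_edges[OF cancel] by (auto simp: simplices_Q)
  have 1: "displacement (p @ [(e, b), (e, \<not> b)] @ q) = displacement (p @ q)"
    by (simp add: displacement_append)
  have "edge_homotopic HF (vertex d) (vertex (d + displacement (p @ [(e, b), (e, \<not> b)] @ q)))
      (lift d (p @ [(e, b), (e, \<not> b)] @ q)) (lift d (p @ q))" if d: "d \<in> Z0" for d
  proof -
    let ?d = "d + displacement p"
    let ?e = "E e (if b then ?d else ?d - h e)"
    have l: "lift d (p @ [(e, b), (e, \<not> b)] @ q) = lift d p @ [(?e, b), (?e, \<not> b)] @ lift ?d q"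
      by (cases b) (simp_all add: lift_append)
    show ?thesis
      using edge_homotopic.cancel[of HF "vertex d" "lift d p" ?e b "lift ?d q"] lift_path[OF P d]
      unfolding l by (simp add: lift_append del: edge_path.simps append.simps)
  qed
  with 1 show ?case by blast
next
  case (triangle \<sigma> p q)
  have s: "\<sigma> \<in> simplices P 2" using triangle by (simp add: simplices_Q)
  have f: "face P 2 i \<sigma> \<in> simplices P 1" if "i \<le> 2" for i
    using P.face_closed[of \<sigma> 1 i] s that by (simp add: numeral_2_eq_2 One_nat_def)
  have pq: "fst ` set p \<subseteq> simplices P 1" "fst ` set q \<subseteq> simplices P 1"
    using edge_path_edges[OF triangle(2)] by (auto simp: simplices_Q)
  note dt = displacement_triangle[OF triangle(1)]
  have 1: "displacement (p @ [(face Q 2 2 \<sigma>, True), (face Q 2 0 \<sigma>, True)] @ q) = displacement (p @ [(face Q 2 1 \<sigma>, True)] @ q)"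
    using dt by (simp add: displacement_append face_Q add.assoc[symmetric])
  have "edge_homotopic HF (vertex d) (vertex (d + displacement (p @ [(face Q 2 2 \<sigma>, True), (face Q 2 0 \<sigma>, True)] @ q)))
      (lift d (p @ [(face Q 2 2 \<sigma>, True), (face Q 2 0 \<sigma>, True)] @ q)) (lift d (p @ [(face Q 2 1 \<sigma>, True)] @ q))"
    if d: "d \<in> Z0" for d
  proof -
    let ?d = "d + displacement p"
    let ?d' = "?d + h (face P 2 1 \<sigma>)"
    have d1: "?d \<in> Z0" "?d' \<in> Z0" using d displacement_Z0[OF pq(1)] h_closed[OF f[of 1]] by (auto intro!: Z0_plus)
    \<comment> \<open>Additivity enters here: it turns the second edge of
      \<open>triangle_lift\<close> into a canonical lift.\<close>
    have "alternating_map n 2 \<sigma> + action ZX 1 [0, 1, 1] ?d = weight (face P 2 0 \<sigma>) (?d + h (face P 2 2 \<sigma>))"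
      unfolding triangle_Q[OF triangle(1)] by (simp add: weight_def action_free_diff)
    then have "edge_homotopic HF (vertex ?d) (vertex ?d')
        [(E (face P 2 2 \<sigma>) ?d, True), (E (face P 2 0 \<sigma>) (?d + h (face P 2 2 \<sigma>)), True)] [(E (face P 2 1 \<sigma>) ?d, True)]"
      using triangle_lift[OF s d1(1)] by (simp add: E_def)
    from edge_homotopic_append[OF simplicial_set_HF this lift_path[OF pq(1) d] lift_path[OF pq(2) d1(2)]]
    moreover have e: "?d + h (face P 2 2 \<sigma>) + h (face P 2 0 \<sigma>) = ?d'" using dt by (simp add: add.assoc)
    have "lift d (p @ [(face Q 2 2 \<sigma>, True), (face Q 2 0 \<sigma>, True)] @ q) = lift d p @
        [(E (face P 2 2 \<sigma>) ?d, True), (E (face P 2 0 \<sigma>) (?d + h (face P 2 2 \<sigma>)), True)] @ lift ?d' q"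
      by (simp add: lift_append face_Q e)
    moreover have "lift d (p @ [(face Q 2 1 \<sigma>, True)] @ q) = lift d p @ [(E (face P 2 1 \<sigma>) ?d, True)] @ lift ?d' q"
      by (simp add: lift_append face_Q)
    moreover have "d + displacement (p @ [(face Q 2 2 \<sigma>, True), (face Q 2 0 \<sigma>, True)] @ q) = ?d' + displacement q"
      unfolding 1 by (simp add: displacement_append face_Q add.assoc)
    ultimately show ?thesis by (simp only:)
  qed
  with 1 show ?case by blast
qed

lemma displacement_reverse: "displacement (reverse_path p) = - displacement p"
  by (induction p) (auto simp: reverse_path_def displacement_append)

lemma lift_reverse: "lift (d + displacement p) (reverse_path p) = reverse_path (lift d p)"
proof (induction p arbitrary: d)
  case (Cons a p)
  obtain e b where a: "a = (e, b)" by force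
  have r: "reverse_path (a # p) = reverse_path p @ [(e, \<not> b)]" by (simp add: a reverse_path_def)
  define d' where "d' = d + (if b then h e else - h e)"
  have d: "d + displacement (a # p) = d' + displacement p" by (simp add: a d'_def)
  have "lift (d + displacement (a # p)) (reverse_path (a # p)) = reverse_path (lift d' p) @ lift d' [(e, \<not> b)]"
    unfolding d r by (simp add: lift_append Cons.IH displacement_reverse del: lift.simps)
  also have "\<dots> = reverse_path (lift d (a # p))"
    by (cases b) (simp_all add: a d'_def reverse_path_def)
  finally show ?case .
qed (simp add: reverse_path_def)

end

section \<open>Paths homotopic to canonical lifts\<close>

context alternating_fiber
begin

definition realizable where
  "realizable d e p \<longleftrightarrow> (\<exists>q. fst ` set q \<subseteq> simplices P 1 \<and> e = d + displacement q \<and>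
     edge_homotopic HF (vertex d) (vertex e) p (lift d q))"

lemma realizable_path: "realizable d e p \<Longrightarrow> edge_path HF (vertex d) p (vertex e)"
  unfolding realizable_def using edge_homotopic_path[OF simplicial_set_HF] by blast

lemma realizable_Z0: "\<lbrakk>realizable d e p; d \<in> Z0\<rbrakk> \<Longrightarrow> e \<in> Z0"
  using displacement_Z0 Z0_plus by (auto simp: realizable_def)

lemma realizable_homotopic:
  "\<lbrakk>edge_homotopic HF (vertex d) (vertex e) p q; realizable d e q\<rbrakk> \<Longrightarrow> realizable d e p"
  unfolding realizable_def by (blast intro: edge_homotopic.trans)

lemma realizable_append:
  assumes "realizable d e p" "realizable e f q" "d \<in> Z0"
  shows "realizable d f (p @ q)"
proof -
  obtain p' where p': "fst ` set p' \<subseteq> simplices P 1" "e = d + displacement p'"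
    "edge_homotopic HF (vertex d) (vertex e) p (lift d p')" using assms(1) by (auto simp: realizable_def)
  obtain q' where q': "fst ` set q' \<subseteq> simplices P 1" "f = e + displacement q'"
    "edge_homotopic HF (vertex e) (vertex f) q (lift e q')" using assms(2) by (auto simp: realizable_def)
  have "edge_homotopic HF (vertex d) (vertex f) (p @ q) (lift d (p' @ q'))"
    unfolding lift_append p'(2)[symmetric]
    by (rule edge_homotopic_append2[OF simplicial_set_HF p'(3) q'(3)])
  then show ?thesis
    unfolding realizable_def using p' q'
    by (intro exI[of _ "p' @ q'"]) (auto simp: displacement_append add.assoc)
qed

lemma edge_homotopic_flip:
  assumes "edge_path HF u [(e, True)] w" "edge_homotopic HF u w [(e, True)] p"
  shows "edge_homotopic HF w u [(e, False)] (reverse_path p)"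
proof -
  note X = simplicial_set_HF
  have p: "edge_path HF u p w" using edge_homotopic_path[OF X assms(2)] by blast
  have r: "edge_path HF w (reverse_path p) u" by (rule edge_path_reverse[OF X p])
  have f: "edge_path HF w [(e, False)] u" using edge_path_reverse[OF X assms(1)] by (simp add: reverse_path_def del: edge_path.simps)
  have w: "edge_path HF w [] w" and u: "edge_path HF u [] u" 
    using edge_path_end[OF p] edge_path_end[OF r] by auto
  have "edge_homotopic HF w u (reverse_path p @ [(e, True)] @ [(e, False)]) (reverse_path p @ p @ [(e, False)])"
    by (rule edge_homotopic_append[OF X assms(2) r f])
  moreover have "edge_homotopic HF w u ([] @ (reverse_path p @ p) @ [(e, False)]) ([] @ [] @ [(e, False)])"
    by (rule edge_homotopic_append[OF X reverse_path_cancel[OF X p] w f])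
  moreover have "edge_homotopic HF w u (reverse_path p @ [(e, True), (e, \<not> True)] @ []) (reverse_path p @ [])"
  proof (rule edge_homotopic.cancel)
    have "edge_path HF w (reverse_path p @ [(e, True)] @ [(e, False)]) u"
      unfolding edge_path_append[OF X] using r assms(1) f by blast
    then show "edge_path HF w (reverse_path p @ [(e, True), (e, \<not> True)] @ []) u" by (simp del: edge_path.simps)
  qed
  ultimately show ?thesis
    by (simp del: edge_path.simps) (blast intro: edge_homotopic.trans edge_homotopic.sym)
qed

lemma realizable_flip:
  assumes "realizable d e [(a, True)]"
  shows "realizable e d [(a, False)]"
proof -
  obtain q where q: "fst ` set q \<subseteq> simplices P 1" "e = d + displacement q"
    "edge_homotopic HF (vertex d) (vertex e) [(a, True)] (lift d q)" using assms by (auto simp: realizable_def)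
  have "edge_homotopic HF (vertex e) (vertex d) [(a, False)] (lift e (reverse_path q))"
    unfolding q(2) lift_reverse using edge_homotopic_flip[OF realizable_path[OF assms] q(3)] unfolding q(2) .
  moreover have "fst ` set (reverse_path q) \<subseteq> simplices P 1" using q(1) by (auto simp: reverse_path_def)
  ultimately show ?thesis
    unfolding realizable_def using q(2) by (intro exI[of _ "reverse_path q"]) (simp add: displacement_reverse)
qed

lemma realizable_E: "\<lbrakk>z \<in> simplices P 1; d \<in> Z0\<rbrakk> \<Longrightarrow> realizable d (d + h z) [(E z d, True)]"
  unfolding realizable_def using lift_path[of "[(z, True)]" d]
  by (intro exI[of _ "[(z, True)]"]) (auto intro: edge_homotopic.refl simp del: edge_path.simps)

text \<open>In a triangle relation the second side is the inverse of the first followed by the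
  third. With \<open>realizable_cancel_right\<close> this is a two-out-of-three principle.\<close>

lemma realizable_cancel_left:
  assumes h: "edge_homotopic HF (vertex d) (vertex f) [(a, True), (b, True)] [(c', True)]"
    and "edge_path HF (vertex e) [(b, True)] (vertex f)"
    and "realizable d e [(a, True)]" "realizable d f [(c', True)]" "d \<in> Z0"
  shows "realizable e f [(b, True)]"
proof -
  note X = simplicial_set_HF
  have e: "e \<in> Z0" using realizable_Z0 assms by blast
  have fl: "realizable e d [(a, False)]" by (rule realizable_flip) fact
  have p: "edge_path HF (vertex f) [] (vertex f)" using edge_path_end[OF assms(2)] by simp
  have "edge_homotopic HF (vertex e) (vertex f) ([(a, False)] @ [(a, True), (b, True)] @ []) ([(a, False)] @ [(c', True)] @ [])"
    by (rule edge_homotopic_append[OF X h realizable_path[OF fl] p])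
  moreover have "edge_homotopic HF (vertex e) (vertex f) ([] @ [(a, False), (a, \<not> False)] @ [(b, True)]) ([] @ [(b, True)])"
  proof (rule edge_homotopic.cancel)
    have "edge_path HF (vertex e) ([(a, False)] @ [(a, True)] @ [(b, True)]) (vertex f)"
      unfolding edge_path_append[OF X] using realizable_path[OF fl] realizable_path[OF assms(3)] assms(2) by blast
    then show "edge_path HF (vertex e) ([] @ [(a, False), (a, \<not> False)] @ [(b, True)]) (vertex f)" by (simp del: edge_path.simps)
  qed
  ultimately have "edge_homotopic HF (vertex e) (vertex f) [(b, True)] ([(a, False)] @ [(c', True)])"
    by (simp del: edge_path.simps) (blast intro: edge_homotopic.trans edge_homotopic.sym)
  then show ?thesis
    by (rule realizable_homotopic) (rule realizable_append[OF fl assms(4) e])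
qed

lemma realizable_cancel_right:
  assumes h: "edge_homotopic HF (vertex d) (vertex f) [(a, True), (b, True)] [(c', True)]"
    and "edge_path HF (vertex d) [(a, True)] (vertex e)"
    and "realizable e f [(b, True)]" "realizable d f [(c', True)]" "d \<in> Z0"
  shows "realizable d e [(a, True)]"
proof -
  note X = simplicial_set_HF
  have fl: "realizable f e [(b, False)]" by (rule realizable_flip) fact
  have p: "edge_path HF (vertex d) [] (vertex d)" using vertex_in_HF[OF assms(5)] by simp
  have "edge_homotopic HF (vertex d) (vertex e) ([] @ [(a, True), (b, True)] @ [(b, False)]) ([] @ [(c', True)] @ [(b, False)])"
    by (rule edge_homotopic_append[OF X h p realizable_path[OF fl]])
  moreover have "edge_homotopic HF (vertex d) (vertex e) ([(a, True)] @ [(b, True), (b, \<not> True)] @ []) ([(a, True)] @ [])"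
  proof (rule edge_homotopic.cancel)
    have "edge_path HF (vertex d) ([(a, True)] @ [(b, True)] @ [(b, False)]) (vertex e)"
      unfolding edge_path_append[OF X] using realizable_path[OF fl] realizable_path[OF assms(3)] assms(2) by blast
    then show "edge_path HF (vertex d) ([(a, True)] @ [(b, True), (b, \<not> True)] @ []) (vertex e)" by (simp del: edge_path.simps)
  qed
  ultimately have "edge_homotopic HF (vertex d) (vertex e) [(a, True)] ([(c', True)] @ [(b, False)])"
    by (simp del: edge_path.simps) (blast intro: edge_homotopic.trans edge_homotopic.sym)
  then show ?thesis
    by (rule realizable_homotopic) (rule realizable_append[OF assms(4) fl assms(5)])
qed

text \<open>
  The projection of the 2-chains to the chains \<open>R\<close> with \<open>d\<^sub>0 R = d\<^sub>2 R = 0\<close>.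
\<close>

definition rho :: "('g list \<Rightarrow>\<^sub>0 int) \<Rightarrow> 'g list \<Rightarrow>\<^sub>0 int" where
  "rho w = w - action ZX 2 [1, 1, 2] w - action ZX 2 [0, 1, 1] w + action ZX 2 [1, 1, 1] w"

lemma rho:
  assumes "w \<in> simplices ZX 2"
  shows "rho w \<in> simplices ZX 2" "action ZX 2 [1, 2] (rho w) = 0" "action ZX 2 [0, 1] (rho w) = 0"
  using assms by (simp_all add: rho_def ZX_simps)

lemma rho_diff: "rho (a - b) = rho a - rho b"
  by (simp add: rho_def action_free_diff algebra_simps)

lemma rho_eq:
  assumes "w \<in> simplices ZX 2" "action ZX 2 [1, 2] w = 0" "action ZX 2 [0, 1] w = 0"
  shows "rho w = w"
proof -
  have "action ZX 1 [0, 0, 1] (action ZX 2 [1, 2] w) = action ZX 2 [1, 1, 2] w"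
    "action ZX 1 [0, 1, 1] (action ZX 2 [0, 1] w) = action ZX 2 [0, 1, 1] w"
    "action ZX 1 [1, 1, 1] (action ZX 2 [0, 1] w) = action ZX 2 [1, 1, 1] w"
    using assms(1) by (simp_all add: ZX_simps)
  then show ?thesis unfolding assms by (simp add: rho_def)
qed

text \<open>An edge over the degenerate edge of the power: only the path component moves,
  translating the label \<open>d\<close> by the remaining face of \<open>R\<close>.\<close>

definition loop_edge where
  "loop_edge R d = (one_edge, cone_path ZX 1 (R + action ZX 1 [0, 1, 1] d))"

lemma loop_edge_path:
  assumes "R \<in> simplices ZX 2" "action ZX 2 [1, 2] R = 0" "action ZX 2 [0, 1] R = 0" "d \<in> Z0"
  shows "edge_path HF (vertex d) [(loop_edge R d, True)] (vertex (d + action ZX 2 [0, 2] R))"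
proof -
  have w: "R + action ZX 1 [0, 1, 1] d \<in> simplices ZX 2" using assms Z0_closed by (simp add: ZX_simps)
  show ?thesis
    using cone_edge_path(1)[OF one_edge(1) w] assms Z0_closed[OF assms(4)] Z0_vertices[OF assms(4)]
    by (simp add: loop_edge_def ZX_simps one_edge add.commute del: edge_path.simps)
qed

lemma loop_edge_Z0:
  assumes "R \<in> simplices ZX 2" "action ZX 2 [0, 1] R = 0" "d \<in> Z0"
  shows "d + action ZX 2 [0, 2] R \<in> Z0"
proof -
  have "action ZX 1 [0] (action ZX 2 [0, 1] R) = action ZX 2 [0] R" using assms(1) by (simp add: ZX_simps)
  then show ?thesis using assms unfolding assms(2) by (intro Z0_plus) (simp_all add: Z0_def ZX_simps)
qed

lemma cone_split_E:
  assumes z: "z \<in> simplices P 1" and d: "d \<in> Z0"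
    and R: "R \<in> simplices ZX 2" "action ZX 2 [1, 2] R = 0" "action ZX 2 [0, 1] R = 0"
  shows "edge_homotopic HF (vertex d) (vertex (d + h z + action ZX 2 [0, 2] R))
    [(E z d, True), (loop_edge R (d + h z), True)] [((z, cone_path ZX 1 (weight z d + R)), True)]"
  using cone_split[OF z weight(1)[OF z d] weight(4)[OF z d] R] weight[OF z d]
  by (simp add: E_def loop_edge_def action_free_diff)

text \<open>The 2-chain [a, b] is produced by a triangle of the power with both entries at index 1,
  which need not lie in \<open>Q\<close>. Its lift has two canonical sides, so the third side is
  realizable; this side differs from a canonical lift by exactly the wanted loop.\<close>

lemma realizable_loop_basis:
  assumes ab: "a \<in> carrier G" "b \<in> carrier G" and d: "d \<in> Z0"
  shows "realizable d (d + action ZX 2 [0, 2] (rho (frag_of [a, b]))) [(loop_edge (rho (frag_of [a, b])) d, True)]"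
proof -
  let ?z = "triangle (single 1 a) (single 1 b)"
  let ?h2 = "alternating_map n 2 ?z"
  have n0: "0 < n" using n by simp
  have cl: "single 1 a k \<in> carrier G \<and> single 1 b k \<in> carrier G" for k using ab by simp
  have z: "?z \<in> simplices P 2" using cl by (intro triangle_closed)
  have h2: "?h2 = frag_of [a, b] - frag_of [\<one>, \<one>]"
  proof -
    have "frag_of [single 1 a (2 * i + 1), single 1 b (2 * i + 1)] - frag_of [single 1 a (2 * i), single 1 b (2 * i)]
        = (if i = 0 then frag_of [a, b] - frag_of [\<one>, \<one>] else 0)" for i
      using odd_neq_even(2)[of i 0] by (auto simp: single_def One_nat_def)
    then show ?thesis unfolding alternating_map_triangle alternating_sum_def using n0 by simp
  qed
  have h2c: "?h2 \<in> simplices ZX 2" by (rule alternating_map_closed[OF z])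
  have "action ZX 2 [1, 1, 2] (frag_of [\<one>, \<one>]) = frag_of [\<one>, \<one>]" "action ZX 2 [0, 1, 1] (frag_of [\<one>, \<one>]) = frag_of [\<one>, \<one>]"
    "action ZX 2 [1, 1, 1] (frag_of [\<one>, \<one>]) = frag_of [\<one>, \<one>]"
    by (simp_all add: free_simplicial_abelian_group_def classifying_space_def segment_product_def upt_rec)
  \<comment> \<open>The triangle yields [a, b] minus the degenerate simplex of units, and the
    projection kills the latter.\<close>
  then have r: "rho (frag_of [a, b]) = rho ?h2" unfolding h2 rho_diff by (simp add: rho_def)
  let ?e0 = "face P 2 0 ?z" and ?e1 = "face P 2 1 ?z" and ?e2 = "face P 2 2 ?z"
  have e: "?e0 \<in> simplices P 1" "?e1 \<in> simplices P 1" "?e2 \<in> simplices P 1"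
    using P.face_closed[of ?z 1] z by (simp_all flip: One_nat_def)
  have he: "h ?e0 = action ZX 2 [1, 2] ?h2" "h ?e1 = action ZX 2 [0, 2] ?h2" "h ?e2 = action ZX 2 [0, 1] ?h2"
    using z by (simp_all add: face_def coface_2 alternating_map_natural mono_lists)
  \<comment> \<open>The starting label is chosen so that the lifts of the faces 2 and 0 end at
    \<open>d\<close>, where the loop begins.\<close>
  define c' where "c' = d - h ?e0 - h ?e2"
  have c': "c' \<in> Z0" unfolding c'_def by (intro Z0_minus d h_closed e)
  have c2: "c' + h ?e2 \<in> Z0" by (intro Z0_plus c' h_closed e)
  have d_eq: "c' + h ?e2 + h ?e0 = d" by (simp add: c'_def)
  have z11: "action ZX 2 [1, 1] ?h2 = 0" "action ZX 2 [1, 1, 1] ?h2 = 0"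
  proof -
    have "action ZX 1 [1, 1] (h ?e2) = action ZX 2 [1, 1] ?h2" "action ZX 1 [1, 1, 1] (h ?e2) = action ZX 2 [1, 1, 1] ?h2"
      unfolding he using h2c by (simp_all add: ZX_simps)
    then show "action ZX 2 [1, 1] ?h2 = 0" "action ZX 2 [1, 1, 1] ?h2 = 0"
      using Z0_vertices[OF h_closed[OF e(3)]] by simp_all
  qed
  let ?w = "?h2 + action ZX 1 [0, 1, 1] c'"
  have w: "?w \<in> simplices ZX 2" using h2c Z0_closed[OF c'] by (simp add: ZX_simps)
  have wf: "action ZX 2 [0, 1] ?w = c' + h ?e2" "action ZX 2 [0, 2] ?w = c' + h ?e1" "action ZX 2 [1, 2] ?w = h ?e0"
    using h2c Z0_closed[OF c'] Z0_vertices[OF c'] by (simp_all add: ZX_simps he add.commute)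
  have mid: "realizable (c' + h ?e2) (c' + h ?e1) [((?e0, cone_path ZX 1 ?w), True)]"
    by (rule realizable_cancel_left[OF triangle_lift[OF z c'] _ realizable_E[OF e(3) c'] realizable_E[OF e(2) c'] c'])
      (use cone_edge_path(1)[OF e(1) w wf(3)] in \<open>simp add: wf del: edge_path.simps\<close>)
  let ?R = "rho ?h2"
  note R = rho[OF h2c]
  have "?R + weight ?e0 (c' + h ?e2) = ?w"
    unfolding rho_def weight_def he using h2c Z0_closed[OF c'] by (simp add: ZX_simps z11)
  then have W: "weight ?e0 (c' + h ?e2) + ?R = ?w" by (simp add: add.commute)
  have "action ZX 2 [0, 2] ?R = h ?e1 - h ?e0 - h ?e2"
    unfolding rho_def he using h2c by (simp add: ZX_simps z11)
  then have end_eq: "d + action ZX 2 [0, 2] ?R = c' + h ?e1" by (simp add: c'_def)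
  have "edge_homotopic HF (vertex (c' + h ?e2)) (vertex (c' + h ?e1))
      [(E ?e0 (c' + h ?e2), True), (loop_edge ?R d, True)] [((?e0, cone_path ZX 1 ?w), True)]"
    using cone_split_E[OF e(1) c2 R] unfolding W d_eq end_eq .
  moreover have "edge_path HF (vertex d) [(loop_edge ?R d, True)] (vertex (c' + h ?e1))"
    using loop_edge_path[OF R d] unfolding end_eq .
  moreover have "realizable (c' + h ?e2) d [(E ?e0 (c' + h ?e2), True)]"
    using realizable_E[OF e(1) c2] unfolding d_eq .
  ultimately have "realizable d (c' + h ?e1) [(loop_edge ?R d, True)]"
    using mid c2 by (rule realizable_cancel_left)
  then show ?thesis unfolding r end_eq .
qed

text \<open>The basic chains extend to all chains by induction over differences: by
  \<open>cone_split\<close> the loop for \<open>rho a\<close> is the loop for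
  \<open>rho a - rho b\<close> followed by that for \<open>rho b\<close>, and two of the three are
  realizable.\<close>

lemma realizable_loop:
  assumes "w \<in> simplices ZX 2"
  shows "\<forall>d\<in>Z0. realizable d (d + action ZX 2 [0, 2] (rho w)) [(loop_edge (rho w) d, True)]"
proof -
  have "Poly_Mapping.keys w \<subseteq> simplices X 2" using assms by (simp add: free_simplicial_abelian_group_def)
  then have "w \<in> simplices ZX 2 \<and> (\<forall>d\<in>Z0. realizable d (d + action ZX 2 [0, 2] (rho w)) [(loop_edge (rho w) d, True)])"
  proof (induction w rule: frag_induction)
    case zero
    have "rho 0 = 0" by (simp add: rho_def)
    moreover have "loop_edge 0 d = E one_edge d" for d
      by (simp add: loop_edge_def E_def weight_def one_edge)
    ultimately show ?case using realizable_E[OF one_edge(1)] by (simp add: zero_closed one_edge)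
  next
    case (one gs)
    then obtain a b where ab: "gs = [a, b]" "a \<in> carrier G" "b \<in> carrier G"
      by (auto simp: classifying_space_def numeral_2_eq_2 length_Suc_conv)
    with one show ?case
      using realizable_loop_basis[OF ab(2,3)] by (auto simp: free_simplicial_abelian_group_def keys_frag_of)
  next
    case (diff a b)
    have ab: "a \<in> simplices ZX 2" "b \<in> simplices ZX 2" using diff by auto
    have "realizable d (d + action ZX 2 [0, 2] (rho (a - b))) [(loop_edge (rho (a - b)) d, True)]" if d: "d \<in> Z0" for d
    proof -
      let ?R = "rho a - rho b"
      have R: "?R \<in> simplices ZX 2" "action ZX 2 [1, 2] ?R = 0" "action ZX 2 [0, 1] ?R = 0"
        using rho[OF ab(1)] rho[OF ab(2)] by (simp_all add: action_free_diff ZX_closed_minus)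
      let ?w = "?R + action ZX 1 [0, 1, 1] d" and ?e = "d + action ZX 2 [0, 2] ?R"
      have w: "?w \<in> simplices ZX 2" using R Z0_closed[OF d] by (simp add: ZX_simps)
      have wf: "action ZX 2 [1, 2] ?w = h one_edge" "action ZX 2 [0, 1] ?w = d" "action ZX 2 [0, 2] ?w = ?e"
        using R Z0_closed[OF d] Z0_vertices[OF d] by (simp_all add: ZX_simps one_edge add.commute)
      have sum: "?w + rho b = rho a + action ZX 1 [0, 1, 1] d" by simp
      have e: "?e \<in> Z0" by (rule loop_edge_Z0[OF R(1,3) d])
      have end_eq: "?e + action ZX 2 [0, 2] (rho b) = d + action ZX 2 [0, 2] (rho a)"
        by (simp add: action_free_diff)
      have "action ZX 2 [0, 2] (?w + rho b) = d + action ZX 2 [0, 2] (rho a)"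
        unfolding action_free_diff(2)[of X 2 "[0, 2]" ?w "rho b"] wf(3) by (rule end_eq)
      then have "edge_homotopic HF (vertex d) (vertex (d + action ZX 2 [0, 2] (rho a)))
          [(loop_edge ?R d, True), (loop_edge (rho b) ?e, True)] [(loop_edge (rho a) d, True)]"
        using cone_split[OF one_edge(1) w wf(1) rho[OF ab(2)]] unfolding wf(2,3) sum by (simp only: loop_edge_def)
      moreover have "edge_path HF (vertex d) [(loop_edge ?R d, True)] (vertex ?e)" by (rule loop_edge_path[OF R d])
      moreover have "realizable ?e (d + action ZX 2 [0, 2] (rho a)) [(loop_edge (rho b) ?e, True)]"
        using diff(2) e end_eq by metis
      moreover have "realizable d (d + action ZX 2 [0, 2] (rho a)) [(loop_edge (rho a) d, True)]"
        using diff(1) d by blast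
      ultimately show ?thesis unfolding rho_diff using d by (rule realizable_cancel_right)
    qed
    then show ?case using ab by (simp add: ZX_closed_minus)
  qed
  then show ?thesis by blast
qed

text \<open>The chain \<open>w\<close> and the degenerate filling \<open>weight\<close> have the
  same two faces, so their difference is fixed by \<open>rho\<close> and splits off as a loop
  edge.\<close>

lemma realizable_cone:
  assumes z: "z \<in> simplices P 1" and w: "w \<in> simplices ZX 2" "action ZX 2 [1, 2] w = h z"
  shows "action ZX 2 [0, 1] w \<in> Z0"
    "realizable (action ZX 2 [0, 1] w) (action ZX 2 [0, 2] w) [((z, cone_path ZX 1 w), True)]"
proof -
  let ?d = "action ZX 2 [0, 1] w"
  have cm: "const_map 0 0 = [0]" by (simp add: const_map_def)
  have "action ZX 2 [0] w = 0"
    using const_vertex[of w 1 z 0 0] z w by (simp add: face_def coface_2 cm)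
  then show d: "?d \<in> Z0" using w(1) by (simp add: Z0_def ZX_simps)
  let ?R = "w - weight z ?d"
  have R: "?R \<in> simplices ZX 2" "action ZX 2 [1, 2] ?R = 0" "action ZX 2 [0, 1] ?R = 0"
    using weight[OF z d] w by (simp_all add: action_free_diff ZX_closed_minus)
  have e: "?d + h z + action ZX 2 [0, 2] ?R = action ZX 2 [0, 2] w"
    using weight(3)[OF z d] by (simp add: action_free_diff)
  have "edge_homotopic HF (vertex ?d) (vertex (action ZX 2 [0, 2] w))
      [(E z ?d, True), (loop_edge ?R (?d + h z), True)] [((z, cone_path ZX 1 w), True)]"
    using cone_split_E[OF z d R] unfolding e by simp
  then have "edge_homotopic HF (vertex ?d) (vertex (action ZX 2 [0, 2] w))
      [((z, cone_path ZX 1 w), True)] ([(E z ?d, True)] @ [(loop_edge ?R (?d + h z), True)])"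
    by (simp add: edge_homotopic.sym)
  moreover have "realizable (?d + h z) (action ZX 2 [0, 2] w) [(loop_edge ?R (?d + h z), True)]"
    using realizable_loop[OF R(1)] Z0_plus[OF d h_closed[OF z]] unfolding rho_eq[OF R] by (metis e)
  then have "realizable ?d (action ZX 2 [0, 2] w) ([(E z ?d, True)] @ [(loop_edge ?R (?d + h z), True)])"
    by (rule realizable_append[OF realizable_E[OF z d] _ d])
  ultimately show "realizable ?d (action ZX 2 [0, 2] w) [((z, cone_path ZX 1 w), True)]"
    by (rule realizable_homotopic)
qed

end

section \<open>From arbitrary squares to cones\<close>

lemma map2_closed:
  assumes a: "\<alpha> \<in> mono_maps m k" and b: "\<beta> \<in> mono_maps m j"
    and f: "\<And>s t s' t'. \<lbrakk>s \<le> s'; s' \<le> k; t \<le> t'; t' \<le> j\<rbrakk> \<Longrightarrow> f s t \<le> f s' t'" and N: "f k j \<le> N"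
  shows "map2 f \<alpha> \<beta> \<in> mono_maps m N"
proof -
  have l: "length \<alpha> = Suc m" "length \<beta> = Suc m" using a b by (simp_all add: mono_maps_length)
  have e: "map2 f \<alpha> \<beta> ! i = f (\<alpha> ! i) (\<beta> ! i)" if "i \<le> m" for i using l that by simp
  have "sorted (map2 f \<alpha> \<beta>)"
    unfolding sorted_iff_nth_mono
  proof (intro allI impI)
    fix i i' assume ij: "i \<le> i'" "i' < length (map2 f \<alpha> \<beta>)"
    then have "i' \<le> m" using l by simp
    then show "map2 f \<alpha> \<beta> ! i \<le> map2 f \<alpha> \<beta> ! i'"
      using e[of i] e[of i'] ij mono_maps_nth_mono[OF a ij(1)] mono_maps_nth_mono[OF b ij(1)]
        mono_maps_nth_le[OF a, of i'] mono_maps_nth_le[OF b, of i'] by (simp add: f)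
  qed
  moreover have "set (map2 f \<alpha> \<beta>) \<subseteq> {..N}"
  proof
    fix z assume "z \<in> set (map2 f \<alpha> \<beta>)"
    then obtain i where i: "i \<le> m" "z = map2 f \<alpha> \<beta> ! i"
      using l by (metis in_set_conv_nth length_map length_zip less_Suc_eq_le min.idem)
    then show "z \<in> {..N}"
      using e[of i] f[of "\<alpha> ! i" k "\<beta> ! i" j] N mono_maps_nth_le[OF a] mono_maps_nth_le[OF b] by fastforce
  qed
  ultimately show ?thesis using l by (simp add: mono_maps_def)
qed

lemma map2_comp:
  assumes "\<alpha> \<in> mono_maps m k" "\<beta> \<in> mono_maps m j" "\<theta> \<in> mono_maps l m"
  shows "map2 f (\<alpha> \<odot> \<theta>) (\<beta> \<odot> \<theta>) = map2 f \<alpha> \<beta> \<odot> \<theta>"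
  using assms mono_maps_nth_le[OF assms(3)]
  by (intro nth_equalityI) (auto simp: comp_map_def mono_maps_length less_Suc_eq_le)

text \<open>A simplex of the square lies in one of its two triangles, since a monotone path cannot
  leave the diagonal on both sides.\<close>

lemma mono_maps_comparable:
  assumes a: "\<alpha> \<in> mono_maps m 1" and b: "\<beta> \<in> mono_maps m 1"
  shows "(\<forall>i\<le>m. \<beta> ! i \<le> \<alpha> ! i) \<or> (\<forall>i\<le>m. \<alpha> ! i \<le> \<beta> ! i)"
proof (rule ccontr)
  assume "\<not> ?thesis"
  then obtain i j where ij: "i \<le> m" "\<alpha> ! i < \<beta> ! i" "j \<le> m" "\<beta> ! j < \<alpha> ! j" by (auto simp: not_le)
  show False
  proof (cases "i \<le> j")
    case True
    then show ?thesis using ij mono_maps_nth_mono[OF b True ij(3)] mono_maps_nth_le[OF a ij(3)] by linarith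
  next
    case False
    then show ?thesis using ij mono_maps_nth_mono[OF a _ ij(1), of j] mono_maps_nth_le[OF b ij(1)] by linarith
  qed
qed

lemma hom_sset_eqI:
  assumes "p \<in> simplices (hom_sset (std_simplex 1) Y) k" "q \<in> simplices (hom_sset (std_simplex 1) Y) k"
    and "\<And>l \<alpha> \<beta>. \<lbrakk>\<alpha> \<in> mono_maps l k; \<beta> \<in> mono_maps l 1\<rbrakk> \<Longrightarrow> p l (\<alpha>, \<beta>) = q l (\<alpha>, \<beta>)"
  shows "p = q"
proof (intro ext)
  fix l z
  have "p l \<in> extensional (simplices (sset_prod (std_simplex k) (std_simplex 1)) l)"
    "q l \<in> extensional (simplices (sset_prod (std_simplex k) (std_simplex 1)) l)"
    using assms(1,2) by (simp_all add: hom_sset_def)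
  then show "p l z = q l z"
    using assms(3) simplices_prod_iff[of z k l] extensional_arb[of "p l" _ z] extensional_arb[of "q l" _ z] by metis
qed

context alternating_fiber
begin

abbreviation "PZX \<equiv> hom_sset (std_simplex 1) ZX"

sublocale PZX: simplicial_set PZX
  by (intro simplicial_set_hom simplicial_set_std_simplex ZX.simplicial_set_axioms)

text \<open>
  The square \<open>p\<close> is compared with the cone over its two triangles: the prism \<open>q\<close> below is a
  degeneracy of \<open>p\<close>, corrected by degeneracies of its lower triangle and of its right edge.
\<close>

lemma edge_homotopic_cone:
  assumes e: "(z, p) \<in> simplices HF 1"
  shows "\<exists>w\<in>simplices ZX 2. action ZX 2 [1, 2] w = h z \<and>
    edge_homotopic HF (face HF 1 1 (z, p)) (face HF 1 0 (z, p)) [((z, p), True)] [((z, cone_path ZX 1 w), True)]"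
proof -
  have zp: "z \<in> simplices P 1" "p \<in> simplices PZX 1" "endpoint 0 1 p = 0" "endpoint 1 1 p = h z"
    using e by (auto simp: simplices_HF)
  have cm: "const_map 1 i = [i, i]" "const_map 2 i = [i, i, i]" for i
    by (simp_all add: const_map_def numeral_2_eq_2 One_nat_def)
  have ends: "p 1 ([0, 1], [0, 0]) = 0" "p 1 ([0, 1], [1, 1]) = h z"
    using zp(3,4) by (simp_all add: endpoint_def id_map_1 cm)
  note nat = hom_sset_natural[OF zp(2)] and cl = hom_sset_closed[OF zp(2)]
  define L where "L = lower p"
  define U where "U = upper p"
  define c1 where "c1 = p 1 ([1, 1], [0, 1])"
  have LU: "L \<in> simplices ZX 2" "U \<in> simplices ZX 2" "c1 \<in> simplices ZX 1"
    unfolding L_def U_def c1_def lower_def upper_def by (intro cl; simp add: mono_lists)+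
  have "action ZX 2 \<theta> L = p l ([0, 1, 1] \<odot> \<theta>, [0, 0, 1] \<odot> \<theta>)" "action ZX 2 \<theta> U = p l ([0, 0, 1] \<odot> \<theta>, [0, 1, 1] \<odot> \<theta>)"
    if "\<theta> \<in> mono_maps l 2" for \<theta> l
    unfolding L_def U_def lower_def upper_def using that by (intro nat; simp add: mono_lists)+
  note actL = this(1) and actU = this(2)
  have faces: "action ZX 2 [0, 1] L = 0" "action ZX 2 [1, 2] L = c1" "action ZX 2 [0, 2] L = p 1 ([0, 1], [0, 1])"
    "action ZX 2 [1, 2] U = h z" "action ZX 2 [0, 2] U = p 1 ([0, 1], [0, 1])"
    using actL[of "[0, 1]" 1] actL[of "[1, 2]" 1] actL[of "[0, 2]" 1] actU[of "[1, 2]" 1] actU[of "[0, 2]" 1] ends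
    by (simp_all add: mono_lists comp_map_def c1_def)
  have c1_0: "action ZX 1 [0] c1 = 0"
  proof -
    have "action ZX 1 [0] c1 = p 0 ([1], [0])"
      unfolding c1_def by (subst nat) (simp_all add: mono_lists comp_map_def)
    also have "\<dots> = action ZX 1 [1] (p 1 ([0, 1], [0, 0]))"
      by (subst nat) (simp_all add: mono_lists comp_map_def)
    finally show ?thesis by (simp add: ends)
  qed
  have c1_const: "action ZX 1 (const_map l 0) c1 = 0" for l
  proof -
    have "action ZX 0 (const_map l 0) (action ZX 1 [0] c1) = action ZX 1 ([0] \<odot> const_map l 0) c1"
      using const_map_closed[of 0 0 l] by (intro ZX.action_comp) (simp_all add: mono_lists LU)
    moreover have "[0] \<odot> const_map l 0 = const_map l 0" by (simp add: comp_map_def const_map_def)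
    ultimately show ?thesis unfolding c1_0 by simp
  qed
  \<comment> \<open>The sum of the upper triangle, the negative of the lower one and a degeneracy of
    the right edge \<open>c1\<close>. The lower triangle cancels the diagonal, leaving
    \<open>c1\<close> as the face opposite vertex 1.\<close>
  define W where "W = U - L + action ZX 1 [0, 0, 1] c1"
  have W: "W \<in> simplices ZX 2" using LU by (simp add: W_def ZX_simps)
  have W12: "action ZX 2 [1, 2] W = h z" using LU by (simp add: W_def ZX_simps faces)
  have W02: "action ZX 2 [0, 2] W = c1" using LU by (simp add: W_def ZX_simps faces)
  \<comment> \<open>The maps from the vertices (i, t) of the prism along which the two corrections
    are pulled back. On the side {0, 1} both corrections vanish and \<open>p\<close> remains; on {1,
    2} they cancel and leave a degenerate square; on {0, 2} they are \<open>i + t\<close> and, after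
    rescaling, \<open>i * t\<close>, and give the cone.\<close>
  define lo :: "nat \<Rightarrow> nat \<Rightarrow> nat" where "lo i t = (if i = 0 then t else if i = 2 \<and> t = 1 then 2 else 1)" for i t
  define hi :: "nat \<Rightarrow> nat \<Rightarrow> nat" where "hi i t = (if i = 2 \<and> t = 1 then 1 else 0)" for i t
  have lo_c: "map2 lo \<alpha> \<beta> \<in> mono_maps m 2" and hi_c: "map2 hi \<alpha> \<beta> \<in> mono_maps m 1"
    if "\<alpha> \<in> mono_maps m 2" "\<beta> \<in> mono_maps m 1" for \<alpha> \<beta> m
    by (rule map2_closed[OF that]; auto simp: lo_def hi_def)+
  define q where "q m = restrict (\<lambda>(\<alpha>, \<beta>). p m ([0, 1, 1] \<odot> \<alpha>, \<beta>) - action ZX 2 (map2 lo \<alpha> \<beta>) L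
      + action ZX 1 (map2 hi \<alpha> \<beta>) c1) (simplices (sset_prod (std_simplex 2) (std_simplex 1)) m)" for m
  have q: "q m (\<alpha>, \<beta>) = p m ([0, 1, 1] \<odot> \<alpha>, \<beta>) - action ZX 2 (map2 lo \<alpha> \<beta>) L + action ZX 1 (map2 hi \<alpha> \<beta>) c1"
    if "\<alpha> \<in> mono_maps m 2" "\<beta> \<in> mono_maps m 1" for m \<alpha> \<beta>
    using that by (simp add: q_def simplices_prod_iff)
  have d01: "[0, 1, 1] \<odot> \<alpha> \<in> mono_maps m 1" if "\<alpha> \<in> mono_maps m 2" for \<alpha> m
    using that by (intro comp_map_closed) (simp_all add: mono_lists)
  have q_closed: "q m (\<alpha>, \<beta>) \<in> simplices ZX m" if "\<alpha> \<in> mono_maps m 2" "\<beta> \<in> mono_maps m 1" for m \<alpha> \<beta>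
    unfolding q[OF that]
    by (intro ZX_closed_plus ZX_closed_minus cl ZX.action_closed[OF lo_c[OF that]] ZX.action_closed[OF hi_c[OF that]])
      (use that d01 LU in auto)
  have q_nat: "action ZX m \<theta> (q m (\<alpha>, \<beta>)) = q l (\<alpha> \<odot> \<theta>, \<beta> \<odot> \<theta>)"
    if a: "\<alpha> \<in> mono_maps m 2" and b: "\<beta> \<in> mono_maps m 1" and t: "\<theta> \<in> mono_maps l m" for m l \<alpha> \<beta> \<theta>
    using nat[OF d01[OF a] b t] ZX.action_comp[OF lo_c[OF a b] t LU(1)] ZX.action_comp[OF hi_c[OF a b] t LU(3)]
    by (simp add: q[OF a b] q[OF comp_map_closed[OF a t] comp_map_closed[OF b t]] action_free_diff
        map2_comp[OF a b t] comp_map_assoc[OF t a])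
  have qH: "q \<in> simplices PZX 2"
    unfolding hom_sset_def simplicial_map_def
    by (auto simp: simplices_prod_iff q_closed q_nat comp_map_closed sset_prod_def std_simplex_def)
      (simp add: q_def sset_prod_def std_simplex_def)
  let ?z = "action P 1 [0, 1, 1] z"
  have z2: "?z \<in> simplices P 2" by (rule P.action_closed[OF _ zp(1)]) (simp add: mono_lists)
  have zid: "action P 1 [0, 1] z = z" using P.action_id[OF zp(1)] by (simp add: id_map_1)
  have "q 2 ([0, 1, 2], [0, 0, 0]) = 0"
  proof -
    have "p 2 ([0, 1, 1], [0, 0, 0]) = action ZX 1 [0, 1, 1] (p 1 ([0, 1], [0, 0]))"
      by (subst nat) (simp_all add: mono_lists comp_map_def)
    moreover have "action ZX 2 [0, 1, 1] L = action ZX 1 [0, 1, 1] (action ZX 2 [0, 1] L)"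
      using LU by (simp add: ZX_simps)
    moreover have "action ZX 1 [0, 0, 0] c1 = 0" using c1_const[of 2] by (simp add: cm)
    ultimately show ?thesis
      by (subst q) (simp_all add: mono_lists mono_maps_lists comp_map_def lo_def hi_def ends faces)
  qed
  moreover have "q 2 ([0, 1, 2], [1, 1, 1]) = alternating_map n 2 ?z"
  proof -
    have "p 2 ([0, 1, 1], [1, 1, 1]) = action ZX 1 [0, 1, 1] (p 1 ([0, 1], [1, 1]))"
      by (subst nat) (simp_all add: mono_lists comp_map_def)
    moreover have "action ZX 2 [1, 1, 2] L = action ZX 1 [0, 0, 1] (action ZX 2 [1, 2] L)"
      using LU by (simp add: ZX_simps)
    moreover have "alternating_map n 2 ?z = action ZX 1 [0, 1, 1] (h z)"
      using alternating_map_natural[OF _ zp(1)] by (simp add: mono_lists)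
    ultimately show ?thesis
      by (subst q) (simp_all add: mono_lists mono_maps_lists comp_map_def lo_def hi_def ends faces)
  qed
  ultimately have s: "(?z, q) \<in> simplices HF 2"
    using z2 qH by (simp add: simplices_HF endpoint_def id_map_2 cm)
  have cf: "coface 2 i \<in> mono_maps 1 2" if "i \<le> 2" for i
    using coface_closed[of i 1] that by (simp add: numeral_2_eq_2 One_nat_def)
  have qa: "action PZX 2 (coface 2 i) q l (\<alpha>, \<beta>) = p l ([0, 1, 1] \<odot> (coface 2 i \<odot> \<alpha>), \<beta>)
      - action ZX 2 (map2 lo (coface 2 i \<odot> \<alpha>) \<beta>) L + action ZX 1 (map2 hi (coface 2 i \<odot> \<alpha>) \<beta>) c1"
    if "i \<le> 2" "\<alpha> \<in> mono_maps l 1" "\<beta> \<in> mono_maps l 1" for i l \<alpha> \<beta>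
    unfolding hom_sset_action[OF cf[OF that(1)] that(2,3)]
    by (rule q[OF comp_map_closed[OF cf[OF that(1)] that(2)] that(3)])
  have le1: "\<alpha> ! i = 0 \<or> \<alpha> ! i = 1" if "\<alpha> \<in> mono_maps l 1" "i \<le> l" for \<alpha> l i
    using mono_maps_nth_le[OF that] by auto
  have d2: "action PZX 2 (coface 2 2) q = p"
  proof (rule hom_sset_eqI[OF PZX.action_closed[OF cf qH] zp(2)])
    fix l \<alpha> \<beta> assume a: "\<alpha> \<in> mono_maps l 1" and b: "\<beta> \<in> mono_maps l 1"
    let ?g = "map2 (\<lambda>i t. if i = 0 then t else 1) \<alpha> \<beta>"
    have g: "?g \<in> mono_maps l 1" by (rule map2_closed[OF a b]) auto
    have "[0, 1, 1] \<odot> (coface 2 2 \<odot> \<alpha>) = \<alpha>" "map2 lo (coface 2 2 \<odot> \<alpha>) \<beta> = [0, 1] \<odot> ?g"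
      "map2 hi (coface 2 2 \<odot> \<alpha>) \<beta> = const_map l 0"
      using le1[OF a] le1[OF b] a b
      by (intro nth_equalityI; force simp: comp_map_def coface_2 lo_def hi_def const_map_def mono_maps_length less_Suc_eq_le simp del: replicate_Suc)+
    moreover have "action ZX 2 ([0, 1] \<odot> ?g) L = 0"
      using ZX.action_comp[OF _ g LU(1), of "[0, 1]"] by (simp add: mono_lists faces)
    ultimately show "action PZX 2 (coface 2 2) q l (\<alpha>, \<beta>) = p l (\<alpha>, \<beta>)"
      using qa[of 2, OF _ a b] by (simp add: c1_const)
  qed simp
  have d0: "action PZX 2 (coface 2 0) q = action PZX 1 [1, 1] p"
  proof (rule hom_sset_eqI[OF PZX.action_closed[OF cf qH] PZX.action_closed[OF _ zp(2)]])
    fix l \<alpha> \<beta> assume a: "\<alpha> \<in> mono_maps l 1" and b: "\<beta> \<in> mono_maps l 1"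
    let ?g = "map2 (\<lambda>i t. i * t) \<alpha> \<beta>"
    have g: "?g \<in> mono_maps l 1" by (rule map2_closed[OF a b]) (auto intro: mult_le_mono)
    have "[0, 1, 1] \<odot> (coface 2 0 \<odot> \<alpha>) = [1, 1] \<odot> \<alpha>" "map2 lo (coface 2 0 \<odot> \<alpha>) \<beta> = [1, 2] \<odot> ?g"
      "map2 hi (coface 2 0 \<odot> \<alpha>) \<beta> = ?g"
      using le1[OF a] le1[OF b] a b
      by (intro nth_equalityI; force simp: comp_map_def coface_2 lo_def hi_def mono_maps_length less_Suc_eq_le)+
    moreover have "action ZX 2 ([1, 2] \<odot> ?g) L = action ZX 1 ?g c1"
      using ZX.action_comp[OF _ g LU(1), of "[1, 2]"] by (simp add: mono_lists faces)
    ultimately show "action PZX 2 (coface 2 0) q l (\<alpha>, \<beta>) = action PZX 1 [1, 1] p l (\<alpha>, \<beta>)"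
      using qa[of 0, OF _ a b] by (simp add: mono_lists hom_sset_action[OF _ a b, of "[1, 1]" 1])
  qed (simp_all add: mono_lists)
  have d1: "action PZX 2 (coface 2 1) q = cone_path ZX 1 W"
  proof (rule hom_sset_eqI[OF PZX.action_closed[OF cf qH] ZX.cone_path_closed])
    fix l \<alpha> \<beta> assume a: "\<alpha> \<in> mono_maps l 1" and b: "\<beta> \<in> mono_maps l 1"
    let ?t = "map2 (\<lambda>i t. i + t) \<alpha> \<beta>" and ?g = "map2 (\<lambda>i t. i * t) \<alpha> \<beta>"
    have t: "?t \<in> mono_maps l 2" by (rule map2_closed[OF a b]) auto
    have "[0, 1, 1] \<odot> (coface 2 1 \<odot> \<alpha>) = \<alpha>" "map2 lo (coface 2 1 \<odot> \<alpha>) \<beta> = ?t" "map2 hi (coface 2 1 \<odot> \<alpha>) \<beta> = ?g"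
      using le1[OF a] le1[OF b] a b
      by (intro nth_equalityI; force simp: comp_map_def coface_2 lo_def hi_def mono_maps_length less_Suc_eq_le)+
    then have lhs: "action PZX 2 (coface 2 1) q l (\<alpha>, \<beta>) = p l (\<alpha>, \<beta>) - action ZX 2 ?t L + action ZX 1 ?g c1"
      using qa[of 1, OF _ a b] by simp
    have rhs: "cone_path ZX 1 W l (\<alpha>, \<beta>) = action ZX 2 (shift_map \<alpha> \<beta>) W"
      by (subst cone_path_apply[OF a b]) (simp add: numeral_2_eq_2 One_nat_def)
    \<comment> \<open>Below the diagonal \<open>p\<close> is its own lower triangle and is cancelled
      by \<open>L\<close>, leaving \<open>c1\<close>; above the diagonal \<open>p\<close> is the
      upper triangle, and the sum is \<open>W\<close>.\<close>
    from mono_maps_comparable[OF a b]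
    show "action PZX 2 (coface 2 1) q l (\<alpha>, \<beta>) = cone_path ZX 1 W l (\<alpha>, \<beta>)"
    proof
      assume le: "\<forall>i\<le>l. \<beta> ! i \<le> \<alpha> ! i"
      then have cases: "\<alpha> ! i = 0 \<and> \<beta> ! i = 0 \<or> \<alpha> ! i = 1 \<and> \<beta> ! i = 0 \<or> \<alpha> ! i = 1 \<and> \<beta> ! i = 1" if "i \<le> l" for i
        using le1[OF a that] le1[OF b that] that by fastforce
      have "[0, 1, 1] \<odot> ?t = \<alpha>" "[0, 0, 1] \<odot> ?t = \<beta>" "?g = \<beta>" "shift_map \<alpha> \<beta> = [0, 2] \<odot> \<beta>"
        using cases a b
        by (intro nth_equalityI; force simp: comp_map_def shift_map_def mono_maps_length less_Suc_eq_le)+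
      then show ?thesis
        unfolding lhs rhs using actL[OF t] ZX.action_comp[OF _ b W, of "[0, 2]"] by (simp add: mono_lists W02)
    next
      assume le: "\<forall>i\<le>l. \<alpha> ! i \<le> \<beta> ! i"
      then have cases: "\<alpha> ! i = 0 \<and> \<beta> ! i = 0 \<or> \<alpha> ! i = 0 \<and> \<beta> ! i = 1 \<or> \<alpha> ! i = 1 \<and> \<beta> ! i = 1" if "i \<le> l" for i
        using le1[OF a that] le1[OF b that] that by fastforce
      have "[0, 0, 1] \<odot> ?t = \<alpha>" "[0, 1, 1] \<odot> ?t = \<beta>" "?g = \<alpha>" "shift_map \<alpha> \<beta> = ?t"
        using cases a b
        by (intro nth_equalityI; force simp: comp_map_def shift_map_def mono_maps_length less_Suc_eq_le)+
      then show ?thesis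
        unfolding lhs rhs unfolding W_def using actU[OF t] ZX.action_comp[OF _ t LU(3), of "[0, 0, 1]"]
        by (simp add: action_free_diff mono_lists)
    qed
  qed (use W in \<open>simp_all add: numeral_2_eq_2 One_nat_def\<close>)
  interpret HF: simplicial_set HF by (rule simplicial_set_HF)
  have aHF: "action HF k \<theta> (y', r) = (action P k \<theta> y', action PZX k \<theta> r)" for k \<theta> y' r
    by (simp add: homotopy_fiber_def)
  let ?u = "face HF 1 0 (z, p)"
  have u: "?u \<in> simplices HF 0" using HF.face_closed[of "(z, p)" 0 0] e by (simp flip: One_nat_def)
  have deg: "degenerate HF ?u 1 = (action P 1 [1, 1] z, action PZX 1 [1, 1] p)"
    unfolding degenerate_def face_def coface_1 cm
    using HF.action_comp_list[of "[1]" 0 1 "[0, 0]" "(z, p)"] e by (simp add: mono_lists comp_map_def aHF)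
  have f2: "face HF 2 2 (?z, q) = (z, p)" "face HF 2 1 (?z, q) = (z, cone_path ZX 1 W)" "face HF 2 0 (?z, q) = degenerate HF ?u 1"
    using zp(1) unfolding deg
    by (simp_all add: face_HF d0 d1 d2) (simp_all add: face_def coface_2 P.action_comp_list mono_lists comp_map_def zid)
  have ep: "edge_path HF (face HF 1 1 (z, p)) [((z, p), True)] ?u"
    using e u by (simp add: edge_source_def edge_target_def)
  have dg: "edge_homotopic HF ?u ?u [(degenerate HF ?u 1, True)] []" by (rule degenerate_edge_homotopic[OF simplicial_set_HF u])
  then have dp: "edge_path HF ?u [(degenerate HF ?u 1, True)] ?u" using edge_homotopic_path[OF simplicial_set_HF] by blast
  have "edge_path HF (face HF 1 1 (z, p)) ([((z, p), True)] @ [(degenerate HF ?u 1, True)]) ?u"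
    unfolding edge_path_append[OF simplicial_set_HF] using ep dp by blast
  then have "edge_homotopic HF (face HF 1 1 (z, p)) ?u [((z, p), True), (degenerate HF ?u 1, True)] [((z, cone_path ZX 1 W), True)]"
    using edge_homotopic.triangle[OF s, of "face HF 1 1 (z, p)" "[]" "[]" ?u] unfolding f2 by (simp del: edge_path.simps)
  moreover have "edge_homotopic HF (face HF 1 1 (z, p)) ?u ([((z, p), True)] @ [(degenerate HF ?u 1, True)]) ([((z, p), True)] @ [])"
    by (rule edge_homotopic_append2[OF simplicial_set_HF edge_homotopic.refl[OF ep] dg])
  ultimately have "edge_homotopic HF (face HF 1 1 (z, p)) ?u [((z, p), True)] [((z, cone_path ZX 1 W), True)]"
    by (simp del: edge_path.simps) (blast intro: edge_homotopic.trans edge_homotopic.sym)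
  then show ?thesis using W W12 by blast
qed

lemma edge_realizable:
  assumes "(z, p) \<in> simplices HF 1"
  obtains d e where "d \<in> Z0" "e \<in> Z0" "face HF 1 1 (z, p) = vertex d" "face HF 1 0 (z, p) = vertex e"
    "realizable d e [((z, p), True)]"
proof -
  have z: "z \<in> simplices P 1" using assms by (simp add: simplices_HF)
  obtain w where w: "w \<in> simplices ZX 2" "action ZX 2 [1, 2] w = h z"
    "edge_homotopic HF (face HF 1 1 (z, p)) (face HF 1 0 (z, p)) [((z, p), True)] [((z, cone_path ZX 1 w), True)]"
    using edge_homotopic_cone[OF assms] by blast
  let ?d = "action ZX 2 [0, 1] w" and ?e = "action ZX 2 [0, 2] w"
  note r = realizable_cone[OF z w(1,2)]
  have "edge_path HF (face HF 1 1 (z, p)) [((z, cone_path ZX 1 w), True)] (face HF 1 0 (z, p))"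
    using edge_homotopic_path[OF simplicial_set_HF w(3)] by blast
  then have v: "face HF 1 1 (z, p) = vertex ?d" "face HF 1 0 (z, p) = vertex ?e"
    using face_cone_1[OF z w(1)] by (simp_all add: edge_source_def edge_target_def)
  show ?thesis
    by (rule that[OF r(1) realizable_Z0[OF r(2,1)] v realizable_homotopic[OF _ r(2)]]) (use w(3) in \<open>simp add: v\<close>)
qed

text \<open>Every edge is homotopic to a cone edge, so its endpoints are cone vertices. The labels
  of consecutive edges agree by \<open>vertex_inject\<close>, which lets the pieces be
  concatenated.\<close>

lemma path_realizable:
  "\<lbrakk>edge_path HF u p w; u = vertex d; d \<in> Z0\<rbrakk> \<Longrightarrow> \<exists>e\<in>Z0. w = vertex e \<and> realizable d e p"
proof (induction p arbitrary: u d)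
  case Nil
  then have "edge_path HF (vertex d) [] (vertex d)" and w: "w = vertex d" by auto
  from edge_homotopic.refl[OF this(1)] have "realizable d d []"
    unfolding realizable_def by (intro exI[of _ "[]"]) simp
  then show ?case using w Nil.prems(3) by blast
next
  case (Cons a p)
  obtain z r b where a: "a = ((z, r), b)" by (metis prod.exhaust)
  have zr: "(z, r) \<in> simplices HF 1" and u: "edge_source HF a = u" and p: "edge_path HF (edge_target HF a) p w"
    using Cons.prems a by auto
  obtain d' e' where de: "d' \<in> Z0" "e' \<in> Z0" "face HF 1 1 (z, r) = vertex d'" "face HF 1 0 (z, r) = vertex e'"
    "realizable d' e' [((z, r), True)]" by (rule edge_realizable[OF zr])
  have "\<exists>e\<in>Z0. edge_target HF a = vertex e \<and> realizable d e [a]"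
  proof (cases b)
    case True
    then have "vertex d' = vertex d" using u a de Cons.prems by (simp add: edge_source_def)
    then have "d' = d" using vertex_inject Z0_closed de Cons.prems by blast
    then show ?thesis using True a de by (auto simp: edge_target_def)
  next
    case False
    then have "vertex e' = vertex d" using u a de Cons.prems by (simp add: edge_source_def)
    then have "e' = d" using vertex_inject Z0_closed de Cons.prems by blast
    then show ?thesis using False a de realizable_flip[OF de(5)] by (auto simp: edge_target_def)
  qed
  then obtain e where e: "e \<in> Z0" "edge_target HF a = vertex e" "realizable d e [a]" by blast
  from Cons.IH[OF p e(2,1)] obtain f where "f \<in> Z0" "w = vertex f" "realizable e f p" by blast
  then show ?case using realizable_append[OF e(3) _ Cons.prems(3), of f p] by auto
qed

lemma cone_path_zero: "cone_path ZX k 0 = const_path ZX 0 k"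
  by (intro ext) (simp add: cone_path_def const_path_def degenerate_zero restrict_def)

lemma inclusion_vertex: "inclusion 0 v = vertex 0"
  by (simp add: fiber_to_homotopy_fiber_def vertex_def cone_path_zero)

text \<open>On the fiber \<open>h\<close> vanishes, so the label stays 0 and the cone on the zero
  chain is the constant path.\<close>

lemma lift_F0: "fst ` set p \<subseteq> simplices F0 1 \<Longrightarrow> lift 0 p = map (map_prod (inclusion 1) id) p \<and> displacement p = 0"
proof (induction p)
  case (Cons a p)
  then have "h (fst a) = 0" by (simp add: simplices_F0)
  with Cons show ?case
    by (cases a) (simp add: E_def weight_def cone_path_zero fiber_to_homotopy_fiber_def)
qed simp

lemma word_value_displacement:
  "fst ` set p \<subseteq> simplices P 1 \<Longrightarrow> word_value A h p = displacement p"
proof (induction p)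
  case (Cons a p)
  then have "h (fst a) \<in> carrier A" using alternating_map_closed[of "fst a" 1] by (simp add: carrier_A)
  then have "inv\<^bsub>A\<^esub> h (fst a) = - h (fst a)" by simp
  then show ?case using Cons by (cases a; cases "snd a") auto
qed simp

lemma inclusion_surjective:
  assumes p: "p \<in> edge_loops HF (inclusion 0 v)"
  shows "\<exists>q\<in>edge_loops F0 v. edge_homotopic HF (inclusion 0 v) (inclusion 0 v) p (map (map_prod (inclusion 1) id) q)"
proof -
  have "edge_path HF (vertex 0) p (vertex 0)" using p by (simp add: edge_loops_def inclusion_vertex)
  then obtain e where e: "e \<in> Z0" "vertex 0 = vertex e" "realizable 0 e p" using path_realizable zero_Z0 by blast
  \<comment> \<open>A loop returns to the label 0, so the underlying word has zero displacement and
    \<open>kernel_displacement\<close> applies.\<close>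
  then have "e = 0" using vertex_inject[of 0 e] Z0_closed zero_closed by simp
  then obtain q where q: "fst ` set q \<subseteq> simplices P 1" "displacement q = 0"
    "edge_homotopic HF (vertex 0) (vertex 0) p (lift 0 q)" using e(3) by (auto simp: realizable_def)
  have "fst ` set q \<subseteq> simplices Q 1"
  proof
    fix y' assume "y' \<in> fst ` set q"
    then obtain t where "y' = edge t" "\<And>k. k < 2 * n \<Longrightarrow> t k \<in> carrier G" using q(1) edgeE by blast
    then show "y' \<in> simplices Q 1" by (simp add: edge_in_Q)
  qed
  then have "q \<in> edge_loops Q v" by (simp add: Q.edge_loops_iff)
  then obtain r where r: "r \<in> edge_loops F0 v" "edge_homotopic Q v v q r"
    using kernel_displacement[of q] q(1,2) by (auto simp: word_value_displacement)
  have qr: "edge_homotopic HF (vertex 0) (vertex 0) (lift 0 q) (lift 0 r)"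
    using lift_homotopic[OF r(2)] q(2) zero_Z0 by auto
  have "lift 0 r = map (map_prod (inclusion 1) id) r"
    using lift_F0 r(1) by (simp add: F0.edge_loops_iff)
  with edge_homotopic.trans[OF q(3) qr] show ?thesis
    unfolding inclusion_vertex by (intro bexI[OF _ r(1)]) simp
qed

lemma inclusion_iso: "fundamental_group_map HF (inclusion 0 v) inclusion \<in> iso (\<pi>\<^sub>1 F0 v) (\<pi>\<^sub>1 HF (inclusion 0 v))"
proof -
  let ?f = "fundamental_group_map HF (inclusion 0 v) inclusion" and ?m = "map (map_prod (inclusion 1) id)"
  note m = fundamental_group_map_path_class[OF simplicial_set_F0 simplicial_set_HF simplicial_map_inclusion]
  have v: "v \<in> simplices F0 0" using F0.vertices by simp
  have hom: "?f \<in> hom (\<pi>\<^sub>1 F0 v) (\<pi>\<^sub>1 HF (inclusion 0 v))"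
    by (rule fundamental_group_map_hom[OF simplicial_set_F0 simplicial_set_HF simplicial_map_inclusion v])
  have "inj_on ?f (carrier (\<pi>\<^sub>1 F0 v))"
  proof
    fix a b assume "a \<in> carrier (\<pi>\<^sub>1 F0 v)" "b \<in> carrier (\<pi>\<^sub>1 F0 v)" and eq: "?f a = ?f b"
    then obtain p q where pq: "p \<in> edge_loops F0 v" "q \<in> edge_loops F0 v" "a = path_class F0 v p" "b = path_class F0 v q"
      by (auto simp: carrier_fundamental_group)
    have "edge_homotopic HF (inclusion 0 v) (inclusion 0 v) (?m p) (?m q)"
      using eq path_class_eq_iff[OF simplicial_set_HF m(2)[OF pq(1)] m(2)[OF pq(2)]]
      unfolding pq(3,4) m(1)[OF pq(1)] m(1)[OF pq(2)] by blast
    then show "a = b"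
      using inclusion_injective[OF pq(1,2)] path_class_eq_iff[OF simplicial_set_F0 pq(1,2)] pq(3,4) by blast
  qed
  moreover have "?f ` carrier (\<pi>\<^sub>1 F0 v) = carrier (\<pi>\<^sub>1 HF (inclusion 0 v))"
  proof
    show "?f ` carrier (\<pi>\<^sub>1 F0 v) \<subseteq> carrier (\<pi>\<^sub>1 HF (inclusion 0 v))"
      using hom by (auto simp: hom_def)
    show "carrier (\<pi>\<^sub>1 HF (inclusion 0 v)) \<subseteq> ?f ` carrier (\<pi>\<^sub>1 F0 v)"
    proof
      fix a assume "a \<in> carrier (\<pi>\<^sub>1 HF (inclusion 0 v))"
      then obtain p where p: "p \<in> edge_loops HF (inclusion 0 v)" "a = path_class HF (inclusion 0 v) p"
        by (auto simp: carrier_fundamental_group)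
      obtain q where q: "q \<in> edge_loops F0 v" "edge_homotopic HF (inclusion 0 v) (inclusion 0 v) p (?m q)"
        using inclusion_surjective[OF p(1)] by blast
      have "a = ?f (path_class F0 v q)"
        unfolding p(2) m(1)[OF q(1)] using q(2) path_class_eq_iff[OF simplicial_set_HF p(1) m(2)[OF q(1)]] by blast
      then show "a \<in> ?f ` carrier (\<pi>\<^sub>1 F0 v)" using q(1) by (auto simp: carrier_fundamental_group)
    qed
  qed
  ultimately show ?thesis using hom by (simp add: iso_def bij_betw_def)
qed

end

theorem theorem2:
  fixes G :: "('g, 'z) monoid_scheme" and n :: nat
  defines "X \<equiv> classifying_space G"
  defines "ZX \<equiv> free_simplicial_abelian_group X"
  defines "P \<equiv> sset_power X (2 * n)"
  defines "F0 \<equiv> fiber P ZX (alternating_map n) 0"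
    and "HF \<equiv> homotopy_fiber P ZX (alternating_map n) 0"
    and "c \<equiv> (fiber_to_homotopy_fiber ZX 0
      :: nat \<Rightarrow> 'g list list \<Rightarrow> 'g list list \<times> (nat \<Rightarrow> nat list \<times> nat list \<Rightarrow> ('g list \<Rightarrow>\<^sub>0 int)))"
  defines "v \<equiv> base_vertex n"
  assumes "group G" and "n \<ge> 3"
  shows "fundamental_group_map HF (c 0 v) c \<in> iso (\<pi>\<^sub>1 F0 v) (\<pi>\<^sub>1 HF (c 0 v))"
proof -
  have "alternating_fiber G n"
    using assms by (simp add: alternating_fiber_def alternating_fiber_axioms_def)
  then show ?thesis
    unfolding X_def ZX_def P_def F0_def HF_def c_def v_def by (rule alternating_fiber.inclusion_iso)
qed

end
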